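(* Let $\mathcal{B}$ be any of the eight families of polynomials: Schubert polynomials, Demazure characters $\kappa_a$, quasi-key polynomials $\mathfrak{Q}_a$, fundamental slide polynomials $\mathfrak{F}_a$, monomial slide polynomials $\mathfrak{M}_a$, Demazure atoms $\mathcal{A}_a$, fundamental particles $\mathfrak{L}_a$, or monomials $x^a$. For any weak composition $a$ of length $n$, letting $f_a\in\mathcal{B}$ be the polynomial indexed by $a$, and for any partition $\lambda$, the product $f_a\cdot s_\lambda(x_1,\ldots,x_n)$ is a linear combination of elements of $\mathcal{B}$ with nonnegative coefficients.
   Context: $s_\lambda(x_1,\ldots,x_n)$ is the Schur polynomial. A weak composition of length $n$ is a sequence $a=(a_1,\ldots,a_n)$ of nonnegative integers (trailing zeros are immaterial for indexing); $x^a=x_1^{a_1}\cdots x_n^{a_n}$; $\mathrm{flat}(a)$ deletes the zero parts; for $a,b$ of the same length $n$, $b\ge a$ means $b_1+\cdots+b_i\ge a_1+\cdots+a_i$ for all $i$. Schubert polynomials: for $w\in S_n$, $\mathfrak{S}_{w_0}=x_1^{n-1}\cdots x_{n-1}$ and $\mathfrak{S}_{ws_i}=\partial_i\mathfrak{S}_w$ when $w(i)>w(i+1)$, with $\partial_if=(f-s_if)/(x_i-x_{i+1})$; they are indexed by weak compositions via the code $c(w)_i=\#\{j>i:w(j)<w(i)\}$. Demazure characters: $\kappa_a=x^a$ if $a$ is weakly decreasing, and $\kappa_a=\pi_i\kappa_{s_ia}$ if $a_i<a_{i+1}$, where $s_ia$ swaps $a_i,a_{i+1}$ and $\pi_if=\partial_i(x_if)$.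 Skyline diagram $D(a)$: $a_i$ left-justified boxes in row $i$, row 1 lowest. For a filling $S$, $\mathrm{wt}(S)_i$ is the number of entries $i$. Triples (rows $r<s$): Type A: $\gamma=(r,c),\alpha=(r,c+1),\beta=(s,c+1)$ with $a_r\ge a_s$; Type B: $\gamma=(s,c),\alpha=(s,c+1),\beta=(r,c)$ with $a_s>a_r$; inversion triple: $\beta>\gamma\ge\alpha$ or $\gamma\ge\alpha>\beta$. A semi-skyline filling: rows weakly decrease left to right, column entries distinct, all triples inversion triples. $\mathcal{A}_a=\sum x^{\mathrm{wt}(S)}$ over semi-skyline fillings of $D(a)$ whose first-column entry in each nonempty row $i$ is $i$. Quasi-key tableau of shape $a$: filling of $D(a)$ with (1) rows weakly decreasing, no entry of row $i$ exceeding $i$; (2) distinct entries in each column, entries increasing up the first column; (3) if $i$ is above $k$ in a column with $i<k$, there is an entry $j>i$ immediately right of $k$; (4) for two rows with the higher strictly longer, an entry $i$ in column $c$ of the lower row and $j$ in column $c+1$ of the higher row satisfy $i<j$. $\mathfrak{Q}_a=\sum x^{\mathrm{wt}(T)}$ over such $T$. $\mathfrak{M}_a=\sum x^b$ over $b\ge a$, $\mathrm{flat}(b)=\mathrm{flat}(a)$; $\mathfrak{F}_a=\sum x^b$ over $b\ge a$, $\mathrm{flat}(b)$ refining $\mathrm{flat}(a)$. Fixed slides of $a$: weak compositions obtained from $a$ by sequences of local moves replacing consecutive entries $(0,k)$ at positions $p,p+1$ by $(i,j)$, $i+j=k$, $i,j\ge0$, with $j>0$ required whenever $a_{p+1}\neq0$;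 $\mathfrak{L}_a=\sum x^b$ over the set of fixed slides $b$ of $a$. *)

theory Defs
  imports "HOL-Library.Poly_Mapping"
begin

(* Polynomials in the variables x_1, x_2, ... with integer coefficients.
   Variable x_(k+1) is represented by the index k :: nat (0-based).
   A monomial is an exponent vector nat \<Rightarrow>\<^sub>0 nat. *)
type_synonym mpoly = "(nat \<Rightarrow>\<^sub>0 nat) \<Rightarrow>\<^sub>0 int"

(* weak compositions are lists of naturals; position i (0-based) is a_(i+1) *)
definition xmon :: "nat list \<Rightarrow> mpoly" where
  "xmon a = Poly_Mapping.single (Poly_Mapping.nth a) 1"

definition xvar :: "nat \<Rightarrow> mpoly" where
  "xvar k = Poly_Mapping.single (Poly_Mapping.single k 1) 1"

(* the simple transposition s_i on variables (0-based i: swaps x_(i+1), x_(i+2)) *)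
definition swapidx :: "nat \<Rightarrow> nat \<Rightarrow> nat" where
  "swapidx i k = (if k = i then Suc i else if k = Suc i then i else k)"

definition swap_mon :: "nat \<Rightarrow> (nat \<Rightarrow>\<^sub>0 nat) \<Rightarrow> (nat \<Rightarrow>\<^sub>0 nat)" where
  "swap_mon i m = (\<Sum>k\<in>Poly_Mapping.keys m. Poly_Mapping.single (swapidx i k) (Poly_Mapping.lookup m k))"

definition swap_poly :: "nat \<Rightarrow> mpoly \<Rightarrow> mpoly" where
  "swap_poly i f = (\<Sum>m\<in>Poly_Mapping.keys f. Poly_Mapping.single (swap_mon i m) (Poly_Mapping.lookup f m))"

definition ddiff :: "nat \<Rightarrow> mpoly \<Rightarrow> mpoly" where
  "ddiff i f = (THE g. (xvar i - xvar (Suc i)) * g = f - swap_poly i f)"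

definition pidiff :: "nat \<Rightarrow> mpoly \<Rightarrow> mpoly" where
  "pidiff i f = ddiff i (xvar i * f)"

definition swapl :: "nat \<Rightarrow> 'a list \<Rightarrow> 'a list" where
  "swapl i xs = xs[i := xs ! Suc i, Suc i := xs ! i]"

definition first_ascent :: "nat list \<Rightarrow> nat option" where
  "first_ascent xs =
     (if \<exists>i. Suc i < length xs \<and> xs ! i < xs ! Suc i
      then Some (LEAST i. Suc i < length xs \<and> xs ! i < xs ! Suc i) else None)"

(* kappa_a = x^a if a weakly decreasing, else pi_i kappa_(s_i a) for an ascent i;
   implemented with the first ascent and a fuel argument that is never exhausted
   (each step removes exactly one inversion; there are < length a ^ 2 of them) *)
fun kappa_fuel :: "nat \<Rightarrow> nat list \<Rightarrow> mpoly" where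
  "kappa_fuel 0 a = xmon a"
| "kappa_fuel (Suc k) a =
     (case first_ascent a of None \<Rightarrow> xmon a
      | Some i \<Rightarrow> pidiff i (kappa_fuel k (swapl i a)))"

definition demazure :: "nat list \<Rightarrow> mpoly" where
  "demazure a = kappa_fuel (length a ^ 2) a"

definition is_perm :: "nat list \<Rightarrow> bool" where
  "is_perm w \<longleftrightarrow> distinct w \<and> set w = {1..length w}"

definition perm_code :: "nat list \<Rightarrow> nat list" where
  "perm_code w = map (\<lambda>i. card {j. i < j \<and> j < length w \<and> w ! j < w ! i}) [0..<length w]"

(* S_{w0} = x_1^(m-1) ... x_(m-1); S_w = \<partial>_i S_(w s_i) for an ascent i of w
   (equivalently S_(u s_i) = \<partial>_i S_u when u(i) > u(i+1)); fuel as above *)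
fun schub_fuel :: "nat \<Rightarrow> nat list \<Rightarrow> mpoly" where
  "schub_fuel 0 w = xmon (rev [0..<length w])"
| "schub_fuel (Suc k) w =
     (case first_ascent w of None \<Rightarrow> xmon (rev [0..<length w])
      | Some i \<Rightarrow> ddiff i (schub_fuel k (swapl i w)))"

definition schubert_perm :: "nat list \<Rightarrow> mpoly" where
  "schubert_perm w = schub_fuel (length w ^ 2) w"

(* trailing zeros are immaterial *)
definition strip0 :: "nat list \<Rightarrow> nat list" where
  "strip0 a = rev (dropWhile (\<lambda>x. x = 0) (rev a))"

definition schubert :: "nat list \<Rightarrow> mpoly" where
  "schubert a = schubert_perm (SOME w. is_perm w \<and> strip0 (perm_code w) = strip0 a)"

definition flat :: "nat list \<Rightarrow> nat list" where
  "flat a = filter (\<lambda>x. x \<noteq> 0) a"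

definition dom_ge :: "nat list \<Rightarrow> nat list \<Rightarrow> bool" where
  "dom_ge b a \<longleftrightarrow> length b = length a \<and>
     (\<forall>i\<le>length a. sum_list (take i b) \<ge> sum_list (take i a))"

definition refines :: "nat list \<Rightarrow> nat list \<Rightarrow> bool" where
  "refines beta alpha \<longleftrightarrow>
     (\<exists>bs. concat bs = beta \<and> map sum_list bs = alpha \<and> (\<forall>x\<in>set bs. x \<noteq> []))"

definition monslide :: "nat list \<Rightarrow> mpoly" where
  "monslide a = (\<Sum>b\<in>{b. dom_ge b a \<and> flat b = flat a}. xmon b)"

definition fundslide :: "nat list \<Rightarrow> mpoly" where
  "fundslide a = (\<Sum>b\<in>{b. dom_ge b a \<and> refines (flat b) (flat a)}. xmon b)"

inductive_set fixed_slides :: "nat list \<Rightarrow> nat list set" for a where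
  refl: "a \<in> fixed_slides a"
| step: "\<lbrakk> b \<in> fixed_slides a; Suc p < length b; b ! p = 0; b ! Suc p = i + j;
           a ! Suc p \<noteq> 0 \<longrightarrow> j > 0 \<rbrakk> \<Longrightarrow> b[p := i, Suc p := j] \<in> fixed_slides a"

definition particle :: "nat list \<Rightarrow> mpoly" where
  "particle a = (\<Sum>b\<in>fixed_slides a. xmon b)"

(* cell (r,c): row r (0-based, row r+1 of the paper, row 1 lowest), column c (0-based) *)
definition skyline :: "nat list \<Rightarrow> (nat \<times> nat) set" where
  "skyline a = {(r, c). r < length a \<and> c < a ! r}"

definition fillings :: "nat list \<Rightarrow> ((nat \<times> nat) \<Rightarrow> nat) set" where
  "fillings a = {S. (\<forall>x\<in>skyline a. S x \<in> {1..length a}) \<and> (\<forall>x. x \<notin> skyline a \<longrightarrow> S x = 0)}"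

definition fwt :: "nat list \<Rightarrow> ((nat \<times> nat) \<Rightarrow> nat) \<Rightarrow> nat list" where
  "fwt a S = map (\<lambda>i. card {x\<in>skyline a. S x = Suc i}) [0..<length a]"

definition inv_triple :: "nat \<Rightarrow> nat \<Rightarrow> nat \<Rightarrow> bool" where
  "inv_triple g al be \<longleftrightarrow> (be > g \<and> g \<ge> al) \<or> (g \<ge> al \<and> al > be)"

definition semi_skyline :: "nat list \<Rightarrow> ((nat \<times> nat) \<Rightarrow> nat) \<Rightarrow> bool" where
  "semi_skyline a S \<longleftrightarrow>
     (\<forall>r c. (r, Suc c) \<in> skyline a \<longrightarrow> S (r, Suc c) \<le> S (r, c)) \<and>
     (\<forall>r s c. (r, c) \<in> skyline a \<and> (s, c) \<in> skyline a \<and> r \<noteq> s \<longrightarrow> S (r, c) \<noteq> S (s, c)) \<and>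
     (\<forall>r s c. r < s \<and> a ! r \<ge> a ! s \<and>
        (r, c) \<in> skyline a \<and> (r, Suc c) \<in> skyline a \<and> (s, Suc c) \<in> skyline a \<longrightarrow>
        inv_triple (S (r, c)) (S (r, Suc c)) (S (s, Suc c))) \<and>
     (\<forall>r s c. r < s \<and> a ! s > a ! r \<and>
        (s, c) \<in> skyline a \<and> (s, Suc c) \<in> skyline a \<and> (r, c) \<in> skyline a \<longrightarrow>
        inv_triple (S (s, c)) (S (s, Suc c)) (S (r, c)))"

definition atom :: "nat list \<Rightarrow> mpoly" where
  "atom a = (\<Sum>S\<in>{S\<in>fillings a. semi_skyline a S \<and>
                 (\<forall>r<length a. a ! r > 0 \<longrightarrow> S (r, 0) = Suc r)}. xmon (fwt a S))"

definition quasi_key_tableau :: "nat list \<Rightarrow> ((nat \<times> nat) \<Rightarrow> nat) \<Rightarrow> bool" where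
  "quasi_key_tableau a T \<longleftrightarrow>
     (\<forall>r c. (r, Suc c) \<in> skyline a \<longrightarrow> T (r, Suc c) \<le> T (r, c)) \<and>
     (\<forall>r c. (r, c) \<in> skyline a \<longrightarrow> T (r, c) \<le> Suc r) \<and>
     (\<forall>r s c. (r, c) \<in> skyline a \<and> (s, c) \<in> skyline a \<and> r \<noteq> s \<longrightarrow> T (r, c) \<noteq> T (s, c)) \<and>
     (\<forall>r s. r < s \<and> (r, 0) \<in> skyline a \<and> (s, 0) \<in> skyline a \<longrightarrow> T (r, 0) < T (s, 0)) \<and>
     (\<forall>r s c. r < s \<and> (r, c) \<in> skyline a \<and> (s, c) \<in> skyline a \<and> T (s, c) < T (r, c) \<longrightarrow>
        (r, Suc c) \<in> skyline a \<and> T (r, Suc c) > T (s, c)) \<and>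
     (\<forall>r s c. r < s \<and> a ! s > a ! r \<and> (r, c) \<in> skyline a \<and> (s, Suc c) \<in> skyline a \<longrightarrow>
        T (r, c) < T (s, Suc c))"

definition quasikey :: "nat list \<Rightarrow> mpoly" where
  "quasikey a = (\<Sum>T\<in>{T\<in>fillings a. quasi_key_tableau a T}. xmon (fwt a T))"

definition partition :: "nat list \<Rightarrow> bool" where
  "partition lam \<longleftrightarrow> (\<forall>i. Suc i < length lam \<longrightarrow> lam ! Suc i \<le> lam ! i)"

definition young :: "nat list \<Rightarrow> (nat \<times> nat) set" where
  "young lam = {(i, j). i < length lam \<and> j < lam ! i}"

definition ssyt :: "nat \<Rightarrow> nat list \<Rightarrow> ((nat \<times> nat) \<Rightarrow> nat) set" where
  "ssyt n lam = {T. (\<forall>x\<in>young lam. T x \<in> {1..n}) \<and> (\<forall>x. x \<notin> young lam \<longrightarrow> T x = 0) \<and>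
      (\<forall>i j. (i, Suc j) \<in> young lam \<longrightarrow> T (i, j) \<le> T (i, Suc j)) \<and>
      (\<forall>i j. (Suc i, j) \<in> young lam \<longrightarrow> T (i, j) < T (Suc i, j))}"

definition schur :: "nat \<Rightarrow> nat list \<Rightarrow> mpoly" where
  "schur n lam = (\<Sum>T\<in>ssyt n lam.
      xmon (map (\<lambda>k. card {x\<in>young lam. T x = Suc k}) [0..<n]))"

datatype family = Schubert | Demazure | QuasiKey | FundSlide | MonSlide | Atom | Particle | Monomial

fun basis :: "family \<Rightarrow> nat list \<Rightarrow> mpoly" where
  "basis Schubert a = schubert a"
| "basis Demazure a = demazure a"
| "basis QuasiKey a = quasikey a"
| "basis FundSlide a = fundslide a"
| "basis MonSlide a = monslide a"
| "basis Atom a = atom a"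
| "basis Particle a = particle a"
| "basis Monomial a = xmon a"

end

theory Submission
  imports Defs "HOL-Library.Multiset"
begin

text \<open>
  Semi-skyline fillings, built column by column, satisfy the relations of the operators \<open>pidiff\<close>; an adjunction
  for the coefficient of a constant composition then makes \<open>atom a * schur n lam\<close> atom positive. Key and
  Schubert coefficients reduce to atom coefficients by \<open>hdiff\<close> and \<open>ddiff\<close>, which commute with the symmetric
  factor. Particles are handled by P-partitions. Monomial slides, fundamental slides and quasi-keys are sums
  of monomials, particles and atoms over principal ideals of positions of the zeros.
\<close>

subsection \<open>Divided differences\<close>

text \<open>A product of two atoms need not be atom positive: x_2 is an atom, while x_2^2 is a
  difference of two. What helps is that \<open>pidiff i\<close> commutes with multiplication by a
  symmetric polynomial and that, at an index b with b_i \<le> b_{i+1}, its transpose on atom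
  coefficients merely swaps the index. This brings every index to increasing form. Multiplying by
  x^eta with eta = M - b then carries the coefficient at an increasing b to the constant composition
  (M,...,M), which all swaps fix: there \<open>hdiff i\<close> is self-adjoint for the product, and
  an atom with an ascent times the symmetric factor contributes nothing. Only partition monomials
  times the Schur polynomial remain, so two facts come beforehand: the atom cone is stable under
  multiplication by x_1...x_k, and it contains the Schur polynomials.

  For the slide bases the obstacle is that zeros may stand anywhere in an index. Setting a variable
  to 0 acts on monomials, particles and atoms by deleting a zero part, so the structure coefficients
  do not see where the zeros of the target index are.\<close>

lemma frag_of_mult: "frag_of m * frag_of m' = (frag_of(m+m') :: 'a::monoid_add \<Rightarrow>\<^sub>0 int)"
by (simp add: mult_single)

text \<open>The linear extension of a multiplicative map on monomials is a ring homomorphism. This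
  serves both the swap of two variables and the later operator \<open>res\<close> that sets a
  variable to 0.\<close>

lemma frag_extend_mult:
 fixes f g :: "'a::comm_monoid_add \<Rightarrow>\<^sub>0 int" and h :: "'a => 'b::comm_monoid_add \<Rightarrow>\<^sub>0 int"
 assumes h: "!!m m'. h(m+m') = h m * h m'"
 shows "frag_extend h(f * g) = frag_extend h f * frag_extend h g"
proof -
have 1: "frag_extend h(frag_of m * g) = h m * frag_extend h g" for m
proof (rule frag_induction[of g UNIV "%g. frag_extend h(frag_of m * g) = h m * frag_extend h g"])
 fix x :: 'a
 show "frag_extend h(frag_of m * frag_of x) = h m * frag_extend h(frag_of x)"
 by (simp only: frag_of_mult frag_extend_of h)
next
 fix a b :: "'a \<Rightarrow>\<^sub>0 int"
 assume "frag_extend h(frag_of m * a) = h m * frag_extend h a"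
 "frag_extend h(frag_of m * b) = h m * frag_extend h b"
 thus "frag_extend h(frag_of m * (a-b)) = h m * frag_extend h(a-b)"
 by (simp only: right_diff_distrib frag_extend_diff)
qed auto
show ?thesis
proof (rule frag_induction[of f UNIV "%f. frag_extend h(f * g) = frag_extend h f * frag_extend h g"])
 fix x :: 'a
 show "frag_extend h(frag_of x * g) = frag_extend h(frag_of x) * frag_extend h g"
 by (simp only: 1 frag_extend_of)
next
 fix a b :: "'a \<Rightarrow>\<^sub>0 int"
 assume "frag_extend h(a * g) = frag_extend h a * frag_extend h g"
 "frag_extend h(b * g) = frag_extend h b * frag_extend h g"
 thus "frag_extend h((a-b) * g) = frag_extend h(a-b) * frag_extend h g"
 by (simp only: left_diff_distrib frag_extend_diff)
qed auto
qed

lemma monomial_induct [case_names zero step]: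
 fixes m :: "nat \<Rightarrow>\<^sub>0 nat"
 assumes "P 0" and step: "!!m k. P m ==> P(m+Poly_Mapping.single k 1)"
 shows "P m"
proof -
have aux: "P m' ==> P(m'+Poly_Mapping.single k v)" for m' k v
proof (induction v)
 case (Suc v)
 hence "P(m'+Poly_Mapping.single k v+Poly_Mapping.single k 1)" by (intro step) auto
 moreover have "m'+Poly_Mapping.single k v+Poly_Mapping.single k 1 = m'+Poly_Mapping.single k(Suc v)"
 unfolding add.assoc single_add[symmetric] by simp
 ultimately show ?case by simp
qed simp
show ?thesis
proof (induction m rule: update_induct)
 case const thus ?case by (simp add: assms)
next
 case (update f a b)
 have "Poly_Mapping.update a b f = f+Poly_Mapping.single a b"
 using update(1) by (intro poly_mapping_eqI)
 (auto simp: lookup_update lookup_add lookup_single in_keys_iff)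
 thus ?case using aux update by simp
qed
qed

text \<open>Differences yield 0, negatives and hence sums, so 1 and multiplication by variables
  generate everything. Identities between ring homomorphisms thus need checking only on
  variables.\<close>

lemma polynomial_induct [case_names one var diff]:
 fixes f :: mpoly
 assumes one: "P 1" and var: "!!f k. P f ==> P(f * xvar k)" and diff: "!!f g. P f ==> P g ==> P(f-g)"
 shows "P f"
proof (rule frag_induction[of f UNIV P])
show "P 0" using diff[OF one one] by simp
next
fix m :: "nat \<Rightarrow>\<^sub>0 nat"
show "P(frag_of m)"
proof (induction m rule: monomial_induct)
 case zero thus ?case using one by simp
next
 case (step m k)
 hence "P(frag_of m * xvar k)" by (rule var)
 thus ?case by (simp add: xvar_def mult_single)
qed
qed (use diff in auto)

lemma lookup_swap_mon: "Poly_Mapping.lookup(swap_mon i m) k = Poly_Mapping.lookup m(swapidx i k)"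
proof -
have "Poly_Mapping.lookup(swap_mon i m) k =
(SUM l:Poly_Mapping.keys m. if l = swapidx i k then Poly_Mapping.lookup m l else 0)"
unfolding swap_mon_def lookup_sum
by (intro sum.cong) (auto simp: lookup_single swapidx_def)
thus ?thesis by (simp add: in_keys_iff)
qed

lemma swapidx_swapidx [simp]: "swapidx i(swapidx i k) = k"
by (auto simp: swapidx_def)

lemma swap_mon_add: "swap_mon i(m+m') = swap_mon i m+swap_mon i m'"
by (rule poly_mapping_eqI) (simp add: lookup_swap_mon lookup_add)

lemma swap_mon_single: "swap_mon i(Poly_Mapping.single k v) = Poly_Mapping.single(swapidx i k) v"
by (rule poly_mapping_eqI) (auto simp: lookup_swap_mon lookup_single swapidx_def)

lemma swap_poly_extend: "swap_poly i = frag_extend(%m. frag_of(swap_mon i m))"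
proof
fix f
have "Poly_Mapping.single(swap_mon i m)(Poly_Mapping.lookup f m)
= frag_cmul(Poly_Mapping.lookup f m)(frag_of(swap_mon i m))" for m
by (rule poly_mapping_eqI) (simp add: lookup_single)
thus "swap_poly i f = frag_extend(%m. frag_of(swap_mon i m)) f"
by (simp add: swap_poly_def frag_extend_def)
qed

lemma swap_add [simp]: "swap_poly i(f+g) = swap_poly i f+swap_poly i g"
 and swap_diff [simp]: "swap_poly i(f-g) = swap_poly i f-swap_poly i g"
 and swap_uminus [simp]: "swap_poly i(- f) =-swap_poly i f"
 and swap_zero [simp]: "swap_poly i 0 = 0"
by (simp_all add: swap_poly_extend frag_extend_add frag_extend_diff frag_extend_minus)

lemma swap_mult [simp]: "swap_poly i(f * g) = swap_poly i f * swap_poly i g"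
unfolding swap_poly_extend
by (rule frag_extend_mult) (simp add: swap_mon_add mult_single)

lemma swap_mon_zero [simp]: "swap_mon i 0 = 0"
by (simp add: swap_mon_def)

lemma swap_frag_of: "swap_poly i(frag_of m) = frag_of(swap_mon i m)"
by (simp only: swap_poly_extend frag_extend_of)

lemma swap_one [simp]: "swap_poly i 1 = 1"
using swap_frag_of[of i 0] by simp

lemma swap_xvar [simp]: "swap_poly i(xvar k) = xvar(swapidx i k)"
unfolding xvar_def swap_frag_of by (simp add: swap_mon_single)

lemma swap_prod: "swap_poly i(prod f X) = (PROD x:X. swap_poly i(f x))"
by (induction X rule: infinite_finite_induct) auto

lemma swap_swap [simp]: "swap_poly i(swap_poly i f) = f"
by (induction f rule: polynomial_induct) auto

lemma swap_braid: "swap_poly i(swap_poly(Suc i)(swap_poly i f)) =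
swap_poly(Suc i)(swap_poly i(swap_poly(Suc i) f))"
by (induction f rule: polynomial_induct) (auto simp: swapidx_def)

lemma swap_commute: "Suc i<j ==> swap_poly i(swap_poly j f) = swap_poly j(swap_poly i f)"
by (induction f rule: polynomial_induct) (auto simp: swapidx_def)

lemma xvar_inj [simp]: "xvar i = xvar j \<longleftrightarrow> i = j"
proof
assume "xvar i = xvar j"
hence "Poly_Mapping.keys(xvar i) = Poly_Mapping.keys(xvar j)" by simp
hence "Poly_Mapping.single i(1::nat) = Poly_Mapping.single j 1" by (simp add: xvar_def)
hence "Poly_Mapping.keys(Poly_Mapping.single i(1::nat)) = Poly_Mapping.keys(Poly_Mapping.single j(1::nat))" by simp
thus "i = j" by simp
qed simp

text \<open>\<open>ddiff\<close> is a definite description, so divisibility has to be proved. The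
  twisted Leibniz rule provides the quotient for f * x_k from the quotient for f.\<close>

lemma ddiff_ex: "EX g. (xvar i-xvar(Suc i)) * g = f-swap_poly i f"
proof (induction f rule: polynomial_induct)
case one thus ?case by (intro exI[of _ 0]) simp
next
case (var f k)
then obtain g where g: "(xvar i-xvar(Suc i)) * g = f-swap_poly i f" by blast
\<comment> \<open>\<open>h\<close> is the divided difference of the single variable
  \<open>xvar k\<close>.\<close>
define h where "h = (if k = i then 1 else if k = Suc i then -1 else(0::mpoly))"
have h: "(xvar i-xvar(Suc i)) * h = xvar k-swap_poly i(xvar k)"
by (auto simp: h_def swapidx_def)
have "(xvar i-xvar(Suc i)) * (g * xvar k+swap_poly i f * h)
= ((xvar i-xvar(Suc i)) * g) * xvar k+swap_poly i f * ((xvar i-xvar(Suc i)) * h)"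
by (simp add: algebra_simps)
also have "...=f * xvar k-swap_poly i(f * xvar k)" unfolding g h by (simp add: algebra_simps)
finally show ?case by blast
next
case (diff f g)
then obtain a b where "(xvar i-xvar(Suc i)) * a = f-swap_poly i f"
"(xvar i-xvar(Suc i)) * b = g-swap_poly i g" by blast
thus ?case by (intro exI[of _ "a-b"]) (simp add: right_diff_distrib)
qed

lemma xdiff_nz: "xvar i-xvar(Suc i) ~= (0::mpoly)" by simp

lemma ddiff_unique: "(xvar i-xvar(Suc i)) * g = f-swap_poly i f ==> ddiff i f = g"
unfolding ddiff_def
by (rule the_equality) (metis mult_cancel_left xdiff_nz)+

lemma ddiff_eq: "(xvar i-xvar(Suc i)) * ddiff i f = f-swap_poly i f"
using ddiff_ex[of i f] ddiff_unique by metis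

lemma ddiff_add [simp]: "ddiff i(f+g) = ddiff i f+ddiff i g"
by (rule ddiff_unique) (simp add: distrib_left ddiff_eq)

lemma ddiff_diff [simp]: "ddiff i(f-g) = ddiff i f-ddiff i g"
by (rule ddiff_unique) (simp add: right_diff_distrib ddiff_eq)

lemma ddiff_zero [simp]: "ddiff i 0 = 0"
by (rule ddiff_unique) simp

lemma ddiff_sym_zero: "ddiff i f = 0 \<longleftrightarrow> swap_poly i f = f"
proof
assume "ddiff i f = 0" thus "swap_poly i f = f" using ddiff_eq[of i f] by simp
next
assume "swap_poly i f = f" thus "ddiff i f = 0" by (intro ddiff_unique) simp
qed

lemma swap_ddiff [simp]: "swap_poly i(ddiff i f) = ddiff i f"
proof -
have "swap_poly i((xvar i-xvar(Suc i)) * ddiff i f) = swap_poly i(f-swap_poly i f)"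
by (simp only: ddiff_eq)
hence "(xvar(Suc i)-xvar i) * swap_poly i(ddiff i f) = swap_poly i f-f"
by (simp add: swapidx_def)
hence "(xvar i-xvar(Suc i)) * swap_poly i(ddiff i f) = f-swap_poly i f"
by (simp add: algebra_simps)
thus ?thesis using ddiff_unique by metis
qed

lemma ddiff_ddiff [simp]: "ddiff i(ddiff i f) = 0"
by (simp add: ddiff_sym_zero)

lemma ddiff_mult: "ddiff i(f * g) = ddiff i f * g+swap_poly i f * ddiff i g"
proof (rule ddiff_unique)
have "(xvar i-xvar(Suc i)) * (ddiff i f * g+swap_poly i f * ddiff i g)
= ((xvar i-xvar(Suc i)) * ddiff i f) * g+swap_poly i f * ((xvar i-xvar(Suc i)) * ddiff i g)"
by (simp add: algebra_simps)
thus "(xvar i-xvar(Suc i)) * (ddiff i f * g+swap_poly i f * ddiff i g) = f * g-swap_poly i(f * g)"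
unfolding ddiff_eq by (simp add: algebra_simps)
qed

lemma ddiff_mult_sym: "swap_poly i f = f ==> ddiff i(f * g) = f * ddiff i g"
using ddiff_mult[of i f g] by (simp add: ddiff_sym_zero[symmetric])

lemma ddiff_xvar: "ddiff i(xvar i) = 1" "ddiff i(xvar(Suc i))=-1"
by (rule ddiff_unique; simp add: swapidx_def)+

text \<open>After clearing denominators both triple products become the signed sum of f over the six
  permutations of three variables, which does not depend on the reduced word.\<close>

lemma ddiff_braid_aux:
 fixes i :: nat and f :: mpoly
 defines "x == xvar i" and "y == xvar(Suc i)" and "z == xvar(Suc(Suc i))"
 and "s == swap_poly i" and "t == swap_poly(Suc i)"
 shows "(x-y) * (y-z) * (x-z) * ddiff i(ddiff(Suc i)(ddiff i f))
= f-s f-t f+t(s f)+s(t f)-s(t(s f))"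
 and "(x-y) * (y-z) * (x-z) * ddiff(Suc i)(ddiff i(ddiff(Suc i) f))
= f-s f-t f+t(s f)+s(t f)-s(t(s f))"
proof -
have [simp]: "s x = y" "s y = x" "s z = z" "t x = x" "t y = z" "t z = y"
by (simp_all add: assms swapidx_def)
have hom: "s(a * b) = s a * s b" "t(a * b) = t a * t b" "s(a-b) = s a-s b" "t(a-b) = t a-t b"
"s(s a) = a" "t(t a) = a" for a b by (simp_all add: s_def t_def)
have d1: "(x-y) * ddiff i g = g-s g" for g unfolding x_def y_def s_def by (rule ddiff_eq)
have d2: "(y-z) * ddiff(Suc i) g = g-t g" for g unfolding z_def y_def t_def by (rule ddiff_eq)
have br: "s(t(s f)) = t(s(t f))" unfolding s_def t_def by (rule swap_braid)
have nz: "x-y ~= 0" "y-z ~= 0" "x-z ~= 0" by (simp_all add: x_def y_def z_def)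
define D where "D = (x-y) * (y-z) * (x-z)"
\<comment> \<open>The Vandermonde product \<open>D\<close> changes sign under both swaps, so
  applying a swap to \<open>D * h\<close> costs only a sign.\<close>
have sD: "s D =-D" "t D =-D" unfolding D_def hom by (simp_all add: algebra_simps)
{
define g where "g = ddiff i f" define h where "h = ddiff(Suc i) g"
have e1: "(x-y) * g = f-s f" unfolding g_def by (rule d1)
have e2: "(x-z) * t g = t f-t(s f)" using arg_cong[OF e1,of t] by (simp add: hom)
have K: "D * h = (x-z) * (f-s f)-(x-y) * (t f-t(s f))"
by (smt(verit) h_def d2 e1 e2 D_def algebra_simps)
have sK: "- D * s h = (y-z) * (s f-f)-(y-x) * (s(t f)-s(t(s f)))"
using arg_cong[OF K,of s] by (simp add: hom sD)
have "(x-y) * (D * ddiff i h) = D * h-D * s h"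
using d1[of h] by (metis mult.left_commute right_diff_distrib)
also have "...=(x-y) * (f-s f-t f+t(s f)+s(t f)-s(t(s f)))"
using sK unfolding K by (simp add: algebra_simps)
finally show "(x-y) * (y-z) * (x-z) * ddiff i(ddiff(Suc i)(ddiff i f))
= f-s f-t f+t(s f)+s(t f)-s(t(s f))"
using nz unfolding D_def[symmetric] h_def g_def by simp
}
{
define g where "g = ddiff(Suc i) f" define h where "h = ddiff i g"
have e1: "(y-z) * g = f-t f" unfolding g_def by (rule d2)
have e2: "(x-z) * s g = s f-s(t f)" using arg_cong[OF e1,of s] by (simp add: hom)
have K: "D * h = (x-z) * (f-t f)-(y-z) * (s f-s(t f))"
by (smt(verit) h_def d1 e1 e2 D_def algebra_simps)
have sK: "- D * t h = (x-y) * (t f-f)-(z-y) * (t(s f)-t(s(t f)))"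
using arg_cong[OF K,of t] by (simp add: hom sD)
have "(y-z) * (D * ddiff(Suc i) h) = D * h-D * t h"
using d2[of h] by (metis mult.left_commute right_diff_distrib)
also have "...=(y-z) * (f-s f-t f+t(s f)+s(t f)-t(s(t f)))"
using sK unfolding K by (simp add: algebra_simps)
finally show "(x-y) * (y-z) * (x-z) * ddiff(Suc i)(ddiff i(ddiff(Suc i) f))
= f-s f-t f+t(s f)+s(t f)-s(t(s f))"
using nz unfolding D_def[symmetric] h_def g_def br by simp
}
qed

lemma ddiff_braid: "ddiff i(ddiff(Suc i)(ddiff i f)) = ddiff(Suc i)(ddiff i(ddiff(Suc i) f))"
proof -
have "(xvar i-xvar(Suc i)) * (xvar(Suc i)-xvar(Suc(Suc i))) * (xvar i-xvar(Suc(Suc i))) ~= (0::mpoly)"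
by simp
thus ?thesis using ddiff_braid_aux[of i f] by (metis mult_cancel_left)
qed

lemma ddiff_commute:
 assumes "Suc i<j"
 shows "ddiff i(ddiff j f) = ddiff j(ddiff i f)"
proof -
have s: "swapidx i j = j" "swapidx i(Suc j) = Suc j" "swapidx j i = i" "swapidx j(Suc i) = Suc i"
using assms by (auto simp: swapidx_def)
have "(xvar j-xvar(Suc j)) * ((xvar i-xvar(Suc i)) * ddiff i(ddiff j f))
= (xvar j-xvar(Suc j)) * ddiff j f-swap_poly i((xvar j-xvar(Suc j)) * ddiff j f)"
by (subst ddiff_eq) (simp add: s algebra_simps)
also have "...=f-swap_poly j f-swap_poly i f+swap_poly i(swap_poly j f)"
unfolding ddiff_eq by (simp)
finally have 1: "(xvar j-xvar(Suc j)) * ((xvar i-xvar(Suc i)) * ddiff i(ddiff j f)) = f-swap_poly j f-swap_poly i f+swap_poly i(swap_poly j f)" .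
have "(xvar i-xvar(Suc i)) * ((xvar j-xvar(Suc j)) * ddiff j(ddiff i f))
= (xvar i-xvar(Suc i)) * ddiff i f-swap_poly j((xvar i-xvar(Suc i)) * ddiff i f)"
by (subst ddiff_eq) (simp add: s algebra_simps)
also have "...=f-swap_poly j f-swap_poly i f+swap_poly i(swap_poly j f)"
unfolding ddiff_eq by (simp add: swap_commute[OF assms])
finally have "(xvar j-xvar(Suc j)) * (xvar i-xvar(Suc i)) * ddiff i(ddiff j f)
= (xvar j-xvar(Suc j)) * (xvar i-xvar(Suc i)) * ddiff j(ddiff i f)"
using 1 by (simp add: mult.assoc mult.left_commute)
thus ?thesis by simp
qed

text \<open>This is pi_i - 1 (\<open>hdiff_alt\<close>). It sends an atom to an atom up to sign, or
  to 0 (\<open>hdiff_atom\<close>), whereas \<open>pidiff\<close> can produce a sum of two.\<close>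

definition hdiff :: "nat => mpoly => mpoly" where
"hdiff i f = xvar(Suc i) * ddiff i f"

lemma pidiff_alt: "pidiff i f = f+hdiff i f"
by (simp add: pidiff_def hdiff_def ddiff_mult ddiff_xvar swapidx_def)

lemma hdiff_alt: "hdiff i f = pidiff i f-f" by (simp add: pidiff_alt)

lemma pidiff_add [simp]: "pidiff i(f+g) = pidiff i f+pidiff i g"
 and pidiff_diff [simp]: "pidiff i(f-g) = pidiff i f-pidiff i g"
 and pidiff_zero [simp]: "pidiff i 0 = 0"
by (simp_all add: pidiff_def algebra_simps)

lemma hdiff_add [simp]: "hdiff i(f+g) = hdiff i f+hdiff i g"
 and hdiff_diff [simp]: "hdiff i(f-g) = hdiff i f-hdiff i g"
 and hdiff_zero [simp]: "hdiff i 0 = 0"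
by (simp_all add: hdiff_def algebra_simps)

lemma pidiff_sum: "pidiff i(sum f X) = (SUM x:X. pidiff i(f x))"
by (induction X rule: infinite_finite_induct) auto

lemma swap_pidiff [simp]: "swap_poly i(pidiff i f) = pidiff i f"
by (simp add: pidiff_def)

lemma pidiff_sym: "pidiff i f = f \<longleftrightarrow> swap_poly i f = f"
proof
assume "pidiff i f = f" thus "swap_poly i f = f" by (metis swap_pidiff)
next
assume "swap_poly i f = f"
hence "ddiff i f = 0" by (simp add: ddiff_sym_zero)
thus "pidiff i f = f" by (simp add: pidiff_alt hdiff_def)
qed

lemma pidiff_idem [simp]: "pidiff i(pidiff i f) = pidiff i f"
by (simp add: pidiff_sym)

lemma hdiff_sym_zero: "swap_poly i f = f ==> hdiff i f = 0"
by (simp add: hdiff_alt pidiff_sym)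

lemma pidiff_mult_sym: "swap_poly i f = f ==> pidiff i(f * g) = f * pidiff i g"
using ddiff_mult_sym[of i f "xvar i * g"] by (simp add: pidiff_def mult.left_commute)

lemma hdiff_mult_sym: "swap_poly i f = f ==> hdiff i(f * g) = f * hdiff i g"
using ddiff_mult_sym[of i f g] by (simp add: hdiff_def)

lemma pidiff_mult_sym2: "swap_poly i f = f ==> pidiff i(g * f) = pidiff i g * f"
using pidiff_mult_sym[of i f g] by (simp add: mult.commute)

lemma hdiff_mult_sym2: "swap_poly i f = f ==> hdiff i(g * f) = hdiff i g * f"
using hdiff_mult_sym[of i f g] by (simp add: mult.commute)

lemma pidiff_xvar_mult: "pidiff i(xvar i * f) = xvar i * f+xvar(Suc i) * pidiff i f"
unfolding pidiff_alt[of i "xvar i * f"] hdiff_def by (simp add: pidiff_def)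

lemma pidiff_xvar_Suc_zero: "swap_poly i f = f ==> pidiff i(xvar(Suc i) * f) = 0"
by (subst pidiff_mult_sym2) (simp_all add: pidiff_alt hdiff_def ddiff_xvar)

text \<open>This trades an \<open>hdiff\<close> for a \<open>pidiff\<close> at the cost of moving a
  variable, the exchange on which \<open>xset_atom_word\<close> rests.\<close>

lemma xvar_hdiff: "xvar i * hdiff i f = pidiff i(xvar(Suc i) * f)"
unfolding pidiff_alt hdiff_def ddiff_mult[of i "xvar(Suc i)" f]
by (simp add: ddiff_xvar swapidx_def algebra_simps)

text \<open>Collecting all multiplications innermost turns both sides into words of divided
  differences applied to the same polynomial x^2 y f, so the braid relation is inherited from
  \<open>ddiff_braid\<close>.\<close>

lemma pidiff_braid_aux:
 fixes i :: nat and f :: mpoly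
 defines "x == xvar i" and "y == xvar(Suc i)" and "z == xvar(Suc(Suc i))"
 shows "pidiff i(pidiff(Suc i)(pidiff i f)) = ddiff i(ddiff(Suc i)(ddiff i(x * x * y * f)))"
 and "pidiff(Suc i)(pidiff i(pidiff(Suc i) f)) = ddiff(Suc i)(ddiff i(ddiff(Suc i)(x * x * y * f)))"
proof -
have [simp]: "swap_poly(Suc i) x = x" "swap_poly i x = y" "swap_poly i y = x"
by (simp_all add: assms swapidx_def)
have "pidiff i(pidiff(Suc i)(pidiff i f)) = ddiff i(x * ddiff(Suc i)(y * ddiff i(x * f)))"
by (simp add: pidiff_def x_def y_def)
also have "...=ddiff i(ddiff(Suc i)((x * y) * ddiff i(x * f)))"
by (simp add: ddiff_mult_sym[symmetric] mult.assoc)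
also have "...=ddiff i(ddiff(Suc i)(ddiff i((x * y) * (x * f))))"
by (subst ddiff_mult_sym[of i "x * y"]) (simp_all)
finally show "pidiff i(pidiff(Suc i)(pidiff i f)) = ddiff i(ddiff(Suc i)(ddiff i(x * x * y * f)))"
by (simp add: algebra_simps)
have "pidiff(Suc i)(pidiff i(pidiff(Suc i) f)) = ddiff(Suc i)(y * ddiff i(x * ddiff(Suc i)(y * f)))"
by (simp add: pidiff_def x_def y_def)
also have "...=ddiff(Suc i)(y * ddiff i(ddiff(Suc i)(x * (y * f))))"
by (simp add: ddiff_mult_sym[symmetric])
also have "...=ddiff(Suc i)(ddiff i(ddiff(Suc i)(x * x * y * f)))"
proof -
 have "ddiff(Suc i)(ddiff i(ddiff(Suc i)(x * (x * y * f)))) = ddiff(Suc i)(ddiff i(x * ddiff(Suc i)(x * y * f)))"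
 by (simp add: ddiff_mult_sym)
 \<comment> \<open>The Leibniz rule for \<open>ddiff i\<close> produces an extra summand in the
   image of \<open>ddiff (Suc i)\<close>, which the outer \<open>ddiff (Suc i)\<close>
   kills.\<close>
 also have "...=ddiff(Suc i)(ddiff(Suc i)(x * y * f)+y * ddiff i(ddiff(Suc i)(x * y * f)))"
 by (subst ddiff_mult) (simp add: x_def y_def ddiff_xvar swapidx_def)
 finally show ?thesis by (simp add: mult.assoc)
qed
finally show "pidiff(Suc i)(pidiff i(pidiff(Suc i) f)) = ddiff(Suc i)(ddiff i(ddiff(Suc i)(x * x * y * f)))" .
qed

lemma pidiff_braid: "pidiff i(pidiff(Suc i)(pidiff i f)) = pidiff(Suc i)(pidiff i(pidiff(Suc i) f))"
by (simp only: pidiff_braid_aux ddiff_braid)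

lemma pidiff_commute:
 assumes "Suc i<j" shows "pidiff i(pidiff j f) = pidiff j(pidiff i f)"
proof -
have s: "swap_poly i(xvar j) = xvar j" "swap_poly j(xvar i) = xvar i"
using assms by (auto simp: swapidx_def)
have "pidiff i(pidiff j f) = ddiff i(ddiff j(xvar i * (xvar j * f)))"
by (simp only: pidiff_def ddiff_mult_sym[OF s(2)])
moreover have "pidiff j(pidiff i f) = ddiff j(ddiff i(xvar j * (xvar i * f)))"
by (simp only: pidiff_def ddiff_mult_sym[OF s(1)])
ultimately show ?thesis by (simp add: ddiff_commute[OF assms] mult.left_commute)
qed

lemma hdiff_braid: "hdiff i(hdiff(Suc i)(hdiff i f)) = hdiff(Suc i)(hdiff i(hdiff(Suc i) f))"
using pidiff_braid[of i f] by (simp add: hdiff_alt)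

lemma hdiff_commute: "Suc i<j ==> hdiff i(hdiff j f) = hdiff j(hdiff i f)"
using pidiff_commute[of i j f] by (simp add: hdiff_alt)

declare lookup_nth [simp del] keys_nth [simp del]

lemma additive_sum:
 fixes T :: "'a::comm_monoid_add => 'b::ab_group_add"
 assumes T: "!!f g. T(f+g) = T f+T g"
 shows "T(sum h X) = (SUM x:X. T(h x))"
proof -
have T0: "T 0 = 0" using T[of 0 0] by simp
show ?thesis by (induction X rule: infinite_finite_induct) (auto simp: T T0)
qed

subsection \<open>Cones and triangular families\<close>

text \<open>Adding one generator at a time makes positivity under linear operators an induction on
  the generators; \<open>cone_coeffs\<close> recovers the coefficient function that the theorem asks
  for.\<close>

inductive_set cone :: "(nat list => mpoly) => nat => mpoly set"
for g :: "nat list => mpoly" and n :: nat where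
cone_zero: "0 : cone g n"
| cone_step: "f : cone g n ==> length b = n ==> f+g b : cone g n"

inductive_set zspan :: "(nat list => mpoly) => nat => mpoly set"
for g :: "nat list => mpoly" and n :: nat where
zspan_zero: "0 : zspan g n"
| zspan_step: "f : zspan g n ==> length b = n ==> f+g b : zspan g n"
| zspan_minus: "f : zspan g n ==> length b = n ==> f-g b : zspan g n"

lemma cone_coeffs:
 assumes "f : cone g n"
 shows "EX c :: nat list => nat. finite {b. c b ~= 0} & (ALL b. c b ~= 0 --> length b = n) &
f = (SUM b:{b. c b ~= 0}. of_nat(c b) * g b)"
using assms
proof induction
case cone_zero
show ?case by (intro exI[of _ "%_. 0"]) simp
next
case (cone_step f b)
then obtain c :: "nat list => nat" where c: "finite {b. c b ~= 0}" "!!b. c b ~= 0 ==> length b = n"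
"f = (SUM b:{b. c b ~= 0}. of_nat(c b) * g b)" by blast
define c' where "c' = c(b := Suc(c b))"
let ?S = "insert b {b. c b ~= 0}"
have s: "{b. c' b ~= 0} = ?S" by (auto simp: c'_def)
have "f = (SUM b:?S. of_nat(c b) * g b)"
unfolding c(3) by (rule sum.mono_neutral_left) (use c in auto)
moreover have "(SUM d:?S. of_nat(c' d) * g d) = (SUM d:?S. of_nat(c d) * g d+(if d = b then g b else 0))"
by (intro sum.cong) (auto simp: c'_def algebra_simps)
moreover have "(SUM d:?S. of_nat(c d) * g d+(if d = b then g b else 0)) = (SUM d:?S. of_nat(c d) * g d)+g b"
using c(1) by (simp add: sum.distrib del: sum.insert sum.insert_if)
ultimately have "f+g b = (SUM b:{b. c' b ~= 0}. of_nat(c' b) * g b)" unfolding s by simp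
moreover have "ALL d. c' d ~= 0 --> length d = n" using c(2) cone_step(2) by (auto simp: c'_def)
moreover have "finite {b. c' b ~= 0}" unfolding s using c(1) by simp
ultimately show ?case by blast
qed

lemma cone_base: "length b = n ==> g b : cone g n"
using cone_step[OF cone_zero] by fastforce

lemma cone_add: "f : cone g n ==> h : cone g n ==> f+h : cone g n"
proof -
assume f: "f : cone g n" and h: "h : cone g n"
from h show "f+h : cone g n"
proof induction
 case cone_zero thus ?case using f by simp
next
 case (cone_step h b)
 thus ?case using cone.cone_step[of "f+h" g n b] by (simp add: add.assoc)
qed
qed

lemma cone_sum: "(!!x. x : X ==> h x : cone g n) ==> sum h X : cone g n"
by (induction X rule: infinite_finite_induct) (auto intro: cone_zero cone_add)

lemma cone_sum_list: "(!!x. x : set X ==> h x : cone g n) ==> sum_list(map h X) : cone g n"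
by (induction X) (auto intro: cone_zero cone_add)

lemma cone_linear:
 fixes T :: "mpoly => mpoly"
 assumes f: "f : cone g n" and T: "!!f g. T(f+g) = T f+T g" and b: "!!b. length b = n ==> T(g b) : cone h m"
 shows "T f : cone h m"
using f
using T[of 0 0] cone_add b by induction (auto simp: T cone.cone_zero)

lemma zspan_add: "f : zspan g n ==> h : zspan g n ==> f+h : zspan g n"
 and zspan_diff: "f : zspan g n ==> h : zspan g n ==> f-h : zspan g n"
proof -
assume f: "f : zspan g n" and h: "h : zspan g n"
from h show "f+h : zspan g n"
proof induction
 case zspan_zero thus ?case using f by simp
next
 case (zspan_step h b)
 thus ?case using zspan.zspan_step[of "f+h" g n b] by (simp add: add.assoc)
next
 case (zspan_minus h b)
 thus ?case using zspan.zspan_minus[of "f+h" g n b] by (simp add: add_diff_eq)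
qed
from h show "f-h : zspan g n"
proof induction
 case zspan_zero thus ?case using f by simp
next
 case (zspan_step h b)
 thus ?case using zspan.zspan_minus[of "f-h" g n b] by (simp add: diff_diff_add)
next
 case (zspan_minus h b)
 thus ?case using zspan.zspan_step[of "f-h" g n b] by (simp add: diff_diff_eq2 diff_add_eq)
qed
qed

lemma zspan_base: "length b = n ==> g b : zspan g n"
using zspan_step[OF zspan_zero] by fastforce

lemma zspan_uminus: "f : zspan g n ==> -f : zspan g n"
using zspan_diff[OF zspan_zero] by fastforce

lemma zspan_sum: "(!!x. x : X ==> h x : zspan g n) ==> sum h X : zspan g n"
by (induction X rule: infinite_finite_induct) (auto intro: zspan_zero zspan_add)

lemma zspan_cmul:
 assumes f: "f : zspan g n"
 shows "frag_cmul k f : zspan g n"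
proof -
have nat: "frag_cmul(int m) f : zspan g n" for m
using zspan_add f by (induction m) (auto simp: zspan_zero frag_cmul_distrib)
show ?thesis
proof (cases k)
 case (nonneg m) thus ?thesis using nat by simp
next
 case (neg m)
 hence "frag_cmul k f =-frag_cmul(int(Suc m)) f" by simp
 thus ?thesis using zspan_uminus[OF nat] by metis
qed
qed

lemma zspan_linear:
 fixes T :: "mpoly => mpoly"
 assumes f: "f : zspan g n" and T: "!!f g. T(f+g) = T f+T g" and b: "!!b. length b = n ==> T(g b) : zspan h m"
 shows "T f : zspan h m"
proof -
have T0: "T 0 = 0" using T[of 0 0] by simp
have Td: "T(f-g) = T f-T g" for f g using T[of "f-g" g] by simp
show ?thesis using f by induction(auto simp: T0 T Td intro: zspan_zero zspan_add zspan_diff b)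
qed

lemma cone_zspan: "f : cone g n ==> f : zspan g n"
by (induction rule: cone.induct) (auto intro: zspan.intros)

section \<open>Polynomials in n variables, coefficients and triangular families\<close>

definition polys :: "nat => mpoly set" where
"polys n = {f. ALL m:Poly_Mapping.keys f. Poly_Mapping.keys m <= {..<n}}"

definition mlist :: "nat => (nat \<Rightarrow>\<^sub>0 nat) => nat list" where
"mlist n m = map(Poly_Mapping.lookup m) [0..<n]"

definition coef :: "mpoly => nat list => int" where
"coef f b = Poly_Mapping.lookup f(Poly_Mapping.nth b)"

lemma length_mlist [simp]: "length(mlist n m) = n" by (simp add: mlist_def)

lemma lookup_nth0: "Poly_Mapping.lookup(Poly_Mapping.nth a) k = (if k<length a then a ! k else 0)"
by (simp add: lookup_nth nth_default_def)

lemma nth_mlist: "Poly_Mapping.keys m <= {..<n} ==> Poly_Mapping.nth(mlist n m) = m"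
by (rule poly_mapping_eqI) (auto simp: lookup_nth0 mlist_def in_keys_iff)

lemma mlist_nth: "length a = n ==> mlist n(Poly_Mapping.nth a) = a"
by (rule nth_equalityI) (auto simp: lookup_nth0 mlist_def)

lemma nth_inj: "length a = length b ==> Poly_Mapping.nth a = Poly_Mapping.nth b ==> a = (b :: nat list)"
by (metis mlist_nth)

lemma coef_xmon: "length a = length b ==> coef(xmon a) b = (if a = b then 1 else 0)"
by (auto simp: coef_def xmon_def dest: nth_inj)

lemma coef_add [simp]: "coef(f+g) b = coef f b+coef g b"
 and coef_diff [simp]: "coef(f-g) b = coef f b-coef g b"
 and coef_zero [simp]: "coef 0 b = 0"
by (simp_all add: coef_def lookup_add lookup_minus)

lemma coef_sum: "coef(sum f X) b = (SUM x:X. coef(f x) b)"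
by (simp add: coef_def lookup_sum)

lemma polys_zero [simp]: "0 : polys n" by (simp add: polys_def)

lemma polys_add: "f : polys n ==> g : polys n ==> f+g : polys n"
using keys_add[of f g] by (fastforce simp: polys_def)

lemma polys_diff: "f : polys n ==> g : polys n ==> f-g : polys n"
using keys_diff[of f g] by (fastforce simp: polys_def)

lemma polys_sum: "(!!x. x : X ==> h x : polys n) ==> sum h X : polys n"
by (induction X rule: infinite_finite_induct) (auto intro: polys_add)

lemma polys_mult: assumes "f : polys n" "g : polys n" shows "f * g : polys n"
unfolding polys_def
proof safe
fix m k assume m: "m : Poly_Mapping.keys(f * g)" and k: "k : Poly_Mapping.keys m"
then obtain a b where "m = a+b" "a : Poly_Mapping.keys f" "b : Poly_Mapping.keys g"
using keys_mult[of f g] by blast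
thus "k<n" using assms k keys_add[of a b] by (fastforce simp: polys_def)
qed

lemma keys_nth_less: "Poly_Mapping.keys(Poly_Mapping.nth(a :: nat list)) <= {..<length a}"
by (auto simp: in_keys_iff lookup_nth0 del: lookup_nth split: if_splits)

lemma xmon_polys: "length a <= n ==> xmon a : polys n"
using keys_nth_less[of a] by (auto simp: polys_def xmon_def)

lemma poly_as_sum: "f = (SUM m:Poly_Mapping.keys f. frag_cmul(Poly_Mapping.lookup f m)(frag_of m))"
using frag_expansion[of f] by (simp add: frag_extend_def)

lemma polys_expand:
 assumes "f : polys n"
 shows "f = (SUM m:Poly_Mapping.keys f. frag_cmul(Poly_Mapping.lookup f m)(xmon(mlist n m)))"
using assms poly_as_sum by (auto simp: xmon_def polys_def nth_mlist)

lemma polys_zspan_xmon: "f : polys n \<longleftrightarrow> f : zspan xmon n"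
proof
assume "f : polys n"
hence "f = (SUM m:Poly_Mapping.keys f. frag_cmul(Poly_Mapping.lookup f m)(xmon(mlist n m)))"
by (rule polys_expand)
moreover have "(SUM m:Poly_Mapping.keys f. frag_cmul(Poly_Mapping.lookup f m)(xmon(mlist n m))) : zspan xmon n"
by (auto intro!: zspan_sum zspan_cmul zspan_base)
ultimately show "f : zspan xmon n" by (rule back_subst[where P= "%x. x : zspan xmon n",OF _ sym,rotated])
next
assume "f : zspan xmon n"
thus "f : polys n" by induction(auto intro: polys_add polys_diff xmon_polys)
qed

lemma polys_coef_eqI:
 assumes "f : polys n" "g : polys n" "!!b. length b = n ==> coef f b = coef g b"
 shows "f = g"
proof (rule poly_mapping_eqI)
fix m
show "Poly_Mapping.lookup f m = Poly_Mapping.lookup g m"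
proof (cases "Poly_Mapping.keys m <= {..<n}")
 case True
 thus ?thesis using assms(3)[of "mlist n m"] by (simp add: coef_def nth_mlist)
next
 case False
 hence "m ~: Poly_Mapping.keys f" "m ~: Poly_Mapping.keys g" using assms by (auto simp: polys_def)
 thus ?thesis by (simp add: in_keys_iff)
qed
qed

text \<open>The rank \<open>rk\<close> is the sum of all partial sums; it strictly increases along the dominance order.\<close>

definition rk :: "nat list => nat" where
"rk b = (SUM j<length b. (length b-j) * b ! j)"

lemma rk_le: "rk b <= length b * sum_list b"
unfolding rk_def sum_list_sum_nth atLeast0LessThan sum_distrib_left
by (intro sum_mono mult_right_mono) auto

lemma finite_lists_sum: "finite {a :: nat list. length a = n & sum_list a = s}"
proof (rule finite_subset)
show "{a :: nat list. length a = n & sum_list a = s} <= {xs. set xs <= {..s} & length xs = n}"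
using member_le_sum_list by fastforce
show "finite {xs. set xs <= {..s} & length xs = n}" by (rule finite_lists_length_eq) simp
qed

definition triangular :: "(nat list => mpoly) => nat => bool" where
"triangular g n \<longleftrightarrow> (ALL a. length a = n --> g a : polys n & coef(g a) a = 1 &
(ALL b. length b = n --> coef(g a) b ~= 0 --> b = a | (sum_list b = sum_list a & rk a<rk b)))"

text \<open>Coefficient of \<open>g b\<close> in the expansion of f over a triangular family,
  obtained by back substitution from the indices of smaller \<open>rk\<close>. Defining it on all
  polynomials, rather than through a chosen expansion, makes it additive at once.\<close>

function dualc :: "(nat list => mpoly) => nat list => mpoly => int" where
"dualc g b f = coef f b-(SUM a:{a. length a = length b & sum_list a = sum_list b & rk a<rk b}.
dualc g a f * coef(g a) b)"
by auto
termination by (relation "measure(%(g,b,f). rk b)") auto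

declare dualc.simps [simp del]

lemma dualc_add [simp]: "dualc g b(f+h) = dualc g b f+dualc g b h"
proof (induction "rk b" arbitrary: b rule: less_induct)
case less
show ?case
unfolding dualc.simps[of g b] by (simp add: less distrib_right sum.distrib)
qed

lemma dualc_zero [simp]: "dualc g b 0 = 0"
using dualc_add[of g b 0 0] by simp

lemma dualc_diff [simp]: "dualc g b(f-h) = dualc g b f-dualc g b h"
using dualc_add[of g b "f-h" h] by simp

lemma dualc_sum: "dualc g b(sum h X) = (SUM x:X. dualc g b(h x))"
by (induction X rule: infinite_finite_induct) auto

lemma dualc_delta:
 assumes tri: "triangular g n" and a: "length a = n" and b: "length b = n"
 shows "dualc g b(g a) = (if a = b then 1 else 0)"
using b
proof (induction "rk b" arbitrary: b rule: less_induct)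
case less
let ?S = "{a. length a = length b & sum_list a = sum_list b & rk a<rk b}"
have fin: "finite ?S" by (rule finite_subset[OF _ finite_lists_sum[of "length b" "sum_list b"]]) auto
\<comment> \<open>By induction the only term left is the one with a' = a; when present it cancels
  the monomial coefficient \<open>coef (g a) b\<close>.\<close>
have "(SUM a':?S. dualc g a'(g a) * coef(g a') b) = (SUM a':?S. if a = a' then coef(g a') b else 0)"
by (intro sum.cong) (use less in auto)
also have "...=(if a : ?S then coef(g a) b else 0)" using fin by (simp)
finally have e: "dualc g b(g a) = coef(g a) b-(if a : ?S then coef(g a) b else 0)"
by (subst dualc.simps) simp
show ?case
proof (cases "a = b")
 case True thus ?thesis unfolding e using tri a by (auto simp: triangular_def)
next
 case False
 hence "coef(g a) b ~= 0 ==> a : ?S" using tri a less(2) unfolding triangular_def by fastforce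
 thus ?thesis unfolding e using False by auto
qed
qed

text \<open>All other exponents of \<open>g a\<close> have larger \<open>rk\<close>, and
  \<open>rk_le\<close> bounds \<open>rk\<close> in a fixed degree, so solving for the leading
  monomial terminates.\<close>

lemma xmon_zspan:
 assumes tri: "triangular g n" and "length a = n"
 shows "xmon a : zspan g n"
using assms(2)
proof (induction "n * sum_list a-rk a" arbitrary: a rule: less_induct)
case less
define K where "K = Poly_Mapping.keys(g a)"
have ga: "g a : polys n" and c1: "coef(g a) a = 1"
and c2: "!!b. length b = n ==> coef(g a) b ~= 0 ==> b = a | (sum_list b = sum_list a & rk a<rk b)"
using tri less(2) by (auto simp: triangular_def)
have aK: "Poly_Mapping.nth a : K" using c1 by (simp add: coef_def K_def in_keys_iff)
have "g a = (SUM m:K. frag_cmul(Poly_Mapping.lookup(g a) m)(xmon(mlist n m)))"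
unfolding K_def by (rule polys_expand[OF ga])
also have "...=xmon a+(SUM m:K-{Poly_Mapping.nth a}. frag_cmul(Poly_Mapping.lookup(g a) m)(xmon(mlist n m)))"
using aK c1 less(2) by (subst sum.remove[of K "Poly_Mapping.nth a"]) (auto simp: K_def coef_def mlist_nth)
finally have "xmon a = g a-(SUM m:K-{Poly_Mapping.nth a}. frag_cmul(Poly_Mapping.lookup(g a) m)(xmon(mlist n m)))"
by (metis add_diff_cancel_right')
moreover have "(SUM m:K-{Poly_Mapping.nth a}. frag_cmul(Poly_Mapping.lookup(g a) m)(xmon(mlist n m))) : zspan g n"
proof (intro zspan_sum zspan_cmul)
 fix m assume m: "m : K-{Poly_Mapping.nth a}"
 hence km: "Poly_Mapping.nth(mlist n m) = m" using ga by (intro nth_mlist) (auto simp: polys_def K_def)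
 hence "coef(g a)(mlist n m) ~= 0" using m by (simp add: coef_def K_def in_keys_iff)
 moreover have "mlist n m ~= a" using km m by auto
 ultimately have r: "sum_list(mlist n m) = sum_list a" "rk a<rk(mlist n m)" using c2[of "mlist n m"] by auto
 show "xmon(mlist n m) : zspan g n"
 using r rk_le[of "mlist n m"] by (intro less(1)) auto
qed
ultimately show ?case using zspan_diff[OF zspan_base[OF less(2)]] by metis
qed

lemma polys_zspan:
 assumes "triangular g n"
 shows "f : polys n \<longleftrightarrow> f : zspan g n"
proof
assume "f : polys n"
thus "f : zspan g n"
using zspan_linear[of f xmon n id g n] xmon_zspan[OF assms] by (simp add: polys_zspan_xmon)
next
assume "f : zspan g n"
thus "f : polys n"
by induction(use assms in \<open>auto simp: triangular_def intro: polys_add polys_diff\<close>)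
qed

lemma cone_of_nat: "f : cone g n ==> of_nat k * f : cone g n"
by (induction k) (auto simp: distrib_right intro: cone_zero cone_add)

lemma zspan_cone_diff: "f : zspan g n ==> EX p:cone g n. EX q:cone g n. f = p-q"
proof (induction rule: zspan.induct)
case zspan_zero show ?case by (intro bexI[of _ 0]) (auto intro: cone_zero)
next
case (zspan_step f b)
then obtain p q where "p : cone g n" "q : cone g n" "f = p-q" by blast
thus ?case using cone_step[of p g n b] zspan_step(2) by (intro bexI[of _ "p+g b"] bexI[of _ q]) auto
next
case (zspan_minus f b)
then obtain p q where "p : cone g n" "q : cone g n" "f = p-q" by blast
thus ?case using cone_step[of q g n b] zspan_minus(2) by (intro bexI[of _ p] bexI[of _ "q+g b"]) auto
qed

text \<open>Write f = p - q with p and q in the cone and cancel the generators of q from p one at a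
  time: a nonnegative value at b forces \<open>g b\<close> to occur in p whenever it occurs in q.
  Arbitrary functionals are allowed because those for Demazure characters and Schubert polynomials
  are built from operators.\<close>

lemma cone_by_functional:
 fixes k :: "nat list => mpoly => int"
 assumes f: "f : zspan g n" and add: "!!b f h. k b(f+h) = k b f+k b h"
 and delta: "!!a b. length a = n ==> length b = n ==> k b(g a) = (if a = b then 1 else 0)"
 and pos: "!!b. length b = n ==> k b f >= 0"
 shows "f : cone g n"
proof -
have k0: "k b 0 = 0" for b using add[of b 0 0] by simp
have k_diff: "k b(p-q) = k b p-k b q" for b p q using add[of b "p-q" q] by simp
have k_nonneg: "k b p >= 0" if "p : cone g n" "length b = n" for b p
using that by induction(auto simp: k0 add delta)
have sub: "p-g b : cone g n" if "p : cone g n" "length b = n" "k b p > 0" for p b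
using that
proof (induction rule: cone.induct)
 case (cone_step p a)
 show ?case
 by (smt(verit) cone_step cone_step(2) cone.cone_step add delta algebra_simps)
qed (simp add: k0)
have main: "p-q : cone g n" if "q : cone g n" "p : cone g n" "!!b. length b = n ==> k b(p-q) >= 0" for p q
using that
proof (induction arbitrary: p rule: cone.induct)
 case (cone_step q b)
 have "k b p > 0" using cone_step(5)[of b] k_nonneg[OF cone_step(1,2)] cone_step(2) by (simp add: k_diff add delta)
 hence "p-g b : cone g n" using sub cone_step by blast
 moreover have "k d(p-g b-q) >= 0" if "length d = n" for d
 using cone_step(5)[OF that] by (simp add: algebra_simps)
 ultimately have "p-g b-q : cone g n" by (rule cone_step(3))
 thus ?case by (simp add: algebra_simps)
qed simp
show ?thesis using zspan_cone_diff[OF f] main pos by blast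
qed

lemma cone_by_dual:
 assumes tri: "triangular g n" and f: "f : polys n" and pos: "!!b. length b = n ==> dualc g b f >= 0"
 shows "f : cone g n"
using f pos by (intro cone_by_functional[where k= "dualc g"]) (auto simp: polys_zspan[OF tri,symmetric] dualc_delta[OF tri])

lemma cone_dual_nonneg:
 assumes tri: "triangular g n" and f: "f : cone g n" and "length b = n"
 shows "dualc g b f >= 0"
using f by induction(auto simp: dualc_delta[OF tri] assms)

section \<open>Adjacent swaps of compositions and monomials\<close>

lemma length_swapl [simp]: "length(swapl i a) = length a" by (simp add: swapl_def)

lemma nth_swapl: "Suc i<length a ==> k<length a ==> swapl i a ! k = a ! swapidx i k"
by (auto simp: swapl_def swapidx_def)

lemma nth_swapl_simps [simp]: "Suc i<length a ==> swapl i a ! i = a ! Suc i"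
"Suc i<length a ==> swapl i a ! Suc i = a ! i"
by (simp_all add: nth_swapl swapidx_def)

lemma swapl_swapl [simp]: "Suc i<length a ==> swapl i(swapl i a) = a"
by (rule nth_equalityI) (auto simp: nth_swapl swapidx_def)

lemma swapl_eq: "Suc i<length a ==> a ! i = a ! Suc i ==> swapl i a = a"
by (rule nth_equalityI) (auto simp: nth_swapl swapidx_def)

lemma swapl_inj: "Suc i<length a ==> length b = length a ==> swapl i a = swapl i b \<longleftrightarrow> a = b"
by (metis swapl_swapl)

lemma mset_swapl [simp]: "Suc i<length a ==> mset(swapl i a) = mset a"
unfolding swapl_def by (rule mset_swap) auto

lemma sum_list_swapl [simp]: "Suc i<length a ==> sum_list(swapl i a) = sum_list(a :: nat list)"
by (metis mset_swapl sum_mset_sum_list)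

lemma swapl_commute: "Suc i<j ==> Suc j<length a ==> swapl i(swapl j a) = swapl j(swapl i a)"
by (rule nth_equalityI) (auto simp: nth_swapl swapidx_def)

lemma swapl_braid: "Suc(Suc i)<length a ==> 
swapl i(swapl(Suc i)(swapl i a)) = swapl(Suc i)(swapl i(swapl(Suc i) a))"
by (rule nth_equalityI) (auto simp: nth_swapl swapidx_def)

lemma xvar_power: "xvar k ^ v = Poly_Mapping.single(Poly_Mapping.single k v) 1"
by (induction v) (auto simp: xvar_def mult_single single_add[symmetric])

lemma xmon_snoc: "xmon(a @ [v]) = xmon a * xvar(length a) ^ v"
by (simp add: lookup_nth0 lookup_add lookup_single nth_append xmon_def xvar_power mult_single poly_mapping_eqI)

lemma xmon_Nil [simp]: "xmon [] = 1" by (simp add: xmon_def)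

lemma xmon_prod: "xmon a = (PROD k<length a. xvar k ^ (a ! k))"
by (induction a rule: rev_induct) (auto simp: nth_append xmon_snoc)

lemma xmon_mult: "length a = length b ==> xmon a * xmon b = xmon(map2(+) a b)"
by (simp add: xmon_prod prod.distrib[symmetric] power_add)

lemma swap_xmon:
 assumes "Suc i<length a" shows "swap_poly i(xmon a) = xmon(swapl i a)"
proof -
have "swap_mon i(Poly_Mapping.nth a) = Poly_Mapping.nth(swapl i a)"
using assms by (intro poly_mapping_eqI)
(auto simp: lookup_swap_mon lookup_nth0 nth_swapl swapidx_def)
thus ?thesis using swap_frag_of[of i "Poly_Mapping.nth a"] by (simp add: xmon_def)
qed

definition xset :: "nat set => mpoly" where "xset K = prod xvar K"

lemma swap_xset: "finite K ==> swap_poly i(xset K) = xset(swapidx i ` K)"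
unfolding xset_def swap_prod
by (subst prod.reindex) (auto simp: inj_on_def,metis swapidx_swapidx)

lemma xset_xmon: "K <= {..<n} ==> xset K = xmon(map(%k. if k : K then 1 else 0) [0..<n])"
proof -
assume K: "K <= {..<n}"
have "xmon(map(%k. if k : K then 1 else 0) [0..<n]) = (PROD k<n. if k : K then xvar k else 1)"
by (auto simp: xmon_prod intro!: prod.cong)
also have "...=(PROD k:K. xvar k)"
using K by (subst prod.If_cases) (auto intro!: prod.cong)
finally show ?thesis by (simp add: xset_def)
qed

text \<open>Local confluence: operators obeying the braid relations may be applied along any maximal chain.\<close>

lemma braid_confluence:
 fixes en :: "nat => 's => bool" and T :: "nat => 's => 's" and meas :: "'s => nat"
 and D :: "nat => 'v => 'v" and val :: "'s => 'v"
 assumes step: "!!s i. I s ==> en i s ==> EX j. en j s & val s = D j(val(T j s))"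
 and dec: "!!s i. I s ==> en i s ==> I(T i s) & meas(T i s)<meas s"
 and far: "!!s i j. I s ==> en i s ==> en j s ==> Suc i<j ==> 
en j(T i s) & en i(T j s) & T i(T j s) = T j(T i s)"
 and near: "!!s i. I s ==> en i s ==> en(Suc i) s ==> 
en(Suc i)(T i s) & en i(T(Suc i)(T i s)) & en i(T(Suc i) s) & en(Suc i)(T i(T(Suc i) s)) &
T i(T(Suc i)(T i s)) = T(Suc i)(T i(T(Suc i) s))"
 and Dfar: "!!i j v. Suc i<j ==> D i(D j v) = D j(D i v)"
 and Dnear: "!!i v. D i(D(Suc i)(D i v)) = D(Suc i)(D i(D(Suc i) v))"
 shows "I s ==> en i s ==> val s = D i(val(T i s))"
proof (induction "meas s" arbitrary: s i rule: less_induct)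
case less
note IH=less(1)
have IH': "val t = D k(val(T k t))" if "I t" "meas t<meas s" "en k t" for t k
using IH that by blast
obtain j where j: "en j s" "val s = D j(val(T j s))" using step less by blast
have Ti: "I(T i s)" "meas(T i s)<meas s" using dec less by auto
have Tj: "I(T j s)" "meas(T j s)<meas s" using dec less j by auto
\<comment> \<open>As in Newman's lemma: two different first steps are completed to a common element
  by a square, or further below by a hexagon, and the induction hypothesis is applied along its
  sides.\<close>
have main: "D i(val(T i s)) = D j(val(T j s))" if "en i s" "en j s" "Suc i<j" "I s"
"meas(T i s)<meas s" "meas(T j s)<meas s" "I(T i s)" "I(T j s)" for i j
proof -
 have f: "en j(T i s)" "en i(T j s)" "T i(T j s) = T j(T i s)" using far that by auto
 have "D i(val(T i s)) = D i(D j(val(T j(T i s))))" using IH'[OF _ _ f(1)] that by simp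
 also have "...=D j(D i(val(T i(T j s))))" using Dfar[OF that(3)] f by simp
 also have "...=D j(val(T j s))" using IH'[OF _ _ f(2)] that by simp
 finally show ?thesis .
qed
have main2: "D i(val(T i s)) = D(Suc i)(val(T(Suc i) s))" if "en i s" "en(Suc i) s" "I s"
"meas(T i s)<meas s" "meas(T(Suc i) s)<meas s" "I(T i s)" "I(T(Suc i) s)" for i
proof -
 let ?j = "Suc i"
 have f: "en ?j(T i s)" "en i(T ?j(T i s))" "en i(T ?j s)" "en ?j(T i(T ?j s))"
 "T i(T ?j(T i s)) = T ?j(T i(T ?j s))" using near that by auto
 have m1: "I(T ?j(T i s))" "meas(T ?j(T i s))<meas s" using dec[OF _ f(1)] that by auto
 have m2: "I(T i(T ?j s))" "meas(T i(T ?j s))<meas s" using dec[OF _ f(3)] that by auto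
 have "D i(val(T i s)) = D i(D ?j(D i(val(T i(T ?j(T i s))))))"
 using IH'[OF _ _ f(1)] IH'[OF _ _ f(2)] that m1 by simp
 also have "...=D ?j(D i(D ?j(val(T ?j(T i(T ?j s))))))" using Dnear f(5) by simp
 also have "...=D ?j(val(T ?j s))"
 using IH'[OF _ _ f(3)] IH'[OF _ _ f(4)] that m2 by simp
 finally show ?thesis .
qed
consider "i = j" | "Suc i<j" | "Suc j<i" | "j = Suc i" | "i = Suc j" by linarith
thus ?case
by (metis j main[of i j] less Ti Tj main[of j i] main2[of i] main2[of j])
qed

subsection \<open>Columns of semi-skyline fillings\<close>

text \<open>\<open>ok N L u t\<close>: the column \<open>t\<close>, living on the rows \<open>N\<close>, may stand to the right of the column \<open>u\<close>
living on the rows \<open>L\<close>. Every entry, largest first, sits in the lowest row that can hold it.\<close>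

definition ok :: "nat set => nat set => (nat => nat) => (nat => nat) => bool" where
"ok N L u t \<longleftrightarrow> (ALL r:N. 0<t r & t r <= u r) & inj_on t N &
(ALL r s. r<s --> s : N --> r : L --> t s <= u r --> r : N & t s<t r)"

lemma okI:
 assumes "!!r. r : N ==> 0<t r & t r <= u r" "inj_on t N"
"!!r s. r<s ==> s : N ==> r : L ==> t s <= u r ==> r : N & t s<t r"
 shows "ok N L u t"
using assms unfolding ok_def by blast

lemma okD:
 assumes "ok N L u t"
 shows "!!r. r : N ==> 0<t r" "!!r. r : N ==> t r <= u r" "inj_on t N"
"!!r s. r<s ==> s : N ==> r : L ==> t s <= u r ==> r : N & t s<t r"
using assms unfolding ok_def by blast+

text \<open>This is the configuration of u in which exchanging the entries \<open>Suc i\<close> and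
  \<open>Suc(Suc i)\<close> acts on the continuations of u as pi_i (\<open>Fk_sv\<close>). In the
  opposite configuration the exchanged column has it, so the generating function is already
  symmetric in the two variables.\<close>

definition good :: "nat set => nat => (nat => nat) => bool" where
"good L i u \<longleftrightarrow> (ALL s:L. u s = Suc(Suc i) --> (EX r:L. r<s & u r = Suc i))"

text \<open>Entries count from 1 and variables from 0: the swap of the variables i and
  \<open>Suc i\<close> exchanges the entries \<open>Suc i\<close> and \<open>Suc(Suc i)\<close> and
  fixes the filler value 0.\<close>

abbreviation "sv i == swapidx(Suc i)"

lemma inj_on_sv: "inj_on t N ==> inj_on(sv i o t) N"
by (rule comp_inj_on) (auto simp: inj_on_def,metis swapidx_swapidx)

lemma sv_comp_comp [simp]: "sv i o(sv i o t) = t" by (auto)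

text \<open>The swap in u changes the truth of \<open>v <= u r\<close> only for v =
  \<open>Suc(Suc i)\<close>. The lemmas from here to \<open>ok_sv_both_rev\<close> treat a column t
  by which of the two entries it contains.\<close>

lemma ok_sv_avoid:
 assumes "!!r. r : N ==> t r ~= Suc(Suc i)"
 shows "ok N L(sv i o u) t \<longleftrightarrow> ok N L u t"
proof -
have "t s <= sv i(u r) \<longleftrightarrow> t s <= u r" if "s : N" for r s
using assms[OF that] by (auto simp: swapidx_def)
thus ?thesis unfolding ok_def by auto
qed

lemma ok_sv_single1:
 assumes g: "good L i u" and NL: "N <= L" and o: "ok N L u t" and f: "f : N" "t f = Suc i"
 and n2: "!!r. r : N ==> t r ~= Suc(Suc i)"
 shows "ok N L(sv i o u)(sv i o t)"
proof -
note D=okD[OF o]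
\<comment> \<open>Such a row could hold \<open>t f\<close>, so the placement rule would demand an
  entry strictly above \<open>Suc i\<close> and at most \<open>u r = Suc i\<close>.\<close>
have no1: False if "r<f" "r : L" "u r = Suc i" for r
using D(4)[of r f] that f D(2)[of r] by fastforce
have uf: "u f ~= Suc(Suc i)" using g f NL no1 unfolding good_def by blast
have other: "t r ~= Suc i" if "r : N" "r ~= f" for r using D(3) f that by (metis inj_onD)
show ?thesis
proof (rule okI)
 fix r assume r: "r : N"
 thus "0<(sv i o t) r & (sv i o t) r <= (sv i o u) r"
 using D(1,2)[OF r] uf other[OF r] by (cases "r = f") (auto simp: swapidx_def)
next
 show "inj_on(sv i o t) N" by (rule inj_on_sv) (rule D(3))
next
 fix r s assume rs: "r<s" "s : N" "r : L" "(sv i o t) s <= (sv i o u) r"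
 show "r : N & (sv i o t) s<(sv i o t) r"
 proof (cases "s = f")
  case True
  hence "u r ~= Suc i" using no1 rs by blast
  hence "Suc(Suc i)<u r" using rs True f by (auto simp: swapidx_def split: if_splits)
  hence "r : N & t s<t r" using D(4)[of r s] rs True f by auto
  thus ?thesis using f n2[of r] by (auto simp: swapidx_def)
 next
  case False
  hence ts: "t s ~= Suc i" "t s ~= Suc(Suc i)" using other rs n2 by auto
  hence "t s <= u r" using rs by (auto simp: swapidx_def split: if_splits)
  hence "r : N & t s<t r" using D(4)[of r s] rs by auto
  thus ?thesis using ts by (auto simp: swapidx_def)
 qed
qed
qed

lemma ok_sv_single2:
 assumes g: "good L i u" and NL: "N <= L" and o: "ok N L(sv i o u) t" and e: "e : N" "t e = Suc(Suc i)"
 and n1: "!!r. r : N ==> t r ~= Suc i"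
 shows "ok N L u(sv i o t)"
proof -
note D=okD[OF o]
have no1: False if "r<e" "r : L" "u r = Suc i" for r
using D(4)[of r e] that e D(2)[of r] by (fastforce simp: swapidx_def)
have no2: "u r ~= Suc(Suc i)" if "r<e" "r : L" for r
using g that no1 unfolding good_def by (meson less_trans)
have other: "t r ~= Suc(Suc i)" if "r : N" "r ~= e" for r using D(3) e that by (metis inj_onD)
show ?thesis
proof (rule okI)
 fix r assume r: "r : N"
 thus "0<(sv i o t) r & (sv i o t) r <= u r"
 using D(1,2)[OF r] n1[OF r] by (cases "r = e") (auto simp: swapidx_def split: if_splits)
next
 show "inj_on(sv i o t) N" by (rule inj_on_sv) (rule D(3))
next
 fix r s assume rs: "r<s" "s : N" "r : L" "(sv i o t) s <= u r"
 show "r : N & (sv i o t) s<(sv i o t) r"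
 proof (cases "s = e")
  case True
  hence "u r ~= Suc i" "u r ~= Suc(Suc i)" using no1 no2 rs by blast+
  hence "Suc(Suc i)<u r" "sv i(u r) = u r" using rs True e by (auto simp: swapidx_def)
  hence "r : N & t s<t r" using D(4)[of r s] rs True e by auto
  thus ?thesis using True e by (auto simp: swapidx_def)
 next
  case False
  hence ts: "t s ~= Suc i" "t s ~= Suc(Suc i)" using other rs n1 by auto
  hence "t s <= sv i(u r)" using rs by (auto simp: swapidx_def)
  hence "r : N & t s<t r" using D(4)[of r s] rs by auto
  thus ?thesis using ts by (auto simp: swapidx_def)
 qed
qed
qed

lemma ok_sv_both_lt:
 assumes g: "good L i u" and NL: "N <= L" and o: "ok N L u t" and e: "e : N" "t e = Suc(Suc i)"
 and f: "f : N" "t f = Suc i" and ef: "e<f"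
 shows "ok N L(sv i o u) t" and "u e ~= Suc i"
proof -
note D=okD[OF o]
show "u e ~= Suc i" using D(2)[of e] e by auto
have no1: False if "r<f" "r : L" "u r = Suc i" for r
using D(4)[of r f] that f D(2)[of r] by fastforce
have ue: "u e ~= Suc(Suc i)" using g e NL no1 ef unfolding good_def by (meson less_trans subsetD)
have other: "t r ~= Suc(Suc i)" if "r : N" "r ~= e" for r using D(3) e that by (metis inj_onD)
show "ok N L(sv i o u) t"
proof (rule okI)
 fix r assume r: "r : N"
 thus "0<t r & t r <= (sv i o u) r"
 using D(1,2)[OF r] other[OF r] ue by (cases "r = e") (auto simp: swapidx_def)
next
 show "inj_on t N" by (rule D(3))
next
 fix r s assume rs: "r<s" "s : N" "r : L" "t s <= (sv i o u) r"
 have "t s <= u r"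
 using no1[of r] rs ef other by (force simp: swapidx_def split: if_splits)
 thus "r : N & t s<t r" using D(4) rs by blast
qed
qed

text \<open>Row f lies below row e but does not hold the larger entry, so \<open>u f\<close> must be
  too small for it. The resulting equation also tells the swapped columns from the unswapped ones in
  \<open>Fk_sv\<close>.\<close>

lemma ok_sv_both_gt:
 assumes iu: "inj_on u L" and NL: "N <= L" and o: "ok N L u t" and e: "e : N" "t e = Suc(Suc i)"
 and f: "f : N" "t f = Suc i" and fe: "f<e"
 shows "ok N L(sv i o u)(sv i o t)" and "u f = Suc i"
proof -
note D=okD[OF o]
have "~ Suc(Suc i) <= u f" using D(4)[of f e] fe e f NL by auto
thus uf: "u f = Suc i" using D(2)[of f] f by auto
have nf: "u r ~= Suc i" if "r : L" "r ~= f" for r using iu uf that f NL by (metis inj_onD subsetD)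
have oe: "t r ~= Suc(Suc i)" if "r : N" "r ~= e" for r using D(3) e that by (metis inj_onD)
have off: "t r ~= Suc i" if "r : N" "r ~= f" for r using D(3) f that by (metis inj_onD)
show "ok N L(sv i o u)(sv i o t)"
proof (rule okI)
 fix r assume r: "r : N"
 thus "0<(sv i o t) r & (sv i o t) r <= (sv i o u) r"
 using D(1,2)[OF r] off[OF r] uf fe
 by (cases "r = e"; cases "r = f") (auto simp: swapidx_def)
next
 show "inj_on(sv i o t) N" by (rule inj_on_sv) (rule D(3))
next
 fix r s assume rs: "r<s" "s : N" "r : L" "(sv i o t) s <= (sv i o u) r"
 consider "s = f" | "s = e" | "s ~= f" "s ~= e" by blast
 thus "r : N & (sv i o t) s<(sv i o t) r"
 proof cases
  case 1
  hence "u r ~= Suc i" using nf[of r] rs by auto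
  hence "Suc(Suc i)<u r" using rs 1 f by (auto simp: swapidx_def split: if_splits)
  hence "r : N & t s<t r" using D(4)[of r s] rs 1 f by auto
  moreover have "r ~= e" using rs 1 fe by auto
  ultimately show ?thesis using f oe[of r] by (auto simp: swapidx_def)
 next
  case 2
  show ?thesis
  proof (cases "r = f")
   case True thus ?thesis using 2 e f by (simp add: swapidx_def)
  next
   case False
   hence "Suc(Suc i) <= u r" using nf[of r] rs 2 e by (auto simp: swapidx_def split: if_splits)
   hence "r : N & t s<t r" using D(4)[of r s] rs 2 e by auto
   thus ?thesis using 2 e by (auto simp: swapidx_def)
  qed
 next
  case 3
  hence ts: "t s ~= Suc i" "t s ~= Suc(Suc i)" using oe off rs by auto
  hence "t s <= u r" using rs by (auto simp: swapidx_def split: if_splits)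
  hence "r : N & t s<t r" using D(4)[of r s] rs by auto
  thus ?thesis using ts by (auto simp: swapidx_def)
 qed
qed
qed

text \<open>The converse reading: over the swapped column the larger entry is necessarily the lower
  one, and \<open>u e\<close> decides from which column over u it comes.\<close>

lemma ok_sv_both_rev:
 assumes g: "good L i u" and iu: "inj_on u L" and NL: "N <= L" and o: "ok N L(sv i o u) t"
 and e: "e : N" "t e = Suc(Suc i)" and f: "f : N" "t f = Suc i"
 shows "e<f" and "u e = Suc i ==> ok N L u(sv i o t)" and "u e ~= Suc i ==> ok N L u t"
proof -
note D=okD[OF o]
have no1: False if "r<e" "r : L" "u r = Suc i" for r
using D(4)[of r e] that e D(2)[of r] by (fastforce simp: swapidx_def)
have no2: "u r ~= Suc(Suc i)" if "r<e" "r : L" for r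
using g that no1 unfolding good_def by (meson less_trans)
have oe: "t r ~= Suc(Suc i)" if "r : N" "r ~= e" for r using D(3) e that by (metis inj_onD)
have off: "t r ~= Suc i" if "r : N" "r ~= f" for r using D(3) f that by (metis inj_onD)
have ne: "e ~= f" using e f by auto
show ef: "e<f"
using ne D(4)[of f e] e f NL D(2)[of f] no2[of f] by (force simp: swapidx_def split: if_splits)
have uf2: "Suc i <= u r" if "Suc i <= sv i(u r)" for r using that by (auto simp: swapidx_def split: if_splits)
{
assume ue: "u e = Suc i"
have nu: "u r ~= Suc i" if "r : L" "r ~= e" for r using iu ue that e NL by (metis inj_onD subsetD)
show "ok N L u(sv i o t)"
proof (rule okI)
 fix r assume r: "r : N"
 have "u r ~= Suc i | r = e" using nu r NL by auto
 thus "0<(sv i o t) r & (sv i o t) r <= u r"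
 using D(1,2)[OF r] oe[OF r] off[OF r] ue e f ne
 by (cases "r = e"; cases "r = f") (auto simp: swapidx_def split: if_splits)
next
 show "inj_on(sv i o t) N" by (rule inj_on_sv) (rule D(3))
next
 fix r s assume rs: "r<s" "s : N" "r : L" "(sv i o t) s <= u r"
 consider "s = f" | "s = e" | "s ~= f" "s ~= e" by blast
 thus "r : N & (sv i o t) s<(sv i o t) r"
 proof cases
  case 1
  hence ge: "Suc(Suc i) <= u r" using rs f by (auto simp: swapidx_def)
  have "u r ~= Suc(Suc i)"
  using D(4)[of r s] rs 1 f D(2)[of r] by (auto simp: swapidx_def)
  hence "sv i(u r) = u r" "Suc(Suc i)<u r" using ge by (auto simp: swapidx_def)
  hence "r : N & t s<t r" using D(4)[of r s] rs 1 f by auto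
  moreover have "r ~= e" using ue ge by auto
  ultimately show ?thesis using f oe[of r] by (auto simp: swapidx_def)
 next
  case 2
  hence "u r ~= Suc i" "u r ~= Suc(Suc i)" using no1 no2 rs by blast+
  hence "sv i(u r) = u r" "Suc(Suc i)<u r" using rs 2 e by (auto simp: swapidx_def)
  hence "r : N & t s<t r" using D(4)[of r s] rs 2 e by auto
  thus ?thesis using 2 e by (auto simp: swapidx_def)
 next
  case 3
  hence ts: "t s ~= Suc i" "t s ~= Suc(Suc i)" using oe off rs by auto
  hence "t s <= sv i(u r)" using rs by (auto simp: swapidx_def)
  hence "r : N & t s<t r" using D(4)[of r s] rs by auto
  thus ?thesis using ts by (auto simp: swapidx_def)
 qed
qed
}
{
assume ue: "u e ~= Suc i"
show "ok N L u t"
proof (rule okI)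
 fix r assume r: "r : N"
 thus "0<t r & t r <= u r"
 using D(1,2)[OF r] oe[OF r] ue by (cases "r = e") (auto simp: swapidx_def split: if_splits)
next
 show "inj_on t N" by (rule D(3))
next
 fix r s assume rs: "r<s" "s : N" "r : L" "t s <= u r"
 have "t s <= sv i(u r)"
 using no2[of r] rs oe by (force simp: swapidx_def)
 thus "r : N & t s<t r" using D(4)[of r s] rs by simp
qed
}
qed

section \<open>Exchanging the entries of two adjacent rows\<close>

definition rsw :: "nat => (nat => nat) => (nat => nat)" where "rsw j t = t o swapidx j"

lemma rsw_simps [simp]: "rsw j t j = t(Suc j)" "rsw j t(Suc j) = t j" "rsw j(rsw j t) = t"
by (auto simp: rsw_def swapidx_def)

lemma rsw_other [simp]: "r ~= j ==> r ~= Suc j ==> rsw j t r = t r"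
by (simp add: rsw_def swapidx_def)

lemma rsw_less: "r<s ==> ~ (r = j & s = Suc j) ==> swapidx j r<swapidx j s"
by (auto simp: swapidx_def)

lemma inj_on_rsw: "inj_on t N ==> j : N ==> Suc j : N ==> inj_on(rsw j t) N"
unfolding rsw_def
proof (rule comp_inj_on)
show "inj_on(swapidx j) N" by (metis inj_onI swapidx_swapidx)
assume "inj_on t N" "j : N" "Suc j : N"
thus "inj_on t(swapidx j ` N)" by (rule_tac inj_on_subset[of _ N]) (auto simp: swapidx_def)
qed

lemma ok_splitI:
 assumes "!!r. r : N ==> 0<t r & t r <= u r" "inj_on t N"
"!!r s. r<s ==> r ~= j ==> r ~= Suc j ==> s ~= j ==> s ~= Suc j ==> s : N ==> r : L ==> t s <= u r ==> r : N & t s<t r"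
"Suc j : N ==> j : L ==> t(Suc j) <= u j ==> j : N & t(Suc j)<t j"
"!!r. r<j ==> j : N ==> r : L ==> t j <= u r ==> r : N & t j<t r"
"!!r. r<j ==> Suc j : N ==> r : L ==> t(Suc j) <= u r ==> r : N & t(Suc j)<t r"
"!!s. Suc j<s ==> s : N ==> j : L ==> t s <= u j ==> j : N & t s<t j"
"!!s. Suc j<s ==> s : N ==> Suc j : L ==> t s <= u(Suc j) ==> Suc j : N & t s<t(Suc j)"
 shows "ok N L u t"
proof (rule okI)
fix r s assume rs: "r<s" "s : N" "r : L" "t s <= u r"
consider "r ~= j" "r ~= Suc j" "s ~= j" "s ~= Suc j" | "r = j" "s = Suc j" | "r<j" "s = j" | "r<j" "s = Suc j"
| "r = j" "Suc j<s" | "r = Suc j" "Suc j<s" using rs(1) by linarith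
thus "r : N & t s<t r" by cases(use rs assms in blast)+
qed (use assms in auto)

text \<open>After the exchange the larger entry of u sits in the lower row j, so the larger entry of
  t must follow it there. Over u itself the placement rule puts that entry in row j exactly if it
  fits under \<open>u j\<close>.\<close>

lemma ok_rsw_pair:
 assumes N: "j : N" "Suc j : N" and NL: "N <= L" and u: "u j<u(Suc j)" and t: "t j<t(Suc j)"
 shows "ok N L(rsw j u)(rsw j t) \<longleftrightarrow> (if t(Suc j) <= u j then ok N L u(rsw j t) else ok N L u t)"
 and "ok N L u t ==> u j<t(Suc j)"
proof -
have L: "j : L" "Suc j : L" using N NL by auto
show "ok N L u t ==> u j<t(Suc j)" using N L t unfolding ok_def by (metis lessI not_le not_less_iff_gr_or_eq)
have inj: "inj_on(rsw j t) N \<longleftrightarrow> inj_on t N" using inj_on_rsw N rsw_simps(3) by metis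
show "ok N L(rsw j u)(rsw j t) \<longleftrightarrow> (if t(Suc j) <= u j then ok N L u(rsw j t) else ok N L u t)" (is "?A \<longleftrightarrow> ?B")
proof
 assume A: ?A
 note D=okD[OF A]
 have fit: "0<t j" "0<t(Suc j)" "t j <= u j" "t(Suc j) <= u(Suc j)"
 using D(1,2)[OF N(1)] D(1,2)[OF N(2)] by auto
 have fit': "0<t r" "t r <= u r" if "r : N" "r ~= j" "r ~= Suc j" for r using D(1,2)[of r] that by auto
 have R: "r<s ==> s : N ==> r : L ==> rsw j t s <= rsw j u r ==> r : N & rsw j t s<rsw j t r" for r s
 using D(4) by blast
 show ?B
 proof (cases "t(Suc j) <= u j")
  case True
  have "ok N L u(rsw j t)"
  proof (rule ok_splitI[where j=j])
   fix r assume "r : N" thus "0<rsw j t r & rsw j t r <= u r"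
   using fit fit'[of r] True u by (cases "r = j"; cases "r = Suc j") auto
  next
   show "inj_on(rsw j t) N" by (rule D(3))
  next
   fix r s assume "r<s" "r ~= j" "r ~= Suc j" "s : N" "r : L" "rsw j t s <= u r"
   thus "r : N & rsw j t s<rsw j t r" using R[of r s] by simp
  next
   show "j : N & rsw j t(Suc j)<rsw j t j" using N t by simp
  next
   fix s assume s: "Suc j<s" "s : N" "rsw j t s <= u j"
   thus "j : N & rsw j t s<rsw j t j" using R[of "Suc j" s] N L t by auto
  next
   fix s assume s: "Suc j<s" "s : N" "rsw j t s <= u(Suc j)"
   thus "Suc j : N & rsw j t s<rsw j t(Suc j)" using R[of "Suc j" s] R[of j s] L True by auto
  next
   fix r assume "r<j" "j : N" "r : L" "rsw j t j <= u r"
   thus "r : N & rsw j t j<rsw j t r" using R[of r j] by simp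
  next
   fix r assume "r<j" "Suc j : N" "r : L" "rsw j t(Suc j) <= u r"
   thus "r : N & rsw j t(Suc j)<rsw j t r" using R[of r "Suc j"] by simp
  qed
  thus ?thesis using True by simp
 next
  case False
  have "ok N L u t"
  proof (rule ok_splitI[where j=j])
   fix r assume "r : N" thus "0<t r & t r <= u r"
   using fit fit'[of r] by (cases "r = j"; cases "r = Suc j") auto
  next
   show "inj_on t N" using D(3) inj by simp
  next
   fix r s assume "r<s" "r ~= j" "r ~= Suc j" "s ~= j" "s ~= Suc j" "s : N" "r : L" "t s <= u r"
   thus "r : N & t s<t r" using R[of r s] by simp
  next
   assume "t(Suc j) <= u j" thus "j : N & t(Suc j)<t j" using False by simp
  next
   fix r assume "r<j" "j : N" "r : L" "t j <= u r"
   thus "r : N & t j<t r" using R[of r "Suc j"] N by auto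
  next
   fix r assume "r<j" "Suc j : N" "r : L" "t(Suc j) <= u r"
   thus "r : N & t(Suc j)<t r" using R[of r j] N by auto
  next
   fix s assume "Suc j<s" "s : N" "j : L" "t s <= u j"
   thus "j : N & t s<t j" using R[of "Suc j" s] L N by auto
  next
   fix s assume "Suc j<s" "s : N" "Suc j : L" "t s <= u(Suc j)"
   thus "Suc j : N & t s<t(Suc j)" using R[of j s] L N by auto
  qed
  thus ?thesis using False by simp
 qed
next
 assume B: ?B
 show ?A
 proof (cases "t(Suc j) <= u j")
  case True
  with B have o: "ok N L u(rsw j t)" by simp
  note D=okD[OF o]
  show ?A
  proof (rule ok_splitI[where j=j])
   fix r assume "r : N" thus "0<rsw j t r & rsw j t r <= rsw j u r"
   using D(1,2)[of r] D(1,2)[of "Suc j"] True t u by (cases "r = j"; cases "r = Suc j") auto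
  next
   show "inj_on(rsw j t) N" by (rule D(3))
  next
   fix r s assume "r<s" "r ~= j" "r ~= Suc j" "s : N" "r : L" "rsw j t s <= rsw j u r"
   thus "r : N & rsw j t s<rsw j t r" using D(4)[of r s] by simp
  next
   show "j : N & rsw j t(Suc j)<rsw j t j" using N t by simp
  next
   fix s assume "Suc j<s" "s : N" "rsw j t s <= rsw j u j"
   thus "j : N & rsw j t s<rsw j t j" using D(4)[of "Suc j" s] N L t by auto
  next
   fix s assume "Suc j<s" "s : N" "rsw j t s <= rsw j u(Suc j)"
   thus "Suc j : N & rsw j t s<rsw j t(Suc j)" using D(4)[of "Suc j" s] L u by auto
  next
   fix r assume "r<j" "j : N" "r : L" "rsw j t j <= rsw j u r"
   thus "r : N & rsw j t j<rsw j t r" using D(4)[of r j] by simp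
  next
   fix r assume "r<j" "Suc j : N" "r : L" "rsw j t(Suc j) <= rsw j u r"
   thus "r : N & rsw j t(Suc j)<rsw j t r" using D(4)[of r "Suc j"] by simp
  qed
 next
  case False
  with B have o: "ok N L u t" by simp
  note D=okD[OF o]
  show ?A
  proof (rule ok_splitI[where j=j])
   fix r assume "r : N" thus "0<rsw j t r & rsw j t r <= rsw j u r"
   using D(1,2)[of r] D(1,2)[of j] D(1,2)[of "Suc j"] N by (cases "r = j"; cases "r = Suc j") auto
  next
   show "inj_on(rsw j t) N" using D(3) inj by simp
  next
   fix r s assume "r<s" "r ~= j" "r ~= Suc j" "s ~= j" "s ~= Suc j" "s : N" "r : L" "rsw j t s <= rsw j u r"
   thus "r : N & rsw j t s<rsw j t r" using D(4)[of r s] by simp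
  next
   show "j : N & rsw j t(Suc j)<rsw j t j" using N t by simp
  next
   fix r assume "r<j" "j : N" "r : L" "rsw j t j <= rsw j u r"
   thus "r : N & rsw j t j<rsw j t r" using D(4)[of r "Suc j"] N by auto
  next
   fix r assume "r<j" "Suc j : N" "r : L" "rsw j t(Suc j) <= rsw j u r"
   thus "r : N & rsw j t(Suc j)<rsw j t r" using D(4)[of r j] N by auto
  next
   fix s assume "Suc j<s" "s : N" "j : L" "rsw j t s <= rsw j u j"
   thus "j : N & rsw j t s<rsw j t j" using D(4)[of "Suc j" s] L N by auto
  next
   fix s assume "Suc j<s" "s : N" "Suc j : L" "rsw j t s <= rsw j u(Suc j)"
   thus "Suc j : N & rsw j t s<rsw j t(Suc j)" using D(4)[of j s] L N by auto
  qed
 qed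
qed
qed

text \<open>Rows that end here only forbid entries of higher rows from fitting under them, and this
  condition is symmetric in the two rows.\<close>

lemma ok_rsw_dead:
 assumes "j ~: N" "Suc j ~: N" "j : L" "Suc j : L"
 shows "ok N L(rsw j u) t \<longleftrightarrow> ok N L u t"
proof -
have *: "ok N L(rsw j u) t" if o: "ok N L u t" for u
proof -
 note D=okD[OF o]
 show ?thesis
 proof (rule ok_splitI[where j=j])
  fix r assume "r : N" thus "0<t r & t r <= rsw j u r"
  using D(1,2)[of r] assms by (cases "r = j"; cases "r = Suc j") auto
 next
  fix r s assume "r<s" "r ~= j" "r ~= Suc j" "s : N" "r : L" "t s <= rsw j u r"
  thus "r : N & t s<t r" using D(4)[of r s] by simp
 next
  fix s assume "Suc j<s" "s : N" "t s <= rsw j u j"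
  thus "j : N & t s<t j" using D(4)[of "Suc j" s] assms by auto
 next
  fix s assume "Suc j<s" "s : N" "t s <= rsw j u(Suc j)"
  thus "Suc j : N & t s<t(Suc j)" using D(4)[of j s] assms by auto
 qed (use D assms in auto)
qed
show ?thesis using *[of u] *[of "rsw j u"] by auto
qed

lemma ok_rsw_one_low:
 assumes "j : N" "Suc j ~: N" "j : L" "Suc j : L" and u: "u j<u(Suc j)" and t: "t j <= u j"
 shows "ok N L(rsw j u) t \<longleftrightarrow> ok N L u t"
proof
assume "ok N L(rsw j u) t"
note D=okD[OF this]
have gt: "u j<t s" if "Suc j<s" "s : N" for s
using D(4)[of "Suc j" s] that assms by (metis not_le rsw_simps(2))
have gt2: "u(Suc j)<t s" if "Suc j<s" "s : N" for s
proof (rule ccontr)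
 assume "~ u(Suc j)<t s"
 hence "t s<t j" using D(4)[of j s] that assms by auto
 thus False using gt[OF that] t by simp
qed
show "ok N L u t"
proof (rule ok_splitI[where j=j])
 fix r assume "r : N" thus "0<t r & t r <= u r"
 using D(1,2)[of r] assms by (cases "r = j"; cases "r = Suc j") auto
next
 fix r s assume "r<s" "r ~= j" "r ~= Suc j" "s : N" "r : L" "t s <= u r"
 thus "r : N & t s<t r" using D(4)[of r s] by simp
next
 fix r assume "r<j" "j : N" "r : L" "t j <= u r"
 thus "r : N & t j<t r" using D(4)[of r j] by simp
next
 fix s assume "Suc j<s" "s : N" "t s <= u j"
 thus "j : N & t s<t j" using gt[of s] by auto
next
 fix s assume "Suc j<s" "s : N" "t s <= u(Suc j)"
 thus "Suc j : N & t s<t(Suc j)" using gt2[of s] by auto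
qed (use D assms in auto)
next
assume "ok N L u t"
note D=okD[OF this]
have gt2: "u(Suc j)<t s" if "Suc j<s" "s : N" for s
using D(4)[of "Suc j" s] that assms by (metis not_le)
show "ok N L(rsw j u) t"
proof (rule ok_splitI[where j=j])
 fix r assume "r : N" thus "0<t r & t r <= rsw j u r"
 using D(1,2)[of r] assms by (cases "r = j"; cases "r = Suc j") auto
next
 fix r s assume "r<s" "r ~= j" "r ~= Suc j" "s : N" "r : L" "t s <= rsw j u r"
 thus "r : N & t s<t r" using D(4)[of r s] by simp
next
 fix r assume "r<j" "j : N" "r : L" "t j <= rsw j u r"
 thus "r : N & t j<t r" using D(4)[of r j] by simp
next
 fix s assume "Suc j<s" "s : N" "t s <= rsw j u j"
 thus "j : N & t s<t j" using gt2[of s] by auto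
next
 fix s assume "Suc j<s" "s : N" "t s <= rsw j u(Suc j)"
 thus "Suc j : N & t s<t(Suc j)" using gt2[of s] u by auto
qed (use D assms in auto)
qed

text \<open>An entry too large for \<open>u j\<close> can, over the unswapped column, only continue
  row \<open>Suc j\<close>. Exactly one of the two rows continues, so its length changes place too,
  whence the row set N'.\<close>

lemma ok_rsw_one_high:
 assumes N: "j : N" "Suc j ~: N" "j : L" "Suc j : L" and u: "u j<u(Suc j)" and t: "u j<t j"
 and N': "N' = insert(Suc j)(N-{j})"
 shows "ok N L(rsw j u) t \<longleftrightarrow> ok N' L u(rsw j t)"
proof -
have im: "N' = swapidx j ` N"
using N' N by (force simp: swapidx_def)
have inj: "inj_on(rsw j t) N' \<longleftrightarrow> inj_on t N"
unfolding im rsw_def inj_on_def by (auto,metis swapidx_swapidx)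
have o': "r : N' \<longleftrightarrow> r : N" if "r ~= j" "r ~= Suc j" for r using that N' by auto
show ?thesis
proof
 assume "ok N L(rsw j u) t"
 note D=okD[OF this]
 have gt: "u j<t s" if "Suc j<s" "s : N" for s
 using D(4)[of "Suc j" s] that assms by (metis not_le rsw_simps(2))
 show "ok N' L u(rsw j t)"
 proof (rule ok_splitI[where j=j])
  fix r assume "r : N'" thus "0<rsw j t r & rsw j t r <= u r"
  using D(1,2)[of r] D(1,2)[of j] assms by (cases "r = j"; cases "r = Suc j") auto
 next
  show "inj_on(rsw j t) N'" using D(3) inj by simp
 next
  fix r s assume "r<s" "r ~= j" "r ~= Suc j" "s ~= j" "s ~= Suc j" "s : N'" "r : L" "rsw j t s <= u r"
  thus "r : N' & rsw j t s<rsw j t r" using D(4)[of r s] o' by simp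
 next
  assume "rsw j t(Suc j) <= u j" thus "j : N' & rsw j t(Suc j)<rsw j t j" using t by simp
 next
  fix r assume "r<j" "r : L" "rsw j t(Suc j) <= u r"
  thus "r : N' & rsw j t(Suc j)<rsw j t r" using D(4)[of r j] o'[of r] N by simp
 next
  fix s assume "Suc j<s" "s : N'" "rsw j t s <= u j"
  thus "j : N' & rsw j t s<rsw j t j" using gt[of s] o'[of s] by auto
 next
  fix s assume "Suc j<s" "s : N'" "rsw j t s <= u(Suc j)"
  thus "Suc j : N' & rsw j t s<rsw j t(Suc j)" using D(4)[of j s] N N' by auto
 qed (use N' in auto)
next
 assume "ok N' L u(rsw j t)"
 note D=okD[OF this]
 have gt: "u j<t s" if "Suc j<s" "s : N" for s
 proof (rule ccontr)
  assume "~ u j<t s"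
  hence "j : N'" using D(4)[of j s] that N o'[of s] by auto
  thus False using N' by auto
 qed
 show "ok N L(rsw j u) t"
 proof (rule ok_splitI[where j=j])
  fix r assume "r : N" thus "0<t r & t r <= rsw j u r"
  using D(1,2)[of r] D(1,2)[of "Suc j"] assms by (cases "r = j"; cases "r = Suc j") auto
 next
  show "inj_on t N" using D(3) inj by simp
 next
  fix r s assume "r<s" "r ~= j" "r ~= Suc j" "s ~= j" "s ~= Suc j" "s : N" "r : L" "t s <= rsw j u r"
  thus "r : N & t s<t r" using D(4)[of r s] o' by simp
 next
  fix r assume "r<j" "r : L" "t j <= rsw j u r"
  thus "r : N & t j<t r" using D(4)[of r "Suc j"] N' by simp
 next
  fix s assume "Suc j<s" "s : N" "t s <= rsw j u j"
  thus "j : N & t s<t j" using D(4)[of "Suc j" s] N N' by auto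
 next
  fix s assume "Suc j<s" "s : N" "t s <= rsw j u(Suc j)"
  thus "Suc j : N & t s<t(Suc j)" using gt[of s] by auto
 qed (use N in auto)
qed
qed

text \<open>The shift by one makes room for a basement: \<open>rows n a 0\<close> consists of all
  rows, and the diagram's column c (counted from 0) occupies
  \<open>rows n a (Suc c)\<close>.\<close>

definition rows :: "nat => (nat => nat) => nat => nat set" where
"rows n a c = {r. r<n & c <= a r}"

text \<open>The value 0 outside the rows makes a column a unique function, so that sums over
  \<open>Th\<close> count each column once.\<close>

definition Th :: "nat => (nat => nat) => nat => (nat => nat) => (nat => nat) set" where
"Th n a c u = {t. ok(rows n a(Suc c))(rows n a c) u t & (ALL r. r ~: rows n a(Suc c) --> t r = 0)}"

definition xt :: "nat set => (nat => nat) => mpoly" where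
"xt N t = (PROD r:N. xvar(t r-1))"

text \<open>Generating function of the fillings of columns \<open>c, ..., c + k - 1\<close> of the diagram of \<open>a\<close>
that continue the column \<open>u\<close>.\<close>

fun Fk :: "nat => (nat => nat) => nat => nat => (nat => nat) => mpoly" where
"Fk n a 0 c u = 1"
| "Fk n a(Suc k) c u = (SUM t:Th n a c u. xt(rows n a(Suc c)) t * Fk n a k(Suc c) t)"

lemma finite_rows [simp]: "finite(rows n a c)" by (simp add: rows_def)

lemma finite_Th [simp]: "finite(Th n a c u)"
proof -
let ?N = "rows n a(Suc c)" let ?B = "{..Max(u ` ?N)}"
have "Th n a c u <= {f. ALL x. (x : ?N --> f x : ?B) & (x ~: ?N --> f x = 0)}"
proof
 fix t assume t: "t : Th n a c u"
 have "t x <= Max(u ` ?N)" if "x : ?N" for x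
 proof -
  have "t x <= u x" using t by (auto simp: Th_def ok_def)
  also have "u x <= Max(u ` ?N)" using that by simp
  finally show ?thesis .
 qed
 thus "t : {f. ALL x. (x : ?N --> f x : ?B) & (x ~: ?N --> f x = 0)}" using t by (auto simp: Th_def)
qed
thus ?thesis by (rule finite_subset) (rule finite_set_of_finite_funs; simp)
qed

lemma xt_xset:
 assumes "inj_on t N" "!!r. r : N ==> 0<t r"
 shows "xt N t = xset((%r. t r-1) ` N)"
proof -
have "inj_on(%r. t r-1) N"
proof (rule inj_onI)
 fix r s assume "r : N" "s : N" "t r-1 = t s-1"
 hence "t r = t s" using assms(2)[of r] assms(2)[of s] by auto
 thus "r = s" using assms(1) \<open>r : N\<close> \<open>s : N\<close> by (metis inj_onD)
qed
thus ?thesis by (simp add: xt_def xset_def prod.reindex)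
qed

lemma xt_sv:
 assumes "!!r. r : N ==> 0<t r"
 shows "xt N(sv i o t) = swap_poly i(xt N t)"
unfolding xt_def swap_prod
by (rule prod.cong) (auto simp: swapidx_def assms)

lemma swapidx_image_same: "(i : K \<longleftrightarrow> Suc i : K) ==> swapidx i ` K = K"
using subset_antisym by (auto simp: swapidx_def)

lemma swap_xset_same: "finite K ==> (i : K \<longleftrightarrow> Suc i : K) ==> swap_poly i(xset K) = xset K"
by (simp add: swap_xset swapidx_image_same)

lemma xset_insert: "finite K ==> k ~: K ==> xset(insert k K) = xvar k * xset K"
by (simp add: xset_def)

lemma xset_single_split:
 assumes "finite K" "i : K" "Suc i ~: K"
 shows "xset K = xvar i * xset(K-{i})" "swap_poly i(xset K) = xvar(Suc i) * xset(K-{i})"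
"swap_poly i(xset(K-{i})) = xset(K-{i})"
using xset_insert[of "K-{i}" i] assms swap_xset_same by (auto simp: insert_absorb swapidx_def)

lemma pidiff_xset_single:
 assumes "finite K" "i : K" "Suc i ~: K"
 shows "pidiff i(xset K * H) = xset K * H+swap_poly i(xset K) * pidiff i H"
proof -
note S=xset_single_split[OF assms]
have "pidiff i(xset K * H) = pidiff i(xset(K-{i}) * (xvar i * H))" unfolding S(1) by (simp add: algebra_simps)
also have "...=xset(K-{i}) * (xvar i * H+xvar(Suc i) * pidiff i H)"
unfolding pidiff_mult_sym[OF S(3)] pidiff_xvar_mult ..
finally show ?thesis unfolding S(2) unfolding S(1) by (simp add: algebra_simps)
qed

lemma pidiff_xset_Suc:
 assumes "finite K" "Suc i : K" "i ~: K" "swap_poly i H = H"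
 shows "pidiff i(xset K * H) = 0"
using xset_insert[of "K-{Suc i}" "Suc i"] assms swap_xset_same pidiff_xvar_Suc_zero[of i "xset(K-{Suc i}) * H"] by (auto simp: insert_absorb mult.assoc)

text \<open>Pulling pi_i through one column: each weight \<open>w t\<close> goes to itself, to the
  weight of the column with the two entries exchanged, to the sum of both, or to 0, and the columns
  so obtained are exactly those that may follow the exchanged u.\<close>

lemma Fk_sv:
 assumes "good(rows n a c) i u" "inj_on u(rows n a c)"
 shows "Fk n a k c(sv i o u) = pidiff i(Fk n a k c u)"
using assms
proof (induction k arbitrary: c u)
case 0
have "pidiff i 1 = 1" by (simp add: pidiff_sym)
thus ?case by simp
next
case (Suc k)
define N where "N = rows n a(Suc c)" define L where "L = rows n a c"
have NL: "N <= L" and fN: "finite N" by (auto simp: N_def L_def rows_def)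
have g: "good L i u" and iu: "inj_on u L" using Suc(2,3) by (simp_all add: L_def)
define \<Theta> where "\<Theta>=Th n a c u" define \<Theta>' where "\<Theta>' = Th n a c(sv i o u)"
define H where "H = Fk n a k(Suc c)" define w where "w t = xt N t * H t" for t
define h1 where "h1 t \<longleftrightarrow> (EX r:N. t r = Suc i)" for t :: "nat => nat"
define h2 where "h2 t \<longleftrightarrow> (EX r:N. t r = Suc(Suc i))" for t :: "nat => nat"
have Th: "t : Th n a c v \<longleftrightarrow> ok N L v t & (ALL r. r ~: N --> t r = 0)" for t v
by (simp add: Th_def N_def L_def)
have IH: "good N i t ==> inj_on t N ==> H(sv i o t) = pidiff i(H t)" for t
unfolding N_def H_def by (rule Suc(1))
have off: "(ALL r. r ~: N --> (sv i o t) r = 0) \<longleftrightarrow> (ALL r. r ~: N --> t r = 0)" for t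
by (auto simp: swapidx_def)
have h_sv: "h1(sv i o t) \<longleftrightarrow> h2 t" "h2(sv i o t) \<longleftrightarrow> h1 t" for t
proof -
 have "(sv i o t) r = Suc i \<longleftrightarrow> t r = Suc(Suc i)" "(sv i o t) r = Suc(Suc i) \<longleftrightarrow> t r = Suc i" for r
 by (auto simp: swapidx_def)
 thus "h1(sv i o t) \<longleftrightarrow> h2 t" "h2(sv i o t) \<longleftrightarrow> h1 t" by (simp_all only: h1_def h2_def)
qed
have good_n2: "~ h2 t ==> good N i t" for t by (auto simp: good_def h2_def)
\<comment> \<open>If t fails the condition, its exchange satisfies it; then \<open>H t\<close> is
  itself an image of pi_i, hence symmetric.\<close>
have not_good: "~ good N i t ==> good N i(sv i o t)" if "inj_on t N" for t
proof -
 assume "~ good N i t"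
 then obtain s where s: "s : N" "t s = Suc(Suc i)" "!!r. r : N ==> r<s ==> t r ~= Suc i"
 unfolding good_def by blast
 have "s<f" if "f : N" "t f = Suc i" for f using s that by (metis n_not_Suc_n linorder_neqE_nat)
 thus "good N i(sv i o t)" unfolding good_def
 using s(1,2) by (auto simp: swapidx_def)
qed
have symH: "swap_poly i(H t) = H t" if "inj_on t N" "~ good N i t" for t
using IH[OF not_good[OF that] inj_on_sv[OF that(1)]] by simp
\<comment> \<open>X collects the columns whose weight survives pi_i, Y those whose exchanged column
  appears. A column with \<open>Suc(Suc i)\<close> but not \<open>Suc i\<close> is in neither,
  because pi_i kills its weight.\<close>
define X where "X = {t : \<Theta>. ~ h2 t | h1 t & ~ good N i t}"
define Y where "Y = {t : \<Theta>. h1 t & good N i t}"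
have gt_lt: "EX e f. e : N & f : N & t e = Suc(Suc i) & t f = Suc i & (good N i t \<longleftrightarrow> f<e) & (~ good N i t \<longleftrightarrow> e<f)"
if "h1 t" "h2 t" "inj_on t N" for t
proof -
 obtain e f where ef: "e : N" "f : N" "t e = Suc(Suc i)" "t f = Suc i" using \<open>h1 t\<close> \<open>h2 t\<close> by (auto simp: h1_def h2_def)
 have "good N i t \<longleftrightarrow> f<e" unfolding good_def using ef that(3) by (metis inj_onD)
 moreover have "e ~= f" using ef by auto
 ultimately show ?thesis using ef by (metis linorder_neqE_nat not_less_iff_gr_or_eq)
qed
have inj\<Theta>: "inj_on t N" if "t : \<Theta>" for t using that by (auto simp: \<Theta>_def Th ok_def)
have phi: "pidiff i(w t) = (if t : X then w t else 0)+(if t : Y then w(sv i o t) else 0)" if t: "t : \<Theta>" for t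
proof -
 have o: "ok N L u t" using t by (simp add: \<Theta>_def Th)
 note D=okD[OF o]
 define K where "K = (%r. t r-1) ` N"
 have fK: "finite K" using fN by (simp add: K_def)
 have xK: "xt N t = xset K" unfolding K_def by (rule xt_xset) (use D in auto)
 have xK': "xt N(sv i o t) = swap_poly i(xset K)" unfolding xK[symmetric] by (rule xt_sv) (use D in auto)
 have pos: "0<t r" if "r : N" for r using D(1)[OF that] .
 have eq: "v = t r-1 \<longleftrightarrow> t r = Suc v" if "r : N" for r v using pos[OF that] by auto
 have K1: "i : K \<longleftrightarrow> h1 t" unfolding K_def h1_def image_iff using eq by metis
 have K2: "Suc i : K \<longleftrightarrow> h2 t" unfolding K_def h2_def image_iff using eq by metis
 have wt: "w t = xset K * H t" "w(sv i o t) = swap_poly i(xset K) * H(sv i o t)" by (simp_all add: w_def xK xK')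
 consider "h1 t" "h2 t" | "h1 t" "~ h2 t" | "~ h1 t" "h2 t" | "~ h1 t" "~ h2 t" by blast
 thus ?thesis
 proof cases
  case 1
  hence s: "swap_poly i(xset K) = xset K" using swap_xset_same[OF fK] K1 K2 by auto
  show ?thesis
  proof (cases "good N i t")
   case True
   hence "t ~: X" "t : Y" using 1 t by (auto simp: X_def Y_def)
   thus ?thesis using IH[OF True D(3)] by (simp add: wt s pidiff_mult_sym)
  next
   case False
   hence "t : X" "t ~: Y" using 1 t by (auto simp: X_def Y_def)
   thus ?thesis using symH[OF D(3) False] by (simp add: wt s pidiff_sym)
  qed
 next
  case 2
  hence "t : X" "t : Y" using t good_n2 by (auto simp: X_def Y_def)
  thus ?thesis using IH[OF good_n2[OF 2(2)] D(3)] pidiff_xset_single[OF fK,of i "H t"] 2 K1 K2 by (simp add: wt)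
 next
  case 3
  hence ng: "~ good N i t" by (auto simp: good_def h1_def h2_def)
  hence "t ~: X" "t ~: Y" using 3 by (auto simp: X_def Y_def)
  thus ?thesis using pidiff_xset_Suc[OF fK _ _ symH[OF D(3) ng]] 3 K1 K2 by (simp add: wt)
 next
  case 4
  hence "t : X" "t ~: Y" using t by (auto simp: X_def Y_def)
  moreover have "sv i o t = t"
  proof
   fix r show "(sv i o t) r = t r"
   using 4 t by (cases "r : N") (auto simp: h1_def h2_def swapidx_def \<Theta>_def Th)
  qed
  hence "pidiff i(H t) = H t" using IH[OF good_n2[OF 4(2)] D(3)] by simp
  moreover have "swap_poly i(xset K) = xset K" using swap_xset_same[OF fK] K1 K2 4 by auto
  ultimately show ?thesis by (simp add: wt pidiff_sym)
 qed
qed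
have sub1: "\<Theta>' <= X Un(%t. sv i o t) ` Y"
proof
 fix t assume "t : \<Theta>'"
 hence o: "ok N L(sv i o u) t" and z: "ALL r. r ~: N --> t r = 0" by (simp_all add: \<Theta>'_def Th)
 note D=okD[OF o]
 show "t : X Un(%t. sv i o t) ` Y"
 proof (cases "h2 t")
  case False
  hence "ok N L u t" using o ok_sv_avoid[of N t i L u] by (auto simp: h2_def)
  thus ?thesis using False z by (auto simp: X_def \<Theta>_def Th)
 next
  case h2: True
  then obtain e where e: "e : N" "t e = Suc(Suc i)" by (auto simp: h2_def)
  show ?thesis
  proof (cases "h1 t")
   case False
   hence "ok N L u(sv i o t)" by (intro ok_sv_single2[OF g NL o e]) (auto simp: h1_def)
   hence "sv i o t : Y" using z off[of t] h2 False h_sv good_n2[of "sv i o t"] by (auto simp: Y_def \<Theta>_def Th)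
   hence "sv i o(sv i o t) : (%t. sv i o t) ` Y" by blast
   thus ?thesis by simp
  next
   case True
   then obtain f where f: "f : N" "t f = Suc i" by (auto simp: h1_def)
   note R=ok_sv_both_rev[OF g iu NL o e f]
   have ng: "~ good N i t" using R(1) e f D(3) unfolding good_def by (metis inj_onD not_less_iff_gr_or_eq)
   show ?thesis
   proof (cases "u e = Suc i")
    case True
    have "good N i(sv i o t)" by (rule not_good[OF D(3) ng])
    hence "sv i o t : Y" using z off[of t] h2 h_sv R(2)[OF True] by (auto simp: Y_def \<Theta>_def Th)
    hence "sv i o(sv i o t) : (%t. sv i o t) ` Y" by blast
    thus ?thesis by simp
   next
    case False
    thus ?thesis using R(3)[OF False] z ng \<open>h1 t\<close> by (auto simp: X_def \<Theta>_def Th)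
   qed
  qed
 qed
qed
have sub2: "X<=\<Theta>'"
proof
 fix t assume t: "t : X"
 hence o: "ok N L u t" and z: "ALL r. r ~: N --> t r = 0" by (simp_all add: X_def \<Theta>_def Th)
 have "ok N L(sv i o u) t"
 proof (cases "h2 t")
  case False
  thus ?thesis using o ok_sv_avoid[of N t i L u] by (auto simp: h2_def)
 next
  case True
  hence "h1 t" "~ good N i t" using t by (auto simp: X_def)
  then obtain e f where "e : N" "f : N" "t e = Suc(Suc i)" "t f = Suc i" "e<f"
  using gt_lt[OF _ True okD(3)[OF o]] by blast
  thus ?thesis using ok_sv_both_lt(1)[OF g NL o] by blast
 qed
 thus "t : \<Theta>'" using z by (simp add: \<Theta>'_def Th)
qed
have sub3: "(%t. sv i o t) ` Y<=\<Theta>'"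
proof safe
 fix t assume t: "t : Y"
 hence o: "ok N L u t" and z: "ALL r. r ~: N --> t r = 0" and h: "h1 t" "good N i t" by (simp_all add: Y_def \<Theta>_def Th)
 have "ok N L(sv i o u)(sv i o t)"
 by (metis h ok_sv_single1[OF g NL o] g NL o gt_lt h(1) okD(3)[OF o] ok_sv_both_gt(1)[OF iu NL o] iu h1_def h2_def)
 thus "sv i o t : \<Theta>'" using z off[of t] by (simp add: \<Theta>'_def Th)
qed
have disj: "X Int(%t. sv i o t) ` Y = {}"
proof (rule ccontr)
 assume "X Int(%t. sv i o t) ` Y ~= {}"
 then obtain t where tX: "sv i o t : X" and tY: "t : Y" by blast
 have o1: "ok N L u(sv i o t)" and o2: "ok N L u t" using tX tY by (auto simp: X_def Y_def \<Theta>_def Th)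
 have h: "h1 t" "good N i t" using tY by (auto simp: Y_def)
 hence "h2(sv i o t)" by (simp add: h_sv)
 hence "h1(sv i o t)" using tX by (auto simp: X_def)
 hence "h2 t" by (simp add: h_sv)
 then obtain e f where ef: "e : N" "f : N" "t e = Suc(Suc i)" "t f = Suc i" "f<e"
 using gt_lt[OF h(1) _ okD(3)[OF o2]] h by blast
 have "u f = Suc i" using ok_sv_both_gt(2)[OF iu NL o2] ef by blast
 moreover have "(sv i o t) f <= u f" using okD(2)[OF o1] ef by blast
 ultimately show False using ef by (simp add: swapidx_def)
qed
have inj: "inj_on(%t. sv i o t) Y" by (rule inj_onI) (metis sv_comp_comp)
have fin: "finite \<Theta>" "finite X" "finite Y" by (simp_all add: \<Theta>_def X_def Y_def)
have XY: "X<=\<Theta>" "Y<=\<Theta>" by (auto simp: X_def Y_def)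
have "pidiff i(Fk n a(Suc k) c u) = (SUM t:\<Theta>. pidiff i(w t))"
by (simp add: pidiff_sum \<Theta>_def w_def N_def H_def)
also have "...=(SUM t:\<Theta>. if t : X then w t else 0)+(SUM t:\<Theta>. if t : Y then w(sv i o t) else 0)"
by (simp add: phi sum.distrib)
also have "...=(SUM t:X. w t)+(SUM t:Y. w(sv i o t))"
using fin XY by (simp add: sum.inter_restrict[symmetric] Int_absorb1)
also have "...=(SUM t:X Un(%t. sv i o t) ` Y. w t)"
using fin disj inj by (simp add: sum.union_disjoint sum.reindex)
also have "X Un(%t. sv i o t) ` Y=\<Theta>'" using sub1 sub2 sub3 by blast
finally have "pidiff i(Fk n a(Suc k) c u) = sum w \<Theta>'" .
also have "sum w \<Theta>' = Fk n a(Suc k) c(sv i o u)"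
unfolding \<Theta>'_def w_def N_def H_def Fk.simps ..
finally show ?case by (rule sym)
qed

lemma ok_reindex:
 assumes sm: "strict_mono_on L h" and NL: "N <= L" and hL: "h ` L <= L'"
 and us: "!!r. r : L ==> u'(h r) = u r" and ts: "!!r. r : N ==> t'(h r) = t r"
 and extra: "!!r' r. r' : L'-h ` L ==> r : N ==> h r<r'"
 shows "ok(h ` N) L' u' t' \<longleftrightarrow> ok N L u t"
proof -
have less: "h r<h s \<longleftrightarrow> r<s" if "r : L" "s : L" for r s
by (rule strict_mono_on_less[OF sm that])
have injh: "inj_on h L" using sm strict_mono_on_imp_inj_on by blast
have hN: "h r : h ` N \<longleftrightarrow> r : N" if "r : L" for r
using injh NL that by (auto simp: inj_on_def)
have "inj_on t'(h ` N) \<longleftrightarrow> inj_on t N"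
proof -
 have "inj_on t'(h ` N) \<longleftrightarrow> inj_on(t' o h) N" by (rule comp_inj_on_iff[OF inj_on_subset[OF injh NL]])
 also have "... \<longleftrightarrow> inj_on t N" by (rule inj_on_cong) (simp add: ts)
 finally show ?thesis .
qed
moreover have "(ALL r:h ` N. 0<t' r & t' r <= u' r) \<longleftrightarrow> (ALL r:N. 0<t r & t r <= u r)"
using us ts NL by force
moreover have "(ALL r s. r<s --> s : h ` N --> r : L' --> t' s <= u' r --> r : h ` N & t' s<t' r)
\<longleftrightarrow> (ALL r s. r<s --> s : N --> r : L --> t s <= u r --> r : N & t s<t r)" (is "?A \<longleftrightarrow> ?B")
proof
 assume A: ?A
 show ?B
 proof (intro allI impI)
  fix r s assume rs: "r<s" "s : N" "r : L" "t s <= u r"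
  have "h r<h s" "h s : h ` N" "h r : L'" "t'(h s) <= u'(h r)" using rs less us ts NL hL by auto
  hence "h r : h ` N & t'(h s)<t'(h r)" using A by blast
  thus "r : N & t s<t r" using hN rs ts by auto
 qed
next
 assume B: ?B
 show ?A
 proof (intro allI impI)
  fix r' s' assume rs: "r'<s'" "s' : h ` N" "r' : L'" "t' s' <= u' r'"
  obtain s where s: "s : N" "s' = h s" using rs by blast
  show "r' : h ` N & t' s'<t' r'"
  proof (cases "r' : h ` L")
   case True
   then obtain r where r: "r : L" "r' = h r" by blast
   hence "r<s" "t s <= u r" using rs s less NL us ts by auto
   thus ?thesis using B r s ts by auto
  next
   case False
   thus ?thesis using extra[of r' s] rs s by auto
  qed
 qed
qed
ultimately show ?thesis unfolding ok_def by simp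
qed

text \<open>Only the relative order of the rows matters. Rows outside the image of h end at the
  current column and lie above every continuing row, so they never appear as the lower row in the
  placement rule.\<close>

lemma Fk_reindex:
 assumes "strict_mono_on(rows n a c) h" "h ` rows n a c <= rows n' a' c'"
"!!r. r : rows n a c ==> a'(h r)+c = a r+c'"
"!!r. r : rows n a c ==> u'(h r) = u r"
"!!r'. r' : rows n' a' c'-h ` rows n a c ==> a' r' = c'"
"!!r' r. r' : rows n' a' c'-h ` rows n a c ==> r : rows n a(Suc c) ==> h r<r'"
 shows "Fk n a k c u = Fk n' a' k c' u'"
using assms
proof (induction k arbitrary: c c' u u')
case (Suc k)
define L where "L = rows n a c" define L' where "L' = rows n' a' c'"
define N where "N = rows n a(Suc c)" define N' where "N' = rows n' a'(Suc c')"
have sm: "strict_mono_on L h" and hL: "h ` L <= L'" using Suc(2,3) by (simp_all add: L_def L'_def)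
have len: "a'(h r)+c = a r+c'" if "r : L" for r using Suc(4) that by (simp add: L_def)
have us: "u'(h r) = u r" if "r : L" for r using Suc(5) that by (simp add: L_def)
have ex1: "a' r' = c'" if "r' : L'-h ` L" for r' using Suc(6) that by (simp add: L_def L'_def)
have ex2: "h r<r'" if "r' : L'-h ` L" "r : N" for r' r using Suc(7) that by (simp add: L_def L'_def N_def)
have NL: "N <= L" by (auto simp: N_def L_def rows_def)
have injh: "inj_on h L" using sm strict_mono_on_imp_inj_on by blast
have N': "N' = h ` N"
proof
 show "h ` N <= N'"
 using NL len hL by (force simp: N_def rows_def N'_def L'_def)
 show "N' <= h ` N"
 using ex1 len by (force simp: N'_def L'_def rows_def N_def L_def)
qed
define hi where "hi = inv_into L h"
have hi: "hi(h r) = r" if "r : L" for r using injh that by (simp add: hi_def)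
define P where "P t r' = (if r' : N' then t(hi r') else 0)" for t :: "nat => nat" and r'
define Q where "Q t r = (if r : N then t(h r) else 0)" for t :: "nat => nat" and r
have Ph: "P t(h r) = t r" if "r : N" for t r using that N' hi NL by (auto simp: P_def)
have okP: "ok N' L' u' t' \<longleftrightarrow> ok N L u t" if "!!r. r : N ==> t'(h r) = t r" for t t'
unfolding N' by (rule ok_reindex[OF sm NL hL]) (use us that ex2 in blast)+
have "(SUM t:Th n a c u. xt N t * Fk n a k(Suc c) t) = (SUM t:Th n' a' c' u'. xt N' t * Fk n' a' k(Suc c') t)"
proof (rule sum.reindex_bij_witness[of _ Q P])
 fix t assume t: "t : Th n a c u"
 hence o: "ok N L u t" and z: "!!r. r ~: N ==> t r = 0" by (auto simp: Th_def N_def L_def)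
 show "Q(P t) = t" using z Ph by (auto simp: Q_def)
 have "ok N' L' u'(P t)" using okP[of "P t" t] Ph o by blast
 thus "P t : Th n' a' c' u'" by (auto simp: Th_def N'_def L'_def P_def)
 have "xt N'(P t) = xt N t"
 unfolding xt_def N' using inj_on_subset[OF injh NL] by (simp add: prod.reindex Ph)
 moreover have "Fk n a k(Suc c) t = Fk n' a' k(Suc c')(P t)"
 proof (rule Suc(1))
  show "strict_mono_on(rows n a(Suc c)) h" using sm NL unfolding N_def by (meson monotone_on_subset)
  show "h ` rows n a(Suc c) <= rows n' a'(Suc c')" using N' by (simp add: N_def N'_def)
  fix r assume r: "r : rows n a(Suc c)"
  thus "a'(h r)+Suc c = a r+Suc c'" using len[of r] NL by (auto simp: N_def)
  show "P t(h r) = t r" using Ph r by (simp add: N_def)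
 next
  fix r' assume "r' : rows n' a'(Suc c')-h ` rows n a(Suc c)"
  thus "a' r' = Suc c'" using N' by (simp add: N_def N'_def)
 next
  fix r' r assume "r' : rows n' a'(Suc c')-h ` rows n a(Suc c)"
  thus "h r<r'" using N' by (simp add: N_def N'_def)
 qed
 ultimately show "xt N'(P t) * Fk n' a' k(Suc c')(P t) = xt N t * Fk n a k(Suc c) t" by simp
next
 fix t assume t: "t : Th n' a' c' u'"
 hence o: "ok N' L' u' t" and z: "!!r. r ~: N' ==> t r = 0" by (auto simp: Th_def N'_def L'_def)
 have Qr: "t(h r) = Q t r" if "r : N" for r using that by (simp add: Q_def)
 show "P(Q t) = t"
 proof
  fix r' show "P(Q t) r' = t r'"
  using z[of r'] Ph[of _ "Q t"] Qr N' by (cases "r' : N'") (auto simp: P_def)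
 qed
 have "ok N L u(Q t)" using okP[of t "Q t"] Qr o by blast
 thus "Q t : Th n a c u" by (auto simp: Th_def N_def L_def Q_def)
qed
thus ?case by (simp add: N_def N'_def)
qed simp

lemma rows_rsw: "Suc j<n ==> rows n(rsw j a) c = swapidx j ` rows n a c"
by (auto simp: rows_def rsw_def swapidx_def)

text \<open>If one of two adjacent rows is already dead, moving the other across it keeps the order
  of the live rows.\<close>

lemma Fk_joint:
 assumes "Suc j<n" "~ (c <= a j & c <= a(Suc j))"
 shows "Fk n(rsw j a) k c(rsw j u) = Fk n a k c u"
proof (rule Fk_reindex[of _ _ _ "swapidx j",symmetric])
show "strict_mono_on(rows n a c)(swapidx j)"
using assms by (auto simp: strict_mono_on_def rows_def swapidx_def)
show "swapidx j ` rows n a c <= rows n(rsw j a) c" using rows_rsw[OF assms(1)] by simp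
qed (use rows_rsw[OF assms(1)] in \<open>auto simp: rsw_def\<close>)

lemma xt_rsw:
"xt(swapidx j ` N)(rsw j t) = xt N t"
proof -
have "inj_on(swapidx j) N" by (metis inj_onI swapidx_swapidx)
thus ?thesis by (simp add: xt_def prod.reindex rsw_def)
qed

lemma Th_rsw_lt:
 assumes "Suc j<n" "c <= a j" "c<a(Suc j)" "u j<u(Suc j)" "t : Th n a c(rsw j u)"
 shows "c<a j & t(Suc j)<t j"
proof -
have o: "ok(rows n a(Suc c))(rows n a c)(rsw j u) t" using assms(5) by (simp add: Th_def)
have m: "Suc j : rows n a(Suc c)" "j : rows n a c" using assms by (auto simp: rows_def)
have "t(Suc j) <= rsw j u j" using okD(2)[OF o m(1)] assms(4) by simp
hence "j : rows n a(Suc c) & t(Suc j)<t j" using okD(4)[OF o _ m] by simp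
thus ?thesis by (auto simp: rows_def)
qed

text \<open>Columns that agree with the order of u are exchanged along with it; columns against the
  order stay. The bound \<open>u j < t (Suc j)\<close> for the former keeps the two kinds
  apart.\<close>

lemma Th_rsw_both:
 assumes n: "Suc j<n" and a: "c<a j" "c<a(Suc j)" and u: "u j<u(Suc j)"
 defines "A == {t : Th n a c u. t j<t(Suc j)}" and "B == {t : Th n a c u. t(Suc j)<t j}"
 shows "Th n a c u = A Un B" "A Int B = {}" "Th n a c(rsw j u) = B Un rsw j ` A" "B Int rsw j ` A = {}"
 and "inj_on(rsw j) A"
proof -
define N where "N = rows n a(Suc c)" define L where "L = rows n a c"
have N: "j : N" "Suc j : N" and NL: "N <= L" using n a by (auto simp: N_def L_def rows_def)
have Th: "t : Th n a c v \<longleftrightarrow> ok N L v t & (ALL r. r ~: N --> t r = 0)" for t v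
by (simp add: Th_def N_def L_def)
have z: "(ALL r. r ~: N --> rsw j t r = 0) \<longleftrightarrow> (ALL r. r ~: N --> t r = 0)" for t
using N by (metis rsw_other)
have "t j ~= t(Suc j)" if "t : Th n a c u" for t
using that N okD(3)[of N L u t] unfolding Th by (metis inj_onD n_not_Suc_n)
thus "Th n a c u = A Un B" unfolding A_def B_def using nat_neq_iff by blast
show "A Int B = {}" by (auto simp: A_def B_def)
note pair=ok_rsw_pair[OF N NL u]
show "Th n a c(rsw j u) = B Un rsw j ` A"
proof (intro equalityI subsetI)
 fix t assume t: "t : Th n a c(rsw j u)"
 hence lt: "t(Suc j)<t j" using Th_rsw_lt[of j n c a u t] n a u by simp
 define t0 where "t0 = rsw j t"
 have t0: "t = rsw j t0" "t0 j<t0(Suc j)" using lt by (simp_all add: t0_def)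
 have "if t0(Suc j) <= u j then ok N L u(rsw j t0) else ok N L u t0"
 using pair(1)[OF t0(2)] t unfolding Th t0(1) by simp
 moreover have "ALL r. r ~: N --> t r = 0" "ALL r. r ~: N --> t0 r = 0" using t z[of t] by (auto simp: Th t0_def)
 ultimately have "t : B | t0 : A" using t0 by (auto simp: A_def B_def Th split: if_splits)
 thus "t : B Un rsw j ` A" using t0(1) by blast
next
 fix t assume "t : B Un rsw j ` A"
 thus "t : Th n a c(rsw j u)"
 proof
  assume t: "t : B"
  have "rsw j t j<rsw j t(Suc j)" "ok N L u t" "t j <= u j" using t okD(2)[of N L u t j] N by (auto simp: B_def Th)
  thus ?thesis using pair(1)[of "rsw j t"] t by (simp add: Th B_def)
 next
  assume "t : rsw j ` A"
  then obtain t0 where t0: "t = rsw j t0" "t0 : A" by blast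
  hence "t0 j<t0(Suc j)" "ok N L u t0" by (auto simp: A_def Th)
  thus ?thesis using pair(1)[of t0] pair(2)[of t0] t0 z[of t0] by (auto simp: Th A_def)
 qed
qed
show "B Int rsw j ` A = {}"
proof (rule ccontr)
 assume "B Int rsw j ` A ~= {}"
 then obtain t where t: "t : A" "rsw j t : B" by blast
 hence "u j<t(Suc j)" using pair(2)[of t] by (auto simp: A_def Th)
 moreover have "rsw j t j <= u j" using t okD(2)[of N L u "rsw j t" j] N by (auto simp: B_def Th)
 ultimately show False by simp
qed
show "inj_on(rsw j) A" by (metis inj_onI rsw_simps(3))
qed

lemma Th_rsw_one:
 assumes n: "Suc j<n" and a: "c<a j" "a(Suc j) = c" and u: "u j<u(Suc j)"
 shows "Th n a c(rsw j u) = Th n a c u Un rsw j ` Th n(rsw j a) c u" "Th n a c u Int rsw j ` Th n(rsw j a) c u = {}"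
 and "inj_on(rsw j) X"
proof -
define N where "N = rows n a(Suc c)" define L where "L = rows n a c"
define N' where "N' = rows n(rsw j a)(Suc c)"
have N: "j : N" "Suc j ~: N" "j : L" "Suc j : L" using n a by (auto simp: N_def L_def rows_def)
have N': "N' = insert(Suc j)(N-{j})"
unfolding N'_def rows_rsw[OF n] using N unfolding N_def[symmetric]
by (auto simp: swapidx_def)
have L': "rows n(rsw j a) c = L" unfolding rows_rsw[OF n] L_def[symmetric] using N by (simp add: swapidx_image_same)
have Th: "t : Th n a c v \<longleftrightarrow> ok N L v t & (ALL r. r ~: N --> t r = 0)" for t v
by (simp add: Th_def N_def L_def)
have Th': "t : Th n(rsw j a) c v \<longleftrightarrow> ok N' L v t & (ALL r. r ~: N' --> t r = 0)" for t v
by (simp add: Th_def N'_def L')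
have z: "(ALL r. r ~: N' --> rsw j t r = 0) \<longleftrightarrow> (ALL r. r ~: N --> t r = 0)" for t
proof -
 have "r ~: N' \<longleftrightarrow> swapidx j r ~: N" for r using N N' by (auto simp: swapidx_def)
 thus ?thesis unfolding rsw_def by (metis comp_apply swapidx_swapidx)
qed
have low: "t : Th n a c u ==> t j <= u j" for t using okD(2)[of N L u t j] N by (simp add: Th)
have high: "rsw j t : Th n(rsw j a) c u ==> u j<t j" for t
using okD(4)[of N' L u "rsw j t" j "Suc j"] N N' by (force simp: Th')
show "Th n a c(rsw j u) = Th n a c u Un rsw j ` Th n(rsw j a) c u"
proof (intro equalityI subsetI)
 fix t assume t: "t : Th n a c(rsw j u)"
 show "t : Th n a c u Un rsw j ` Th n(rsw j a) c u"
 proof (cases "t j <= u j")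
  case True
  thus ?thesis using t ok_rsw_one_low[where j=j and N=N and L=L and u=u and t=t] N u by (simp add: Th)
 next
  case False
  hence "rsw j t : Th n(rsw j a) c u"
  using t ok_rsw_one_high[where j=j and N=N and L=L and u=u and t=t,OF N u _ N'] z[of t] by (simp add: Th Th')
  thus ?thesis by (metis UnI2 image_eqI rsw_simps(3))
 qed
next
 fix t assume "t : Th n a c u Un rsw j ` Th n(rsw j a) c u"
 thus "t : Th n a c(rsw j u)"
 proof
  assume t: "t : Th n a c u"
  thus ?thesis using low[OF t] ok_rsw_one_low[where j=j and N=N and L=L and u=u and t=t] N u by (simp add: Th)
 next
  assume "t : rsw j ` Th n(rsw j a) c u"
  hence t: "rsw j t : Th n(rsw j a) c u" by auto
  thus ?thesis
  using high[OF t] ok_rsw_one_high[where j=j and N=N and L=L and u=u and t=t,OF N u _ N'] z[of t] by (simp add: Th Th')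
 qed
qed
show "Th n a c u Int rsw j ` Th n(rsw j a) c u = {}"
proof (rule ccontr)
 assume "Th n a c u Int rsw j ` Th n(rsw j a) c u ~= {}"
 then obtain t where "rsw j t : Th n a c u" "t : Th n(rsw j a) c u" by blast
 thus False using low[of "rsw j t"] high[of "rsw j t"] by simp
qed
show "inj_on(rsw j) X" by (metis inj_onI rsw_simps(3))
qed

text \<open>Exchanging two adjacent basement entries has the same three outcomes as pi_i on an atom;
  at column 0 this becomes \<open>pidiff_atom\<close>. In the induction over columns the exchanged
  row lengths first enter where only row j continues.\<close>

lemma Fk_rsw:
 assumes "Suc j<n" "c <= a j" "c <= a(Suc j)" "u j<u(Suc j)" "!!r. r<n ==> a r <= c+k"
 shows "Fk n a k c(rsw j u) = (if a j<a(Suc j) then 0 else if a j = a(Suc j) then Fk n a k c u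
else Fk n a k c u+Fk n(rsw j a) k c u)"
using assms
proof (induction k arbitrary: a c u)
case 0
have "a j = c" "a(Suc j) = c" using 0(2,3) 0(5)[of j] 0(5)[of "Suc j"] 0(1) by auto
thus ?case by simp
next
case (Suc k)
note n=Suc(2) and u=Suc(5)
have bnd: "a r <= Suc c+k" if "r<n" for r using Suc(6)[OF that] by simp
let ?N = "rows n a(Suc c)"
have IH: "Fk n a k(Suc c)(rsw j t) = (if a j<a(Suc j) then 0 else if a j = a(Suc j) then Fk n a k(Suc c) t
else Fk n a k(Suc c) t+Fk n(rsw j a) k(Suc c) t)"
if "c<a j" "c<a(Suc j)" "t j<t(Suc j)" for t
by (rule Suc(1)[OF n _ _ that(3) bnd]) (use that in auto)
have IH': "Fk n(rsw j a) k(Suc c) t = 0"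
if "c<a j" "c<a(Suc j)" "t(Suc j)<t j" "a(Suc j)<a j" for t
proof -
 have "Fk n(rsw j a) k(Suc c)(rsw j(rsw j t)) = 0"
 by (subst Suc(1)[OF n]) (use that bnd n in \<open>auto simp: rsw_def swapidx_def\<close>)
 thus ?thesis by simp
qed
have xs: "xt ?N(rsw j t) = xt ?N t" if "c<a j" "c<a(Suc j)" for t
proof -
 have "swapidx j ` ?N = ?N" by (rule swapidx_image_same) (use that n in \<open>auto simp: rows_def\<close>)
 thus ?thesis using xt_rsw[of j ?N t] by simp
qed
consider(lt) "a j<a(Suc j)" | (both) "a(Suc j) <= a j" "c<a(Suc j)" | (dead) "a j = c" "a(Suc j) = c" | (one) "c<a j" "a(Suc j) = c"
using Suc(3,4) by linarith
thus ?case
proof cases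
 case lt
 have "Fk n a k(Suc c) t = 0" if t: "t : Th n a c(rsw j u)" for t
 using Th_rsw_lt[of j n c a u t] n u t lt Suc(3) IH[of "rsw j t"] by auto
 thus ?thesis using lt by simp
next
 case both
 define A where "A = {t : Th n a c u. t j<t(Suc j)}"
 define B where "B = {t : Th n a c u. t(Suc j)<t j}"
 have aj: "c<a j" using both by simp
 note T=Th_rsw_both[OF n aj both(2) u,folded A_def B_def]
 have fA: "finite A" "finite B" by (simp_all add: A_def B_def)
 let ?w = "%t. xt ?N t * Fk n a k(Suc c) t"
 have 1: "Fk n a(Suc k) c(rsw j u) = sum ?w B+(SUM t:A. ?w(rsw j t))"
 using T(4,5) fA by (simp add: T(3) sum.union_disjoint sum.reindex)
 have 2: "Fk n a(Suc k) c u = sum ?w A+sum ?w B"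
 using T(2) fA by (simp add: T(1) sum.union_disjoint)
 show ?thesis
 proof (cases "a j = a(Suc j)")
  case True
  have "(SUM t:A. ?w(rsw j t)) = sum ?w A"
  by (intro sum.cong) (use IH aj both True xs in \<open>auto simp: A_def\<close>)
  thus ?thesis using 1 2 True by (simp)
 next
  case False
  hence lt: "a(Suc j)<a j" using both by simp
  have rs: "rows n(rsw j a)(Suc c) = ?N" "rows n(rsw j a) c = rows n a c"
  unfolding rows_rsw[OF n] using both n by (intro swapidx_image_same; auto simp: rows_def)+
  let ?w' = "%t. xt ?N t * Fk n(rsw j a) k(Suc c) t"
  have th: "Th n(rsw j a) c u = Th n a c u" by (simp add: Th_def rs)
  have "Fk n(rsw j a)(Suc k) c u = sum ?w' A+sum ?w' B"
  using T(2) fA by (simp add: rs th T(1) sum.union_disjoint)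
  moreover have "sum ?w' B = 0"
  by (intro sum.neutral) (use IH' aj both lt in \<open>auto simp: B_def\<close>)
  moreover have "(SUM t:A. ?w(rsw j t)) = sum ?w A+sum ?w' A"
  unfolding sum.distrib[symmetric]
  by (intro sum.cong) (use IH aj both lt xs in \<open>auto simp: A_def distrib_left\<close>)
  ultimately show ?thesis using 1 2 lt by (simp)
 qed
next
 case dead
 have "Th n a c(rsw j u) = Th n a c u"
 unfolding Th_def using ok_rsw_dead[of j ?N "rows n a c"] dead n by (auto simp: rows_def)
 thus ?thesis using dead by simp
next
 case one
 note T=Th_rsw_one[OF n one u]
 let ?w = "%t. xt ?N t * Fk n a k(Suc c) t"
 have "Fk n a(Suc k) c(rsw j u) = Fk n a(Suc k) c u+(SUM t:Th n(rsw j a) c u. ?w(rsw j t))"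
 using T(2,3) by (simp add: T(1) sum.union_disjoint sum.reindex)
 moreover have "?w(rsw j t) = xt(rows n(rsw j a)(Suc c)) t * Fk n(rsw j a) k(Suc c) t" for t
 proof -
  have "Fk n(rsw j a) k(Suc c)(rsw j(rsw j t)) = Fk n a k(Suc c)(rsw j t)"
  by (rule Fk_joint[OF n]) (use one in auto)
  moreover have "xt(swapidx j ` ?N)(rsw j(rsw j t)) = xt ?N(rsw j t)" by (rule xt_rsw)
  ultimately show ?thesis by (simp add: rows_rsw[OF n])
 qed
 ultimately show ?thesis using one by simp
qed
qed

lemma xmon_count:
 assumes "finite A" "!!x. x : A ==> f x : {1..n}"
 shows "xmon(map(%k. card {x : A. f x = Suc k}) [0..<n]) = (PROD x:A. xvar(f x-1))"
proof -
have "(PROD x:A. xvar(f x-1)) = (PROD k<n. PROD x:{x : A. f x-1 = k}. xvar(f x-1))"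
proof (rule prod.group[symmetric])
 have "f x-1<n" if "x : A" for x using assms(2)[OF that] by auto
 thus "(%x. f x-1) ` A <= {..<n}" by blast
qed (use assms in auto)
also have "...=(PROD k<n. xvar k ^ card {x : A. f x = Suc k})"
proof (rule prod.cong)
 fix k assume "k : {..<n}"
 have "{x : A. f x-1 = k} = {x : A. f x = Suc k}" using assms(2) by force
 moreover have "(PROD x:{x : A. f x = Suc k}. xvar(f x-1)) = (PROD x:{x : A. f x = Suc k}. xvar k)"
 by (rule prod.cong) auto
 ultimately show "(PROD x:{x : A. f x-1 = k}. xvar(f x-1)) = xvar k ^ card {x : A. f x = Suc k}" by simp
qed simp
also have "...=xmon(map(%k. card {x : A. f x = Suc k}) [0..<n])" by (simp add: xmon_prod)
finally show ?thesis ..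
qed

definition cells :: "nat => (nat => nat) => nat => (nat \<times> nat) set" where
"cells n a c = {(r,d). r<n & c <= d & d<a r}"

definition Fill :: "nat => (nat => nat) => nat => (nat => nat) => (nat \<times> nat => nat) set" where
"Fill n a c u = {S. (ALL x. x ~: cells n a c --> S x = 0) &
ok(rows n a(Suc c))(rows n a c) u(%r. S(r,c)) &
(ALL d>=c. ok(rows n a(Suc(Suc d)))(rows n a(Suc d))(%r. S(r,d))(%r. S(r,Suc d)))}"

lemma finite_cells [simp]: "finite(cells n a c)"
proof (rule finite_subset)
show "cells n a c <= (SIGMA r:{..<n}. {..<a r})" by (auto simp: cells_def)
qed simp

lemma cells_Suc: "cells n a c = (%r. (r,c)) ` rows n a(Suc c) Un cells n a(Suc c)"
"(%r. (r,c)) ` rows n a(Suc c) Int cells n a(Suc c) = {}"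
by (auto simp: cells_def rows_def)

lemma Fk_Fill:
 assumes "!!r. r<n ==> a r <= c+k"
 shows "finite(Fill n a c u) & Fk n a k c u = (SUM S:Fill n a c u. PROD x:cells n a c. xvar(S x-1))"
using assms
proof (induction k arbitrary: c u)
case 0
have e: "cells n a c = {}" "!!d. c <= d ==> rows n a(Suc d) = {}" using 0 by (fastforce simp: cells_def rows_def)+
have "Fill n a c u = {%_. 0}" by (auto simp: Fill_def e ok_def)
thus ?case by (simp add: e)
next
case (Suc k)
let ?N = "rows n a(Suc c)"
define J where "J = (%(t :: nat => nat,S :: nat \<times> nat => nat)(r,d). if d = c then t r else S(r,d))"
define P where "P = (%S :: nat \<times> nat => nat. (%r. S(r,c),%(r,d). if d = c then 0 else S(r,d)))"
have IH: "finite(Fill n a(Suc c) t)" "Fk n a k(Suc c) t = (SUM S:Fill n a(Suc c) t. PROD x:cells n a(Suc c). xvar(S x-1))" for t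
using Suc(1)[of "Suc c" t] Suc(2) by auto
have Fill0: "S(r,c) = 0" if "S : Fill n a(Suc c) t" for S t r
using that by (auto simp: Fill_def cells_def)
have PJ: "P(J(t,S)) = (t,S)" if "t : Th n a c u" "S : Fill n a(Suc c) t" for t S
using Fill0[OF that(2)] by (auto simp: P_def J_def)
have JP: "J(P S) = S" for S by (auto simp: P_def J_def)
have JF: "J(t,S) : Fill n a c u" if "t : Th n a c u" "S : Fill n a(Suc c) t" for t S
proof -
 have z: "J(t,S) x = 0" if x: "x ~: cells n a c" for x
 proof -
  obtain r d where rd: "x = (r,d)" by (cases x)
  show ?thesis
  using x rd \<open>t : Th n a c u\<close> \<open>S : Fill n a(Suc c) t\<close> by (auto simp: cells_def rows_def J_def Th_def Fill_def)
 qed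
 have "ok(rows n a(Suc(Suc d)))(rows n a(Suc d))(%r. J(t,S)(r,d))(%r. J(t,S)(r,Suc d))" if "c <= d" for d
 using that \<open>S : Fill n a(Suc c) t\<close> by (cases "d = c") (auto simp: J_def Fill_def)
 moreover have "ok(rows n a(Suc c))(rows n a c) u(%r. J(t,S)(r,c))" using that(1) by (simp add: J_def Th_def)
 ultimately show ?thesis using z unfolding Fill_def by blast
qed
have PF: "fst(P S) : Th n a c u & snd(P S) : Fill n a(Suc c)(fst(P S))" if S: "S : Fill n a c u" for S
using S by (auto simp: Fill_def P_def Th_def cells_def rows_def)
have im: "Fill n a c u = J ` (SIGMA t:Th n a c u. Fill n a(Suc c) t)"
proof
 show "Fill n a c u <= J ` (SIGMA t:Th n a c u. Fill n a(Suc c) t)"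
 proof
  fix S assume "S : Fill n a c u"
  hence "P S : (SIGMA t:Th n a c u. Fill n a(Suc c) t)" using PF[of S] by (cases "P S") auto
  thus "S : J ` (SIGMA t:Th n a c u. Fill n a(Suc c) t)" using JP by (metis image_eqI)
 qed
qed (use JF in auto)
have inj: "inj_on J(SIGMA t:Th n a c u. Fill n a(Suc c) t)"
by (rule inj_on_inverseI[of _ P]) (use PJ in auto)
have w: "(PROD x:cells n a c. xvar(J(t,S) x-1)) = xt ?N t * (PROD x:cells n a(Suc c). xvar(S x-1))" for t S
proof -
 have "(PROD x:cells n a c. xvar(J(t,S) x-1)) =
 (PROD x:(%r. (r,c)) ` ?N. xvar(J(t,S) x-1)) * (PROD x:cells n a(Suc c). xvar(J(t,S) x-1))"
 unfolding cells_Suc(1)[of n a c] by (rule prod.union_disjoint) (use cells_Suc(2) in auto)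
 moreover have "(PROD x:(%r. (r,c)) ` ?N. xvar(J(t,S) x-1)) = xt ?N t"
 by (subst prod.reindex) (auto simp: xt_def J_def inj_on_def)
 moreover have "(PROD x:cells n a(Suc c). xvar(J(t,S) x-1)) = (PROD x:cells n a(Suc c). xvar(S x-1))"
 by (rule prod.cong) (auto simp: J_def cells_def)
 ultimately show ?thesis by simp
qed
have "(SUM S:Fill n a c u. PROD x:cells n a c. xvar(S x-1)) =
(SUM p:(SIGMA t:Th n a c u. Fill n a(Suc c) t). PROD x:cells n a c. xvar(J p x-1))"
unfolding im by (simp add: sum.reindex[OF inj])
also have "...=(SUM (t,S):(SIGMA t:Th n a c u. Fill n a(Suc c) t). xt ?N t * (PROD x:cells n a(Suc c). xvar(S x-1)))"
by (intro sum.cong HOL.refl) (clarsimp simp: w simp del: One_nat_def)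
also have "...=(SUM t:Th n a c u. SUM S:Fill n a(Suc c) t. xt ?N t * (PROD x:cells n a(Suc c). xvar(S x-1)))"
by (rule sum.Sigma[symmetric]) (auto simp: IH)
also have "...=Fk n a(Suc k) c u" by (simp add: sum_distrib_left[symmetric] IH)
finally show ?case using IH(1) unfolding im by auto
qed

subsection \<open>Demazure atoms\<close>

text \<open>Padding with 0 makes the row lengths total and independent of trailing zeros, so that
  they can be compared and reindexed as functions.\<close>

definition ln :: "nat list => nat => nat" where "ln a r = (if r<length a then a ! r else 0)"

lemma ln_swapl: "Suc i<length a ==> ln(swapl i a) = rsw i(ln a)"
by (auto simp: ln_def nth_swapl swapidx_def)

lemma skyline_cells: "skyline a = cells(length a)(ln a) 0"
by (auto simp: skyline_def cells_def ln_def)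

text \<open>If \<open>t r\<close> were smaller than \<open>Suc r\<close>, it would fit under the
  basement entry of the lower row \<open>t r - 1\<close>, which would then need a larger entry than
  its basement allows. So the basement \<open>Suc\<close> encodes the prescribed first column of an
  atom.\<close>

lemma first_col_id:
 assumes o: "ok N {..<n} Suc t" and N: "N <= {..<n}" and r: "r : N"
 shows "t r = Suc r"
proof (rule ccontr)
assume "t r ~= Suc r"
hence lt: "t r<Suc r" "0<t r" using okD(1,2)[OF o r] by auto
let ?s = "t r-1"
have "?s : N & t r<t ?s" using okD(4)[OF o,of ?s r] lt r N by auto
thus False using okD(2)[OF o,of ?s] lt by auto
qed

definition atom_fill :: "nat list => (nat \<times> nat => nat) set" where
"atom_fill a = {S:fillings a. semi_skyline a S & (ALL r<length a. a ! r > 0 --> S(r,0) = Suc r)}"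

text \<open>The triple conditions compare pairs of rows according to their full lengths, whereas the
  placement rule of \<open>ok\<close> looks only at two neighbouring columns. The equivalence is
  what allows columns to be built one by one.\<close>

lemma atom_fill_eq: "atom_fill a = Fill(length a)(ln a) 0 Suc"
proof (intro equalityI subsetI)
let ?n = "length a"
have rows: "r : rows ?n(ln a)(Suc c) \<longleftrightarrow> (r,c) : skyline a" for r c by (auto simp: rows_def skyline_def ln_def)
fix S assume "S : atom_fill a"
hence f: "S : fillings a" and ss: "semi_skyline a S" and fc: "!!r. r<?n ==> a ! r > 0 ==> S(r,0) = Suc r"
by (auto simp: atom_fill_def)
have dec: "(r,Suc c) : skyline a ==> S(r,Suc c) <= S(r,c)" for r c using ss by (auto simp: semi_skyline_def)
have dis: "(r,c) : skyline a ==> (s,c) : skyline a ==> r ~= s ==> S(r,c) ~= S(s,c)" for r s c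
using ss by (auto simp: semi_skyline_def)
have tA: "r<s ==> a ! r >= a ! s ==> (r,c) : skyline a ==> (r,Suc c) : skyline a ==> (s,Suc c) : skyline a ==> 
inv_triple(S(r,c))(S(r,Suc c))(S(s,Suc c))" for r s c using ss unfolding semi_skyline_def by blast
have tB: "r<s ==> a ! s > a ! r ==> (s,c) : skyline a ==> (s,Suc c) : skyline a ==> (r,c) : skyline a ==> 
inv_triple(S(s,c))(S(s,Suc c))(S(r,c))" for r s c using ss unfolding semi_skyline_def by blast
\<comment> \<open>Type B triples propagate the order of the first column: a longer row lying above a
  shorter one keeps the larger entries.\<close>
have lt: "S(r,c)<S(s,c)" if "r<s" "a ! r<a ! s" "(r,c) : skyline a" "s<?n" for r s c
using that
proof (induction c)
 case 0 thus ?case using fc[of r] fc[of s] by (auto simp: skyline_def)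
next
 case (Suc c)
 have sk: "(r,c) : skyline a" "(s,c) : skyline a" "(s,Suc c) : skyline a" using Suc by (auto simp: skyline_def)
 hence "S(r,c)<S(s,Suc c)" using tB[OF Suc(2,3) sk(2,3,1)] Suc by (auto simp: inv_triple_def)
 thus ?case using dec[OF Suc(4)] by simp
qed
have pos: "0<S x" if "x : skyline a" for x using f that by (auto simp: fillings_def)
have o0: "ok(rows ?n(ln a)(Suc 0))(rows ?n(ln a) 0) Suc(%r. S(r,0))"
by (rule okI) (use fc in \<open>auto simp: rows skyline_def inj_on_def\<close>)
have oc: "ok(rows ?n(ln a)(Suc(Suc c)))(rows ?n(ln a)(Suc c))(%r. S(r,c))(%r. S(r,Suc c))" for c
proof (rule okI)
 fix r assume "r : rows ?n(ln a)(Suc(Suc c))"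
 thus "0<S(r,Suc c) & S(r,Suc c) <= S(r,c)" using pos dec by (auto simp: rows)
next
 show "inj_on(%r. S(r,Suc c))(rows ?n(ln a)(Suc(Suc c)))" by (rule inj_onI) (use dis rows in blast)
next
 fix r s assume "r<s" "s : rows ?n(ln a)(Suc(Suc c))" "r : rows ?n(ln a)(Suc c)" and le: "S(s,Suc c) <= S(r,c)"
 hence rs: "r<s" "(s,Suc c) : skyline a" "(r,c) : skyline a" by (auto simp: rows)
 have sc: "(s,c) : skyline a" "s<?n" using rs by (auto simp: skyline_def)
 show "r : rows ?n(ln a)(Suc(Suc c)) & S(s,Suc c)<S(r,Suc c)"
 proof (cases "a ! s <= a ! r")
  case True
  hence r2: "(r,Suc c) : skyline a" using rs by (auto simp: skyline_def)
  thus ?thesis using tA[OF rs(1) True rs(3) r2 rs(2)] le by (auto simp: inv_triple_def rows)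
 next
  case False
  thus ?thesis using tB[OF rs(1) _ sc(1) rs(2,3)] lt[OF rs(1) _ rs(3) sc(2)] le by (auto simp: inv_triple_def)
 qed
qed
show "S : Fill ?n(ln a) 0 Suc" using o0 oc f by (auto simp: Fill_def fillings_def skyline_cells)
next
let ?n = "length a"
have rows: "r : rows ?n(ln a)(Suc c) \<longleftrightarrow> (r,c) : skyline a" for r c by (auto simp: rows_def skyline_def ln_def)
fix S assume "S : Fill ?n(ln a) 0 Suc"
hence z: "x ~: skyline a ==> S x = 0" and o0: "ok(rows ?n(ln a)(Suc 0))(rows ?n(ln a) 0) Suc(%r. S(r,0))"
and oc: "ok(rows ?n(ln a)(Suc(Suc c)))(rows ?n(ln a)(Suc c))(%r. S(r,c))(%r. S(r,Suc c))" for x c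
by (auto simp: Fill_def skyline_cells simp del: split_paired_All)
have r0: "rows ?n(ln a) 0 = {..<?n}" by (auto simp: rows_def)
have fc: "S(r,0) = Suc r" if "(r,0) : skyline a" for r
using first_col_id[of "rows ?n(ln a)(Suc 0)" ?n "%r. S(r,0)" r] o0 that
unfolding r0 by (auto simp: rows) (auto simp: rows_def)
have dec: "S(r,Suc c) <= S(r,c)" if "(r,Suc c) : skyline a" for r c using okD(2)[OF oc] that by (simp add: rows)
have pos: "0<S(r,c)" if "(r,c) : skyline a" for r c
using that okD(1)[OF oc] fc by (cases c) (auto simp: rows)
have bnd: "S(r,c) <= Suc r" if "(r,c) : skyline a" for r c
using that
proof (induction c)
 case (Suc c)
 hence "(r,c) : skyline a" by (auto simp: skyline_def)
 thus ?case using dec[OF Suc(2)] Suc(1) by simp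
qed (simp add: fc)
have dis: "S(r,c) ~= S(s,c)" if "(r,c) : skyline a" "(s,c) : skyline a" "r ~= s" for r s c
proof (cases c)
 case 0 thus ?thesis using that fc by auto
next
 case (Suc d)
 thus ?thesis using okD(3)[OF oc[of d]] that by (auto simp: inj_on_def rows)
qed
have rule: "(r,Suc c) : skyline a & S(s,Suc c)<S(r,Suc c)"
if "r<s" "(s,Suc c) : skyline a" "(r,c) : skyline a" "S(s,Suc c) <= S(r,c)" for r s c
using okD(4)[OF oc[of c],of r s] that by (simp add: rows)
\<comment> \<open>Otherwise the placement rule makes the shorter row continue with the same defect
  in the next column, and it would never end.\<close>
have B: "S(r,c)<S(s,Suc c)" if "r<s" "a ! r<a ! s" "(s,Suc c) : skyline a" "(r,c) : skyline a" for r s c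
proof (rule ccontr)
 assume "~ S(r,c)<S(s,Suc c)"
 hence "S(s,Suc c) <= S(r,c)" by simp
 thus False using that
 proof (induction "a ! r-c" arbitrary: c rule: less_induct)
  case less
  have r: "(r,Suc c) : skyline a" "S(s,Suc c)<S(r,Suc c)" using rule less by auto
  hence s: "(s,Suc(Suc c)) : skyline a" using less by (auto simp: skyline_def)
  have "a ! r-Suc c<a ! r-c" using r by (auto simp: skyline_def)
  thus False using less(1)[of "Suc c"] r s less(3,4) dec[OF s] by simp
 qed
qed
have "semi_skyline a S"
unfolding semi_skyline_def inv_triple_def using dec dis rule B by (meson not_le)
moreover have "S : fillings a"
proof -
 have "S x : {1..?n}" if "x : skyline a" for x
 using that pos bnd by (cases x) (force simp: skyline_def)
 thus ?thesis using z by (simp add: fillings_def)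
qed
ultimately show "S : atom_fill a" using fc by (auto simp: atom_fill_def skyline_def)
qed

lemma finite_skyline [simp]: "finite(skyline a)" by (simp add: skyline_cells)

lemma xmon_fwt: "S : fillings a ==> xmon(fwt a S) = (PROD x:skyline a. xvar(S x-1))"
unfolding fwt_def by (rule xmon_count) (auto simp: fillings_def)

lemma atom_Fk:
 assumes "length a = n" "!!r. ln a r <= k"
 shows "atom a = Fk n(ln a) k 0 Suc"
proof -
have "atom a = (SUM S:atom_fill a. PROD x:skyline a. xvar(S x-1))"
unfolding atom_def atom_fill_def by (rule sum.cong) (auto simp: xmon_fwt)
thus ?thesis using Fk_Fill[of n "ln a" 0 k Suc] assms by (simp add: atom_fill_eq skyline_cells)
qed

lemma ln_le_sum: "ln a r <= sum_list a"
using member_le_sum_list[of "a ! r" a] by (auto simp: ln_def)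

text \<open>In the basement \<open>Suc\<close>, exchanging the entries \<open>Suc i\<close> and
  \<open>Suc(Suc i)\<close> is the same as exchanging the entries of rows i and
  \<open>Suc i\<close>. \<open>Fk_sv\<close> evaluates the former as pi_i, \<open>Fk_rsw\<close> the
  latter by row lengths.\<close>

lemma pidiff_atom:
 assumes i: "Suc i<length a"
 shows "pidiff i(atom a) = (if a ! i<a ! Suc i then 0 else if a ! i = a ! Suc i then atom a else atom a+atom(swapl i a))"
proof -
let ?n = "length a" let ?k = "sum_list a"
have ai: "ln a i = a ! i" "ln a(Suc i) = a ! Suc i" using i by (auto simp: ln_def)
have "pidiff i(atom a) = Fk ?n(ln a) ?k 0(sv i o Suc)"
unfolding atom_Fk[OF HOL.refl ln_le_sum]
by (rule Fk_sv[symmetric]) (use i in \<open>auto simp: good_def rows_def\<close>)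
also have "sv i o Suc = rsw i Suc" by (auto simp: swapidx_def fun_eq_iff)
also have "Fk ?n(ln a) ?k 0(rsw i Suc) = (if ln a i<ln a(Suc i) then 0 else if ln a i = ln a(Suc i) then Fk ?n(ln a) ?k 0 Suc
else Fk ?n(ln a) ?k 0 Suc+Fk ?n(rsw i(ln a)) ?k 0 Suc)"
by (rule Fk_rsw) (use i ln_le_sum in auto)
also have "Fk ?n(ln a) ?k 0 Suc = atom a" by (rule atom_Fk[symmetric]) (auto intro: ln_le_sum)
also have "Fk ?n(rsw i(ln a)) ?k 0 Suc = atom(swapl i a)"
unfolding ln_swapl[OF i,symmetric] using ln_le_sum[of "swapl i a"] i by (intro atom_Fk[symmetric]) auto
finally show ?thesis by (simp add: ai)
qed

lemma hdiff_atom: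
 assumes i: "Suc i<length a"
 shows "hdiff i(atom a) = (if a ! i<a ! Suc i then-atom a else if a ! i = a ! Suc i then 0 else atom(swapl i a))"
by (simp add: hdiff_alt pidiff_atom[OF i])

definition increasing :: "nat list => bool" where
"increasing a \<longleftrightarrow> (ALL i. Suc i<length a --> a ! i <= a ! Suc i)"

lemma partition_le: "partition a ==> i <= j ==> j<length a ==> a ! j <= a ! i"
proof (induction j)
case (Suc j)
thus ?case by (cases "i = Suc j") (auto simp: partition_def)
qed simp

lemma increasing_le: "increasing a ==> i <= j ==> j<length a ==> a ! i <= a ! j"
proof (induction j)
case (Suc j)
thus ?case by (cases "i = Suc j") (auto simp: increasing_def)
qed simp

lemma increasing_sort: "increasing a ==> sort a = a"
by (rule sort_key_id_if_sorted) (auto simp: sorted_iff_nth_mono intro: increasing_le)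

lemma rk_swapl:
 assumes "Suc i<length a"
 shows "rk(swapl i a)+a ! i = rk a+a ! Suc i"
proof -
let ?n = "length a"
define f where "f b j = (?n-j) * b ! j" for b j
have split: "(SUM j<?n. f b j) = f b i+(f b(Suc i)+(SUM j:{..<?n}-{i}-{Suc i}. f b j))" for b
using assms by (subst sum.remove[of _ i]) (auto simp: sum.remove[of _ "Suc i"])
have "(SUM j:{..<?n}-{i}-{Suc i}. f(swapl i a) j) = (SUM j:{..<?n}-{i}-{Suc i}. f a j)"
by (rule sum.cong) (use assms in \<open>auto simp: f_def nth_swapl swapidx_def\<close>)
moreover have "f(swapl i a) i+f(swapl i a)(Suc i)+a ! i = f a i+f a(Suc i)+a ! Suc i"
proof -
 have "?n-i = Suc(?n-Suc i)" using assms by simp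
 thus ?thesis using assms by (simp add: f_def)
qed
ultimately show ?thesis using split[of a] split[of "swapl i a"] by (simp add: rk_def f_def)
qed

text \<open>Sorting by adjacent swaps as an induction rule; \<open>rk\<close> weights early
  positions more, so moving a larger part to the right decreases it.\<close>

lemma increasing_induct [consumes 1,case_names sorted swap]:
 assumes "length b = n" and "!!b. length b = n ==> increasing b ==> P b"
 and step: "!!b i. length b = n ==> Suc i<n ==> b ! Suc i<b ! i ==> P(swapl i b) ==> P b"
 shows "P b"
using assms(1)
proof (induction "rk b" arbitrary: b rule: less_induct)
case less
show ?case
proof (cases "increasing b")
 case True thus ?thesis using assms(2) less by blast
next
 case False
 then obtain i where i: "Suc i<n" "b ! Suc i<b ! i" using less(2) by (auto simp: increasing_def)
 hence "rk(swapl i b)<rk b" using rk_swapl[of i b] less(2) by simp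
 thus ?thesis using step[OF less(2) i] less by simp
qed
qed

lemma partition_induct [consumes 1,case_names sorted swap]:
 assumes "length b = n" and "!!b. length b = n ==> partition b ==> P b"
 and step: "!!b i. length b = n ==> Suc i<n ==> b ! i<b ! Suc i ==> P(swapl i b) ==> P b"
 shows "P b"
using assms(1)
proof (induction "n * sum_list b-rk b" arbitrary: b rule: less_induct)
case less
show ?case
proof (cases "partition b")
 case True thus ?thesis using assms(2) less by blast
next
 case False
 then obtain i where i: "Suc i<n" "b ! i<b ! Suc i" using less(2) by (auto simp: partition_def)
 hence "rk b<rk(swapl i b)" using rk_swapl[of i b] less(2) by simp
 thus ?thesis using step[OF less(2) i] less(1)[of "swapl i b"] less(2) i rk_le[of "swapl i b"] by simp
qed
qed

lemma coef_swap: "Suc i<length b ==> coef(swap_poly i f) b = coef f(swapl i b)"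
proof -
assume i: "Suc i<length b"
have m: "swap_mon i(swap_mon i m) = m" for m by (rule poly_mapping_eqI) (simp add: lookup_swap_mon)
have "Poly_Mapping.lookup(swap_poly i f) m = Poly_Mapping.lookup f(swap_mon i m)" for m
using frag_induction[of f UNIV "%f. Poly_Mapping.lookup(swap_poly i f) m = Poly_Mapping.lookup f(swap_mon i m)"] m by (force simp: swap_frag_of lookup_minus)
moreover have "swap_mon i(Poly_Mapping.nth b) = Poly_Mapping.nth(swapl i b)"
using i by (intro poly_mapping_eqI) (auto simp: lookup_swap_mon lookup_nth0 nth_swapl swapidx_def)
ultimately show ?thesis by (simp add: coef_def)
qed

lemma symmetric_coef_mset:
 assumes sym: "!!i. Suc i<n ==> swap_poly i f = f" and b: "length b = n" and b': "mset b = mset b'"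
 shows "coef f b = coef f b'"
proof -
have "coef f b = coef f(sort b)" if "length b = n" for b
using that
proof (induction rule: increasing_induct)
 case (sorted b) thus ?case by (simp add: increasing_sort)
next
 case (swap b i)
 have "sort(swapl i b) = sort b" by (rule properties_for_sort) (use swap in auto)
 thus ?case using swap coef_swap[of i b f] sym[of i] by simp
qed
moreover have "sort b = sort b'" using b' by (metis mset_sort properties_for_sort sorted_sort)
moreover have "length b' = n" using b b' by (metis size_mset)
ultimately show ?thesis using b by metis
qed

section \<open>Weights of atom fillings\<close>

lemma atom_fill_bound:
 assumes "S : atom_fill a" "(r,c) : skyline a"
 shows "S(r,c) <= Suc r" "0<S(r,c)"
proof -
show "0<S(r,c)" using assms by (auto simp: atom_fill_def fillings_def)
show "S(r,c) <= Suc r" using assms(2)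
proof (induction c)
 case 0 thus ?case using assms(1) by (auto simp: atom_fill_def skyline_def)
next
 case (Suc c)
 hence "(r,c) : skyline a" by (auto simp: skyline_def)
 moreover have "S(r,Suc c) <= S(r,c)" using assms(1) Suc by (auto simp: atom_fill_def semi_skyline_def)
 ultimately show ?case using Suc by simp
qed
qed

lemma atom_alt: "atom a = (SUM S:atom_fill a. xmon(fwt a S))"
by (simp add: atom_def atom_fill_def)

lemma finite_atom_fill: "finite(atom_fill a)"
unfolding atom_fill_eq using Fk_Fill[of "length a" "ln a" 0 "sum_list a" Suc] ln_le_sum by auto

lemma length_fwt [simp]: "length(fwt a S) = length a" by (simp add: fwt_def)

lemma coef_atom: "length b = length a ==> coef(atom a) b = int(card {S : atom_fill a. fwt a S = b})"
using finite_atom_fill by (auto simp: atom_alt coef_sum coef_xmon sum.If_cases Int_def)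

lemma sum_fwt:
 assumes "S : fillings a"
 shows "(SUM j<length a. g j * fwt a S ! j) = (SUM x:skyline a. g(S x-1))"
proof -
have "(SUM x:skyline a. g(S x-1)) = (SUM j<length a. SUM x:{x : skyline a. S x-1 = j}. g(S x-1))"
proof (rule sum.group[symmetric])
 have "S x-1<length a" if "x : skyline a" for x using assms that by (fastforce simp: fillings_def)
 thus "(%x. S x-1) ` skyline a <= {..<length a}" by blast
qed auto
also have "...=(SUM j<length a. g j * fwt a S ! j)"
proof (rule sum.cong)
 fix j assume j: "j : {..<length a}"
 have "1 <= S x" if "x : skyline a" for x using assms that unfolding fillings_def by (cases x) auto
 hence "{x : skyline a. S x-1 = j} = {x : skyline a. S x = Suc j}" by fastforce
 moreover have "(SUM x:{x : skyline a. S x = Suc j}. g(S x-1)) = (SUM x:{x : skyline a. S x = Suc j}. g j)"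
 by (rule sum.cong) auto
 ultimately show "(SUM x:{x : skyline a. S x-1 = j}. g(S x-1)) = g j * fwt a S ! j" using j by (simp add: fwt_def)
qed simp
finally show ?thesis ..
qed

lemma skyline_sum: "(SUM x:skyline a. g(fst x)) = (SUM r<length a. (g r :: nat) * a ! r)"
proof -
have "skyline a = (SIGMA r:{..<length a}. {..<a ! r})" by (auto simp: skyline_def)
hence "(SUM x:skyline a. g(fst x)) = (SUM (r,c):(SIGMA r:{..<length a}. {..<a ! r}). g r)"
by (simp add: split_beta)
also have "...=(SUM r<length a. SUM c<a ! r. g r)" by (rule sum.Sigma[symmetric]) auto
finally show ?thesis by (simp add: mult.commute)
qed

lemma sum_list_lessThan: "sum_list a = (SUM r<length a. (a ! r :: nat))"
by (simp add: sum_list_sum_nth atLeast0LessThan)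

definition S0 :: "nat list => nat \<times> nat => nat" where
"S0 a x = (if x : skyline a then Suc(fst x) else 0)"

lemma S0_atom_fill: "S0 a : atom_fill a"
by (auto simp: semi_skyline_def S0_def skyline_def inv_triple_def fillings_def atom_fill_def)

lemma fwt_S0: "fwt a(S0 a) = a"
proof (rule nth_equalityI)
fix i assume "i<length(fwt a(S0 a))"
hence i: "i<length a" by simp
have "{x : skyline a. S0 a x = Suc i} = (%c. (i,c)) ` {..<a ! i}" using i by (auto simp: S0_def skyline_def)
thus "fwt a(S0 a) ! i = a ! i" using i by (simp add: fwt_def card_image inj_on_def)
qed simp

text \<open>An entry is at most one more than its row index, so exponents only move towards earlier
  variables, which raises \<open>rk\<close>; equality fixes every entry.\<close>

lemma atom_fill_fwt:
 assumes S: "S : atom_fill a"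
 shows "sum_list(fwt a S) = sum_list a" "rk a <= rk(fwt a S)" "rk a = rk(fwt a S) ==> S = S0 a"
proof -
let ?n = "length a"
have f: "S : fillings a" using S by (simp add: atom_fill_def)
have "sum_list(fwt a S) = (SUM j<?n. 1 * fwt a S ! j)" by (simp add: sum_list_lessThan)
also have "...=(SUM x:skyline a. 1)" by (rule sum_fwt[OF f])
also have "...=sum_list a" using skyline_sum[where g= "%_. 1" and a=a] by (simp add: sum_list_lessThan)
finally show "sum_list(fwt a S) = sum_list a" .
have r1: "rk(fwt a S) = (SUM x:skyline a. ?n-(S x-1))"
using sum_fwt[OF f,of "%j. ?n-j"] by (simp add: rk_def)
have r2: "rk a = (SUM x:skyline a. ?n-fst x)"
using skyline_sum[where g= "%j. ?n-j" and a=a] by (simp add: rk_def)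
have le: "?n-fst x <= ?n-(S x-1)" if "x : skyline a" for x
using atom_fill_bound[OF S,of "fst x" "snd x"] that by auto
show "rk a <= rk(fwt a S)" unfolding r1 r2 by (rule sum_mono) (rule le)
assume eq: "rk a = rk(fwt a S)"
have "?n-fst x = ?n-(S x-1)" if "x : skyline a" for x
proof (rule ccontr)
 assume "?n-fst x ~= ?n-(S x-1)"
 hence "?n-fst x<?n-(S x-1)" using le[OF that] by linarith
 hence "(SUM x:skyline a. ?n-fst x)<(SUM x:skyline a. ?n-(S x-1))"
 using le that by (intro sum_strict_mono_ex1 bexI[of _ x] ballI) simp_all
 thus False using eq r1 r2 by simp
qed
hence "S x = Suc(fst x)" if "x : skyline a" for x
using atom_fill_bound[OF S,of "fst x" "snd x"] that by (fastforce simp: skyline_def)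
moreover have "S x = 0" if "x ~: skyline a" for x using f that unfolding fillings_def by blast
ultimately have "S x = S0 a x" for x by (cases "x : skyline a") (simp_all add: S0_def)
thus "S = S0 a" by blast
qed

lemma triangular_atom: "triangular atom n"
unfolding triangular_def
proof (intro allI impI conjI)
fix a :: "nat list" assume a: "length a = n"
show "atom a : polys n" unfolding atom_alt by (intro polys_sum xmon_polys) (simp add: a)
have "{S : atom_fill a. fwt a S = a} = {S0 a}"
proof (intro equalityI subsetI)
 fix S assume "S : {S : atom_fill a. fwt a S = a}"
 thus "S : {S0 a}" using atom_fill_fwt(3)[of S a] by simp
qed (simp add: S0_atom_fill fwt_S0)
thus "coef(atom a) a = 1" by (simp add: coef_atom)
fix b :: "nat list" assume b: "length b = n" "coef(atom a) b ~= 0"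
then obtain S where S: "S : atom_fill a" "fwt a S = b" using a by (auto simp: coef_atom card_gt_0_iff)
thus "b = a | sum_list b = sum_list a & rk a<rk b"
using atom_fill_fwt[OF S(1)] fwt_S0 by (metis le_neq_implies_less)
qed

lemma coef_atom_nonneg: "length b = length a ==> coef(atom a) b >= 0"
by (simp add: coef_atom)

text \<open>In a partition shape all lower rows reach every column of row r. By induction they hold
  their own numbers there, and distinctness leaves \<open>Suc r\<close> as the only entry within the
  bound.\<close>

lemma atom_partition:
 assumes p: "partition a" shows "atom a = xmon a"
proof -
have "S = S0 a" if S: "S : atom_fill a" for S
proof -
 have "S(r,c) = Suc r" if "(r,c) : skyline a" for r c
 using that
 proof (induction r arbitrary: c rule: less_induct)
  case (less r)
  show ?case
  proof (rule ccontr)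
   assume ne: "S(r,c) ~= Suc r"
   obtain s where s: "S(r,c) = Suc s" "s<r"
   using atom_fill_bound[OF S less(2)] ne by (metis Suc_less_eq gr0_implies_Suc le_neq_implies_less)
   have sk: "(s,c) : skyline a" using less(2) s(2) partition_le[OF p,of s r] by (simp add: skyline_def)
   have "S(s,c) = S(r,c)" using less(1)[OF s(2) sk] s(1) by (rule trans[OF _ sym])
   moreover have "S(s,c) ~= S(r,c)" using S less(2) sk s(2) unfolding atom_fill_def semi_skyline_def by blast
   ultimately show False by simp
  qed
 qed
 moreover have "S x = 0" if "x ~: skyline a" for x using S that unfolding atom_fill_def fillings_def by blast
 ultimately have "S x = S0 a x" for x by (cases x; cases "x : skyline a") (simp_all add: S0_def)
 thus ?thesis by blast
qed
hence "atom_fill a = {S0 a}" using S0_atom_fill by blast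
thus ?thesis by (simp add: atom_alt fwt_S0)
qed

lemma card_column_prefix:
 assumes "partition m" "k <= length m"
 shows "card {p. p<k & c<m ! p} = min k(card {p. p<length m & c<m ! p})"
proof -
define A where "A = {p. p<length m & c<m ! p}"
define h where "h = card A"
have fin: "finite A" by (simp add: A_def)
have down: "q : A" if "p : A" "q <= p" for p q
proof -
 have "p<length m" "c<m ! p" using that by (simp_all add: A_def)
 thus ?thesis using partition_le[OF assms(1) that(2)] that(2) by (simp add: A_def)
qed
have "q : A" if "q<h" for q
proof (rule ccontr)
 assume q: "q ~: A"
 have "p<q" if "p : A" for p using down[OF that,of q] q by (meson not_less)
 hence "A <= {..<q}" by blast
 hence "card A <= q" using card_mono[of "{..<q}" A] by simp
 thus False using that by (simp add: h_def)
qed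
hence "{..<h} <= A" by blast
hence "{..<h} = A" by (rule card_subset_eq[OF fin]) (simp add: h_def)
hence A: "p<length m & c<m ! p \<longleftrightarrow> p<h" for p unfolding A_def by blast
have "p<k & c<m ! p \<longleftrightarrow> p<min k h" for p using A[of p] assms(2) by linarith
hence "{p. p<k & c<m ! p} = {..<min k h}" by (intro set_eqI) (simp only: mem_Collect_eq lessThan_iff)
thus ?thesis unfolding A_def[symmetric] h_def[symmetric] by simp
qed

text \<open>A column contains at most |I| entries with variable index in I, and at most as many as
  it has cells. The minimum of the two, summed over all columns, is the sum of the |I| largest
  parts, which m lists first.\<close>

lemma atom_subset_bound:
 assumes b: "length b = length a" "coef(atom a) b ~= 0" and m: "partition m" "mset m = mset a"
 and I: "I <= {..<length a}"
 shows "(SUM p:I. b ! p) <= (SUM p<card I. m ! p)"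
proof -
let ?n = "length a" let ?C = "Suc(sum_list a)"
have lm: "length m = ?n" using m(2) by (metis size_mset)
have cI: "card I <= ?n" using card_mono[OF _ I] by simp
have fI: "finite I" using I finite_subset by blast
obtain S where S: "S : atom_fill a" "fwt a S = b" using b by (auto simp: coef_atom card_gt_0_iff)
have f: "S : fillings a" using S by (simp add: atom_fill_def)
have pos: "0<S x" if "x : skyline a" for x using atom_fill_bound[OF S(1),of "fst x" "snd x"] that by simp
define R where "R c = {r. (r,c) : skyline a & S(r,c)-1 : I}" for c
have finR: "finite(R c)" for c by (rule finite_subset[of _ "{..<?n}"]) (auto simp: R_def skyline_def)
have "(SUM p:I. b ! p) = (SUM j<?n. (if j : I then 1 else 0) * fwt a S ! j)"
using I by (simp add: S(2) if_distrib[of "%x. x * _"] sum.If_cases Int_absorb1 cong: if_cong)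
also have "...=(SUM x:skyline a. if S x-1 : I then 1 else 0)" by (rule sum_fwt[OF f])
also have "...=card {x : skyline a. S x-1 : I}" by (simp add: sum.If_cases Int_def)
also have "{x : skyline a. S x-1 : I} = (%(c,r). (r,c)) ` (SIGMA c:{..<?C}. R c)"
proof -
 have "c<?C" if "(r,c) : skyline a" for r c using that ln_le_sum[of a r] by (auto simp: skyline_def ln_def)
 thus ?thesis by (auto simp: R_def)
qed
also have "card ...=card(SIGMA c:{..<?C}. R c)" by (rule card_image) (auto simp: inj_on_def)
also have "...=(SUM c<?C. card(R c))" using finR by simp
also have "...<=(SUM c<?C. min(card I)(card {r. r<?n & c<a ! r}))"
proof (rule sum_mono)
 fix c
 have "card(R c) <= card {r. r<?n & c<a ! r}" by (rule card_mono) (auto simp: R_def skyline_def)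
 moreover have "card(R c) <= card I"
 proof (rule card_inj_on_le[of "%r. S(r,c)-1"])
  show "inj_on(%r. S(r,c)-1)(R c)"
  proof (rule inj_onI)
   fix r s assume rs: "r : R c" "s : R c" "S(r,c)-1 = S(s,c)-1"
   hence "S(r,c) = S(s,c)" using pos[of "(r,c)"] pos[of "(s,c)"] by (auto simp: R_def)
   thus "r = s" using S(1) rs unfolding atom_fill_def semi_skyline_def R_def by blast
  qed
 qed (use fI in \<open>auto simp: R_def\<close>)
 ultimately show "card(R c) <= min(card I)(card {r. r<?n & c<a ! r})" by simp
qed
also have "...=(SUM c<?C. card {p. p<card I & c<m ! p})"
proof (rule sum.cong)
 fix c
 have "card {r. r<?n & c<a ! r} = length(filter(%x. c<x) a)" by (simp add: length_filter_conv_card)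
 also have "...=length(filter(%x. c<x) m)" using m(2) by (metis mset_filter size_mset)
 also have "...=card {r. r<length m & c<m ! r}" by (simp add: length_filter_conv_card)
 finally show "min(card I)(card {r. r<?n & c<a ! r}) = card {p. p<card I & c<m ! p}"
 using card_column_prefix[OF m(1),of "card I" c] cI lm by simp
qed simp
also have "...=(SUM c<?C. SUM p<card I. if c<m ! p then 1 else 0)"
by (rule sum.cong) (auto simp: sum.If_cases Int_def)
also have "...=(SUM p<card I. SUM c<?C. if c<m ! p then 1 else 0)" by (rule sum.swap)
also have "...=(SUM p<card I. m ! p)"
proof (rule sum.cong)
 fix p assume p: "p : {..<card I}"
 have "m ! p <= sum_list m" using p cI lm by (intro member_le_sum_list) auto
 also have "sum_list m = sum_list a" using m(2) by (metis sum_mset_sum_list)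
 finally have "{..<?C} Int {c. c<m ! p} = {..<m ! p}" by auto
 thus "(SUM c<?C. if c<m ! p then 1 else 0) = m ! p" by (simp add: sum.If_cases del: lessThan_Suc sum.lessThan_Suc)
qed simp
finally show ?thesis .
qed

text \<open>Sorting the basement one swap at a time, \<open>Fk_rsw\<close> never produces a negative
  sign, and the sorted basement gives an atom. The case of interest is the decreasing basement of
  the Schur polynomial.\<close>

lemma Fk_perm_cone:
 assumes "length w = n" "mset w = mset [1..<Suc n]"
 shows "!!a. length a = n ==> Fk n(ln a)(sum_list a) 0(ln w) : cone atom n"
using assms
proof (induction rule: increasing_induct)
case (sorted w a)
have "increasing [1..<Suc n]" by (auto simp: increasing_def simp del: upt_Suc)
hence "w = [1..<Suc n]" using increasing_sort sorted by (metis mset_sort properties_for_sort sorted_sort)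
hence "Fk n(ln a)(sum_list a) 0 Suc = Fk n(ln a)(sum_list a) 0(ln w)"
by (intro Fk_reindex[where h=id]) (auto simp: rows_def ln_def strict_mono_on_def simp del: upt_Suc)
thus ?case using atom_Fk[OF sorted(3) ln_le_sum] cone_base[of a n atom] sorted by simp
next
case (swap w i a)
let ?k = "sum_list a"
let ?v = "swapl i w"
have lw: "ln w = rsw i(ln ?v)" using swap(1,2) by (simp add: ln_swapl)
have "ln ?v i<ln ?v(Suc i)" using swap(1,2,3) by (simp add: ln_def)
hence eq: "Fk n(ln a) ?k 0(ln w) = (if ln a i<ln a(Suc i) then 0 else if ln a i = ln a(Suc i) then Fk n(ln a) ?k 0(ln ?v)
else Fk n(ln a) ?k 0(ln ?v)+Fk n(rsw i(ln a)) ?k 0(ln ?v))"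
unfolding lw by (intro Fk_rsw) (use swap(2) ln_le_sum in auto)
have m: "mset ?v = mset [1..<Suc n]" using swap(1,2,6) by simp
have "Fk n(ln a) ?k 0(ln ?v) : cone atom n" using swap(4)[OF swap(5) m] .
moreover have "Fk n(rsw i(ln a)) ?k 0(ln ?v) : cone atom n"
using swap(4)[OF _ m,of "swapl i a"] swap(2,5) by (simp add: ln_swapl)
ultimately show ?case unfolding eq by (auto intro: cone_zero cone_add)
qed

section \<open>Schur polynomials as fillings over a decreasing basement\<close>

definition tw :: "nat => nat list => (nat \<times> nat => nat) => nat list" where
"tw n lam T = map(%k. card {x:young lam. T x = Suc k}) [0..<n]"

lemma finite_young [simp]: "finite(young lam)"
proof (rule finite_subset)
show "young lam <= (SIGMA r:{..<length lam}. {..<lam ! r})" by (auto simp: young_def)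
qed simp

lemma finite_ssyt [simp]: "finite(ssyt n lam)"
proof (rule finite_subset)
show "ssyt n lam <= {f. ALL x. (x : young lam --> f x : {1..n}) & (x ~: young lam --> f x = 0)}"
by (auto simp: ssyt_def)
show "finite {f. ALL x. (x : young lam --> f x : {1..n}) & (x ~: young lam --> f x = 0)}"
by (rule finite_set_of_finite_funs) auto
qed

lemma young_up: "partition lam ==> (s,c) : young lam ==> r <= s ==> (r,c) : young lam"
using partition_le[of lam r s] by (auto simp: young_def)

lemma ssyt_col:
 assumes p: "partition lam" and T: "T : ssyt n lam" and "(s,c) : young lam" "r<s"
 shows "T(r,c)+(s-r) <= T(s,c)"
using assms(3,4)
proof (induction s)
case (Suc s)
have y: "(s,c) : young lam" using young_up[OF p Suc(2),of s] by simp
have "T(s,c)<T(Suc s,c)" using T Suc(2) by (auto simp: ssyt_def)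
thus ?case using Suc(1)[OF y] Suc(3) by (cases "r = s") auto
qed simp

lemma ssyt_empty:
 assumes p: "partition lam" and "(n,0) : young lam"
 shows "ssyt n lam = {}"
proof (rule ccontr)
assume "ssyt n lam ~= {}"
then obtain T where T: "T : ssyt n lam" by blast
have "T(n,0) <= n" "1 <= T(0,0)" using T assms young_up[OF p assms(2),of 0] by (fastforce simp: ssyt_def)+
thus False using ssyt_col[OF p T assms(2),of 0] by (cases "n = 0") auto
qed

text \<open>Complementing entries to n + 1 - T makes rows weakly and columns strictly decreasing,
  which describes the fillings over the basement n - r. The complement reverses the weight.\<close>

lemma schur_Fk:
 assumes p: "partition lam" and ne: "(n,0) ~: young lam"
 shows "(SUM T:ssyt n lam. xmon(rev(tw n lam T))) = Fk n(ln lam)(sum_list lam) 0(%r. n-r)"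
proof -
let ?a = "ln lam"
have yc: "young lam = cells n ?a 0"
proof -
 have "r<n" if "(r,c) : young lam" for r c
 using ne young_up[OF p that,of n] by (auto simp: young_def intro: ccontr)
 thus ?thesis by (auto simp: young_def cells_def ln_def split: if_splits)
qed
have rows: "r : rows n ?a(Suc c) \<longleftrightarrow> (r,c) : young lam" for r c by (auto simp: yc cells_def rows_def)
define C where "C T x = (if x : young lam then Suc n-T x else 0)" for T :: "nat \<times> nat => nat" and x
have CF: "C T : Fill n ?a 0(%r. n-r)" if T: "T : ssyt n lam" for T
proof -
 have rng: "T x : {1..n}" if "x : young lam" for x using T that by (auto simp: ssyt_def)
 have lt: "C T(s,c)<C T(r,c)" if "r<s" "(s,c) : young lam" for r s c
 using ssyt_col[OF p T that(2,1)] rng[OF that(2)] young_up[OF p that(2),of r] that by (auto simp: C_def)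
 have inj: "inj_on(%r. C T(r,c))(rows n ?a(Suc c))" for c
 by (rule inj_onI) (metis lt rows linorder_neqE_nat less_irrefl)
 have o0: "ok(rows n ?a(Suc 0))(rows n ?a 0)(%r. n-r)(%r. C T(r,0))"
 proof (rule okI)
  fix r assume "r : rows n ?a(Suc 0)"
  hence r: "(r,0) : young lam" by (simp add: rows)
  have "T(0,0)+r <= T(r,0)" "1 <= T(0,0)"
  using ssyt_col[OF p T r,of 0] rng[OF young_up[OF p r,of 0]] by (cases "r = 0"; auto)+
  thus "0<C T(r,0) & C T(r,0) <= n-r" using r rng[OF r] by (auto simp: C_def)
 next
  fix r s assume "r<s" "s : rows n ?a(Suc 0)"
  thus "r : rows n ?a(Suc 0) & C T(s,0)<C T(r,0)" using lt young_up[OF p] by (auto simp: rows)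
 qed (rule inj)
 have oc: "ok(rows n ?a(Suc(Suc c)))(rows n ?a(Suc c))(%r. C T(r,c))(%r. C T(r,Suc c))" for c
 proof (rule okI)
  fix r assume "r : rows n ?a(Suc(Suc c))"
  hence r: "(r,Suc c) : young lam" by (simp add: rows)
  moreover have "(r,c) : young lam" using r by (auto simp: young_def)
  moreover have "T(r,c) <= T(r,Suc c)" using T r by (auto simp: ssyt_def)
  ultimately show "0<C T(r,Suc c) & C T(r,Suc c) <= C T(r,c)" using rng[OF r] by (auto simp: C_def)
 next
  fix r s assume "r<s" "s : rows n ?a(Suc(Suc c))"
  thus "r : rows n ?a(Suc(Suc c)) & C T(s,Suc c)<C T(r,Suc c)" using lt young_up[OF p] by (auto simp: rows)
 qed (rule inj)
 show ?thesis unfolding Fill_def using o0 oc by (simp add: C_def yc)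
qed
have CT: "C S : ssyt n lam & (ALL x:young lam. S x : {1..n})" if S: "S : Fill n ?a 0(%r. n-r)" for S
proof -
 have o0: "ok(rows n ?a(Suc 0))(rows n ?a 0)(%r. n-r)(%r. S(r,0))"
 and oc: "ok(rows n ?a(Suc(Suc c)))(rows n ?a(Suc c))(%r. S(r,c))(%r. S(r,Suc c))" for c
 using S by (auto simp: Fill_def)
 have dec: "S(r,Suc c) <= S(r,c)" if "(r,Suc c) : young lam" for r c using okD(2)[OF oc] that by (simp add: rows)
 have pos: "0<S(r,c)" if "(r,c) : young lam" for r c using okD(1)[OF oc] okD(1)[OF o0] that by (cases c) (simp_all add: rows)
 have bnd: "S(r,c) <= n" if "(r,c) : young lam" for r c
 using that
 proof (induction c)
  case 0 thus ?case using okD(2)[OF o0,of r] by (simp add: rows)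
 next
  case (Suc c)
  hence "(r,c) : young lam" by (auto simp: young_def)
  thus ?case using dec[OF Suc(2)] Suc(1) by simp
 qed
 have col: "S(Suc r,c)<S(r,c)" if "(Suc r,c) : young lam" for r c
 using that
 proof (induction c)
  case 0
  have "r : rows n ?a 0" "Suc r<n" using 0 by (auto simp: yc cells_def rows_def)
  moreover have "S(Suc r,0) <= n-Suc r" using okD(2)[OF o0,of "Suc r"] 0 by (simp add: rows)
  ultimately show ?case using okD(4)[OF o0,of r "Suc r"] 0 by (simp add: rows)
 next
  case (Suc c)
  hence y: "(Suc r,c) : young lam" "(r,c) : young lam" using young_up[OF p,of "Suc r" c r] by (auto simp: young_def)
  hence "S(Suc r,Suc c) <= S(r,c)" using dec[OF Suc(2)] Suc(1)[OF y(1)] by simp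
  thus ?case using okD(4)[OF oc,of r "Suc r" c] Suc(2) y by (simp add: rows)
 qed
 have rng: "ALL x:young lam. S x : {1..n}" using pos bnd by (auto simp: Suc_le_eq)
 have "C S : ssyt n lam"
 unfolding ssyt_def mem_Collect_eq
 proof (intro conjI allI impI ballI)
  fix x assume "x : young lam" thus "C S x : {1..n}" using rng by (force simp: C_def)
 next
  fix i j assume y: "(i,Suc j) : young lam"
  hence "(i,j) : young lam" by (auto simp: young_def)
  thus "C S(i,j) <= C S(i,Suc j)" using y dec[OF y] by (simp add: C_def)
 next
  fix i j assume y: "(Suc i,j) : young lam"
  thus "C S(i,j)<C S(Suc i,j)" using col[OF y] young_up[OF p y,of i] bnd[of i j] by (simp add: C_def)
 qed (simp add: C_def)
 thus ?thesis using rng by blast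
qed
have CC: "C(C S) = S" if "ALL x:young lam. S x : {1..n}" "ALL x. x ~: young lam --> S x = 0" for S
proof
 fix x show "C(C S) x = S x"
 proof (cases "x : young lam")
  case True thus ?thesis using that(1) by (force simp: C_def)
 next
  case False thus ?thesis using that(2) by (cases x) (simp add: C_def)
 qed
qed
have "(SUM T:ssyt n lam. xmon(rev(tw n lam T))) = (SUM S:Fill n ?a 0(%r. n-r). PROD x:cells n ?a 0. xvar(S x-1))"
proof (rule sum.reindex_bij_witness[of _ C C])
 fix T assume T: "T : ssyt n lam"
 have rng: "ALL x:young lam. T x : {1..n}" using T by (auto simp: ssyt_def)
 show "C(C T) = T" using T by (intro CC) (auto simp: ssyt_def)
 show "C T : Fill n ?a 0(%r. n-r)" by (rule CF[OF T])
 have "rev(tw n lam T) = map(%k. card {x : young lam. C T x = Suc k}) [0..<n]"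
 proof (rule nth_equalityI)
  fix k assume "k<length(rev(tw n lam T))"
  hence k: "k<n" by (simp add: tw_def)
  have "T x = Suc(n-Suc k) \<longleftrightarrow> C T x = Suc k" if "x : young lam" for x
  using k that by (fastforce simp: C_def)
  hence "{x : young lam. T x = Suc(n-Suc k)} = {x : young lam. C T x = Suc k}" by blast
  thus "rev(tw n lam T) ! k = map(%k. card {x : young lam. C T x = Suc k}) [0..<n] ! k"
  using k by (simp add: tw_def rev_nth)
 qed (simp add: tw_def)
 moreover have "C T x : {1..n}" if "x : young lam" for x using rng that by (force simp: C_def)
 ultimately have "xmon(rev(tw n lam T)) = (PROD x:young lam. xvar(C T x-1))"
 using xmon_count[of "young lam" "C T" n] by simp
 thus "(PROD x:cells n ?a 0. xvar(C T x-1)) = xmon(rev(tw n lam T))" by (simp add: yc)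
next
 fix S assume S: "S : Fill n ?a 0(%r. n-r)"
 show "C(C S) = S" using S CT[OF S] unfolding Fill_def yc[symmetric] by (intro CC) auto
 show "C S : ssyt n lam" using CT[OF S] by blast
qed
also have "...=Fk n ?a(sum_list lam) 0(%r. n-r)" using Fk_Fill[of n ?a 0 "sum_list lam" "%r. n-r"] ln_le_sum by simp
finally show ?thesis .
qed

lemma schur_alt: "schur n lam = (SUM T:ssyt n lam. xmon(tw n lam T))"
by (simp add: schur_def tw_def)

lemma schur_polys: "schur n lam : polys n"
unfolding schur_alt by (intro polys_sum xmon_polys) (simp add: tw_def)

text \<open>Exchanging two entries of the decreasing basement gives a \<open>good\<close> one, and
  exchanging back exhibits the generating function as an image of pi_i, hence symmetric. Symmetry in
  turn removes the reversal of weights in \<open>schur_Fk\<close>.\<close>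

lemma schur_cone_sym:
 assumes p: "partition lam"
 shows "schur n lam : cone atom n & (ALL i. Suc i<n --> swap_poly i(schur n lam) = schur n lam)"
proof (cases "(n,0) : young lam")
case True
hence "schur n lam = 0" by (simp add: schur_alt ssyt_empty[OF p])
thus ?thesis by (simp add: cone_zero)
next
case False
let ?F = "Fk n(ln lam)(sum_list lam) 0(%r. n-r)"
define a where "a = map(ln lam) [0..<n]"
have yn: "r<n" if "(r,c) : young lam" for r c
using False young_up[OF p that,of n] by (auto simp: young_def intro: ccontr)
have la: "length a = n" "ln a = ln lam"
proof -
 have "ln lam r = 0" if "~ r<n" for r using yn[of r 0] that by (fastforce simp: young_def ln_def)
 moreover have "ln a r = (if r<n then ln lam r else 0)" for r
 by (simp add: a_def ln_def[of "map(ln lam) [0..<n]"])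
 ultimately show "ln a = ln lam" by (intro ext) simp
qed (simp add: a_def)
have kk: "Fk n(ln lam) k 0 u = Fk n(ln lam) k' 0 u" if "!!r. ln lam r <= k" "!!r. ln lam r <= k'" for k k' u
using Fk_Fill[of n "ln lam" 0 k u] Fk_Fill[of n "ln lam" 0 k' u] that by simp
have sym: "swap_poly i ?F = ?F" if i: "Suc i<n" for i
proof -
 let ?u = "%r. n-r"
 have "Fk n(ln lam)(sum_list lam) 0(sv i o(sv i o ?u)) = pidiff i(Fk n(ln lam)(sum_list lam) 0(sv i o ?u))"
 proof (rule Fk_sv)
  show "inj_on(sv i o ?u)(rows n(ln lam) 0)" by (rule inj_on_sv) (auto simp: rows_def inj_on_def)
  show "good(rows n(ln lam) 0) i(sv i o ?u)"
  unfolding good_def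
  proof (intro ballI impI)
   fix s assume s: "s : rows n(ln lam) 0" "(sv i o ?u) s = Suc(Suc i)"
   hence "n-s = Suc i" by (auto simp: swapidx_def split: if_splits)
   thus "EX r:rows n(ln lam) 0. r<s & (sv i o ?u) r = Suc i"
   using i by (intro bexI[of _ "s-1"]) (auto simp: rows_def swapidx_def)
  qed
 qed
 thus ?thesis by simp
qed
have F: "?F = (SUM T:ssyt n lam. xmon(rev(tw n lam T)))" using schur_Fk[OF p False] by simp
have "schur n lam = ?F"
proof (rule polys_coef_eqI[OF schur_polys])
 show "?F : polys n" unfolding F by (intro polys_sum xmon_polys) (simp add: tw_def)
 fix b :: "nat list" assume b: "length b = n"
 have "coef(schur n lam) b = coef ?F(rev b)"
 unfolding F schur_alt coef_sum by (intro sum.cong) (use b in \<open>auto simp: coef_xmon tw_def\<close>)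
 also have "...=coef ?F b" by (rule symmetric_coef_mset) (use sym b in auto)
 finally show "coef(schur n lam) b = coef ?F b" .
qed
moreover have "?F : cone atom n"
proof -
 have "Fk n(ln a)(sum_list a) 0(ln(rev [1..<Suc n])) : cone atom n"
 by (rule Fk_perm_cone) (simp_all add: la del: upt_Suc)
 also have "Fk n(ln a)(sum_list a) 0(ln(rev [1..<Suc n])) = Fk n(ln a)(sum_list a) 0(%r. n-r)"
 by (intro Fk_reindex[where h=id]) (auto simp: ln_def strict_mono_on_def rev_nth simp del: upt_Suc)
 also have "...=?F" using kk[of "sum_list a" "sum_list lam"] ln_le_sum[of a] ln_le_sum[of lam] la by simp
 finally show ?thesis .
qed
ultimately show ?thesis using sym by simp
qed

definition desc :: "nat list => nat => bool" where
"desc u i \<longleftrightarrow> Suc i<length u & u ! Suc i<u ! i"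

lemma rk_desc: "desc u i ==> rk(swapl i u)<rk u"
using rk_swapl[of i u] by (auto simp: desc_def)

lemma LEAST_desc: "desc u i ==> desc u(LEAST i. desc u i)"
by (rule LeastI)

subsection \<open>Atoms times Schur polynomials\<close>

text \<open>The operator \<open>hdiff\<close> along a reduced word of the permutation \<open>u\<close>.\<close>

function hop :: "nat list => mpoly => mpoly" where
"hop u f = (if EX i. desc u i then hop(swapl(LEAST i. desc u i) u)(hdiff(LEAST i. desc u i) f) else f)"
by auto
termination by (relation "measure(%(u,f). rk u)") (auto intro: rk_desc LEAST_desc)

declare hop.simps [simp del]

text \<open>The confluence lemma is applied with the operator \<open>hop u\<close> itself as the
  value. The recursion applies its \<open>hdiff\<close> first, so \<open>D\<close> composes on the
  inside.\<close>

lemma hop_desc: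
 assumes "desc u i"
 shows "hop u f = hop(swapl i u)(hdiff i f)"
proof -
have "hop u = (%f. hop(swapl i u)(hdiff i f))"
proof (rule braid_confluence[where I= "%_. True" and en= "%i u. desc u i" and T=swapl and meas=rk and val=hop
 and D= "%i V f. V(hdiff i f)"])
 fix s :: "nat list" and i assume "desc s i"
 thus "EX j. desc s j & hop s = (%f. hop(swapl j s)(hdiff j f))"
 by (intro exI[of _ "LEAST i. desc s i"]) (auto simp: hop.simps[of s] fun_eq_iff intro: LEAST_desc)
next
 fix s :: "nat list" and i j assume "desc s i" "desc s j" "Suc i<j"
 thus "desc(swapl i s) j & desc(swapl j s) i & swapl i(swapl j s) = swapl j(swapl i s)"
 using swapl_commute[of i j s] by (auto simp: desc_def nth_swapl swapidx_def)
next
 fix s :: "nat list" and i assume "desc s i" "desc s(Suc i)"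
 thus "desc(swapl i s)(Suc i) & desc(swapl(Suc i)(swapl i s)) i & desc(swapl(Suc i) s) i &
 desc(swapl i(swapl(Suc i) s))(Suc i) &
 swapl i(swapl(Suc i)(swapl i s)) = swapl(Suc i)(swapl i(swapl(Suc i) s))"
 using swapl_braid[of i s] by (auto simp: desc_def nth_swapl swapidx_def)
next
 fix i j :: nat and v :: "mpoly => mpoly" assume "Suc i<j"
 thus "(%f. v(hdiff j(hdiff i f))) = (%f. v(hdiff i(hdiff j f)))" by (simp add: hdiff_commute[of i j])
next
 fix i :: nat and v :: "mpoly => mpoly"
 show "(%f. v(hdiff i(hdiff(Suc i)(hdiff i f)))) = (%f. v(hdiff(Suc i)(hdiff i(hdiff(Suc i) f))))"
 by (simp only: hdiff_braid)
qed (use assms in \<open>auto simp: rk_desc\<close>)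
thus ?thesis by (rule fun_cong)
qed

lemma hop_no_desc: "~ (EX i. desc u i) ==> hop u f = f"
by (subst hop.simps) (simp only: if_False)

lemma hop_add [simp]: "hop u(f+g) = hop u f+hop u g"
proof (induction "rk u" arbitrary: u f g rule: less_induct)
case less
show ?case
proof (cases "EX i. desc u i")
 case True
 then obtain i where i: "desc u i" by blast
 show ?thesis using less(1)[OF rk_desc[OF i]] by (simp add: hop_desc[OF i])
next
 case False
 thus ?thesis by (simp add: hop_no_desc)
qed
qed

lemma hop_zero [simp]: "hop u 0 = 0"
using hop_add[of u 0 0] by simp

text \<open>If the word gets longer, pi_j = 1 + \<open>hdiff j\<close> splits it in two; otherwise
  the word can be arranged to apply \<open>hdiff j\<close> first, which annihilates the image of
  pi_j.\<close>

lemma hop_pidiff: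
 assumes "Suc j<length u" "distinct u"
 shows "hop u(pidiff j f) = (if u ! j<u ! Suc j then hop u f+hop(swapl j u) f else 0)"
proof (cases "u ! j<u ! Suc j")
case True
hence "desc(swapl j u) j" using assms by (simp add: desc_def)
hence "hop(swapl j u) f = hop u(hdiff j f)" using hop_desc[of "swapl j u" j f] assms by simp
thus ?thesis using True by (simp add: pidiff_alt)
next
case False
moreover have "u ! j ~= u ! Suc j" using assms by (simp add: nth_eq_iff_index_eq)
ultimately have "desc u j" using assms by (simp add: desc_def)
hence "hop u(pidiff j f) = hop(swapl j u)(hdiff j(pidiff j f))" by (rule hop_desc)
also have "hdiff j(pidiff j f) = 0" by (rule hdiff_sym_zero) simp
finally show ?thesis using False by simp
qed

lemma distinct_swapl: "Suc i<length u ==> distinct(swapl i u) \<longleftrightarrow> distinct u"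
by (metis mset_eq_imp_distinct_iff mset_swapl)

lemma hop_word:
 assumes "length u = n" "distinct u" "!!j. j : set js ==> Suc j<n"
 shows "EX us. (ALL v:set us. length v = n & distinct v) & hop u(foldr pidiff js f) = (SUM v<-us. hop v f)"
using assms
proof (induction js arbitrary: u)
case Nil
thus ?case by (intro exI[of _ "[u]"]) simp
next
case (Cons j js)
have j: "Suc j<n" using Cons(4) by simp
have e: "hop u(foldr pidiff(j # js) f) = (if u ! j<u ! Suc j then hop u(foldr pidiff js f)+hop(swapl j u)(foldr pidiff js f) else 0)"
using hop_pidiff[of j u] Cons by simp
show ?case
proof (cases "u ! j<u ! Suc j")
 case True
 obtain us where us: "ALL v:set us. length v = n & distinct v" "hop u(foldr pidiff js f) = (SUM v<-us. hop v f)"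
 using Cons(1)[OF Cons(2,3)] Cons(4) by auto
 obtain vs where vs: "ALL v:set vs. length v = n & distinct v" "hop(swapl j u)(foldr pidiff js f) = (SUM v<-vs. hop v f)"
 using Cons(1)[of "swapl j u"] Cons(2,3,4) by (auto simp: distinct_swapl)
 show ?thesis using us vs True by (intro exI[of _ "us @ vs"]) (auto simp: e simp del: foldr.simps)
next
 case False
 thus ?thesis by (intro exI[of _ "[]"]) (simp add: e del: foldr.simps)
qed
qed

text \<open>Since b weakly decreases along every inversion of u, each \<open>hdiff\<close> meets a
  weak descent and the negative case of \<open>hdiff_atom\<close> never arises; swapping both lists
  preserves the condition.\<close>

lemma hop_atom:
 assumes "length b = length u" "!!p q. p<q ==> q<length u ==> u ! q<u ! p ==> b ! q <= b ! p"
 shows "hop u(atom b) = 0 | (EX d. mset d = mset b & hop u(atom b) = atom d)"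
using assms
proof (induction "rk u" arbitrary: u b rule: less_induct)
case less
show ?case
proof (cases "EX i. desc u i")
 case True
 then obtain i where i: "desc u i" by blast
 hence il: "Suc i<length u" and ui: "u ! Suc i<u ! i" by (auto simp: desc_def)
 have e: "hop u(atom b) = hop(swapl i u)(hdiff i(atom b))" by (rule hop_desc[OF i])
 have bi: "b ! Suc i <= b ! i" using less(3)[of i "Suc i"] il ui by simp
 show ?thesis
 proof (cases "b ! i = b ! Suc i")
  case True
  thus ?thesis unfolding e using hdiff_atom[of i b] il less(2) by simp
 next
  case False
  hence h: "hdiff i(atom b) = atom(swapl i b)" using hdiff_atom[of i b] il less(2) bi by simp
  have "hop(swapl i u)(atom(swapl i b)) = 0 | (EX d. mset d = mset(swapl i b) & hop(swapl i u)(atom(swapl i b)) = atom d)"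
  proof (rule less(1)[OF rk_desc[OF i]])
   fix p q assume pq: "p<q" "q<length(swapl i u)" "swapl i u ! q<swapl i u ! p"
   hence l: "p<length u" "q<length u" by auto
   have "~ (p = i & q = Suc i)" using pq(3) il ui by auto
   hence lt: "swapidx i p<swapidx i q" using rsw_less[OF pq(1)] by blast
   have "swapidx i q<length u" using l il by (auto simp: swapidx_def)
   thus "swapl i b ! q <= swapl i b ! p"
   using less(3)[OF lt] pq(3) l il less(2) by (simp add: nth_swapl)
  qed (use less in simp)
  thus ?thesis unfolding e h using il less(2) by simp
 qed
next
 case False
 thus ?thesis by (auto simp: hop_no_desc)
qed
qed

section \<open>Multiplying an atom by x_1 ... x_k\<close>

definition addK :: "nat list => nat set => nat list" where
"addK a K = map(%k. a ! k+(if k : K then 1 else 0)) [0..<length a]"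

lemma length_addK [simp]: "length(addK a K) = length a" by (simp add: addK_def)

lemma nth_addK: "k<length a ==> addK a K ! k = a ! k+(if k : K then 1 else 0)" by (simp add: addK_def)

lemma xset_mult_xmon: "K <= {..<length a} ==> xset K * xmon a = xmon(addK a K)"
proof -
assume K: "K <= {..<length a}"
have "xset K * xmon a = xmon(map2(+)(map(%k. if k : K then 1 else 0) [0..<length a]) a)"
unfolding xset_xmon[OF K] by (rule xmon_mult) simp
also have "map2(+)(map(%k. if k : K then 1 else 0) [0..<length a]) a = addK a K"
by (rule nth_equalityI) (auto simp: addK_def)
finally show ?thesis .
qed

lemma swapl_addK: "Suc i<length a ==> addK(swapl i a)(swapidx i ` K) = swapl i(addK a K)"
by (rule nth_equalityI) (auto simp: swapidx_def nth_addK nth_swapl)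

lemma xset_hdiff:
 assumes "finite K" "i : K" "Suc i ~: K"
 shows "xset K * hdiff i g = pidiff i(xset(swapidx i ` K) * g)"
proof -
note S=xset_single_split[OF assms]
have "xset K * hdiff i g = xset(K-{i}) * pidiff i(xvar(Suc i) * g)"
unfolding S(1) xvar_hdiff[symmetric] by (simp)
also have "...=pidiff i(xset(K-{i}) * (xvar(Suc i) * g))" by (rule pidiff_mult_sym[OF S(3),symmetric])
also have "xset(K-{i}) * (xvar(Suc i) * g) = xset(swapidx i ` K) * g"
using S(2) swap_xset[OF assms(1),of i] by (simp)
finally show ?thesis .
qed

lemma atom_unswap:
 assumes "Suc i<length a" "a ! i<a ! Suc i"
 shows "atom a = hdiff i(atom(swapl i a))"
using hdiff_atom[of i "swapl i a"] assms by simp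

text \<open>Each \<open>hdiff\<close> in the word that builds the atom from a partition monomial
  becomes a \<open>pidiff\<close> while K is carried along. The condition on ascents allows this
  trade at every step; the one on equal parts makes the exponent left at the end a
  partition.\<close>

lemma xset_atom_word:
 assumes "length a = n" "K <= {..<n}"
"!!p q. p<q ==> q<n ==> a ! p<a ! q ==> p : K & q ~: K"
"!!p q. p<q ==> q<n ==> a ! p = a ! q ==> q : K ==> p : K"
 shows "EX js m. (ALL j:set js. Suc j<n) & partition m & length m = n & mset m = mset(addK a K) &
xset K * atom a = foldr pidiff js(xmon m)"
using assms
proof (induction arbitrary: K rule: partition_induct)
case (sorted a)
have "partition(addK a K)"
unfolding partition_def
proof (intro allI impI)
 fix i assume "Suc i<length(addK a K)"
 hence i: "Suc i<n" using sorted by simp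
 have "a ! Suc i <= a ! i" using sorted i by (simp add: partition_def)
 thus "addK a K ! Suc i <= addK a K ! i"
 using sorted(5)[of i "Suc i"] i sorted(1) by (cases "a ! i = a ! Suc i") (auto simp: nth_addK)
qed
thus ?case using sorted xset_mult_xmon[of K a]
by (intro exI[of _ "[]"] exI[of _ "addK a K"]) (simp add: atom_partition)
next
case (swap a i)
have i: "i : K" "Suc i ~: K" using swap(6)[of i "Suc i"] swap(2,3) by auto
have fK: "finite K" using swap(5) finite_subset by blast
let ?K = "swapidx i ` K" let ?a = "swapl i a"
have mem: "k : ?K \<longleftrightarrow> swapidx i k : K" for k by (metis image_iff swapidx_swapidx)
have e: "xset K * atom a = pidiff i(xset ?K * atom ?a)"
unfolding atom_unswap[of i a,unfolded swap(1),OF swap(2,3)] by (rule xset_hdiff[OF fK i])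
have nth: "swapidx i k<n" "?a ! k = a ! swapidx i k" if "k<n" for k
using that swap(1,2) by (auto simp: nth_swapl swapidx_def)
have neq: "~ (p = i & q = Suc i)" if "?a ! p <= ?a ! q" for p q using that swap(1,2,3) by auto
obtain js m where jm: "ALL j:set js. Suc j<n" "partition m" "length m = n" "mset m = mset(addK ?a ?K)"
"xset ?K * atom ?a = foldr pidiff js(xmon m)"
proof -
 have "EX js m. (ALL j:set js. Suc j<n) & partition m & length m = n & mset m = mset(addK ?a ?K) &
 xset ?K * atom ?a = foldr pidiff js(xmon m)"
 proof (rule swap(4))
  show "?K <= {..<n}" using swap(2,5) by (auto simp: swapidx_def)
  fix p q assume pq: "p<q" "q<n" "?a ! p<?a ! q"
  hence "swapidx i p<swapidx i q" using rsw_less[of p q i] neq[of p q] by auto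
  thus "p : ?K & q ~: ?K" using swap(6)[of "swapidx i p" "swapidx i q"] pq nth[of p] nth[of q] mem by auto
 next
  fix p q assume pq: "p<q" "q<n" "?a ! p = ?a ! q" "q : ?K"
  hence "swapidx i p<swapidx i q" using rsw_less[of p q i] neq[of p q] by auto
  thus "p : ?K" using swap(7)[of "swapidx i p" "swapidx i q"] pq nth[of p] nth[of q] mem by auto
 qed
 thus ?thesis using that by blast
qed
have "mset(addK ?a ?K) = mset(addK a K)" using swap(1,2) by (simp add: swapl_addK)
thus ?case using jm swap(2) by (intro exI[of _ "i # js"] exI[of _ m]) (auto simp: e)
qed

lemma block_decreasing: "p <= q ==> (!!i. p <= i ==> i<q ==> b ! Suc i <= (b ! i :: nat)) ==> b ! q <= b ! p"
proof (induction q)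
case (Suc q)
thus ?case
proof (cases "p = Suc q")
 case False
 hence pq: "p <= q" using Suc(2) by simp
 have "b ! q <= b ! p" by (rule Suc(1)[OF pq]) (use Suc(3) in auto)
 moreover have "b ! Suc q <= b ! q" using Suc(3)[of q] pq by simp
 ultimately show ?thesis by simp
qed simp
qed simp

lemma xset_atom_blocks:
 assumes "length u = n" "distinct u" "length b = n" "k <= n"
"!!p q. p<q ==> q<n ==> u ! q<u ! p ==> b ! q<b ! p"
 shows "EX u' b'. length u' = n & distinct u' & length b' = n & mset(addK b' {..<k}) = mset(addK b {..<k}) &
hop u(xset {..<k} * atom b) = hop u'(xset {..<k} * atom b') &
(ALL p q. p<q --> q<n --> b' ! p<b' ! q --> p<k & k <= q)"
using assms
proof (induction "n * sum_list b-rk b" arbitrary: u b rule: less_induct)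
case less
show ?case
proof (cases "EX i. Suc i<n & Suc i ~= k & b ! i<b ! Suc i")
 case True
 then obtain i where i: "Suc i<n" "Suc i ~= k" "b ! i<b ! Suc i" by blast
 have "u ! i ~= u ! Suc i" using less(2,3) i(1) by (simp add: nth_eq_iff_index_eq)
 moreover have "~ u ! Suc i<u ! i"
 using less(6)[OF lessI i(1)] i(1) i(3) by auto
 ultimately have ui: "u ! i<u ! Suc i" by linarith
 let ?u = "swapl i u" let ?b = "swapl i b"
 have sym: "swap_poly i(xset {..<k}) = xset {..<k}" using i by (intro swap_xset_same) auto
 have "hop u(xset {..<k} * atom b) = hop u(hdiff i(xset {..<k} * atom ?b))"
 using atom_unswap[of i b] i less(4) hdiff_mult_sym[OF sym] by simp
 also have "...=hop ?u(xset {..<k} * atom ?b)"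
 using hop_desc[of ?u i] i ui less(2) by (simp add: desc_def)
 finally have e: "hop u(xset {..<k} * atom b) = hop ?u(xset {..<k} * atom ?b)" .
 have "swapidx i ` {..<k} = {..<k}" using i by (intro swapidx_image_same) auto
 hence m: "mset(addK ?b {..<k}) = mset(addK b {..<k})" using swapl_addK[of i b "{..<k}"] i less(4) by simp
 have "rk b<rk ?b" using rk_swapl[of i b] i less(4) by simp
 hence r: "n * sum_list ?b-rk ?b<n * sum_list b-rk b" using rk_le[of ?b] i less(4) by simp
 have inv: "?b ! q<?b ! p" if pq: "p<q" "q<n" "?u ! q<?u ! p" for p q
 using i rsw_less[OF pq(1)] pq less by (cases "p = i & q = Suc i") (auto simp: swapidx_def nth_swapl)
 have "EX u' b'. length u' = n & distinct u' & length b' = n & mset(addK b' {..<k}) = mset(addK ?b {..<k}) &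
 hop ?u(xset {..<k} * atom ?b) = hop u'(xset {..<k} * atom b') &
 (ALL p q. p<q --> q<n --> b' ! p<b' ! q --> p<k & k <= q)"
 using less(1)[OF r] inv less(2-5) i(1) by (auto simp: distinct_swapl)
 thus ?thesis unfolding m e .
next
 case False
 have "p<k & k <= q" if pq: "p<q" "q<n" "b ! p<b ! q" for p q
 proof (rule ccontr)
  assume nb: "~ (p<k & k <= q)"
  have "b ! q <= b ! p"
  proof (rule block_decreasing)
   fix i assume i: "p <= i" "i<q"
   hence "Suc i<n" "Suc i ~= k" using pq nb by auto
   thus "b ! Suc i <= b ! i" using False by (meson not_less)
  qed (use pq in simp)
  thus False using pq by simp
 qed
 thus ?thesis using less(2-5) by (intro exI[of _ u] exI[of _ b] conjI allI impI) simp_all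
qed
qed

text \<open>The pulled-out \<open>hdiff\<close> word meets the \<open>pidiff\<close> word of
  \<open>xset_atom_word\<close>; by \<open>hop_word\<close> their composite is a sum of
  \<open>hdiff\<close> words, and on a partition monomial each of these gives one atom or 0.\<close>

lemma xset_atom:
 assumes a: "length a = n" and k: "k <= n"
 shows "EX ds. (ALL d:set ds. length d = n & mset d = mset(addK a {..<k})) & xset {..<k} * atom a = (SUM d<-ds. atom d)"
proof -
let ?X = "xset {..<k}"
have "hop [0..<n] f = f" for f
by (rule hop_no_desc) (auto simp: desc_def)
then obtain u b where ub: "length u = n" "distinct u" "length b = n" "mset(addK b {..<k}) = mset(addK a {..<k})"
"?X * atom a = hop u(?X * atom b)" "!!p q. p<q ==> q<n ==> b ! p<b ! q ==> p<k & k <= q"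
using xset_atom_blocks[of "[0..<n]" n a k] a k by auto
have "EX js m. (ALL j:set js. Suc j<n) & partition m & length m = n & mset m = mset(addK b {..<k}) &
?X * atom b = foldr pidiff js(xmon m)"
proof (rule xset_atom_word)
 fix p q assume "p<q" "q<n" "b ! p<b ! q"
 thus "p : {..<k} & q ~: {..<k}" using ub(6)[of p q] by simp
qed (use ub k in auto)
then obtain js m where jm: "ALL j:set js. Suc j<n" "partition m" "length m = n" "mset m = mset(addK b {..<k})"
"?X * atom b = foldr pidiff js(xmon m)" by blast
obtain us where us: "ALL v:set us. length v = n & distinct v" "hop u(foldr pidiff js(xmon m)) = (SUM v<-us. hop v(xmon m))"
using hop_word[OF ub(1,2),of js "xmon m"] jm(1) by blast
have each: "hop v(xmon m) = 0 | (EX d. mset d = mset m & hop v(xmon m) = atom d)" if "v : set us" for v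
proof -
 have "hop v(atom m) = 0 | (EX d. mset d = mset m & hop v(atom m) = atom d)"
 using us(1) that jm(2,3) partition_le[OF jm(2)] by (intro hop_atom) auto
 thus ?thesis by (simp add: atom_partition[OF jm(2)])
qed
have "EX ds. (ALL d:set ds. mset d = mset m) & (SUM v<-us. hop v(xmon m)) = (SUM d<-ds. atom d)"
using each
proof (induction us)
 case (Cons v us)
 then obtain ds where ds: "ALL d:set ds. mset d = mset m" "(SUM v<-us. hop v(xmon m)) = (SUM d<-ds. atom d)" by auto
 show ?case
 proof (cases "hop v(xmon m) = 0")
  case True thus ?thesis using ds by auto
 next
  case False
  then obtain d where "mset d = mset m" "hop v(xmon m) = atom d" using Cons(2)[of v] by auto
  thus ?thesis using ds by (intro exI[of _ "d # ds"]) simp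
 qed
qed (intro exI[of _ "[]"],simp)
then obtain ds where ds: "ALL d:set ds. mset d = mset m" "(SUM v<-us. hop v(xmon m)) = (SUM d<-ds. atom d)" by blast
have "length d = n" if "mset d = mset m" for d using that jm(3) by (metis size_mset)
thus ?thesis using ds us jm ub by (intro exI[of _ ds]) auto
qed

lemma xset_cone:
 assumes "f : cone atom n" "k <= n"
 shows "xset {..<k} * f : cone atom n"
proof (rule cone_linear[OF assms(1),where T= "%f. xset {..<k} * f"])
fix b :: "nat list" assume "length b = n"
then obtain ds where "ALL d:set ds. length d = n & mset d = mset(addK b {..<k})" "xset {..<k} * atom b = (SUM d<-ds. atom d)"
using xset_atom[OF _ assms(2)] by blast
thus "xset {..<k} * atom b : cone atom n" by (auto intro: cone_sum_list cone_base)
qed (simp add: distrib_left)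

text \<open>Column by column, a partition monomial is a product of monomials x_1...x_k, to which
  \<open>xset_cone\<close> applies.\<close>

lemma xmon_partition_cone:
 assumes "partition m" "length m = n" "f : cone atom n"
 shows "xmon m * f : cone atom n"
using assms(1,2)
proof (induction "sum_list m" arbitrary: m rule: less_induct)
case less
define K where "K = {k. k<n & 0<m ! k}"
show ?case
proof (cases "K = {}")
 case True
 hence "xmon m = 1" using less(3) by (auto simp: K_def xmon_prod)
 thus ?thesis using assms(3) by simp
next
 case False
 define m' where "m' = map(%x. x-1) m"
 have "{p. p<n & 0<m ! p} = {..<card K}"
 proof -
  have "p : K \<longleftrightarrow> p<card K" for p
  using card_column_prefix[OF less(2),of "min(Suc p) n" 0] card_column_prefix[OF less(2),of "min p n" 0] less(3)
  proof -
   have dn: "q : K" if "p : K" "q <= p" for p q using that partition_le[OF less(2),of q p] less(3) by (auto simp: K_def)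
   have fK: "finite K" by (simp add: K_def)
   show ?thesis
   using dn card_mono[OF fK,of "{..p}"] card_mono[of "{..<p}" K] by force
  qed
  thus ?thesis unfolding K_def by blast
 qed
 hence Kc: "K = {..<card K}" unfolding K_def .
 have kn: "card K <= n" using card_mono[of "{..<n}" K] by (auto simp: K_def)
 have "m = addK m' K" using less(3) by (intro nth_equalityI) (auto simp: m'_def addK_def K_def)
 moreover have "xset K * xmon m' = xmon(addK m' K)" by (rule xset_mult_xmon) (use less(3) in \<open>auto simp: m'_def K_def\<close>)
 ultimately have e: "xmon m = xset K * xmon m'" by metis
 have "partition m'" using less(2) by (auto simp: partition_def m'_def)
 moreover have "sum_list m'<sum_list m"
 proof -
  obtain k where k: "k<n" "0<m ! k" using False by (auto simp: K_def)
  have "(SUM r<n. m' ! r)<(SUM r<n. m ! r)" using k less(3)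
  by (intro sum_strict_mono_ex1 bexI[of _ k]) (auto simp: m'_def)
  thus ?thesis using less(3) by (simp add: sum_list_lessThan m'_def)
 qed
 ultimately have "xmon m' * f : cone atom n" using less(1)[of m'] less(3) by (simp add: m'_def)
 hence "xset {..<card K} * (xmon m' * f) : cone atom n" by (rule xset_cone[OF _ kn])
 thus ?thesis using e Kc by (metis mult.assoc)
qed
qed

section \<open>Atom coefficients and the adjunction at constant compositions\<close>

abbreviation "ac == dualc atom"

lemmas ac_delta=dualc_delta[OF triangular_atom]

lemma hdiff_polys: "Suc i<n ==> f : polys n ==> hdiff i f : polys n"
unfolding polys_zspan[OF triangular_atom]
by (rule zspan_linear[where g=atom and n=n and T= "hdiff i"]) (auto simp: hdiff_atom intro: zspan_base zspan_zero zspan_uminus)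

lemma pidiff_polys: "Suc i<n ==> f : polys n ==> pidiff i f : polys n"
unfolding pidiff_alt by (intro polys_add hdiff_polys)

lemma swap_polys: "Suc i<n ==> f : polys n ==> swap_poly i f : polys n"
unfolding polys_zspan_xmon
by (rule zspan_linear[where g=xmon and n=n and T= "swap_poly i"]) (auto simp: swap_xmon intro: zspan_base)

lemma pidiff_cone: "Suc i<n ==> f : cone atom n ==> pidiff i f : cone atom n"
by (rule cone_linear[where g=atom and n=n and T= "pidiff i"]) (auto simp: pidiff_atom intro!: cone_base cone_zero cone_add)

lemma cone_polys: "f : cone atom n ==> f : polys n"
using cone_zspan polys_zspan[OF triangular_atom] by blast

text \<open>Read off from \<open>pidiff_atom\<close>: for b_i \<le> b_{i+1} the atom of b appears in
  pi_i of an atom only if the latter has index s_i b.\<close>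

lemma ac_pidiff:
 assumes i: "Suc i<n" and b: "length b = n" "b ! i <= b ! Suc i" and f: "f : polys n"
 shows "ac b(pidiff i f) = ac(swapl i b) f"
proof -
have atom: "ac b(pidiff i(atom a)) = ac(swapl i b)(atom a)" if a: "length a = n" for a
proof -
 have ia: "Suc i<length a" "Suc i<length b" using a b i by simp_all
 have sw: "swapl i a = b \<longleftrightarrow> a = swapl i b" using swapl_swapl[OF ia(1)] swapl_swapl[OF ia(2)] by auto
 consider "a ! i<a ! Suc i" | "a ! i = a ! Suc i" | "a ! Suc i<a ! i" by linarith
 thus ?thesis
 proof cases
  case 1
  hence "a ~= swapl i b" using b ia by auto
  thus ?thesis using 1 a b ia by (simp add: pidiff_atom ac_delta)
 next
  case 2
  hence "a = b \<longleftrightarrow> a = swapl i b" using sw swapl_eq[OF ia(1) 2] by simp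
  thus ?thesis using 2 a b ia by (simp add: pidiff_atom ac_delta)
 next
  case 3
  hence "a ~= b" using b by auto
  thus ?thesis using 3 a b ia sw by (simp add: pidiff_atom ac_delta)
 qed
qed
have "f : zspan atom n" using f polys_zspan[OF triangular_atom] by blast
thus ?thesis by induction(auto simp: atom)
qed

lemma cone_coef_ge:
 assumes "f : cone atom n" "length b = n"
 shows "coef f b >= ac b f"
using assms(1)
proof induction
case (cone_step f a)
have "coef(atom a) b >= ac b(atom a)"
using triangular_atom[of n] assms(2) cone_step(2) coef_atom_nonneg[of b a] by (auto simp: triangular_def ac_delta[of a n b])
thus ?case using cone_step by simp
qed simp

lemma coef_xmon_mult:
 assumes "g : polys n" "length m = n" "length e = n"
 shows "coef(xmon m * g) e = (if ALL p<n. m ! p <= e ! p then coef g(map2(-) e m) else 0)"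
proof -
have base: "coef(xmon m * xmon a) e = (if ALL p<n. m ! p <= e ! p then coef(xmon a)(map2(-) e m) else 0)" if a: "length a = n" for a
proof -
 have "map2(+) m a = e \<longleftrightarrow> (ALL p<n. m ! p <= e ! p) & a = map2(-) e m"
 proof
  assume e: "map2(+) m a = e"
  have nth: "e ! p = m ! p+a ! p" if "p<n" for p using that a assms(2) by (simp add: e[symmetric])
  have "a = map2(-) e m" using nth a assms by (intro nth_equalityI) simp_all
  thus "(ALL p<n. m ! p <= e ! p) & a = map2(-) e m" using nth by simp
 next
  assume r: "(ALL p<n. m ! p <= e ! p) & a = map2(-) e m"
  show "map2(+) m a = e" using r assms by (intro nth_equalityI) simp_all
 qed
 thus ?thesis using a assms by (auto simp: xmon_mult coef_xmon)
qed
have "g : zspan xmon n" using assms(1) polys_zspan_xmon by blast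
thus ?thesis by induction(auto simp: base distrib_left right_diff_distrib)
qed

lemma atom_prefix:
 assumes b: "length b = length a" "coef(atom a) b ~= 0" and i: "i <= length a"
 shows "(SUM p<i. a ! p) <= (SUM p<i. b ! p)"
proof -
let ?n = "length a" let ?g = "%j. if j<i then 1 else(0::nat)"
obtain S where S: "S : atom_fill a" "fwt a S = b" using b by (auto simp: coef_atom card_gt_0_iff)
have f: "S : fillings a" using S by (simp add: atom_fill_def)
have pre: "(SUM p<i. c ! p) = (SUM j<?n. ?g j * c ! j)" for c :: "nat list"
proof -
 have "{..<?n} Int {j. j<i} = {..<i}" using i by auto
 thus ?thesis by (simp add: if_distrib[of "%x. x * _"] sum.If_cases cong: if_cong)
qed
have "(SUM p<i. a ! p) = (SUM x:skyline a. ?g(fst x))" unfolding pre by (rule skyline_sum[symmetric])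
also have "...<=(SUM x:skyline a. ?g(S x-1))"
proof (rule sum_mono)
 fix x assume "x : skyline a"
 hence "S x <= Suc(fst x)" using atom_fill_bound[OF S(1),of "fst x" "snd x"] by simp
 thus "?g(fst x) <= ?g(S x-1)" by auto
qed
also have "...=(SUM p<i. b ! p)" unfolding pre S(2)[symmetric] by (rule sum_fwt[OF f,symmetric])
finally show ?thesis .
qed

lemma ac_const_hdiff:
 assumes i: "Suc i<n" and f: "f : polys n"
 shows "ac(replicate n M)(hdiff i f) = 0"
proof -
have "swapl i(replicate n M) = replicate n M" using i by (intro swapl_eq) auto
hence "ac(replicate n M)(pidiff i f) = ac(replicate n M) f" using ac_pidiff[OF i _ _ f,of "replicate n M"] i by simp
thus ?thesis by (simp add: hdiff_alt)
qed

text \<open>The two products differ by an \<open>hdiff\<close>, by the Leibniz rule applied to the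
  swapped f, and the coefficient at a constant composition vanishes on images of
  \<open>hdiff\<close>.\<close>

lemma ac_const_adjoint:
 assumes i: "Suc i<n" and f: "f : polys n" "g : polys n"
 shows "ac(replicate n M)(f * hdiff i g) = ac(replicate n M)(hdiff i f * g)"
proof -
let ?F = "swap_poly i f"
have "ddiff i ?F =-ddiff i f"
by (rule ddiff_unique) (simp only: mult_minus_right ddiff_eq swap_swap minus_diff_eq)
hence "hdiff i(?F * g) = f * hdiff i g-hdiff i f * g"
unfolding hdiff_def ddiff_mult[of i ?F g] by (simp add: algebra_simps)
moreover have "ac(replicate n M)(hdiff i(?F * g)) = 0"
by (rule ac_const_hdiff[OF i]) (intro polys_mult swap_polys i f)
ultimately show ?thesis by simp
qed

lemma atom_polys: "length a = n ==> atom a : polys n"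
using triangular_atom[of n] by (auto simp: triangular_def)

text \<open>Each \<open>hdiff\<close> that builds \<open>atom d\<close> is moved onto
  \<open>atom c\<close>, so that both lists are permuted alike until d is a partition. The
  hypothesis makes c weakly decrease where d ascends, so no negative sign arises; equal parts of c
  give 0.\<close>

lemma pairing_sort:
 assumes "length d = n" "length c = n" "!!p q. p<q ==> q<n ==> c ! p<c ! q ==> d ! q<d ! p"
 shows "ac(replicate n M)(atom c * atom d) = 0 |
(EX f. bij_betw f {..<n} {..<n} & partition(map(%p. d ! f p) [0..<n]) &
ac(replicate n M)(atom c * atom d) = ac(replicate n M)(atom(map(%p. c ! f p) [0..<n]) * atom(map(%p. d ! f p) [0..<n])))"
using assms
proof (induction arbitrary: c rule: partition_induct)
case (sorted d)
have "map(%p. d ! p) [0..<n] = d" "map(%p. c ! p) [0..<n] = c" using sorted(1,3) map_nth[of d] map_nth[of c] by simp_all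
thus ?case using sorted(2) by (intro disjI2 exI[of _ "%p. p"]) (simp add: bij_betw_def)
next
case (swap d i)
let ?d = "swapl i d" let ?c = "swapl i c"
have ci: "c ! Suc i <= c ! i" using swap(6)[of i "Suc i"] swap(2,3) by force
have "ac(replicate n M)(atom c * atom d) = ac(replicate n M)(atom c * hdiff i(atom ?d))"
using atom_unswap[of i d] swap(1,2,3) by simp
also have "...=ac(replicate n M)(hdiff i(atom c) * atom ?d)"
by (rule ac_const_adjoint) (use swap in \<open>auto intro: atom_polys\<close>)
finally have e: "ac(replicate n M)(atom c * atom d) = ac(replicate n M)(hdiff i(atom c) * atom ?d)" .
show ?case
proof (cases "c ! i = c ! Suc i")
 case True
 thus ?thesis unfolding e using hdiff_atom[of i c] swap by simp
next
 case False
 hence h: "hdiff i(atom c) = atom ?c" using hdiff_atom[of i c] swap(2,5) ci by simp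
 have "ac(replicate n M)(atom ?c * atom ?d) = 0 |
 (EX f. bij_betw f {..<n} {..<n} & partition(map(%p. ?d ! f p) [0..<n]) &
 ac(replicate n M)(atom ?c * atom ?d) = ac(replicate n M)(atom(map(%p. ?c ! f p) [0..<n]) * atom(map(%p. ?d ! f p) [0..<n])))"
 proof (rule swap(4))
  fix p q assume pq: "p<q" "q<n" "?c ! p<?c ! q"
  show "?d ! q<?d ! p"
  proof (cases "p = i & q = Suc i")
   case True thus ?thesis using swap(1,2,3) by simp
  next
   case False
   hence lt: "swapidx i p<swapidx i q" using rsw_less[OF pq(1)] by blast
   have "swapidx i q<n" using pq swap(2) by (auto simp: swapidx_def)
   thus ?thesis using swap(6)[OF lt] pq swap(1,2,5) by (simp add: nth_swapl)
  qed
 qed (use swap in simp)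
 thus ?thesis
 proof
  assume "ac(replicate n M)(atom ?c * atom ?d) = 0"
  thus ?thesis by (simp add: e h)
 next
  assume "EX f. bij_betw f {..<n} {..<n} & partition(map(%p. ?d ! f p) [0..<n]) &
  ac(replicate n M)(atom ?c * atom ?d) = ac(replicate n M)(atom(map(%p. ?c ! f p) [0..<n]) * atom(map(%p. ?d ! f p) [0..<n]))"
  then obtain f where f: "bij_betw f {..<n} {..<n}" "partition(map(%p. ?d ! f p) [0..<n])"
  "ac(replicate n M)(atom ?c * atom ?d) = ac(replicate n M)(atom(map(%p. ?c ! f p) [0..<n]) * atom(map(%p. ?d ! f p) [0..<n]))" by blast
  have fn: "f p<n" if "p<n" for p using f(1) that by (auto simp: bij_betw_def)
  have b: "bij_betw(swapidx i) {..<n} {..<n}"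
  by (rule bij_betw_byWitness[where f'= "swapidx i"]) (use swap(2) in \<open>auto simp: swapidx_def\<close>)
  have eqd: "map(%p. ?d ! f p) [0..<n] = map(%p. d ! (swapidx i o f) p) [0..<n]" and eqc: "map(%p. ?c ! f p) [0..<n] = map(%p. c ! (swapidx i o f) p) [0..<n]"
  using fn swap(1,2,5) by (auto simp: nth_swapl)
  show ?thesis
  using bij_betw_trans[OF f(1) b] f(1) b f(2)[unfolded eqd] by (auto simp: e h f(3) eqc eqd)
 qed
qed
qed

lemma rk_add: "length a = length b ==> rk(map2(+) a b) = rk a+rk b"
by (simp add: rk_def sum.distrib[symmetric] distrib_left)

lemma ac_cone_coef_nz:
 assumes "f : cone atom n" "length b = n" "ac b f ~= 0"
 shows "coef f b ~= 0"
using cone_coef_ge[OF assms(1,2)] cone_dual_nonneg[OF triangular_atom assms(1,2)] assms(3) by linarith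

text \<open>Multiplication by x^eta identifies the coefficient at the increasing composition M - eta
  with the one at the constant composition; this carries the adjunction to all increasing
  indices.\<close>

lemma ac_shift_atom:
 assumes eta: "partition eta" "length eta = n" "!!p. p<n ==> eta ! p <= M" and d: "length d = n"
 shows "ac(replicate n M)(xmon eta * atom d) = (if d = map(%x. M-x) eta then 1 else 0)"
proof -
let ?R = "replicate n M" let ?b = "map(%x. M-x) eta"
have cn: "xmon eta * atom d : cone atom n" if "length d = n" for d by (rule xmon_partition_cone[OF eta(1,2) cone_base[OF that]])
have bR: "map2(-) ?R eta = ?b" using eta(2) by (intro nth_equalityI) auto
have le: "ALL p<n. eta ! p <= ?R ! p" using eta(3) by simp
show ?thesis
proof (cases "d = ?b")
 case True
 let ?f = "xmon eta * atom ?b"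
 \<comment> \<open>No correction enters the back substitution: an index a occurring in
   \<open>?f\<close> has \<open>rk a >= rk ?b + rk eta\<close>, which is already the rank of the
   constant composition.\<close>
 have "ac a ?f * coef(atom a) ?R = 0" if a: "length a = n" "rk a<rk ?R" for a
 proof (rule ccontr)
  assume "ac a ?f * coef(atom a) ?R ~= 0"
  hence "coef ?f a ~= 0" using ac_cone_coef_nz[OF cn a(1)] eta(2) by simp
  hence h: "ALL p<n. eta ! p <= a ! p" "coef(atom ?b)(map2(-) a eta) ~= 0"
  using coef_xmon_mult[OF atom_polys eta(2) a(1),of ?b] eta(2) by (auto split: if_splits)
  have "length ?b = n" "length(map2(-) a eta) = n" using a(1) eta(2) by simp_all
  hence "map2(-) a eta = ?b | rk ?b<rk(map2(-) a eta)"
  using triangular_atom[of n] h(2) unfolding triangular_def by blast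
  hence "rk ?b <= rk(map2(-) a eta)" by auto
  moreover have "rk a = rk(map2(-) a eta)+rk eta"
  proof -
   have "map2(+)(map2(-) a eta) eta = a" using a(1) eta(2) h(1) by (intro nth_equalityI) auto
   thus ?thesis using rk_add[of "map2(-) a eta" eta] a(1) eta(2) by simp
  qed
  moreover have "rk ?R = rk ?b+rk eta"
  proof -
   have "map2(+) ?b eta = ?R" using eta by (intro nth_equalityI) auto
   thus ?thesis using rk_add[of ?b eta] by simp
  qed
  ultimately show False using a(2) by simp
 qed
 hence "(SUM a:{a. length a = length ?R & sum_list a = sum_list ?R & rk a<rk ?R}. ac a ?f * coef(atom a) ?R) = 0"
 by (intro sum.neutral) auto
 hence "ac ?R ?f = coef ?f ?R" by (simp add: dualc.simps[of atom ?R])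
 also have "...=coef(atom ?b) ?b"
 using coef_xmon_mult[OF atom_polys eta(2),of ?b ?R] eta(2) le bR by simp
 also have "...=1" using triangular_atom[of n] eta(2) by (simp add: triangular_def)
 finally show ?thesis using True by simp
next
 case False
 have "ac ?R(xmon eta * atom d) = 0"
 proof (rule ccontr)
  assume nz: "ac ?R(xmon eta * atom d) ~= 0"
  have e: "atom eta = xmon eta" by (rule atom_partition[OF eta(1)])
  have "ac ?R(atom eta * atom d) = 0 | (EX f. bij_betw f {..<n} {..<n} & partition(map(%p. d ! f p) [0..<n]) &
  ac ?R(atom eta * atom d) = ac ?R(atom(map(%p. eta ! f p) [0..<n]) * atom(map(%p. d ! f p) [0..<n])))"
  proof (rule pairing_sort[OF d eta(2)])
   fix p q assume "p<q" "q<n" "eta ! p<eta ! q"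
   thus "d ! q<d ! p" using partition_le[OF eta(1),of p q] eta(2) by simp
  qed
  moreover have "ac ?R(atom eta * atom d) ~= 0" using nz unfolding e .
  ultimately obtain f where f: "bij_betw f {..<n} {..<n}" "partition(map(%p. d ! f p) [0..<n])"
  "ac ?R(atom eta * atom d) = ac ?R(atom(map(%p. eta ! f p) [0..<n]) * atom(map(%p. d ! f p) [0..<n]))" by blast
  define c where "c = map(%p. eta ! f p) [0..<n]" define m where "m = map(%p. d ! f p) [0..<n]"
  have fn: "f p<n" if "p<n" for p using f(1) that by (auto simp: bij_betw_def)
  have len: "length c = n" "length m = n" by (simp_all add: c_def m_def)
  have pm: "partition m" using f(2) by (simp add: m_def)
  have "ac ?R(xmon m * atom c) ~= 0" using nz f(3) e atom_partition[OF pm] by (simp add: c_def m_def mult.commute)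
  hence "coef(xmon m * atom c) ?R ~= 0"
  by (intro ac_cone_coef_nz[of _ n] xmon_partition_cone[OF pm] cone_base) (use len in auto)
  hence h: "ALL p<n. m ! p <= ?R ! p" "coef(atom c)(map2(-) ?R m) ~= 0"
  using coef_xmon_mult[OF atom_polys len(2),of c ?R] len by (auto split: if_splits)
  \<comment> \<open>Two opposite estimates. Here the prefix sums of c are at most those of M - m,
    because entries of an atom filling are bounded by their rows. In \<open>suf\<close> the subset
    bound for \<open>atom d\<close> gives the reverse inequality, so c + m = M in every
    position.\<close>
  have pre: "(SUM p<i. c ! p) <= (SUM p<i. M-m ! p)" if "i <= n" for i
  proof -
   have "(SUM p<i. c ! p) <= (SUM p<i. map2(-) ?R m ! p)" using atom_prefix[OF _ h(2),of i] len that by simp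
   also have "...=(SUM p<i. M-m ! p)" using that len by (intro sum.cong) auto
   finally show ?thesis .
  qed
  have "coef(xmon eta * atom d) ?R ~= 0" by (rule ac_cone_coef_nz[OF cn[OF d] _ nz]) simp
  hence h2: "coef(atom d) ?b ~= 0"
  using coef_xmon_mult[OF atom_polys[OF d] eta(2),of ?R] bR by (auto split: if_splits)
  have md: "mset m = mset d"
  proof -
   have inj: "inj_on f {..<n}" and im: "f ` {..<n} = {..<n}" using f(1) by (simp_all add: bij_betw_def)
   have "mset(map f [0..<n]) = mset_set(f ` {..<n})"
   using image_mset_mset_set[OF inj] by (simp add: atLeast0LessThan)
   also have "...=mset [0..<n]" unfolding im by (simp add: atLeast0LessThan)
   finally have "mset(map((!) d)(map f [0..<n])) = mset(map((!) d) [0..<n])" unfolding mset_map by simp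
   also have "map((!) d) [0..<n] = d" using d map_nth[of d] by simp
   finally show ?thesis by (simp add: m_def comp_def)
  qed
  have suf: "(SUM p<i. M-c ! p) <= (SUM p<i. m ! p)" if i: "i <= n" for i
  proof -
   have inj: "inj_on f {..<i}" using f(1) i by (meson bij_betw_def inj_on_subset lessThan_subset_iff)
   have "(SUM p:f ` {..<i}. ?b ! p) <= (SUM p<card(f ` {..<i}). m ! p)"
   by (rule atom_subset_bound[OF _ h2 pm md]) (use fn i d eta(2) in auto)
   also have "card(f ` {..<i}) = i" using inj by (simp add: card_image)
   also have "(SUM p:f ` {..<i}. ?b ! p) = (SUM p<i. M-c ! p)"
   unfolding sum.reindex[OF inj] using fn i eta(2) by (intro sum.cong) (auto simp: c_def)
   finally show ?thesis .
  qed
  have cM: "c ! p <= M" "m ! p <= M" if "p<n" for p using eta(3) fn h(1) that by (auto simp: c_def)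
  have tot: "(SUM p<i. c ! p+m ! p) = i * M" if i: "i <= n" for i
  proof -
   have "(SUM p<i. M-m ! p)+(SUM p<i. m ! p) = (SUM p<i. M)" "(SUM p<i. M-c ! p)+(SUM p<i. c ! p) = (SUM p<i. M)"
   unfolding sum.distrib[symmetric] using cM i by (auto intro!: sum.cong)
   thus ?thesis using pre[OF i] suf[OF i] by (simp add: sum.distrib)
  qed
  have pt: "c ! p+m ! p = M" if "p<n" for p using tot[of p] tot[of "Suc p"] that by simp
  have "d ! q = M-eta ! q" if "q<n" for q
  proof -
   obtain p where "p<n" "q = f p" using f(1) \<open>q<n\<close> unfolding bij_betw_def by (metis imageE lessThan_iff)
   thus ?thesis using pt[of p] by (simp add: c_def m_def)
  qed
  hence "d = ?b" using d eta(2) by (intro nth_equalityI) auto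
  thus False using False by simp
 qed
 thus ?thesis using False by simp
qed
qed

theorem atom_schur:
 assumes a: "length a = n" and lam: "partition lam"
 shows "atom a * schur n lam : cone atom n"
proof -
let ?s = "schur n lam"
have sym: "swap_poly i ?s = ?s" if "Suc i<n" for i using schur_cone_sym[OF lam] that by blast
have sc: "?s : cone atom n" using schur_cone_sym[OF lam] by blast
have pol: "f * ?s : polys n" if "f : polys n" for f by (intro polys_mult that schur_polys)
\<comment> \<open>At a constant index pi_i leaves the coefficient unchanged, so an atom with an
  ascent, killed by some pi_i, contributes 0; for a partition the atom is a monomial.\<close>
have const: "ac(replicate n M)(g * ?s) >= 0" if g: "g : cone atom n" for g M
using g
proof induction
 case (cone_step f d)
 have "ac(replicate n M)(atom d * ?s) >= 0"
 proof (cases "partition d")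
  case True
  hence "atom d * ?s : cone atom n" using xmon_partition_cone[OF True cone_step(2) sc] by (simp add: atom_partition)
  thus ?thesis by (intro cone_dual_nonneg[OF triangular_atom]) auto
 next
  case False
  then obtain i where i: "Suc i<n" "d ! i<d ! Suc i" using cone_step(2) by (auto simp: partition_def)
  have "swapl i(replicate n M) = replicate n M" using i by (intro swapl_eq) auto
  hence "ac(replicate n M)(atom d * ?s) = ac(replicate n M)(pidiff i(atom d * ?s))"
  using ac_pidiff[OF i(1),of "replicate n M"] pol[OF atom_polys[OF cone_step(2)]] i by simp
  also have "pidiff i(atom d * ?s) = 0" using pidiff_mult_sym2[OF sym[OF i(1)]] pidiff_atom[of i d] i cone_step(2) by simp
  finally show ?thesis by simp
 qed
 thus ?case using cone_step by (simp add: distrib_right)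
qed simp
have "ac b(atom a * ?s) >= 0" if "length b = n" "length a = n" for a b
using that
proof (induction arbitrary: a rule: increasing_induct)
 case (sorted b)
 define M where "M = sum_list b"
 define eta where "eta = map(%x. M-x) b"
 have bM: "b ! p <= M" if "p<n" for p unfolding M_def using sorted(1) that by (intro member_le_sum_list) auto
 have eta: "partition eta" "length eta = n" "!!p. p<n ==> eta ! p <= M" "map(%x. M-x) eta = b"
 using sorted bM by (auto simp: eta_def partition_def increasing_def intro!: nth_equalityI)
 have shift: "ac b f = ac(replicate n M)(xmon eta * f)" if "f : polys n" for f
 proof -
  have "f : zspan atom n" using that polys_zspan[OF triangular_atom] by blast
  thus ?thesis
  by induction(use sorted(1) eta ac_shift_atom[OF eta(1,2,3)] in \<open>auto simp: distrib_left right_diff_distrib ac_delta\<close>)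
 qed
 have "ac b(atom a * ?s) = ac(replicate n M)((xmon eta * atom a) * ?s)"
 using shift[OF pol[OF atom_polys[OF sorted(3)]]] by (simp add: mult.assoc)
 also have "... >= 0" by (intro const xmon_partition_cone eta cone_base sorted)
 finally show ?case .
next
 case (swap b i)
 have "ac b(atom a * ?s) = ac(swapl i b)(pidiff i(atom a * ?s))"
 using ac_pidiff[OF swap(2),of "swapl i b"] pol[OF atom_polys[OF swap(5)]] swap(1,2,3) by simp
 also have "pidiff i(atom a * ?s) = pidiff i(atom a) * ?s" by (rule pidiff_mult_sym2[OF sym[OF swap(2)]])
 also have "ac(swapl i b)(pidiff i(atom a) * ?s) >= 0"
 using swap(4)[OF swap(5)] swap(4)[of "swapl i a"] pidiff_atom[of i a] swap(2,5) by (simp add: distrib_right)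
 finally show ?case .
qed
thus ?thesis using a by (intro cone_by_dual[OF triangular_atom] pol atom_polys) auto
qed

definition rise :: "nat => nat list => bool" where
"rise i a \<longleftrightarrow> Suc i<length a & a ! i<a ! Suc i"

text \<open>The number of steps that the recursions for Demazure characters and Schubert polynomials
  take on this list, hence the amount of fuel that suffices.\<close>

definition asc :: "nat list => nat" where
"asc a = card {(p,q). p<q & q<length a & a ! p<a ! q}"

lemma finite_asc: "finite {(p,q). p<q & q<length a & a ! p<(a ! q :: nat)}"
by (rule finite_subset[of _ "{..<length a} \<times> {..<length a}"]) auto

lemma asc_le: "asc a <= length a ^ 2"
proof -
have "asc a <= card({..<length a} \<times> {..<length a})" unfolding asc_def by (rule card_mono) auto
thus ?thesis by (simp add: power2_eq_square)
qed

subsection \<open>Demazure characters\<close>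

text \<open>Exchanging the two positions in both coordinates is a bijection of the ascending pairs
  other than \<open>(i, Suc i)\<close>.\<close>

lemma asc_swapl:
 assumes "rise i a" shows "asc a = Suc(asc(swapl i a))"
proof -
let ?A = "{(p,q). p<q & q<length a & a ! p<a ! q}"
let ?B = "{(p,q). p<q & q<length(swapl i a) & swapl i a ! p<swapl i a ! q}"
let ?h = "map_prod(swapidx i)(swapidx i)"
have i: "Suc i<length a" "a ! i<a ! Suc i" using assms by (auto simp: rise_def)
have sl: "swapidx i q<length a" if "q<length a" for q using that i by (auto simp: swapidx_def)
have "bij_betw ?h(?A-{(i,Suc i)}) ?B"
proof (rule bij_betw_byWitness[where f'= "?h"])
 show "?h ` (?A-{(i,Suc i)}) <= ?B"
 proof
  fix x assume "x : ?h ` (?A-{(i,Suc i)})"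
  then obtain p q where x: "x = (swapidx i p,swapidx i q)" "p<q" "q<length a" "a ! p<a ! q" "~ (p = i & q = Suc i)" by auto
  thus "x : ?B" using rsw_less[OF x(2,5)] i sl[of q] by (auto simp: nth_swapl)
 qed
 show "?h ` ?B <= ?A-{(i,Suc i)}"
 using i by (auto simp: nth_swapl swapidx_def split: if_splits)
qed auto
hence "card(?A-{(i,Suc i)}) = card ?B" by (rule bij_betw_same_card)
moreover have "card ?A = Suc(card(?A-{(i,Suc i)}))" by (rule card.remove) (use i finite_asc in auto)
ultimately show ?thesis by (simp add: asc_def)
qed

lemma first_ascent_None: "first_ascent a = None \<longleftrightarrow> ~ (EX i. rise i a)"
by (simp add: first_ascent_def rise_def)

lemma first_ascent_rise: "first_ascent a = Some i ==> rise i a"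
unfolding first_ascent_def rise_def[symmetric] by (auto split: if_splits intro: LeastI)

lemma partition_no_rise: "partition a \<longleftrightarrow> ~ (EX i. rise i a)"
unfolding partition_def rise_def by (metis linorder_not_less)

lemma rise_far: "rise i s ==> rise j s ==> Suc i<j ==> 
rise j(swapl i s) & rise i(swapl j s) & swapl i(swapl j s) = swapl j(swapl i s)"
using swapl_commute[of i j s] by (auto simp: rise_def nth_swapl swapidx_def)

lemma rise_near: "rise i s ==> rise(Suc i) s ==> 
rise(Suc i)(swapl i s) & rise i(swapl(Suc i)(swapl i s)) & rise i(swapl(Suc i) s) &
rise(Suc i)(swapl i(swapl(Suc i) s)) &
swapl i(swapl(Suc i)(swapl i s)) = swapl(Suc i)(swapl i(swapl(Suc i) s))"
using swapl_braid[of i s] by (auto simp: rise_def nth_swapl swapidx_def)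

lemma kappa_fuel_indep: "asc a <= k ==> asc a <= k' ==> kappa_fuel k a = kappa_fuel k' a"
proof (induction k arbitrary: k' a)
case 0
hence "~ rise i a" for i using asc_swapl[of i a] by auto
hence "first_ascent a = None" by (simp add: first_ascent_None)
thus ?case by (cases k') simp_all
next
case (Suc k)
show ?case
proof (cases "first_ascent a")
 case None thus ?thesis by (cases k') simp_all
next
 case (Some i)
 have e: "asc a = Suc(asc(swapl i a))" by (rule asc_swapl[OF first_ascent_rise[OF Some]])
 then obtain l where "k' = Suc l" using Suc(3) by (cases k') auto
 thus ?thesis using Some Suc(1)[of "swapl i a" l] Suc(2,3) unfolding e by simp
qed
qed

lemma demazure_partition: "partition a ==> demazure a = xmon a"
proof -
assume "partition a"
hence "first_ascent a = None" using partition_no_rise first_ascent_None by blast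
hence "kappa_fuel k a = xmon a" for k by (cases k) simp_all
thus ?thesis unfolding demazure_def .
qed

lemma demazure_first: "first_ascent a = Some i ==> demazure a = pidiff i(demazure(swapl i a))"
proof -
assume i: "first_ascent a = Some i"
have e: "asc a = Suc(asc(swapl i a))" by (rule asc_swapl[OF first_ascent_rise[OF i]])
have l: "asc(swapl i a) <= length a ^ 2" using asc_le[of "swapl i a"] by simp
have "demazure a = kappa_fuel(Suc(asc(swapl i a))) a"
unfolding demazure_def using e asc_le[of a] by (intro kappa_fuel_indep) auto
also have "...=pidiff i(kappa_fuel(asc(swapl i a))(swapl i a))" using i by simp
also have "kappa_fuel(asc(swapl i a))(swapl i a) = demazure(swapl i a)"
unfolding demazure_def using l by (intro kappa_fuel_indep) auto
finally show ?thesis .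
qed

text \<open>The fuelled recursion always takes the first ascent; confluence frees the
  choice.\<close>

lemma demazure_rise: "rise i a ==> demazure a = pidiff i(demazure(swapl i a))"
proof (rule braid_confluence[where I= "%_. True" and en=rise and T=swapl and meas=asc and val=demazure and D=pidiff])
fix s :: "nat list" and i assume "rise i s"
then obtain j where "first_ascent s = Some j" using first_ascent_None[of s] by (cases "first_ascent s") auto
thus "EX j. rise j s & demazure s = pidiff j(demazure(swapl j s))"
using first_ascent_rise demazure_first by blast
next
fix s :: "nat list" and i assume "rise i s"
thus "True & asc(swapl i s)<asc s" using asc_swapl by simp
next
fix s :: "nat list" and i j assume "rise i s" "rise j s" "Suc i<j"
thus "rise j(swapl i s) & rise i(swapl j s) & swapl i(swapl j s) = swapl j(swapl i s)" by (rule rise_far)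
next
fix s :: "nat list" and i assume "rise i s" "rise(Suc i) s"
thus "rise(Suc i)(swapl i s) & rise i(swapl(Suc i)(swapl i s)) & rise i(swapl(Suc i) s) &
rise(Suc i)(swapl i(swapl(Suc i) s)) &
swapl i(swapl(Suc i)(swapl i s)) = swapl(Suc i)(swapl i(swapl(Suc i) s))" by (rule rise_near)
qed (auto intro: pidiff_commute pidiff_braid)

text \<open>Induction along any ascent j: a distant pi_j commutes with pi_i, while for neighbouring
  i and j the equal parts reappear one place over after two swaps, and the braid relation brings
  pi_i to the front.\<close>

lemma demazure_equal:
 assumes "length a = n"
 shows "Suc i<n ==> a ! i = a ! Suc i ==> pidiff i(demazure a) = demazure a"
using assms
proof (induction "asc a" arbitrary: a i rule: less_induct)
case less
note l=less(4)
show ?case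
proof (cases "EX j. rise j a")
 case False
 hence "demazure a = xmon a" using demazure_partition partition_no_rise by blast
 thus ?thesis using less(2,3) l by (simp add: pidiff_sym swap_xmon swapl_eq)
next
 case True
 then obtain j where j: "rise j a" by blast
 have jn: "Suc j<n" "a ! j<a ! Suc j" using j l by (auto simp: rise_def)
 have d: "demazure a = pidiff j(demazure(swapl j a))" by (rule demazure_rise[OF j])
 consider "Suc i<j | Suc j<i" | "j = Suc i" | "i = Suc j" using jn(2) less(3) by (metis less_irrefl linorder_neqE_nat not_less_eq)
 thus ?thesis
 proof cases
  case 1
  have "pidiff i(demazure(swapl j a)) = demazure(swapl j a)"
  by (rule less(1)) (use less(2,3) l jn 1 asc_swapl[OF j] in \<open>auto simp: nth_swapl swapidx_def\<close>)
  thus ?thesis unfolding d using 1 pidiff_commute[of i j] pidiff_commute[of j i] by metis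
 next
  case 2
  have r: "rise i(swapl j a)" using less(2,3) l jn by (auto simp: rise_def 2 nth_swapl swapidx_def)
  let ?k = "demazure(swapl i(swapl j a))"
  have "pidiff j ?k = ?k"
  by (rule less(1)) (use less(2,3) l jn 2 asc_swapl[OF j] asc_swapl[OF r] in \<open>auto simp: nth_swapl swapidx_def\<close>)
  moreover have "demazure a = pidiff j(pidiff i ?k)" unfolding d by (simp only: demazure_rise[OF r])
  ultimately have "demazure a = pidiff j(pidiff i(pidiff j ?k))" by simp
  hence "demazure a = pidiff i(pidiff j(pidiff i ?k))" by (simp only: 2 pidiff_braid)
  thus ?thesis by (simp only: pidiff_idem)
 next
  case 3
  have r: "rise i(swapl j a)" using less(2,3) l jn by (auto simp: rise_def 3 nth_swapl swapidx_def)
  let ?k = "demazure(swapl i(swapl j a))"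
  have "pidiff j ?k = ?k"
  by (rule less(1)) (use less(2,3) l jn 3 asc_swapl[OF j] asc_swapl[OF r] in \<open>auto simp: nth_swapl swapidx_def\<close>)
  moreover have "demazure a = pidiff j(pidiff i ?k)" unfolding d by (simp only: demazure_rise[OF r])
  ultimately have "demazure a = pidiff j(pidiff i(pidiff j ?k))" by simp
  hence "demazure a = pidiff i(pidiff j(pidiff i ?k))" by (simp only: 3 pidiff_braid)
  thus ?thesis by (simp only: pidiff_idem)
 qed
qed
qed

lemma pidiff_demazure:
 assumes "Suc i<length a"
 shows "pidiff i(demazure a) = (if a ! Suc i<a ! i then demazure(swapl i a) else demazure a)"
proof -
consider "a ! i<a ! Suc i" | "a ! i = a ! Suc i" | "a ! Suc i<a ! i" by linarith
thus ?thesis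
proof cases
 case 1
 hence "rise i a" using assms by (simp add: rise_def)
 hence "demazure a = pidiff i(demazure(swapl i a))" by (rule demazure_rise)
 thus ?thesis using 1 by simp
next
 case 2 thus ?thesis using demazure_equal[OF HOL.refl assms] by simp
next
 case 3
 hence "rise i(swapl i a)" using assms by (simp add: rise_def)
 from demazure_rise[OF this] show ?thesis using 3 assms by simp
qed
qed

text \<open>By \<open>pidiff_atom\<close> one pi_i adds at most one ascending pair to the index of
  an atom, and only the leading atom starts with enough of them to reach the count of a.\<close>

lemma demazure_atoms:
 assumes "length a = n"
 shows "EX ds. demazure a = atom a+(SUM d<-ds. atom d) & (ALL d:set ds. mset d = mset a & asc d<asc a)"
using assms
proof (induction rule: partition_induct)
case (sorted a)
thus ?case by (intro exI[of _ "[]"]) (simp add: demazure_partition atom_partition)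
next
case (swap a i)
let ?a = "swapl i a"
have r: "rise i a" using swap by (simp add: rise_def)
from swap(4) obtain ds where ds: "demazure ?a = atom ?a+(SUM d<-ds. atom d)" "ALL d:set ds. mset d = mset ?a & asc d<asc ?a" by blast
have ln: "length d = n" if "d : set ds" for d using ds(2) that swap(1) by (metis length_swapl mset_eq_length)
have A: "EX es. pidiff i(atom d) = (SUM e<-es. atom e) & (ALL e:set es. mset e = mset d & asc e <= Suc(asc d))" if "length d = n" for d
proof -
 consider "d ! i<d ! Suc i" | "d ! i = d ! Suc i" | "d ! Suc i<d ! i" by linarith
 thus ?thesis
 proof cases
  case 1 thus ?thesis using pidiff_atom[of i d] that swap(2) by (intro exI[of _ "[]"]) auto
 next
  case 2 thus ?thesis using pidiff_atom[of i d] that swap(2) by (intro exI[of _ "[d]"]) auto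
 next
  case 3
  have "rise i(swapl i d)" using 3 that swap(2) by (simp add: rise_def)
  from asc_swapl[OF this] have "asc(swapl i d) = Suc(asc d)" using that swap(2) by simp
  thus ?thesis using 3 pidiff_atom[of i d] that swap(2) by (intro exI[of _ "[d,swapl i d]"]) auto
 qed
qed
have B: "EX fs. pidiff i(SUM d<-es. atom d) = (SUM e<-fs. atom e) & (ALL e:set fs. mset e = mset ?a & asc e<Suc(asc ?a))"
if "set es <= set ds" for es
using that
proof (induction es)
 case Nil show ?case by (intro exI[of _ "[]"]) simp
next
 case (Cons d es)
 then obtain fs where fs: "pidiff i(SUM d<-es. atom d) = (SUM e<-fs. atom e)" "ALL e:set fs. mset e = mset ?a & asc e<Suc(asc ?a)" by auto
 obtain gs where gs: "pidiff i(atom d) = (SUM e<-gs. atom e)" "ALL e:set gs. mset e = mset d & asc e <= Suc(asc d)"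
 using A[of d] ln Cons by auto
 show ?case using fs gs ds(2) Cons(2) by (intro exI[of _ "gs @ fs"]) fastforce
qed
from B[OF subset_refl] obtain fs where fs: "pidiff i(SUM d<-ds. atom d) = (SUM e<-fs. atom e)" "ALL e:set fs. mset e = mset ?a & asc e<Suc(asc ?a)" by blast
have "pidiff i(atom ?a) = atom a+atom ?a" using pidiff_atom[of i ?a] swap by simp
hence "demazure a = atom a+(SUM e<-?a # fs. atom e)" using demazure_rise[OF r] ds(1) fs(1) by simp
moreover have "ALL e:set(?a # fs). mset e = mset a & asc e<asc a" using fs(2) asc_swapl[OF r] swap by auto
ultimately show ?case by blast
qed

lemma asc_increasing_max:
 assumes "length a = n" "increasing b" "mset a = mset b"
 shows "asc a <= asc b"
using assms
proof (induction rule: increasing_induct)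
case (sorted a)
hence "a = b" using increasing_sort by (metis sorted_list_of_multiset_mset)
thus ?case by simp
next
case (swap a i)
have "rise i(swapl i a)" using swap by (simp add: rise_def)
from asc_swapl[OF this] have "asc(swapl i a) = Suc(asc a)" using swap by simp
thus ?case using swap by simp
qed

text \<open>Coefficient of the Demazure character of b. The \<open>hdiff\<close> word sorts b into
  increasing order, and there it is an atom coefficient: an increasing list has the most ascending
  pairs among its rearrangements and so occurs only in its own character.\<close>

definition kc :: "nat list => mpoly => int" where
"kc b f = ac(sort b)(hop b f)"

lemma kc_add [simp]: "kc b(f+g) = kc b f+kc b g" by (simp add: kc_def)
lemma kc_zero [simp]: "kc b 0 = 0" by (simp add: kc_def)
lemma kc_diff [simp]: "kc b(f-g) = kc b f-kc b g" using kc_add[of b "f-g" g] by simp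

lemma kc_increasing: "increasing b ==> kc b f = ac b f"
unfolding kc_def by (subst hop_no_desc) (auto simp: desc_def increasing_def increasing_sort)

lemma kc_desc: "Suc i<length b ==> b ! Suc i<b ! i ==> kc b f = kc(swapl i b)(hdiff i f)"
by (metis hop_desc mset_swapl sorted_list_of_multiset_mset desc_def kc_def)

lemma kc_delta:
 assumes "length b = n" "length a = n"
 shows "kc b(demazure a) = (if a = b then 1 else 0)"
using assms
proof (induction arbitrary: a rule: increasing_induct)
case (sorted b)
obtain ds where ds: "demazure a = atom a+(SUM d<-ds. atom d)" "ALL d:set ds. mset d = mset a & asc d<asc a"
using demazure_atoms[OF sorted(3)] by blast
have "ac b(SUM d<-es. atom d) = 0" if "set es <= set ds" for es
using that
proof (induction es)
 case (Cons d es)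
 have d: "mset d = mset a" "asc d<asc a" using ds(2) Cons(2) by auto
 hence "length d = n" using sorted(3) mset_eq_length by metis
 moreover have "d ~= b" using d asc_increasing_max[OF sorted(3,2)] by auto
 ultimately show ?case using Cons sorted(1) by (simp add: ac_delta)
qed simp
from this[OF subset_refl] show ?case using ds(1) sorted by (simp add: kc_increasing ac_delta)
next
case (swap b i)
\<comment> \<open>With \<open>hdiff i\<close> = pi_i - 1 both terms are known by induction; they
  cancel unless a has a descent at i.\<close>
have e: "kc b(demazure a) = kc(swapl i b)(pidiff i(demazure a))-kc(swapl i b)(demazure a)"
using kc_desc[of i b] swap by (simp add: hdiff_alt)
show ?case
using swap by (cases "a ! Suc i<a ! i") (auto simp: e pidiff_demazure swapl_inj)
qed

lemma pidiff_zspan_demazure: "Suc i<n ==> f : zspan demazure n ==> pidiff i f : zspan demazure n"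
by (rule zspan_linear[of f demazure n "pidiff i"]) (auto simp: pidiff_demazure intro: zspan_base)

lemma pidiff_cone_demazure: "Suc i<n ==> f : cone demazure n ==> pidiff i f : cone demazure n"
by (rule cone_linear[of f demazure n "pidiff i"]) (auto simp: pidiff_demazure intro: cone_base)

lemma atom_zspan_demazure: "length a = n ==> atom a : zspan demazure n"
proof (induction rule: partition_induct)
case (sorted a)
thus ?case using zspan_base[of a n demazure] by (simp add: demazure_partition atom_partition)
next
case (swap a i)
thus ?case using atom_unswap[of i a] by (auto simp: hdiff_alt intro: zspan_diff pidiff_zspan_demazure)
qed

lemma polys_zspan_demazure:
 assumes "f : polys n" shows "f : zspan demazure n"
proof -
have "f : zspan atom n" using assms polys_zspan[OF triangular_atom] by blast
thus ?thesis by (rule zspan_linear[where T= "%f. f"]) (auto intro: atom_zspan_demazure)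
qed

text \<open>The Schur factor is symmetric, so the sorting word of b acts on the atom alone;
  compatibility of d with b keeps every step an atom or 0, and at the end stands a nonnegative atom
  coefficient from \<open>atom_schur\<close>.\<close>

lemma kc_schur_atom:
 assumes "length b = n" "length d = n" "partition lam"
"!!p q. p<q ==> q<n ==> d ! p<d ! q ==> b ! p <= b ! q"
 shows "kc b(atom d * schur n lam) >= 0"
using assms
proof (induction arbitrary: d rule: increasing_induct)
case (sorted b)
thus ?case using cone_dual_nonneg[OF triangular_atom atom_schur] by (simp add: kc_increasing)
next
case (swap b i)
let ?d = "swapl i d"
have sym: "swap_poly i(schur n lam) = schur n lam" using schur_cone_sym swap by blast
have e: "kc b(atom d * schur n lam) = kc(swapl i b)(hdiff i(atom d) * schur n lam)"
using kc_desc[of i b] swap by (simp add: hdiff_mult_sym2[OF sym])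
have di: "d ! Suc i <= d ! i" using swap(7)[of i "Suc i"] swap(2,3) by force
show ?case
proof (cases "d ! i = d ! Suc i")
 case True
 thus ?thesis unfolding e using hdiff_atom[of i d] swap by simp
next
 case False
 hence h: "hdiff i(atom d) = atom ?d" using hdiff_atom[of i d] swap(2,5) di by simp
 show ?thesis unfolding e h
 proof (rule swap(4))
  fix p q assume pq: "p<q" "q<n" "?d ! p<?d ! q"
  show "swapl i b ! p <= swapl i b ! q"
  proof (cases "p = i & q = Suc i")
   case True thus ?thesis using swap(1,2,3) by simp
  next
   case False
   hence lt: "swapidx i p<swapidx i q" using rsw_less[OF pq(1)] by blast
   have "swapidx i q<n" using pq swap(2) by (auto simp: swapidx_def)
   thus ?thesis using swap(7)[OF lt] pq swap(1,2,5) by (simp add: nth_swapl)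
  qed
 qed (use swap in auto)
qed
qed

text \<open>pi_i commutes with the Schur factor and sends Demazure characters to Demazure
  characters, so the claim reduces to partition indices, where the character is an atom.\<close>

theorem demazure_schur:
 assumes a: "length a = n" and lam: "partition lam"
 shows "demazure a * schur n lam : cone demazure n"
using a
proof (induction rule: partition_induct)
case (sorted a)
show ?case
proof (rule cone_by_functional[where k=kc])
 show "demazure a * schur n lam : zspan demazure n"
 using sorted by (intro polys_zspan_demazure polys_mult schur_polys) (simp add: demazure_partition xmon_polys)
 show "kc b(demazure a * schur n lam) >= 0" if "length b = n" for b
 proof -
  have "kc b(atom a * schur n lam) >= 0"
  by (rule kc_schur_atom) (use that sorted lam partition_le[OF sorted(2)] in \<open>auto simp: not_le[symmetric] del: not_le\<close>)
  thus ?thesis using sorted by (simp add: demazure_partition atom_partition)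
 qed
qed (simp_all add: kc_delta)
next
case (swap a i)
have r: "rise i a" using swap by (simp add: rise_def)
have sym: "swap_poly i(schur n lam) = schur n lam" using schur_cone_sym lam swap by blast
have "demazure a * schur n lam = pidiff i(demazure(swapl i a) * schur n lam)"
by (simp only: pidiff_mult_sym2[OF sym] demazure_rise[OF r,symmetric])
thus ?case using pidiff_cone_demazure[OF swap(2,4)] by simp
qed

subsection \<open>Schubert polynomials\<close>

lemma perm_code_Nil [simp]: "perm_code [] = []" by (simp add: perm_code_def)

lemma perm_code_Cons [simp]: "perm_code(x # w) = length(filter(%y. y<x) w) # perm_code w"
proof -
have a: "card {j. 0<j & j<Suc(length w) & (x # w) ! j<x} = length(filter(%y. y<x) w)"
proof -
 have "{j. 0<j & j<Suc(length w) & (x # w) ! j<x} = Suc ` {j. j<length w & w ! j<x}"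
 by (auto simp: gr0_conv_Suc)
 thus ?thesis by (simp add: card_image length_filter_conv_card)
qed
have b: "card {j. Suc i<j & j<Suc(length w) & (x # w) ! j<w ! i} = card {j. i<j & j<length w & w ! j<w ! i}" for i
proof -
 have "{j. Suc i<j & j<Suc(length w) & (x # w) ! j<w ! i} = Suc ` {j. i<j & j<length w & w ! j<w ! i}"
 proof (rule set_eqI)
  fix j show "j : {j. Suc i<j & j<Suc(length w) & (x # w) ! j<w ! i} \<longleftrightarrow> j : Suc ` {j. i<j & j<length w & w ! j<w ! i}"
  by (cases j) auto
 qed
 thus ?thesis by (simp add: card_image)
qed
have "[0..<length(x # w)] = 0 # map Suc [0..<length w]" by (simp add: map_Suc_upt upt_conv_Cons del: upt_Suc)
thus ?thesis unfolding perm_code_def using a b by simp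
qed

lemma length_perm_code [simp]: "length(perm_code w) = length w" by (simp add: perm_code_def)

lemma swapl_0 [simp]: "swapl 0(x # y # w) = y # x # w" by (simp add: swapl_def)
lemma swapl_Suc [simp]: "swapl(Suc i)(x # w) = x # swapl i w" by (simp add: swapl_def)

lemma length_filter_swapl: "Suc i<length w ==> length(filter P(swapl i w)) = length(filter P w)"
by (metis mset_swapl mset_filter size_mset)

lemma perm_code_rise:
 assumes "rise i w"
 shows "perm_code(swapl i w) = (perm_code w)[i := Suc(perm_code w ! Suc i),Suc i := perm_code w ! i] &
perm_code w ! i <= perm_code w ! Suc i"
using assms
proof (induction i arbitrary: w)
case 0
then obtain x y v where w: "w = x # y # v" by (cases w; cases "tl w") (auto simp: rise_def)
hence xy: "x<y" using 0 by (simp add: rise_def)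
have "length(filter(%z. z<x) v) <= length(filter(%z. z<y) v)"
using xy by (induction v) auto
thus ?case using xy w by simp
next
case (Suc i)
then obtain x v where w: "w = x # v" by (cases w) (auto simp: rise_def)
hence r: "rise i v" using Suc by (simp add: rise_def)
hence "Suc i<length v" by (simp add: rise_def)
thus ?case using Suc.IH[OF r] w by (simp add: length_filter_swapl)
qed

lemma perm_code_fall:
 assumes "Suc i<length w" "w ! Suc i<w ! i"
 shows "perm_code w ! Suc i<perm_code w ! i"
proof -
have r: "rise i(swapl i w)" using assms by (simp add: rise_def)
from perm_code_rise[OF r] assms have
"perm_code w = (perm_code(swapl i w))[i := Suc(perm_code(swapl i w) ! Suc i),Suc i := perm_code(swapl i w) ! i]"
"perm_code(swapl i w) ! i <= perm_code(swapl i w) ! Suc i" by auto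
thus ?thesis using assms
by (metis length_list_update length_perm_code less_Suc_eq_le nth_list_update_eq nth_list_update_neq n_not_Suc_n Suc_lessD length_swapl)
qed

lemma is_perm_distinct: "is_perm w ==> distinct w" by (simp add: is_perm_def)

lemma is_perm_swapl: "Suc i<length w ==> is_perm w ==> is_perm(swapl i w)"
unfolding is_perm_def by (metis distinct_swapl length_swapl mset_swapl set_mset_mset)

lemma perm_rise_iff:
 assumes "is_perm w" "Suc i<length w"
 shows "rise i w \<longleftrightarrow> perm_code w ! i <= perm_code w ! Suc i"
proof -
have "w ! i ~= w ! Suc i" using assms by (simp add: is_perm_def nth_eq_iff_index_eq)
then consider "rise i w" | "w ! Suc i<w ! i" using assms(2) unfolding rise_def by linarith
thus ?thesis
using perm_code_rise perm_code_fall[of i w] assms by (force)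
qed

lemma schub_fuel_indep: "asc w <= k ==> asc w <= k' ==> schub_fuel k w = schub_fuel k' w"
proof (induction k arbitrary: k' w)
case 0
hence "~ rise i w" for i using asc_swapl[of i w] by auto
hence "first_ascent w = None" by (simp add: first_ascent_None)
thus ?case by (cases k') simp_all
next
case (Suc k)
show ?case
proof (cases "first_ascent w")
 case None thus ?thesis by (cases k') simp_all
next
 case (Some i)
 have e: "asc w = Suc(asc(swapl i w))" by (rule asc_swapl[OF first_ascent_rise[OF Some]])
 then obtain l where "k' = Suc l" using Suc(3) by (cases k') auto
 thus ?thesis using Some Suc(1)[of "swapl i w" l] Suc(2,3) unfolding e by simp
qed
qed

lemma schubert_perm_top: "~ (EX i. rise i w) ==> schubert_perm w = xmon(rev [0..<length w])"
proof -
assume "~ (EX i. rise i w)"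
hence "first_ascent w = None" using first_ascent_None by blast
hence "schub_fuel k w = xmon(rev [0..<length w])" for k by (cases k) simp_all
thus ?thesis unfolding schubert_perm_def .
qed

lemma schubert_perm_first: "first_ascent w = Some i ==> schubert_perm w = ddiff i(schubert_perm(swapl i w))"
proof -
assume i: "first_ascent w = Some i"
have e: "asc w = Suc(asc(swapl i w))" by (rule asc_swapl[OF first_ascent_rise[OF i]])
have l: "asc(swapl i w) <= length w ^ 2" using asc_le[of "swapl i w"] by simp
have "schubert_perm w = schub_fuel(Suc(asc(swapl i w))) w"
unfolding schubert_perm_def using e asc_le[of w] by (intro schub_fuel_indep) auto
also have "...=ddiff i(schub_fuel(asc(swapl i w))(swapl i w))" using i by simp
also have "schub_fuel(asc(swapl i w))(swapl i w) = schubert_perm(swapl i w)"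
unfolding schubert_perm_def using l by (intro schub_fuel_indep) auto
finally show ?thesis .
qed

lemma schubert_perm_rise: "rise i w ==> schubert_perm w = ddiff i(schubert_perm(swapl i w))"
proof (rule braid_confluence[where I= "%_. True" and en=rise and T=swapl and meas=asc and val=schubert_perm and D=ddiff])
fix s :: "nat list" and i assume "rise i s"
then obtain j where "first_ascent s = Some j" using first_ascent_None[of s] by (cases "first_ascent s") auto
thus "EX j. rise j s & schubert_perm s = ddiff j(schubert_perm(swapl j s))"
using first_ascent_rise schubert_perm_first by blast
next
fix s :: "nat list" and i assume "rise i s"
thus "True & asc(swapl i s)<asc s" using asc_swapl by simp
next
fix s :: "nat list" and i j assume "rise i s" "rise j s" "Suc i<j"
thus "rise j(swapl i s) & rise i(swapl j s) & swapl i(swapl j s) = swapl j(swapl i s)" by (rule rise_far)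
next
fix s :: "nat list" and i assume "rise i s" "rise(Suc i) s"
thus "rise(Suc i)(swapl i s) & rise i(swapl(Suc i)(swapl i s)) & rise i(swapl(Suc i) s) &
rise(Suc i)(swapl i(swapl(Suc i) s)) &
swapl i(swapl(Suc i)(swapl i s)) = swapl(Suc i)(swapl i(swapl(Suc i) s))" by (rule rise_near)
qed (auto intro: ddiff_commute ddiff_braid)

lemma xmon_incr: "i<length c ==> xmon(c[i := Suc(c ! i)]) = xvar i * xmon c"
proof -
assume i: "i<length c"
have "addK c {i} = c[i := Suc(c ! i)]" by (rule nth_equalityI) (auto simp: nth_addK)
thus ?thesis using xset_mult_xmon[of "{i}" c] i by (simp add: xset_def)
qed

lemma xmon_ln: "ln a = ln b ==> xmon a = xmon b"
by (metis poly_mapping_eqI lookup_nth0 fun_eq_iff ln_def xmon_def)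

lemma perm_code_top:
 assumes "is_perm w" "~ (EX i. rise i w)"
 shows "perm_code w = rev [0..<length w]"
proof (rule nth_equalityI)
fix i assume i: "i<length(perm_code w)"
have p: "partition w" using assms(2) partition_no_rise by blast
have "w ! j<w ! i" if "i<j" "j<length w" for j
proof -
 have "w ! j ~= w ! i" using that assms(1) by (simp add: is_perm_def nth_eq_iff_index_eq)
 thus ?thesis using partition_le[OF p,of i j] that by simp
qed
hence "{j. i<j & j<length w & w ! j<w ! i} = {i<..<length w}" by auto
thus "perm_code w ! i = rev [0..<length w] ! i" using i by (simp add: perm_code_def rev_nth)
qed simp

text \<open>At the first ascent i of w the partition code has c_i = c_{i+1}, and undoing the ascent
  only raises c_i by one. Strict descents of the code before i keep it a partition, and the divided
  difference removes the extra variable from a monomial symmetric in the two variables.\<close>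

lemma schubert_perm_dominant:
 assumes "is_perm w" "partition(perm_code w)"
 shows "schubert_perm w = xmon(perm_code w)"
using assms
proof (induction "asc w" arbitrary: w rule: less_induct)
case less
show ?case
proof (cases "first_ascent w")
 case None
 hence nr: "~ (EX i. rise i w)" using first_ascent_None by blast
 show ?thesis using schubert_perm_top[OF nr] perm_code_top[OF less(2) nr] by simp
next
 case (Some i)
 let ?c = "perm_code w"
 have r: "rise i w" by (rule first_ascent_rise[OF Some])
 hence il: "Suc i<length w" by (simp add: rise_def)
 have "i = (LEAST i. rise i w)" using Some by (auto simp: first_ascent_def rise_def split: if_splits)
 hence nr: "~ rise k w" if "k<i" for k using that not_less_Least by blast
 have eq: "?c ! i = ?c ! Suc i" using perm_code_rise[OF r] less(3) il by (auto simp: partition_def)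
 have code: "perm_code(swapl i w) = ?c[i := Suc(?c ! i)]"
 using perm_code_rise[OF r] il by (simp) (metis eq list_update_id list_update_swap n_not_Suc_n)
 have "partition(?c[i := Suc(?c ! i)])" unfolding partition_def
 proof (intro allI impI)
  fix k assume k: "Suc k<length(?c[i := Suc(?c ! i)])"
  hence ck: "?c ! Suc k <= ?c ! k" using less(3) by (simp add: partition_def)
  show "?c[i := Suc(?c ! i)] ! Suc k <= ?c[i := Suc(?c ! i)] ! k"
  proof (cases "Suc k = i")
   case True
   hence "~ rise k w" using nr by simp
   hence "?c ! Suc k<?c ! k" using perm_rise_iff[OF less(2),of k] k by simp
   thus ?thesis using True k by (simp)
  next
   case False
   thus ?thesis using ck k by (cases "k = i") (auto)
  qed
 qed
 hence "schubert_perm(swapl i w) = xmon(?c[i := Suc(?c ! i)])"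
 using less(1)[of "swapl i w"] asc_swapl[OF r] is_perm_swapl[OF il less(2)] code by simp
 also have "...=xmon ?c * xvar i" using il by (simp add: xmon_incr)
 finally have s: "schubert_perm(swapl i w) = xmon ?c * xvar i" .
 have "swap_poly i(xmon ?c) = xmon ?c" using il eq by (simp add: swap_xmon swapl_eq)
 hence "ddiff i(xmon ?c * xvar i) = xmon ?c" by (simp add: ddiff_mult_sym ddiff_xvar)
 thus ?thesis using schubert_perm_rise[OF r] s by simp
qed
qed

text \<open>Independence of the size of the symmetric group: an ascent of the code is an ascent of
  both permutations, and once the code is a partition both polynomials are the same monomial. This
  makes the choice by \<open>SOME\<close> in \<open>schubert\<close> harmless.\<close>

lemma schubert_perm_code_cong:
 assumes "is_perm w" "is_perm w'" "ln(perm_code w) = ln(perm_code w')"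
 shows "schubert_perm w = schubert_perm w'"
using assms
proof (induction "asc w" arbitrary: w w' rule: less_induct)
case less
let ?c = "perm_code w" and ?c' = "perm_code w'"
have ln: "ln ?c k = ln ?c' k" for k using less(4) by simp
show ?case
proof (cases "partition ?c")
 case True
 have "partition ?c'" unfolding partition_def
 proof (intro allI impI)
  fix i assume i: "Suc i<length ?c'"
  have "ln ?c(Suc i) <= ln ?c i" using True by (auto simp: ln_def partition_def)
  thus "?c' ! Suc i <= ?c' ! i" unfolding ln using i by (simp add: ln_def)
 qed
 thus ?thesis using True less(2,3,4) schubert_perm_dominant xmon_ln by metis
next
 case False
 then obtain i where i: "rise i ?c" using partition_no_rise by blast
 hence il: "Suc i<length w" "?c ! i<?c ! Suc i" by (auto simp: rise_def)
 hence "ln ?c'(Suc i) > 0" using ln[of "Suc i"] by (auto simp: ln_def)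
 hence il': "Suc i<length w'" by (auto simp: ln_def split: if_splits)
 have e: "?c ! i = ?c' ! i" "?c ! Suc i = ?c' ! Suc i" using ln[of i] ln[of "Suc i"] il by (auto simp: ln_def)
 have r: "rise i w" "rise i w'" using perm_rise_iff[OF less(2) il(1)] perm_rise_iff[OF less(3) il'] il e by auto
 have "ln(perm_code(swapl i w)) = ln(perm_code(swapl i w'))"
 proof
  fix k show "ln(perm_code(swapl i w)) k = ln(perm_code(swapl i w')) k"
  using perm_code_rise[OF r(1)] perm_code_rise[OF r(2)] e il il' ln[of k] by (auto simp: ln_def nth_list_update)
 qed
 hence "schubert_perm(swapl i w) = schubert_perm(swapl i w')"
 using less(1)[of "swapl i w" "swapl i w'"] asc_swapl[OF r(1)] is_perm_swapl[OF il(1) less(2)] is_perm_swapl[OF il' less(3)] by simp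
 thus ?thesis using schubert_perm_rise[OF r(1)] schubert_perm_rise[OF r(2)] by simp
qed
qed

lemma perm_code_map_mono: "strict_mono_on(set w) f ==> perm_code(map f w) = perm_code w"
proof (induction w)
case (Cons x w)
have "strict_mono_on(set w) f" using Cons.prems by (auto simp: strict_mono_on_def)
moreover have "length(filter(%y. y<f x)(map f w)) = length(filter(%y. y<x) w)"
proof -
 have "f y<f x \<longleftrightarrow> y<x" if "y : set w" for y
 using Cons.prems that by (metis list.set_intros(1,2) strict_mono_on_less)
 hence "filter(%y. f y<f x) w = filter(%y. y<x) w" by (intro filter_cong) auto
 thus ?thesis by (simp add: comp_def)
qed
ultimately show ?case using Cons by simp
qed simp

text \<open>Lehmer's construction: prepend \<open>Suc x\<close> and shift the values above x, which
  leaves the code of the tail unchanged.\<close>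

lemma perm_of_code:
 assumes "!!i. i<length c ==> c ! i+i<length c"
 shows "EX w. is_perm w & perm_code w = c"
using assms
proof (induction c)
case Nil show ?case by (intro exI[of _ "[]"]) (simp add: is_perm_def)
next
case (Cons x c)
have "c ! i+i<length c" if "i<length c" for i using Cons.prems[of "Suc i"] that by simp
then obtain w where w: "is_perm w" "perm_code w = c" using Cons.IH by blast
have x: "x <= length c" using Cons.prems[of 0] by simp
have lw: "length w = length c" using w(2) by (metis length_perm_code)
let ?f = "%y. if x<y then Suc y else y"
have mono: "strict_mono_on(set w) ?f" by (rule strict_mono_onI) auto
have "length(filter(%y. y<Suc x)(map ?f w)) = length(filter(%y. y <= x) w)"
by (simp) (rule arg_cong[where f=length],rule filter_cong,auto)
also have "...=card(set(filter(%y. y <= x) w))" using w(1) by (metis distinct_card distinct_filter is_perm_distinct)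
also have "set(filter(%y. y <= x) w) = {1..x}" using w(1) x lw by (auto simp: is_perm_def)
finally have len: "length(filter(%y. y<Suc x)(map ?f w)) = x" by simp
have "is_perm(Suc x # map ?f w)"
proof -
 have d: "distinct(map ?f w)" using mono is_perm_distinct[OF w(1)] by (simp add: distinct_map strict_mono_on_imp_inj_on)
 have im: "?f ` {1..length w} = {1..Suc(length w)}-{Suc x}"
 proof (rule set_eqI)
  fix z show "z : ?f ` {1..length w} \<longleftrightarrow> z : {1..Suc(length w)}-{Suc x}"
  proof (cases "z <= x")
   case True thus ?thesis using x lw by (auto)
  next
   case False
   thus ?thesis by (cases z) (auto)
  qed
 qed
 hence "insert(Suc x)(?f ` set w) = {1..Suc(length w)}" using w(1) x lw by (auto simp: is_perm_def)
 moreover have "Suc x ~: set(map ?f w)" by auto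
 ultimately show ?thesis using d by (simp add: is_perm_def)
qed
thus ?case using len w(2) perm_code_map_mono[OF mono] by (intro exI[of _ "Suc x # map ?f w"]) simp
qed

lemma strip0_snoc: "strip0(a @ [x]) = (if x = 0 then strip0 a else a @ [x])"
by (simp add: strip0_def)

lemma strip0_replicate: "strip0(a @ replicate k 0) = strip0 a"
by (induction k) (simp_all add: strip0_snoc replicate_append_same[symmetric] flip: append_assoc)

lemma ln_strip0: "ln(strip0 a) = ln a"
by (induction a rule: rev_induct) (auto simp: ln_def nth_append strip0_def)

lemma strip0_ln: "strip0 a = strip0 b \<longleftrightarrow> ln a = ln b"
proof
assume l: "ln a = ln b"
have "a @ replicate(length b) 0 = b @ replicate(length a) 0"
proof (rule nth_equalityI)
 fix k assume "k<length(a @ replicate(length b) 0)"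
 thus "(a @ replicate(length b) 0) ! k = (b @ replicate(length a) 0) ! k"
 using fun_cong[OF l,of k] by (auto simp: ln_def nth_append)
qed simp
thus "strip0 a = strip0 b" by (metis strip0_replicate)
next
assume "strip0 a = strip0 b" thus "ln a = ln b" by (metis ln_strip0)
qed

lemma schubert_ln: "ln a = ln b ==> schubert a = schubert b"
unfolding schubert_def by (simp add: strip0_ln)

lemma schubert_perm_eq: "is_perm w ==> ln(perm_code w) = ln a ==> schubert a = schubert_perm w"
by (smt(verit) someI strip0_ln schubert_perm_code_cong schubert_def strip0_ln)

lemma schubert_perm_ex: "EX w. is_perm w & ln(perm_code w) = ln a & length a <= length w"
proof -
\<comment> \<open>Enough zeros to satisfy the bound of \<open>perm_of_code\<close>, every part being
  at most the sum.\<close>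
let ?c = "a @ replicate(sum_list a) 0"
have "?c ! i+i<length ?c" if "i<length ?c" for i
using that member_le_sum_list[of "a ! i" a] by (auto simp: nth_append)
then obtain w where w: "is_perm w" "perm_code w = ?c" using perm_of_code by blast
moreover have "length w = length ?c" using w by (metis length_perm_code)
moreover have "ln ?c = ln a" by (auto simp: ln_def nth_append)
ultimately show ?thesis by (intro exI[of _ w]) simp
qed

lemma schubert_snoc0 [simp]: "schubert(a @ [0]) = schubert a"
by (rule schubert_ln) (auto simp: ln_def nth_append)

lemma schubert_partition:
 assumes "partition a" shows "schubert a = xmon a"
proof -
obtain w where w: "is_perm w" "ln(perm_code w) = ln a" using schubert_perm_ex by blast
have "partition(perm_code w)" unfolding partition_def
proof (intro allI impI)
 fix i assume i: "Suc i<length(perm_code w)"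
 have "ln a(Suc i) <= ln a i" using assms by (auto simp: ln_def partition_def)
 thus "perm_code w ! Suc i <= perm_code w ! i" unfolding w(2)[symmetric] using i by (simp add: ln_def)
qed
thus ?thesis using w schubert_perm_eq schubert_perm_dominant xmon_ln by metis
qed

text \<open>The recursion transported from permutations to codes, where it no longer refers to a
  representative.\<close>

lemma ddiff_schubert:
 assumes i: "Suc i<length a"
 shows "ddiff i(schubert a) = (if a ! Suc i<a ! i then schubert(a[i := a ! Suc i,Suc i := a ! i-1]) else 0)"
proof -
obtain w where w: "is_perm w" "ln(perm_code w) = ln a" "length a <= length w" using schubert_perm_ex by blast
have iw: "Suc i<length w" using w(3) i by simp
have S: "schubert a = schubert_perm w" by (rule schubert_perm_eq[OF w(1,2)])
have e: "perm_code w ! k = ln a k" if "k<length w" for k using fun_cong[OF w(2),of k] that by (simp add: ln_def)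
have ei: "perm_code w ! i = a ! i" "perm_code w ! Suc i = a ! Suc i" using e[of i] e[of "Suc i"] i iw by (auto simp: ln_def)
show ?thesis
proof (cases "a ! Suc i<a ! i")
 case True
 let ?v = "swapl i w"
 have "~ rise i w" using perm_rise_iff[OF w(1) iw] ei True by simp
 moreover have "w ! i ~= w ! Suc i" using w(1) iw by (simp add: is_perm_def nth_eq_iff_index_eq)
 ultimately have r: "rise i ?v" using iw by (auto simp: rise_def)
 have pv: "is_perm ?v" by (rule is_perm_swapl[OF iw w(1)])
 have c: "perm_code w = (perm_code ?v)[i := Suc(perm_code ?v ! Suc i),Suc i := perm_code ?v ! i]"
 using perm_code_rise[OF r] iw by simp
 have "ln(perm_code ?v) = ln(a[i := a ! Suc i,Suc i := a ! i-1])"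
 proof
  fix k
  have vi: "Suc(perm_code ?v ! Suc i) = a ! i" "perm_code ?v ! i = a ! Suc i"
  using arg_cong[OF c,of "%l. l ! i"] arg_cong[OF c,of "%l. l ! Suc i"] iw ei by (simp_all)
  have vk: "perm_code ?v ! k = perm_code w ! k" if "k ~= i" "k ~= Suc i" using arg_cong[OF c,of "%l. l ! k"] that by simp
  show "ln(perm_code ?v) k = ln(a[i := a ! Suc i,Suc i := a ! i-1]) k"
  using vi vk i iw fun_cong[OF w(2),of k] by (auto simp: ln_def nth_list_update)
 qed
 hence "schubert(a[i := a ! Suc i,Suc i := a ! i-1]) = schubert_perm ?v" by (rule schubert_perm_eq[OF pv])
 also have "...=ddiff i(schubert_perm w)" using schubert_perm_rise[OF r] iw by simp
 finally show ?thesis using True S by simp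
next
 case False
 hence "rise i w" using perm_rise_iff[OF w(1) iw] ei by simp
 hence "schubert_perm w = ddiff i(schubert_perm(swapl i w))" by (rule schubert_perm_rise)
 thus ?thesis using False S by simp
qed
qed

lemma schubert_rise:
 assumes "rise i a"
 shows "schubert a = ddiff i(schubert(a[i := Suc(a ! Suc i),Suc i := a ! i]))"
proof -
have i: "Suc i<length a" "a ! i<a ! Suc i" using assms by (auto simp: rise_def)
have "(a[i := Suc(a ! Suc i),Suc i := a ! i])[i := a ! i,Suc i := a ! Suc i] = a"
by (rule nth_equalityI) (use i in \<open>auto simp: nth_list_update\<close>)
thus ?thesis using ddiff_schubert[of i "a[i := Suc(a ! Suc i),Suc i := a ! i]"] i by simp
qed

text \<open>The product of the first n variables is symmetric in all variables concerned, so it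
  passes through the divided differences; for partitions the claim is one about monomials.\<close>

lemma schubert_map_Suc:
 assumes "length c = n"
 shows "schubert(map Suc c) = xset {..<n} * schubert c"
proof -
\<comment> \<open>Undoing an ascent raises the sum of the code. The bound c_i + i < m survives,
  because the part that moves one place to the left grows by one, and it caps the sum by n *
  m.\<close>
define m where "m = n+sum_list c"
have "ALL i<n. c ! i+i<m"
proof (intro allI impI)
 fix i assume "i<n"
 thus "c ! i+i<m" using assms member_le_sum_list[of "c ! i" c] by (simp add: m_def)
qed
with assms show ?thesis
proof (induction "n * m-sum_list c" arbitrary: c rule: less_induct)
 case less
 show ?case
 proof (cases "EX i. rise i c")
  case False
  hence "partition c" using partition_no_rise by blast
  moreover hence "partition(map Suc c)" by (simp add: partition_def)
  moreover have "addK c {..<n} = map Suc c" by (rule nth_equalityI) (auto simp: nth_addK less(2))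
  ultimately show ?thesis using xset_mult_xmon[of "{..<n}" c] less(2) by (simp add: schubert_partition)
 next
  case True
  then obtain i where r: "rise i c" by blast
  hence i: "Suc i<n" "c ! i<c ! Suc i" using less(2) by (auto simp: rise_def)
  let ?c = "c[i := Suc(c ! Suc i),Suc i := c ! i]"
  have b: "ALL k<n. ?c ! k+k<m"
  using less(3) i less(2) by (auto simp: nth_list_update)
  have sum: "sum_list ?c = Suc(sum_list c)"
  using i less(2) by (auto simp: sum_list_update)
  have le: "sum_list ?c <= n * m"
  proof -
   have "sum_list ?c = (SUM k<n. ?c ! k)" using less(2) by (simp add: sum_list_lessThan)
   also have "...<=(SUM k<n. m)" by (rule sum_mono) (use b in \<open>auto\<close>)
   finally show ?thesis by simp
  qed
  have IH: "schubert(map Suc ?c) = xset {..<n} * schubert ?c"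
  by (rule less(1)) (use sum le less(2) b in auto)
  have r': "rise i(map Suc c)" using r by (simp add: rise_def)
  have "schubert(map Suc c) = ddiff i(schubert(map Suc ?c))"
  using schubert_rise[OF r'] i less(2) by (simp add: map_update)
  also have "...=xset {..<n} * ddiff i(schubert ?c)"
  unfolding IH by (rule ddiff_mult_sym,rule swap_xset_same) (use i in auto)
  finally show ?thesis using schubert_rise[OF r] by simp
 qed
qed
qed

lemma xset_foldr_pidiff:
 assumes "!!i. i : set is ==> swap_poly i g = g"
 shows "g * foldr pidiff is f = foldr pidiff is(g * f)"
using assms
proof (induction "is")
case (Cons i "is")
have "g * foldr pidiff(i # is) f = pidiff i(g * foldr pidiff is f)" using pidiff_mult_sym[of i g] Cons.prems by simp
thus ?case using Cons by simp
qed simp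

text \<open>A divided difference moves the zero one place to the left, from (e_j + 1, 0) to (0,
  e_j); the factor \<open>xvar j\<close> of \<open>xset {..<Suc j}\<close> turns it into
  \<open>pidiff j\<close>.\<close>

lemma schubert_insert_zero:
 assumes e: "length e = N" and "j <= N"
 shows "schubert(map Suc(take j e) @ 0 # drop j e) = foldr pidiff [j..<N](xset {..<j} * schubert e)"
using assms(2)
proof (induction rule: inc_induct)
case base
show ?case using e schubert_map_Suc[OF e] by simp
next
case (step j)
let ?d = "map Suc(take(Suc j) e) @ 0 # drop(Suc j) e"
have x: "xset {..<k} * foldr pidiff [k..<N](schubert e) = foldr pidiff [k..<N](xset {..<k} * schubert e)" for k
by (rule xset_foldr_pidiff,rule swap_xset_same) auto
have "?d[j := ?d ! Suc j,Suc j := ?d ! j-1] = map Suc(take j e) @ 0 # drop j e"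
using step(2) e by (intro nth_equalityI) (auto simp: nth_append nth_list_update nth_Cons' min_def not_less less_Suc_eq intro!: arg_cong[where f= "(!) e"])
moreover have "?d ! Suc j = 0" "?d ! j = Suc(e ! j)" using step(2) e by (auto simp: nth_append)
ultimately have "schubert(map Suc(take j e) @ 0 # drop j e) = ddiff j(schubert ?d)"
using ddiff_schubert[of j ?d] step(2) e by simp
also have "...=ddiff j(xset {..<Suc j} * foldr pidiff [Suc j..<N](schubert e))"
using step(3) x[of "Suc j"] by simp
also have "xset {..<Suc j} = xset {..<j} * xvar j" by (simp add: xset_def)
also have "ddiff j(xset {..<j} * xvar j * foldr pidiff [Suc j..<N](schubert e)) = xset {..<j} * pidiff j(foldr pidiff [Suc j..<N](schubert e))"
by (simp only: mult.assoc pidiff_def,rule ddiff_mult_sym,rule swap_xset_same) auto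
also have "pidiff j(foldr pidiff [Suc j..<N](schubert e)) = foldr pidiff [j..<N](schubert e)"
using step(2) by (simp add: upt_conv_Cons)
finally show ?case using x[of j] by simp
qed

text \<open>Every code arises from the empty one by adding 1 throughout or by inserting a zero
  behind entries raised by 1; the first zero of the code, if any, tells which. Both operations are
  understood on Schubert polynomials.\<close>

lemma code_induct [consumes 1,case_names Nil positive zero]:
 assumes "length c = n" and nil: "P 0 []"
 and pos: "!!n c. length c = n ==> 0<n ==> P n c ==> P n(map Suc c)"
 and zero: "!!N e j. length e = N ==> j <= N ==> P N e ==> P(Suc N)(map Suc(take j e) @ 0 # drop j e)"
 shows "P n c"
using assms(1)
proof (induction "n+sum_list c" arbitrary: n c rule: less_induct)
case less
show ?case
proof (cases "n = 0")
 case True thus ?thesis using less(2) nil by simp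
next
 case n: False
 show ?thesis
 proof (cases "0 : set c")
  case False
  let ?c = "map(%x. x-1) c"
  have c: "map Suc ?c = c" using False by (induction c) auto
  have "sum_list(map Suc ?c) = sum_list ?c+n" using less(2) by (simp add: sum_list_Suc comp_def)
  hence "sum_list c = sum_list ?c+n" unfolding c .
  hence "P n ?c" using less n by simp
  from pos[OF _ _ this] show ?thesis unfolding c using less(2) n by simp
 next
  case True
  then obtain u v where c: "c = u @ 0 # v" and u: "0 ~: set u" using split_list_first by fast
  let ?e = "map(%x. x-1) u @ v"
  have mu: "map Suc(map(%x. x-1) u) = u" using u by (induction u) auto
  have le: "Suc(length ?e) = n" using less(2) c by simp
  have "sum_list(map(%x. x-1) u) <= sum_list u" by (induction u) auto
  hence "P(length ?e) ?e" using le c by (intro less(1)) auto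
  from zero[OF HOL.refl _ this,of "length u"] have "P(Suc(length ?e))(map Suc(map(%x. x-1) u) @ 0 # v)" by simp
  thus ?thesis unfolding mu le c .
 qed
qed
qed

section \<open>Appending a zero, and atom positivity of Schubert polynomials\<close>

lemma partition_snoc0: "partition d ==> partition(d @ [0])"
by (auto simp: partition_def nth_append)

lemma xmon_snoc0: "xmon(d @ [0]) = xmon d" by (simp add: xmon_snoc)

lemma swapl_append: "Suc i<length d ==> swapl i(d @ x) = swapl i d @ x"
by (simp add: swapl_def nth_append list_update_append)

lemma atom_snoc0: "atom(d @ [0]) = atom d"
proof -
have "length d = length d" by simp
thus ?thesis
proof (induction rule: partition_induct)
 case (sorted b)
 thus ?case by (simp add: atom_partition partition_snoc0 xmon_snoc0)
next
 case (swap b i)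
 hence "atom(b @ [0]) = hdiff i(atom(swapl i(b @ [0])))" by (intro atom_unswap) (auto simp: nth_append)
 thus ?case using swap atom_unswap[of i b] by (simp add: swapl_append)
qed
qed

lemma cone_atom_mono: "f : cone atom N ==> f : cone atom(Suc N)"
proof (rule cone_linear[of f atom N "%f. f"])
fix b :: "nat list" assume "length b = N"
thus "atom b : cone atom(Suc N)" using cone_base[of "b @ [0]" "Suc N" atom] by (simp add: atom_snoc0)
qed simp_all

lemma foldr_pidiff_cone: "f : cone atom n ==> (!!i. i : set is ==> Suc i<n) ==> foldr pidiff is f : cone atom n"
by (induction "is") (auto intro: pidiff_cone)

lemma foldr_pidiff_polys: "f : polys n ==> (!!i. i : set is ==> Suc i<n) ==> foldr pidiff is f : polys n"
by (induction "is") (auto intro: pidiff_polys)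

lemma schubert_Nil: "schubert [] = 1"
by (simp add: schubert_partition partition_def)

lemma schubert_cone: "length c = n ==> schubert c : cone atom n"
proof (induction rule: code_induct)
case Nil
show ?case using cone_base[of "[]" 0 atom] by (simp add: schubert_Nil atom_partition partition_def)
next
case (positive n c)
thus ?case by (simp add: schubert_map_Suc xset_cone)
next
case (zero N e j)
thus ?case unfolding schubert_insert_zero[OF zero(1,2)]
by (intro foldr_pidiff_cone xset_cone cone_atom_mono) auto
qed

section \<open>Leading terms of Schubert polynomials\<close>

lemma coef_xvar_mult:
 assumes "g : polys n" "length e = n" "k<n"
 shows "coef(xvar k * g) e = (if e ! k = 0 then 0 else coef g(e[k := e ! k-1]))"
proof -
let ?m = "map(%i. if i : {k} then 1 else 0) [0..<n]"
have x: "xvar k = xmon ?m" using xset_xmon[of "{k}" n] assms(3) by (simp add: xset_def)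
have "map2(-) e ?m = e[k := e ! k-1]" using assms by (intro nth_equalityI) (auto)
moreover have "(ALL p<n. ?m ! p <= e ! p) \<longleftrightarrow> e ! k ~= 0"
using assms(3) by auto
ultimately show ?thesis unfolding x using coef_xmon_mult[OF assms(1) _ assms(2),of ?m] by simp
qed

lemma pidiff_eq: "xvar i * pidiff i f-xvar(Suc i) * pidiff i f = xvar i * f-xvar(Suc i) * swap_poly i f"
using ddiff_eq[of i "xvar i * f"] by (simp add: pidiff_def left_diff_distrib swapidx_def)

lemma coef_pidiff_zero:
 assumes f: "f : polys n" and d: "length d = n" and i: "Suc i<n" "d ! i = 0"
 shows "coef(pidiff i f) d = coef f(swapl i d)"
proof -
let ?e = "d[Suc i := Suc(d ! Suc i)]"
have e: "?e[Suc i := ?e ! Suc i-1] = d" "?e ! i = 0" "?e ! Suc i = Suc(d ! Suc i)" using d i by auto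
have "coef(xvar i * pidiff i f-xvar(Suc i) * pidiff i f) ?e = coef(xvar i * f-xvar(Suc i) * swap_poly i f) ?e"
by (simp only: pidiff_eq)
thus ?thesis using d i by (simp add: coef_xvar_mult[OF f] coef_xvar_mult[OF pidiff_polys[OF i(1) f]]
coef_xvar_mult[OF swap_polys[OF i(1) f]] coef_swap)
qed

text \<open>Compare the coefficients of x^d times \<open>xvar (Suc i)\<close> in
  \<open>pidiff_eq\<close>; iterating lowers d_i until \<open>coef_pidiff_zero\<close>
  applies.\<close>

lemma coef_pidiff_pos:
 assumes f: "f : polys n" and d: "length d = n" and i: "Suc i<n" "d ! i ~= 0"
 defines "d' == d[i := d ! i-1,Suc i := Suc(d ! Suc i)]"
 shows "coef(pidiff i f) d = coef(pidiff i f) d'-coef f d'+coef f(swapl i d)"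
proof -
let ?e = "d[Suc i := Suc(d ! Suc i)]"
have e: "?e[Suc i := ?e ! Suc i-1] = d" "?e[i := ?e ! i-1] = d'" "?e ! i = d ! i" "?e ! Suc i = Suc(d ! Suc i)"
using d i by (auto simp: d'_def list_update_swap)
have "coef(xvar i * pidiff i f-xvar(Suc i) * pidiff i f) ?e = coef(xvar i * f-xvar(Suc i) * swap_poly i f) ?e"
by (simp only: pidiff_eq)
thus ?thesis using d i e by (simp add: coef_xvar_mult[OF f] coef_xvar_mult[OF pidiff_polys[OF i(1) f]]
coef_xvar_mult[OF swap_polys[OF i(1) f]] coef_swap)
qed

definition psum :: "nat list => nat => nat" where
"psum b k = (SUM p<k. b ! p)"

lemma psum_pair:
 assumes "length b = n" "length d = n" "Suc i<n" "b ! i+b ! Suc i = d ! i+d ! Suc i"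
"!!p. p ~= i ==> p ~= Suc i ==> p<n ==> b ! p = d ! p" "k <= n" "k ~= Suc i"
 shows "psum b k = psum d k"
proof (cases "k <= i")
case True
thus ?thesis unfolding psum_def using assms by (intro sum.cong) auto
next
case False
have s: "psum x k = x ! i+x ! Suc i+(SUM p:{..<k}-{i,Suc i}. x ! p)" for x
proof -
 have "psum x k = (SUM p:{i,Suc i}. x ! p)+(SUM p:{..<k}-{i,Suc i}. x ! p)" unfolding psum_def
 using False assms(7) by (intro sum.subset_diff[THEN trans,OF _ _ add.commute]) auto
 thus ?thesis by simp
qed
have "(SUM p:{..<k}-{i,Suc i}. b ! p) = (SUM p:{..<k}-{i,Suc i}. d ! p)"
using assms(5,6) by (intro sum.cong) auto
thus ?thesis using assms(4) by (simp add: s)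
qed

text \<open>Along that recursion exponents move between the positions i and \<open>Suc i\<close>
  only, so only the partial sum ending between them can change.\<close>

lemma coef_pidiff_support:
 assumes f: "f : polys n" and i: "Suc i<n"
 shows "length d = n ==> coef(pidiff i f) d ~= 0 ==> 
EX b. length b = n & coef f b ~= 0 & (ALL k <= n. k ~= Suc i --> psum b k = psum d k)"
proof (induction "d ! i" arbitrary: d)
case 0
hence "coef f(swapl i d) ~= 0" using coef_pidiff_zero[OF f] i by simp
moreover have "psum(swapl i d) k = psum d k" if "k <= n" "k ~= Suc i" for k
by (rule psum_pair[of _ n _ i]) (use 0 i that in \<open>auto simp: nth_swapl swapidx_def\<close>)
ultimately show ?case using 0 by (intro exI[of _ "swapl i d"]) auto
next
case (Suc x)
let ?d = "d[i := d ! i-1,Suc i := Suc(d ! Suc i)]"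
have pd: "psum ?d k = psum d k" if "k <= n" "k ~= Suc i" for k
by (rule psum_pair[of _ n _ i]) (use Suc i that in \<open>auto\<close>)
have ps: "psum(swapl i d) k = psum d k" if "k <= n" "k ~= Suc i" for k
by (rule psum_pair[of _ n _ i]) (use Suc i that in \<open>auto simp: nth_swapl swapidx_def\<close>)
consider "coef(pidiff i f) ?d ~= 0" | "coef f ?d ~= 0" | "coef f(swapl i d) ~= 0"
using coef_pidiff_pos[OF f Suc(3) i] Suc(2,4) by fastforce
thus ?case
proof cases
 case 1
 have "x = ?d ! i" "length ?d = n" using Suc(2,3) i by simp_all
 from Suc(1)[OF this 1] obtain b where b: "length b = n" "coef f b ~= 0" "ALL k <= n. k ~= Suc i --> psum b k = psum ?d k" by blast
 thus ?thesis using pd by (intro exI[of _ b]) auto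
next
 case 2 thus ?thesis using pd Suc(3) by (intro exI[of _ ?d]) auto
next
 case 3 thus ?thesis using ps Suc(3) by (intro exI[of _ "swapl i d"]) auto
qed
qed

text \<open>The exponent c is the least one of f in the order of partial sums. Unlike a statement
  about \<open>rk\<close> alone, this can be followed through pi_i when a zero moves to the
  left.\<close>

definition leads :: "nat => mpoly => nat list => bool" where
"leads n f c \<longleftrightarrow> length c = n & f : polys n & coef f c = 1 &
(ALL b. length b = n --> coef f b ~= 0 --> psum b n = psum c n & (ALL k <= n. psum c k <= psum b k))"

lemma leads_pidiff:
 assumes l: "leads n f c" and i: "Suc i<n" "c ! Suc i = 0"
 shows "leads n(pidiff i f)(swapl i c)"
proof -
have c: "length c = n" "f : polys n" "coef f c = 1"
and b: "!!b. length b = n ==> coef f b ~= 0 ==> psum b n = psum c n & (ALL k <= n. psum c k <= psum b k)"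
using l unfolding leads_def by blast+
have pc: "psum(swapl i c) k = psum c k" if "k <= n" "k ~= Suc i" for k
by (rule psum_pair[of _ n _ i]) (use c i that in \<open>auto simp: nth_swapl swapidx_def\<close>)
have pc2: "psum(swapl i c)(Suc i) = psum c i" using pc[of i] i c by (simp add: psum_def)
show ?thesis unfolding leads_def
proof (intro conjI allI impI)
 show "coef(pidiff i f)(swapl i c) = 1" using coef_pidiff_zero[OF c(2),of "swapl i c" i] c i by simp
next
 fix d assume d: "length d = n" "coef(pidiff i f) d ~= 0"
 then obtain b' where b': "length b' = n" "coef f b' ~= 0" "!!k. k <= n ==> k ~= Suc i ==> psum b' k = psum d k"
 using coef_pidiff_support[OF c(2) i(1)] by blast
 show "psum d n = psum(swapl i c) n" using b[OF b'(1,2)] b'(3)[of n] pc[of n] i by simp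
 fix k assume k: "k <= n"
 show "psum(swapl i c) k <= psum d k"
 proof (cases "k = Suc i")
  case True
  \<comment> \<open>At the one partial sum that is not controlled, the swapped c has just passed a
    zero part, so its value is the preceding partial sum and as small as possible.\<close>
  have "psum c i <= psum b' i" using b[OF b'(1,2)] i by simp
  also have "...=psum d i" using b'(3)[of i] i by simp
  also have "psum d i <= psum d(Suc i)" by (simp add: psum_def)
  finally show ?thesis using pc2 True by simp
 next
  case False
  have "psum c k <= psum b' k" using b[OF b'(1,2)] k by simp
  thus ?thesis using False b'(3)[of k] pc[of k] k by simp
 qed
qed (use c i in \<open>auto intro: pidiff_polys\<close>)
qed

lemma leads_xmon_mult:
 assumes l: "leads n f c" and m: "length m = n"
 shows "leads n(xmon m * f)(map2(+) c m)"
proof -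
have c: "length c = n" "f : polys n" "coef f c = 1"
and b: "!!b. length b = n ==> coef f b ~= 0 ==> psum b n = psum c n & (ALL k <= n. psum c k <= psum b k)"
using l unfolding leads_def by blast+
have pc: "psum(map2(+) c m) k = psum c k+psum m k" if "k <= n" for k
using that c m by (simp add: psum_def sum.distrib[symmetric])
show ?thesis unfolding leads_def
proof (intro conjI allI impI)
 have "map2(-)(map2(+) c m) m = c" using c m by (intro nth_equalityI) auto
 thus "coef(xmon m * f)(map2(+) c m) = 1" using coef_xmon_mult[OF c(2) m,of "map2(+) c m"] c m by simp
next
 fix d assume d: "length d = n" "coef(xmon m * f) d ~= 0"
 hence le: "ALL p<n. m ! p <= d ! p" and nz: "coef f(map2(-) d m) ~= 0"
 using coef_xmon_mult[OF c(2) m d(1)] by (auto split: if_splits)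
 have pd: "psum d k = psum(map2(-) d m) k+psum m k" if "k <= n" for k
 using that d m le by (simp add: psum_def sum.distrib[symmetric])
 show "psum d n = psum(map2(+) c m) n" using b[OF _ nz] pd[of n] pc[of n] d m by simp
 fix k assume k: "k <= n"
 show "psum(map2(+) c m) k <= psum d k" using b[OF _ nz] pd[OF k] pc[OF k] d m k by simp
next
 show "xmon m * f : polys n" using c m by (intro polys_mult xmon_polys) auto
qed (use c m in auto)
qed

lemma coef_snoc:
 assumes "f : polys N" "length b = N"
 shows "coef f(b @ [x]) = (if x = 0 then coef f b else 0)"
proof (cases "x = 0")
case True
have "Poly_Mapping.nth(b @ [0]) = Poly_Mapping.nth b"
by (intro poly_mapping_eqI) (auto simp: lookup_nth0 nth_append)
thus ?thesis using True by (simp add: coef_def)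
next
case False
have "Poly_Mapping.nth(b @ [x]) ~: Poly_Mapping.keys f"
proof
 assume "Poly_Mapping.nth(b @ [x]) : Poly_Mapping.keys f"
 hence "Poly_Mapping.keys(Poly_Mapping.nth(b @ [x])) <= {..<N}" using assms(1) by (auto simp: polys_def)
 moreover have "N : Poly_Mapping.keys(Poly_Mapping.nth(b @ [x]))" using False assms(2) by (auto simp: in_keys_iff lookup_nth0)
 ultimately show False by auto
qed
thus ?thesis using False by (simp add: coef_def in_keys_iff)
qed

lemma polys_mono: "f : polys N ==> N <= n ==> f : polys n"
by (fastforce simp: polys_def)

lemma leads_snoc0:
 assumes l: "leads N f c" shows "leads(Suc N) f(c @ [0])"
proof -
have c: "length c = N" "f : polys N" "coef f c = 1"
and b: "!!b. length b = N ==> coef f b ~= 0 ==> psum b N = psum c N & (ALL k <= N. psum c k <= psum b k)"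
using l unfolding leads_def by blast+
have ps: "psum(b @ [0]) k = psum b(min k N)" if "length b = N" "k <= Suc N" for b k
using that by (cases "k = Suc N") (auto simp: psum_def nth_append)
show ?thesis unfolding leads_def
proof (intro conjI allI impI)
 show "coef f(c @ [0]) = 1" using coef_snoc[OF c(2,1)] c by simp
next
 fix d assume d: "length d = Suc N" "coef f d ~= 0"
 then obtain b' x where d': "d = b' @ [x]" "length b' = N" by (metis length_Suc_conv_rev)
 hence x: "x = 0" "coef f b' ~= 0" using coef_snoc[OF c(2) d'(2)] d by (auto split: if_splits)
 show "psum d(Suc N) = psum(c @ [0])(Suc N)" using b[OF d'(2) x(2)] ps[of b' "Suc N"] ps[of c "Suc N"] c d' x by simp
 fix k assume "k <= Suc N"
 thus "psum(c @ [0]) k <= psum d k" using b[OF d'(2) x(2)] ps[of b' k] ps[of c k] c d' x by simp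
qed (use c polys_mono in auto)
qed

lemma leads_foldr_pidiff:
 assumes c: "length c = N" and l: "leads(Suc N) f(c @ [0])" and "j <= N"
 shows "leads(Suc N)(foldr pidiff [j..<N] f)(take j c @ 0 # drop j c)"
using assms(3)
proof (induction rule: inc_induct)
case base thus ?case using l c by simp
next
case (step j)
let ?c = "take(Suc j) c @ 0 # drop(Suc j) c"
have "swapl j ?c = take j c @ 0 # drop j c" using step(2) c
by (intro nth_equalityI) (auto simp: swapl_def nth_append nth_list_update intro!: arg_cong[where f= "(!) c"])
moreover have "leads(Suc N)(pidiff j(foldr pidiff [Suc j..<N] f))(swapl j ?c)"
by (rule leads_pidiff[OF step(3)]) (use step(2) c in \<open>auto simp: nth_append\<close>)
ultimately show ?case using step(2) by (simp add: upt_conv_Cons)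
qed

lemma leads_schubert: "length c = n ==> leads n(schubert c) c"
proof (induction rule: code_induct)
case Nil
thus ?case using coef_xmon[of "[]" "[]"] xmon_polys[of "[]" 0] by (simp add: leads_def schubert_Nil)
next
case (positive n c)
let ?m = "map(%k. if k : {..<n} then 1 else 0) [0..<n]"
have "map2(+) c ?m = map Suc c" using positive(1) by (intro nth_equalityI) auto
thus ?case using leads_xmon_mult[OF positive(3),of ?m] xset_xmon[of "{..<n}" n] positive(1) by (simp add: schubert_map_Suc)
next
case (zero N e j)
let ?m = "map(%k. if k : {..<j} then 1 else 0) [0..<Suc N]"
let ?c = "map Suc(take j e) @ drop j e"
have "map2(+)(e @ [0]) ?m = ?c @ [0]" using zero(1,2)
by (intro nth_equalityI) (auto simp: nth_append less_Suc_eq del: upt_Suc)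
moreover have "xset {..<j} = xmon ?m" using zero(2) by (intro xset_xmon) auto
ultimately have "leads(Suc N)(xset {..<j} * schubert e)(?c @ [0])"
using leads_xmon_mult[OF leads_snoc0[OF zero(3)],of ?m] by simp
from leads_foldr_pidiff[OF _ this zero(2)] zero(1,2) show ?case unfolding schubert_insert_zero[OF zero(1,2)] by (simp)
qed

lemma psum_Suc: "psum b(Suc k) = psum b k+b ! k" by (simp add: psum_def)

lemma rk_psum: "rk b = (SUM k <= length b. psum b k)"
proof -
have "(SUM k <= m. psum b k) = (SUM j<m. (m-j) * b ! j)" for m
proof (induction m)
 case (Suc m)
 have "(SUM j<Suc m. (Suc m-j) * b ! j) = (SUM j<m. (m-j) * b ! j+b ! j)+b ! m"
 by (simp add: algebra_simps)
 thus ?case using Suc by (simp add: sum.distrib) (simp add: psum_def)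
qed (simp add: psum_def)
thus ?thesis by (simp add: rk_def)
qed

lemma psum_inj:
 assumes "length b = n" "length c = n" "!!k. k <= n ==> psum b k = psum c k"
 shows "b = c"
proof (rule nth_equalityI)
fix k assume "k<length b"
thus "b ! k = c ! k" using assms(3)[of k] assms(3)[of "Suc k"] assms(1) by (simp add: psum_Suc)
qed (use assms in simp)

text \<open>\<open>rk\<close> is the sum of the partial sums, so dominance with equal
  \<open>rk\<close> forces equality.\<close>

lemma triangular_leads:
 assumes "!!c. length c = n ==> leads n(g c) c"
 shows "triangular g n"
unfolding triangular_def
proof (intro allI impI conjI)
fix a b :: "nat list" assume a: "length a = n" and b: "length b = n" "coef(g a) b ~= 0"
have l: "psum b n = psum a n" "!!k. k <= n ==> psum a k <= psum b k" using assms[OF a] b unfolding leads_def by blast+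
have le: "rk a <= rk b" unfolding rk_psum a b(1) by (rule sum_mono) (use l(2) in simp)
have "b = a" if "rk a = rk b"
proof -
 have s: "(SUM k <= n. psum b k) = (SUM k <= n. psum a k)" using that a b by (simp add: rk_psum)
 have "psum b k = psum a k" if k: "k <= n" for k
 proof (rule ccontr)
  assume "psum b k ~= psum a k"
  hence "psum a k<psum b k" using l(2)[OF k] by simp
  hence "(SUM k <= n. psum a k)<(SUM k <= n. psum b k)" using l(2) k by (intro sum_strict_mono_ex1) auto
  thus False using s by simp
 qed
 thus ?thesis by (intro psum_inj[OF b(1) a]) auto
qed
moreover have "sum_list b = sum_list a" using l(1) a b by (simp add: sum_list_lessThan psum_def)
ultimately show "b = a | sum_list b = sum_list a & rk a<rk b" using le by linarith
qed (use assms in \<open>auto simp: leads_def\<close>)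

lemma triangular_schubert: "triangular schubert n"
by (rule triangular_leads[OF leads_schubert])

lemma schubert_polys: "length c = n ==> schubert c : polys n"
using leads_schubert unfolding leads_def by blast

lemma polys_atom_induct [consumes 1,case_names zero plus minus]:
 assumes "f : polys n" "P 0" "!!f a. P f ==> length a = n ==> P(f+atom a)" "!!f a. P f ==> length a = n ==> P(f-atom a)"
 shows "P f"
proof -
have "f : zspan atom n" using assms(1) polys_zspan[OF triangular_atom] by blast
thus ?thesis by induction(use assms in auto)
qed

section \<open>Coefficients of Schubert polynomials\<close>

lemma ac_snoc:
 assumes "f : polys N" "length b = N"
 shows "ac(b @ [x]) f = (if x = 0 then ac b f else 0)"
proof -
have "ac(b @ [x])(atom a) = (if x = 0 then ac b(atom a) else 0)" if "length a = N" for a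
using ac_delta[of "a @ [0]" "Suc N" "b @ [x]"] that assms(2) by (auto simp: atom_snoc0 ac_delta)
with assms(1) show ?thesis by (induction rule: polys_atom_induct) auto
qed

lemma atom_map_Suc: "length a = n ==> xset {..<n} * atom a = atom(map Suc a)"
proof (induction rule: partition_induct)
case (sorted a)
have "partition(map Suc a)" using sorted by (simp add: partition_def)
moreover have "addK a {..<n} = map Suc a" by (rule nth_equalityI) (auto simp: nth_addK sorted)
ultimately show ?case using xset_mult_xmon[of "{..<n}" a] sorted by (simp add: atom_partition)
next
case (swap a i)
have sym: "swap_poly i(xset {..<n}) = xset {..<n}" by (rule swap_xset_same) (use swap in auto)
have "atom a = hdiff i(atom(swapl i a))" using atom_unswap[of i a] swap(1-3) by simp
hence "xset {..<n} * atom a = hdiff i(xset {..<n} * atom(swapl i a))" by (simp only: hdiff_mult_sym[OF sym])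
also have "...=hdiff i(atom(swapl i(map Suc a)))" using swap by (simp add: swapl_def map_update)
also have "...=atom(map Suc a)" using atom_unswap[of i "map Suc a"] swap by simp
finally show ?case .
qed

lemma ac_map_Suc:
 assumes "f : polys n" "length b = n"
 shows "ac(map Suc b)(xset {..<n} * f) = ac b f"
using assms(1)
using assms(2) by (induction rule: polys_atom_induct) (auto simp: distrib_left atom_map_Suc ac_delta[of _ n] right_diff_distrib)

lemma ac_foldr_pidiff:
 assumes "length b = Suc N" "k <= N" "!!q. k<q ==> q <= N ==> b ! k <= b ! q" "f : polys(Suc N)"
 shows "ac b(foldr pidiff [k..<N] f) = ac(take k b @ drop(Suc k) b @ [b ! k]) f"
using assms
proof (induction "N-k" arbitrary: k b)
case 0
hence "k = N" by simp
moreover have "take N b @ [b ! N] = b" using 0(2) by (metis lessI take_Suc_conv_app_nth take_all_iff order_refl)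
ultimately show ?case using 0 by simp
next
case (Suc x)
hence k: "k<N" by simp
let ?b = "swapl k b"
have "ac b(foldr pidiff [k..<N] f) = ac b(pidiff k(foldr pidiff [Suc k..<N] f))" using k by (simp add: upt_conv_Cons)
also have "...=ac ?b(foldr pidiff [Suc k..<N] f)"
by (rule ac_pidiff[of k "Suc N"]) (use k Suc(3,5,6) in \<open>auto intro!: foldr_pidiff_polys\<close>)
also have "...=ac(take(Suc k) ?b @ drop(Suc(Suc k)) ?b @ [?b ! Suc k]) f"
by (rule Suc(1)) (use k Suc(2,3,5,6) in \<open>auto simp: nth_swapl swapidx_def\<close>)
also have "take(Suc k) ?b @ drop(Suc(Suc k)) ?b @ [?b ! Suc k] = take k b @ drop(Suc k) b @ [b ! k]"
using k Suc(3) by (simp add: swapl_def take_Suc_conv_app_nth Cons_nth_drop_Suc[symmetric])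
finally show ?case .
qed

lemma coef_xset_zero:
 assumes "g : polys n" "j <= n" "length b = n" "p<j" "b ! p = 0"
 shows "coef(xset {..<j} * g) b = 0"
using assms xset_xmon coef_xmon_mult[OF assms(1) _ assms(3)] by auto

text \<open>Induction over the code. Adding 1 throughout shifts b as well. A zero inserted at j
  forces b_j = 0; for j > 0 the increasing b then also has b_0 = 0, which is incompatible with the
  factor \<open>xvar 0\<close> of the polynomial.\<close>

lemma ac_schubert_increasing:
 assumes "length c = n" "length b = n" "increasing b"
 shows "ac b(schubert c) = (if c = b then 1 else 0)"
using assms
proof (induction arbitrary: b rule: code_induct)
case Nil
have "schubert [] = atom []" by (simp add: schubert_Nil atom_partition partition_def)
thus ?case using Nil ac_delta[of "[]" 0 "[]"] by simp
next
case (positive n c)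
have s: "schubert(map Suc c) = xset {..<n} * schubert c" by (rule schubert_map_Suc[OF positive(1)])
have n: "schubert c : polys n" by (rule schubert_polys[OF positive(1)])
show ?case
proof (cases "b ! 0 = 0")
 case True
 have "coef(schubert(map Suc c)) b = 0" unfolding s
 by (rule coef_xset_zero[OF n _ positive(4),of _ 0]) (use positive True in auto)
 hence "ac b(schubert(map Suc c)) = 0"
 using ac_cone_coef_nz[OF schubert_cone[of "map Suc c" n] positive(4)] positive(1) by auto
 moreover have "map Suc c ~= b" using True positive by auto
 ultimately show ?thesis by simp
next
 case False
 have "x ~= 0" if "x : set b" for x
 proof -
  from that obtain p where "p<length b" "b ! p = x" by (auto simp: in_set_conv_nth)
  thus ?thesis using increasing_le[OF positive(5),of 0 p] False by auto
 qed
 hence b: "b = map Suc(map(%x. x-1) b)" by (simp add: map_idI)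
 let ?b = "map(%x. x-1) b"
 have inc: "increasing ?b" using positive(5) by (auto simp: increasing_def)
 have "ac b(schubert(map Suc c)) = ac ?b(schubert c)" unfolding s
 using ac_map_Suc[OF n,of ?b] b positive(4) by simp
 also have "...=(if c = ?b then 1 else 0)" by (rule positive(3)) (use inc positive(4) in auto)
 also have "c = ?b \<longleftrightarrow> map Suc c = b" by (metis b inj_Suc inj_map_eq_map)
 finally show ?thesis by simp
qed
next
case (zero N e j)
let ?c = "map Suc(take j e) @ 0 # drop j e" and ?f = "xset {..<j} * schubert e"
let ?b = "take j b @ drop(Suc j) b"
have lb: "length ?b = N" using zero by simp
have co: "?f : cone atom N" by (rule xset_cone[OF schubert_cone[OF zero(1)] zero(2)])
have po: "?f : polys N" by (rule cone_polys[OF co])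
\<comment> \<open>The pi word carries the part b_j to the end, where a polynomial in N variables
  admits only 0.\<close>
have "ac b(schubert ?c) = ac(?b @ [b ! j]) ?f" unfolding schubert_insert_zero[OF zero(1,2)]
using ac_foldr_pidiff[OF zero(4,2),of ?f] increasing_le[OF zero(5),of j] zero(4) polys_mono[OF po] by simp
also have "...=(if b ! j = 0 then ac ?b ?f else 0)" by (rule ac_snoc[OF po lb])
finally have e: "ac b(schubert ?c) = (if b ! j = 0 then ac ?b ?f else 0)" .
show ?case
proof (cases "j = 0")
 case True
 have xs: "xset {..<0} = 1" by (simp add: xset_def)
 have inc: "increasing(drop(Suc 0) b)" using zero(5) by (simp add: increasing_def)
 obtain x b' where b: "b = x # b'" using zero(4) by (cases b) auto
 have "ac b'(schubert e) = (if e = b' then 1 else 0)" by (rule zero(3)) (use inc b zero(4) in auto)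
 thus ?thesis using e True xs b by (auto)
next
 case False
 have "?c ~= b"
 using False zero(1,2) increasing_le[OF zero(5),of 0 j] by (auto simp: nth_append)
 moreover have "ac ?b ?f = 0" if "b ! j = 0"
 proof -
  have "b ! 0 = 0" using increasing_le[OF zero(5),of 0 j] that zero(2,4) by simp
  hence "?b ! 0 = 0" using False zero(4) by (simp add: nth_append)
  hence "coef ?f ?b = 0" by (intro coef_xset_zero[OF schubert_polys[OF zero(1)] zero(2) lb,of 0]) (use False in auto)
  thus ?thesis using ac_cone_coef_nz[OF co lb] by auto
 qed
 ultimately show ?thesis using e by simp
qed
qed

lemma sum_list_desc: "desc b i ==> sum_list(b[i := b ! Suc i,Suc i := b ! i-1])<sum_list b"
proof -
assume d: "desc b i"
hence i: "Suc i<length b" "b ! Suc i<b ! i" by (auto simp: desc_def)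
have "b[i := b ! Suc i,Suc i := b ! i-1] = (swapl i b)[Suc i := b ! i-1]" by (simp add: swapl_def)
moreover have "sum_list((swapl i b)[Suc i := b ! i-1])<sum_list(swapl i b)"
using i member_le_sum_list[of "b ! i" b] by (simp add: sum_list_update)
ultimately show ?thesis using i by simp
qed

text \<open>The coefficient of the Schubert polynomial of code \<open>b\<close>: divided differences make \<open>b\<close> increasing,
 and then it is an atom coefficient.\<close>

function sp :: "nat list => mpoly => int" where
"sp b f = (if EX i. desc b i then sp(b[(LEAST i. desc b i) := b ! Suc(LEAST i. desc b i),
Suc(LEAST i. desc b i) := b ! (LEAST i. desc b i)-1])(ddiff(LEAST i. desc b i) f)
else ac b f)"
by auto
termination by (relation "measure(%(b,f). sum_list b)") (auto intro!: sum_list_desc[unfolded One_nat_def] LEAST_desc)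

declare sp.simps [simp del]

lemma sp_cases:
 obtains(increasing) "increasing b" "!!f. sp b f = ac b f"
| (desc) i where "desc b i" "!!f. sp b f = sp(b[i := b ! Suc i,Suc i := b ! i-1])(ddiff i f)"
proof (cases "EX i. desc b i")
case True
hence "desc b(LEAST i. desc b i)" using LEAST_desc by blast
thus ?thesis using sp.simps[of b] by (intro that(2)) auto
next
case False
hence "increasing b" unfolding increasing_def desc_def by (meson linorder_not_less)
thus ?thesis using False sp.simps[of b] by (intro that(1)) auto
qed

lemma sp_add: "sp b(f+g) = sp b f+sp b g"
proof (induction "sum_list b" arbitrary: b f g rule: less_induct)
case less
show ?case
using less sum_list_desc by (cases b rule: sp_cases)  auto
qed

lemma sp_zero [simp]: "sp b 0 = 0" using sp_add[of b 0 0] by simp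

lemma sp_delta:
"length a = n ==> length b = n ==> sp b(schubert a) = (if a = b then 1 else 0)"
proof (induction "sum_list b" arbitrary: a b rule: less_induct)
case less
show ?case
proof (cases b rule: sp_cases)
 case increasing thus ?thesis using ac_schubert_increasing less by simp
next
 case (desc i)
 hence i: "Suc i<n" "b ! Suc i<b ! i" using less(3) by (auto simp: desc_def)
 let ?b = "b[i := b ! Suc i,Suc i := b ! i-1]" and ?a = "a[i := a ! Suc i,Suc i := a ! i-1]"
 show ?thesis
 proof (cases "a ! Suc i<a ! i")
  case True
  \<comment> \<open>The map on codes is injective on those with a descent at i, so the Kronecker
    delta is preserved.\<close>
  have "?a = ?b \<longleftrightarrow> a = b"
  proof
   assume e: "?a = ?b"
   have "a ! Suc i = b ! Suc i" "a ! i-1 = b ! i-1"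
   using arg_cong[OF e,of "%l. l ! i"] arg_cong[OF e,of "%l. l ! Suc i"] i less(2,3) by (simp_all)
   moreover have "a ! k = b ! k" if "k ~= i" "k ~= Suc i" for k using arg_cong[OF e,of "%l. l ! k"] that by simp
   ultimately show "a = b" using i less(2,3) True by (intro nth_equalityI; simp) (metis Suc_pred gr_implies_not0 neq0_conv)
  qed simp
  thus ?thesis using less(1)[OF sum_list_desc[OF desc(1)],of ?a] less(2,3) desc(2) i True by (simp add: ddiff_schubert)
 next
  case False
  thus ?thesis using desc(2) i less(2,3) by (auto simp: ddiff_schubert)
 qed
qed
qed

lemma sp_schubert_schur_nonneg:
 assumes lam: "partition lam"
 shows "length a = n ==> length b = n ==> sp b(schubert a * schur n lam) >= 0"
proof (induction "sum_list b" arbitrary: a b rule: less_induct)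
case less
show ?case
proof (cases b rule: sp_cases)
 case increasing
 have "schubert a * schur n lam : cone atom n"
 by (rule cone_linear[OF schubert_cone[OF less(2)],where T= "%f. f * schur n lam"])
 (auto simp: distrib_right intro: atom_schur lam)
 thus ?thesis using increasing cone_dual_nonneg[OF triangular_atom _ less(3)] by simp
next
 case (desc i)
 hence i: "Suc i<n" "b ! Suc i<b ! i" using less(3) by (auto simp: desc_def)
 have "swap_poly i(schur n lam) = schur n lam" using schur_cone_sym[OF lam] i by blast
 hence "ddiff i(schubert a * schur n lam) = ddiff i(schubert a) * schur n lam"
 by (metis ddiff_mult_sym mult.commute)
 thus ?thesis
 using desc(2) less(1)[OF sum_list_desc[OF desc(1)],of "a[i := a ! Suc i,Suc i := a ! i-1]"] less(2,3) i
 by (simp add: ddiff_schubert)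
qed
qed

theorem schubert_schur:
 assumes "length a = n" "partition lam"
 shows "schubert a * schur n lam : cone schubert n"
proof (rule cone_by_functional[where k=sp])
show "schubert a * schur n lam : zspan schubert n"
using assms polys_zspan[OF triangular_schubert] by (blast intro: polys_mult schubert_polys schur_polys)
qed (use assms in \<open>auto simp: sp_add sp_delta sp_schubert_schur_nonneg\<close>)

definition skip :: "nat => nat => nat" where
"skip i k = (if k<i then k else Suc k)"

lemma inj_skip: "inj(skip i)"
by (rule injI) (auto simp: skip_def split: if_splits)

subsection \<open>Slide sums\<close>

text \<open>Sets the variable i to 0 and renumbers the later ones by \<open>skip\<close>. On
  monomials, particles and atoms it deletes a zero part of the index or gives 0.\<close>

definition res :: "nat => mpoly => mpoly" where
"res i = frag_extend(%m. if Poly_Mapping.lookup m i = 0 then frag_of(Poly_Mapping.map_key(skip i) m) else 0)"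

lemma res_add [simp]: "res i(f+g) = res i f+res i g"
 and res_diff [simp]: "res i(f-g) = res i f-res i g"
 and res_zero [simp]: "res i 0 = 0"
by (simp_all add: res_def frag_extend_add frag_extend_diff)

lemma res_sum: "res i(sum f X) = (SUM x:X. res i(f x))"
by (rule additive_sum) simp

lemma res_mult: "res i(f * g) = res i f * res i g"
unfolding res_def
by (rule frag_extend_mult) (auto simp: lookup_add frag_of_mult map_key_plus[OF inj_skip])

lemma res_frag_of: "res i(frag_of m) = (if Poly_Mapping.lookup m i = 0 then frag_of(Poly_Mapping.map_key(skip i) m) else 0)"
by (simp add: res_def)

lemma res_one: "res i 1 = 1"
using res_frag_of[of i 0] by (simp add: map_key_zero[OF inj_skip])

lemma map_key_skip: "Poly_Mapping.map_key(skip i) m = m' \<longleftrightarrow> (ALL k. Poly_Mapping.lookup m(skip i k) = Poly_Mapping.lookup m' k)"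
by (simp add: poly_mapping_eq_iff map_key.rep_eq[OF inj_skip] fun_eq_iff)

lemma res_xvar: "res i(xvar k) = (if k = i then 0 else xvar(if k<i then k else k-1))"
proof -
have "k ~= i ==> Poly_Mapping.map_key(skip i)(Poly_Mapping.single k 1) = Poly_Mapping.single(if k<i then k else k-1)(1::nat)"
by (auto simp: map_key_skip skip_def lookup_single when_def)
thus ?thesis using res_frag_of[of i "Poly_Mapping.single k 1"]
by (auto simp: xvar_def lookup_single)
qed

lemma res_xmon:
 assumes "length a = Suc N" "i <= N"
 shows "res i(xmon a) = (if a ! i = 0 then xmon(take i a @ drop(Suc i) a) else 0)"
proof -
have "Poly_Mapping.map_key(skip i)(Poly_Mapping.nth a) = Poly_Mapping.nth(take i a @ drop(Suc i) a)"
by (auto simp: map_key_skip skip_def lookup_nth0 nth_append)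
thus ?thesis using res_frag_of[of i "Poly_Mapping.nth a"] assms
by (simp add: xmon_def lookup_nth0)
qed

lemma res_swap: "res i(swap_poly i f) = res(Suc i) f"
by (induction f rule: polynomial_induct) (auto simp: res_xvar swapidx_def res_mult res_one)

text \<open>For the last variable the tableaux without the largest entry remain; by symmetry all
  variables behave alike.\<close>

lemma res_schur:
 assumes "partition lam" "i <= N"
 shows "res i(schur(Suc N) lam) = schur N lam"
using assms(2)
proof (induction rule: inc_induct)
case base
have tw: "tw(Suc N) lam T = tw N lam T @ [card {x : young lam. T x = Suc N}]" for T by (simp add: tw_def)
have l: "length(tw N lam T) = N" for T by (simp add: tw_def)
have "res N(schur(Suc N) lam) = (SUM T:ssyt(Suc N) lam. if card {x : young lam. T x = Suc N} = 0 then xmon(tw N lam T) else 0)"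
unfolding schur_alt res_sum by (rule sum.cong) (auto simp: res_xmon[of _ N] tw l nth_append)
also have "...=(SUM T:{T : ssyt(Suc N) lam. card {x : young lam. T x = Suc N} = 0}. xmon(tw N lam T))"
by (rule sum.inter_filter[symmetric]) simp
also have "{T : ssyt(Suc N) lam. card {x : young lam. T x = Suc N} = 0} = ssyt N lam"
by (force simp: ssyt_def le_Suc_eq)
finally show ?case by (simp add: schur_alt)
next
case (step i)
have "swap_poly i(schur(Suc N) lam) = schur(Suc N) lam" using schur_cone_sym[OF assms(1)] step(2) by simp
thus ?case using res_swap[of i "schur(Suc N) lam"] step(3) by simp
qed

section \<open>Positions of the zeros of a composition\<close>

fun emb :: "nat list => nat list => nat list" where
"emb [] us = []"
| "emb(0 # b) us = 0 # emb b us"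
| "emb(Suc x # b) us = hd us # emb b(tl us)"

text \<open>With b fixed, \<open>pick b\<close> and \<open>emb b\<close> are inverse to each other
  between the lists supported where b is nonzero and the lists as long as \<open>flat b\<close>.
  Such lists may themselves contain zeros.\<close>

definition pick :: "nat list => nat list => nat list" where
"pick b a = map fst(filter(%(x,y). y ~= 0)(zip a b))"

definition supported :: "nat list => nat list => bool" where
"supported b a \<longleftrightarrow> (ALL (x,y):set(zip a b). y = 0 --> x = 0)"

lemma length_emb [simp]: "length(emb b us) = length b"
by (induction b us rule: emb.induct) auto

lemma emb_pick: "length a = length b ==> supported b a ==> emb b(pick b a) = a & length(pick b a) = length(flat b)"
proof (induction b arbitrary: a)
case (Cons y b)
then obtain x a' where "a = x # a'" by (cases a) auto
thus ?case using Cons by (cases y) (auto simp: pick_def supported_def flat_def)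
qed (simp add: pick_def flat_def)

lemma pick_emb: "length u = length(flat b) ==> pick b(emb b u) = u & supported b(emb b u)"
proof (induction b arbitrary: u)
case (Cons y b)
show ?case
proof (cases y)
 case 0 thus ?thesis using Cons by (auto simp: pick_def supported_def flat_def)
next
 case (Suc z)
 then obtain x u' where "u = x # u'" using Cons by (cases u) (auto simp: flat_def)
 thus ?thesis using Cons Suc by (auto simp: pick_def supported_def flat_def)
qed
qed (simp add: pick_def supported_def flat_def)

lemma flat_append: "flat(a @ b) = flat a @ flat b" by (simp add: flat_def)

lemma flat_take_emb: "length u = length(flat b) ==> flat(take i(emb b u)) = flat(take(length(flat(take i b))) u)"
proof (induction b arbitrary: u i)
case (Cons y b)
show ?case
proof (cases i)
 case i: (Suc j)
 show ?thesis
 proof (cases y)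
  case 0 thus ?thesis using Cons i by (auto simp: flat_def)
 next
  case (Suc z)
  then obtain x u' where "u = x # u'" using Cons by (cases u) (auto simp: flat_def)
  thus ?thesis using Cons Suc i by (auto simp: flat_def)
 qed
qed (simp add: flat_def)
qed (simp add: flat_def)

lemma flat_emb: "length u = length(flat b) ==> flat(emb b u) = flat u"
using flat_take_emb[of u b "length b"] by simp

definition cn :: "nat list => nat => nat" where
"cn b i = length(flat(take i b))"

lemma flat_take: "flat(take i b) = take(cn b i)(flat b)"
unfolding cn_def by (metis append_eq_conv_conj append_take_drop_id flat_append)

lemma cn_le: "cn b i <= length(flat b)"
unfolding cn_def flat_def by (metis append_take_drop_id filter_append length_append le_add1)

lemma sum_list_flat: "sum_list(flat b) = sum_list b"
by (induction b) (auto simp: flat_def)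

lemma sum_take_strict:
 assumes "0 ~: set xs" "k<l" "l <= length xs"
 shows "sum_list(take k xs)<sum_list(take l xs :: nat list)"
proof -
have "take l xs = take k xs @ take(l-k)(drop k xs)" using assms(2) by (metis le_add_diff_inverse less_imp_le take_add)
moreover have "take(l-k)(drop k xs) = xs ! k # take(l-k-1)(drop(Suc k) xs)"
using assms(2,3) by (metis Cons_nth_drop_Suc diff_is_0_eq not_le order_less_le_trans take_Cons' One_nat_def)
moreover have "xs ! k ~= 0" using assms by (metis nth_mem order_less_le_trans)
ultimately show ?thesis by simp
qed

lemma flat_nonzero: "0 ~: set(flat b)" by (simp add: flat_def)

text \<open>For compositions with the same nonzero parts, the partial sums grow strictly with the
  number of parts passed, so dominance only compares these numbers.\<close>

lemma dom_ge_cn: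
 assumes "flat b = flat a" "length b = length a"
 shows "dom_ge b a \<longleftrightarrow> (ALL i <= length a. cn a i <= cn b i)"
proof -
have s: "sum_list(take i d) = sum_list(take(cn d i)(flat d))" for i d by (metis flat_take sum_list_flat)
have "sum_list(take i a) <= sum_list(take i b) \<longleftrightarrow> cn a i <= cn b i" for i
proof
 assume "sum_list(take i a) <= sum_list(take i b)"
 thus "cn a i <= cn b i"
 using sum_take_strict[OF flat_nonzero,of "cn b i" "cn a i" a] cn_le[of a i] assms(1) s[of i a] s[of i b] by fastforce
next
 assume le: "cn a i <= cn b i"
 show "sum_list(take i a) <= sum_list(take i b)"
 proof (cases "cn a i = cn b i")
  case False
  thus ?thesis
  using sum_take_strict[OF flat_nonzero,of "cn a i" "cn b i" a] le cn_le[of b i] assms(1) s[of i a] s[of i b] by simp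
 qed (use assms(1) s[of i a] s[of i b] in simp)
qed
thus ?thesis using assms(2) by (simp add: dom_ge_def)
qed

lemma cn_Suc: "i<length b ==> cn b(Suc i) = cn b i+(if b ! i = 0 then 0 else 1)"
by (simp add: cn_def flat_def take_Suc_conv_app_nth)

definition place :: "nat => nat list => (nat => nat) => nat list" where
"place n be N = map(%i. if N i<N(Suc i) then be ! N i else 0) [0..<n]"

lemma flat_place:
 assumes N: "N 0 = 0" "!!i. i<n ==> N(Suc i) = N i | N(Suc i) = Suc(N i)" "N n = length be" and be: "0 ~: set be"
 shows "flat(place n be N) = be" "!!i. i <= n ==> cn(place n be N) i = N i"
proof -
have mono: "N i <= N n" if "i <= n" for i using that
by (induction rule: inc_induct) (use N(2) in \<open>fastforce+\<close>)
have f: "flat(take i(place n be N)) = take(N i) be" if "i <= n" for i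
using that
proof (induction i)
 case (Suc i)
 have t: "take(Suc i)(place n be N) = take i(place n be N) @ [if N i<N(Suc i) then be ! N i else 0]"
 using Suc(2) by (simp add: place_def take_map)
 show ?case
 proof (cases "N(Suc i) = N i")
  case True thus ?thesis using Suc t by (simp) (simp add: flat_def)
 next
  case False
  hence s: "N(Suc i) = Suc(N i)" using N(2)[of i] Suc(2) by simp
  hence lt: "N i<length be" using mono[OF Suc(2)] N(3) by simp
  hence "be ! N i ~= 0" using be by (metis nth_mem)
  thus ?thesis using Suc t s lt by (simp add: take_Suc_conv_app_nth) (simp add: flat_def)
 qed
qed (simp add: N(1) flat_def)
have "take n(place n be N) = place n be N" by (simp add: place_def)
thus "flat(place n be N) = be" using f[of n] N(3) by simp
show "cn(place n be N) i = N i" if "i <= n" for i using f[OF that] mono[OF that] N(3) by (simp add: cn_def)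
qed

lemma cn_mono: "i <= j ==> cn b i <= cn b j"
unfolding cn_def by (metis flat_append le_add1 length_append take_add le_add_diff_inverse)

lemma dom_ge_emb:
 assumes "length u = length(flat b)" "length b = length a" "flat u = flat a"
 shows "dom_ge(emb b u) a \<longleftrightarrow> (ALL i <= length a. cn a i <= cn u(cn b i))"
proof -
have "cn(emb b u) i = cn u(cn b i)" for i
unfolding cn_def using flat_take_emb[OF assms(1),of i] by simp
thus ?thesis using dom_ge_cn[of "emb b u" a] flat_emb[OF assms(1)] assms by simp
qed

text \<open>The admissible positions of the parts of \<open>be\<close> are closed under pointwise minima of the
counting functions, so they form a principal ideal.\<close>

lemma emb_principal:
 assumes be: "0 ~: set be" and u: "length u = length be" "flat u = flat a"
 and ne: "V ~= {}" and V: "V = {b. length b = length a & flat b = be & dom_ge(emb b u) a}"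
 shows "EX t. length t = length a & flat t = be & V = {b. dom_ge b t & flat b = flat t}"
proof -
have Vi: "b : V \<longleftrightarrow> length b = length a & flat b = be & (ALL i <= length a. cn a i <= cn u(cn b i))" for b
unfolding V using dom_ge_emb[of u b a] u by auto
define m where "m b = (SUM i <= length a. cn b i)" for b
\<comment> \<open>\<open>t\<close> minimizes the total count; closure under pointwise minima makes
  it the least element of V.\<close>
obtain t where t: "t : V" "!!b. b : V ==> m t <= m b" using ex_has_least_nat[of "%b. b : V" _ m] ne by blast
have tl: "length t = length a" "flat t = be" using t(1) Vi by auto
have "dom_ge b t & flat b = flat t" if b: "b : V" for b
proof -
 have bl: "length b = length a" "flat b = be" using b Vi by auto
 define N where "N i = min(cn b i)(cn t i)" for i
 let ?d = "place(length a) be N"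
 have N1: "N 0 = 0" by (simp add: N_def cn_def flat_def)
 have N2: "N(Suc i) = N i | N(Suc i) = Suc(N i)" if "i<length a" for i
 using cn_Suc[of i b] cn_Suc[of i t] bl tl that by (auto simp: N_def)
 have N3: "N(length a) = length be" using bl tl by (simp add: N_def cn_def)
 have fp: "flat ?d = be" "!!i. i <= length a ==> cn ?d i = N i"
 by (rule flat_place[OF N1 N2 N3 be],assumption+)+
 \<comment> \<open>At each i the minimum equals one of the two counts, and both are
   admissible.\<close>
 have "?d : V" unfolding Vi
 using fp b t(1) by (auto simp: Vi N_def min_def place_def)
 hence "m t <= m ?d" by (rule t(2))
 have "N i = cn t i" if i: "i <= length a" for i
 proof (rule ccontr)
  assume "N i ~= cn t i"
  hence "N i<cn t i" by (simp add: N_def)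
  hence "(SUM i <= length a. N i)<(SUM i <= length a. cn t i)" using i by (intro sum_strict_mono_ex1) (auto simp: N_def)
  moreover have "m ?d = (SUM i <= length a. N i)" unfolding m_def by (rule sum.cong) (auto simp: fp(2))
  ultimately show False using \<open>m t<=m ?d\<close> by (simp add: m_def)
 qed
 hence "cn t i <= cn b i" if "i <= length a" for i using that by (metis N_def min.cobounded1)
 thus ?thesis using dom_ge_cn[of b t] bl tl by simp
qed
moreover have "b : V" if b: "dom_ge b t" "flat b = flat t" for b
proof -
 have bl: "length b = length a" "flat b = be" using b tl by (auto simp: dom_ge_def)
 have c: "cn t i <= cn b i" if "i <= length a" for i using dom_ge_cn[of b t] b bl tl that by simp
 show ?thesis unfolding Vi
 proof (intro conjI allI impI)
  fix i assume i: "i <= length a"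
  have "cn a i <= cn u(cn t i)" using t(1) i unfolding Vi by blast
  also have "...<=cn u(cn b i)" by (rule cn_mono[OF c[OF i]])
  finally show "cn a i <= cn u(cn b i)" .
 qed (use bl in auto)
qed
ultimately show ?thesis using tl by (intro exI[of _ t]) blast
qed

lemma finite_slides: "finite {b. dom_ge b a & flat b = flat a}"
proof (rule finite_subset)
show "{b. dom_ge b a & flat b = flat a} <= {b. length b = length a & sum_list b = sum_list a}"
by (auto simp: dom_ge_def) (metis sum_list_flat)
qed (rule finite_lists_sum)

definition slidesum :: "(nat list => mpoly) => nat list => mpoly" where
"slidesum g a = (SUM b:{b. dom_ge b a & flat b = flat a}. g b)"

lemma dualc_of_nat: "dualc g b(of_nat k * f) = int k * dualc g b f"
by (induction k) (auto simp: distrib_right)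

text \<open>What the argument for slide sums asks of a basis: an expansion with coefficients,
  compatibility with setting a variable to 0, and Schur positivity. Monomials, particles and atoms
  are the instances.\<close>

locale slide_family =
 fixes g :: "nat list => mpoly"
 assumes tri: "!!n. triangular g n"
 and restrict: "!!N a i. length a = Suc N ==> i <= N ==> 
res i(g a) = (if a ! i = 0 then g(take i a @ drop(Suc i) a) else 0)"
 and schur_positive: "!!n a lam. length a = n ==> partition lam ==> g a * schur n lam : cone g n"
begin

lemma g_polys: "length a = n ==> g a : polys n"
using tri unfolding triangular_def by blast

text \<open>Only basis elements whose index vanishes at i survive the restriction, and they lose
  just that part; coefficients at indices with b_i = 0 are therefore still visible.\<close>

lemma dualc_res:
 assumes f: "f : polys(Suc N)" and b: "length b = Suc N" "i <= N" "b ! i = 0"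
 shows "dualc g b f = dualc g(take i b @ drop(Suc i) b)(res i f)"
proof -
let ?b = "take i b @ drop(Suc i) b"
have delta: "dualc g b(g a) = dualc g ?b(res i(g a))" if a: "length a = Suc N" for a
proof (cases "a ! i = 0")
 case True
 have "a = b \<longleftrightarrow> take i a @ drop(Suc i) a = ?b"
 proof
  assume "take i a @ drop(Suc i) a = ?b"
  hence "take i a = take i b" "drop(Suc i) a = drop(Suc i) b" using a b by (auto)
  moreover have "x = take i x @ x ! i # drop(Suc i) x" if "length x = Suc N" for x :: "nat list"
  using id_take_nth_drop[of i x] that b(2) by simp
  ultimately show "a = b" using a b True by metis
 qed simp
 thus ?thesis using True a b restrict[OF a b(2)]
 by (simp add: dualc_delta[OF tri[of "Suc N"]] dualc_delta[OF tri[of N]])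
next
 case False
 thus ?thesis using a b restrict[OF a b(2)] by (auto simp: dualc_delta[OF tri[of "Suc N"]])
qed
have "f : zspan g(Suc N)" using f polys_zspan[OF tri] by blast
thus ?thesis by induction(auto simp: delta)
qed

definition cc :: "nat list => nat list => nat list => int" where
"cc lam a b = dualc g b(g a * schur(length a) lam)"

lemma cc_nonneg: "partition lam ==> length a = length b ==> cc lam a b >= 0"
unfolding cc_def by (rule cone_dual_nonneg[OF tri schur_positive]) auto

text \<open>Delete the zeros of b one at a time: restriction is multiplicative and sends the Schur
  polynomial to the one in fewer variables. So structure coefficients do not depend on where the
  zeros of b stand.\<close>

lemma cc_pick:
 assumes lam: "partition lam"
 shows "length a = length b ==> cc lam a b = (if supported b a then cc lam(pick b a)(flat b) else 0)"
proof (induction "length b" arbitrary: a b)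
case 0
thus ?case by (simp add: supported_def pick_def flat_def)
next
case (Suc N)
show ?case
proof (cases "0 : set b")
 case False
 hence "pick b a = a" "flat b = b" "supported b a" using Suc(3)
 by (induction a b rule: list_induct2') (auto simp: pick_def flat_def supported_def)
 thus ?thesis by simp
next
 case True
 then obtain u v where b: "b = u @ 0 # v" by (metis split_list)
 define i where "i = length u"
 obtain a1 x a2 where a: "a = a1 @ x # a2" "length a1 = i" "length a2 = length v"
 proof -
  have "a = take i a @ a ! i # drop(Suc i) a" using Suc(3) b by (intro id_take_nth_drop) (simp add: i_def)
  moreover have "length(take i a) = i" "length(drop(Suc i) a) = length v" using Suc(3) b by (auto simp: i_def)
  ultimately show ?thesis using that by blast
 qed
 have l: "length a = Suc N" "length b = Suc N" "i <= N" using Suc b by (auto simp: i_def)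
 have e: "take i b @ drop(Suc i) b = u @ v" "take i a @ drop(Suc i) a = a1 @ a2" "b ! i = 0" "a ! i = x"
 using a b by (auto simp: i_def nth_append)
 have "g a * schur(Suc N) lam : polys(Suc N)" by (rule polys_mult[OF g_polys[OF l(1)] schur_polys])
 from dualc_res[OF this l(2,3) e(3)] have "cc lam a b = dualc g(u @ v)(res i(g a * schur(Suc N) lam))"
 using e(1) l(1) by (simp add: cc_def)
 also have "...=(if x = 0 then cc lam(a1 @ a2)(u @ v) else 0)"
 using restrict[OF l(1,3)] res_schur[OF lam l(3)] e l a by (simp add: res_mult cc_def)
 finally have c: "cc lam a b = (if x = 0 then cc lam(a1 @ a2)(u @ v) else 0)" .
 have "cc lam(a1 @ a2)(u @ v) = (if supported(u @ v)(a1 @ a2) then cc lam(pick(u @ v)(a1 @ a2))(flat(u @ v)) else 0)"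
 by (rule Suc(1)) (use a b l in \<open>auto\<close>)
 moreover have "supported b a \<longleftrightarrow> x = 0 & supported(u @ v)(a1 @ a2)"
 using a b by (auto simp: supported_def i_def)
 moreover have "pick b a = pick(u @ v)(a1 @ a2)" "flat b = flat(u @ v)" using a b by (auto simp: pick_def flat_def i_def)
 ultimately show ?thesis using c by simp
qed
qed

lemma cc_finite: "partition lam ==> finite {b. length b = length a & cc lam a b ~= 0}"
proof -
assume lam: "partition lam"
obtain c :: "nat list => nat" where c: "finite {b. c b ~= 0}" "ALL b. c b ~= 0 --> length b = length a"
"g a * schur(length a) lam = (SUM b:{b. c b ~= 0}. of_nat(c b) * g b)"
using cone_coeffs[OF schur_positive[OF HOL.refl lam,of a]] by blast
have "cc lam a d = 0" if "length d = length a" "c d = 0" for d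
unfolding cc_def c(3) dualc_sum
by (rule sum.neutral) (use c(2) that in \<open>auto simp: dualc_of_nat dualc_delta[OF tri]\<close>)
hence "{b. length b = length a & cc lam a b ~= 0} <= {b. c b ~= 0}" by auto
thus ?thesis using c(1) finite_subset by blast
qed

lemma polys_dualc_eqI:
 assumes "f : polys n" "h : polys n" "!!b. length b = n ==> dualc g b f = dualc g b h"
 shows "f = h"
proof -
have "f-h : polys n" "h-f : polys n" using assms(1,2) by (auto intro: polys_diff)
hence z: "f-h : zspan g n" using polys_zspan[OF tri] by blast
obtain p q where pq: "p : cone g n" "q : cone g n" "f-h = p-q" using zspan_cone_diff[OF z] by blast
have c: "f-h : cone g n"
by (rule cone_by_dual[OF tri polys_diff[OF assms(1,2)]]) (use assms(3) in simp)
have k0: "!!b. length b = n ==> dualc g b(f-h) = 0" using assms(3) by simp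
have "f-h = 0" using c k0
proof (cases rule: cone.cases)
 case (cone_step x b)
 have "dualc g b(f-h) = dualc g b x+1" using cone_step by (simp add: dualc_delta[OF tri])
 thus ?thesis using k0[OF cone_step(3)] cone_dual_nonneg[OF tri cone_step(2,3)] by simp
qed
thus ?thesis by simp
qed

lemma dualc_slide:
 assumes "finite X" "!!x. x : X ==> length x = n" "length b = n"
 shows "dualc g b(SUM x:X. g x) = (if b : X then 1 else 0)"
using assms by (auto simp: dualc_sum dualc_delta[OF tri])

theorem slidesum_schur:
 assumes a: "length a = n" and lam: "partition lam"
 shows "slidesum g a * schur n lam : cone(slidesum g) n"
proof -
define U where "U = {b. dom_ge b a & flat b = flat a}"
have Ul: "length a' = n" if "a' : U" for a' using that a by (auto simp: U_def dom_ge_def)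
have fU: "finite U" unfolding U_def by (rule finite_slides)
define B where "B = (UN a':U. {b. length b = length a' & cc lam a' b ~= 0})"
have fB: "finite B" unfolding B_def by (rule finite_UN_I[OF fU cc_finite[OF lam]])
\<comment> \<open>By \<open>cc_pick\<close> a term depends only on the compressed pair u, be. For
  fixed u and be the admissible positions form \<open>V u be\<close>, which is empty or a principal
  ideal, so each pair contributes a multiple of one slide sum.\<close>
define Q where "Q = (%(b,a'). pick b a') ` (B \<times> U)"
have fQ: "finite Q" unfolding Q_def using fB fU by simp
define V where "V u be = {b. length b = n & flat b = be & length u = length be & emb b u : U}" for u be
define H where "H = (SUM u:Q. SUM be:flat ` B. of_nat(nat(cc lam u be)) * (SUM b:V u be. g b))"
have Vsum: "V u be = {} | (EX t. length t = n & (SUM b:V u be. g b) = slidesum g t)" if "be : flat ` B" for u be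
proof (cases "V u be = {}")
 case False
 then obtain b0 where b0: "flat b0 = be" "length u = length be" "emb b0 u : U" by (auto simp: V_def)
 have fu: "flat u = flat a" using b0 flat_emb[of u b0] by (auto simp: U_def)
 have "V u be = {b. length b = length a & flat b = be & dom_ge(emb b u) a}"
 unfolding V_def U_def using a b0(2) fu flat_emb by auto
 then obtain t where "length t = length a" "V u be = {b. dom_ge b t & flat b = flat t}"
 using emb_principal[of be u a "V u be"] b0(1,2) fu False flat_nonzero[of b0] by blast
 thus ?thesis using a by (intro disjI2 exI[of _ t]) (simp add: slidesum_def)
qed simp
have Hc: "H : cone(slidesum g) n" unfolding H_def
proof (rule cone_sum,rule cone_sum,rule cone_of_nat)
 fix u be assume "be : flat ` B"
 from Vsum[OF this,of u] show "(SUM b:V u be. g b) : cone(slidesum g) n" by (auto intro: cone_zero cone_base)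
qed
have fV: "finite(V u be)" for u be
by (rule finite_subset[OF _ finite_lists_sum[of n "sum_list be"]]) (auto simp: V_def sum_list_flat)
have F: "slidesum g a * schur n lam = (SUM a':U. g a' * schur n lam)" by (simp add: slidesum_def U_def sum_distrib_right)
have "slidesum g a * schur n lam = H"
proof (rule polys_dualc_eqI)
 show "slidesum g a * schur n lam : polys n" unfolding F by (intro polys_sum polys_mult schur_polys g_polys Ul)
 show "H : polys n" unfolding H_def
 proof (intro polys_sum)
  fix u be assume "u : Q" "be : flat ` B"
  have "(SUM b:V u be. g b) : cone g n" by (intro cone_sum cone_base) (simp add: V_def)
  hence "of_nat(nat(cc lam u be)) * (SUM b:V u be. g b) : zspan g n" by (intro cone_zspan cone_of_nat)
  thus "of_nat(nat(cc lam u be)) * (SUM b:V u be. g b) : polys n" using polys_zspan[OF tri] by blast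
 qed
 fix b :: "nat list" assume b: "length b = n"
 have lhs: "dualc g b(slidesum g a * schur n lam) = (SUM a':U. if supported b a' then cc lam(pick b a')(flat b) else 0)"
 unfolding F dualc_sum by (rule sum.cong) (use b Ul cc_pick[OF lam] in \<open>auto simp: cc_def\<close>)
 have trm: "dualc g b(of_nat(nat(cc lam u be)) * (SUM b:V u be. g b)) = (if be = flat b then(if b : V u(flat b) then cc lam u(flat b) else 0) else 0)" for u be
 using cc_nonneg[OF lam,of u be] lam dualc_slide[OF fV,of u be n b] fV b by (auto simp: dualc_of_nat V_def)
 have "dualc g b H = (SUM u:Q. SUM be:flat ` B. if be = flat b then(if b : V u(flat b) then cc lam u(flat b) else 0) else 0)"
 unfolding H_def dualc_sum trm ..
 also have "...=(SUM u:Q. if flat b : flat ` B then(if b : V u(flat b) then cc lam u(flat b) else 0) else 0)"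
 by (rule sum.cong) (use fB in auto)
 finally have rhs: "dualc g b H = (SUM u:Q. if flat b : flat ` B then(if b : V u(flat b) then cc lam u(flat b) else 0) else 0)" .
 have inB: "b : B" if "a' : U" "supported b a'" "cc lam(pick b a')(flat b) ~= 0" for a'
 using that cc_pick[OF lam,of a' b] Ul[OF that(1)] b by (auto simp: B_def)
 show "dualc g b(slidesum g a * schur n lam) = dualc g b H"
 proof (cases "b : B")
  case False
  have "flat b : flat ` B ==> b : V u(flat b) ==> cc lam u(flat b) = 0" for u
  using inB[of "emb b u"] pick_emb[of u b] False by (auto simp: V_def)
  moreover have "a' : U ==> supported b a' ==> cc lam(pick b a')(flat b) = 0" for a' using inB False by blast
  ultimately have "dualc g b(slidesum g a * schur n lam) = 0" "dualc g b H = 0"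
  unfolding lhs rhs by (intro sum.neutral ballI; simp)+
  thus ?thesis by simp
 next
  case True
  have "(SUM a':U. if supported b a' then cc lam(pick b a')(flat b) else 0) = (SUM a':{a':U. supported b a'}. cc lam(pick b a')(flat b))"
  by (rule sum.inter_filter[symmetric]) (rule fU)
  also have "...=(SUM u:{u:Q. b : V u(flat b)}. cc lam u(flat b))"
  by (rule sum.reindex_bij_witness[of _ "emb b" "pick b"]) (auto simp: Q_def V_def emb_pick Ul b True pick_emb)
  also have "...=(SUM u:Q. if b : V u(flat b) then cc lam u(flat b) else 0)"
  by (rule sum.inter_filter) (rule fQ)
  finally show ?thesis unfolding lhs rhs using True by simp
 qed
qed
thus ?thesis using Hc by simp
qed

end

lemma xmon_schur: "length a = n ==> xmon a * schur n lam : cone xmon n"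
unfolding schur_alt sum_distrib_left
by (rule cone_sum) (auto simp: tw_def xmon_mult intro!: cone_base)

lemma triangular_xmon: "triangular xmon n"
unfolding triangular_def by (auto simp: coef_xmon xmon_polys)

interpretation monomials: slide_family xmon
by unfold_locales(auto simp: triangular_xmon res_xmon xmon_schur)

theorem monslide_schur:
 assumes "length a = n" "partition lam"
 shows "monslide a * schur n lam : cone monslide n"
by (metis monomials.slidesum_schur[OF assms] assms fun_eq_iff monslide_def slidesum_def)

lemma psum_0 [simp]: "psum b 0 = 0" by (simp add: psum_def)

lemma psum_mono: "i <= j ==> psum b i <= psum b j"
unfolding psum_def by (rule sum_mono2) auto

lemma psum_take: "k <= length b ==> psum b k = sum_list(take k b)"
by (simp add: psum_def sum_list_lessThan)

lemma dom_ge_psum: "dom_ge b a \<longleftrightarrow> length b = length a & (ALL k <= length a. psum a k <= psum b k)"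
by (auto simp: dom_ge_def psum_take)

subsection \<open>Fundamental particles\<close>

text \<open>Closed form of the fixed slides: parts may spread left across zeros of a, but each
  nonzero part of a keeps a positive remainder in its place, and the sum up to that place is
  unchanged.\<close>

definition fsl :: "nat list => nat list => bool" where
"fsl a b \<longleftrightarrow> length b = length a & psum b(length a) = psum a(length a) &
(ALL i<length a. a ! i ~= 0 --> b ! i ~= 0 & psum b(Suc i) = psum a(Suc i))"

lemma fsl_dom:
 assumes "fsl a b" "k <= length a" shows "psum a k <= psum b k"
using assms(2)
proof (induction k)
case (Suc k)
show ?case
using Suc assms(1) by (cases "a ! k = 0") (auto simp: psum_Suc fsl_def)
qed simp

lemma fsl_refl: "fsl a a" by (simp add: fsl_def)

lemma fsl_update:
 assumes b: "fsl a b" and p: "Suc p<length a" "a ! p = 0" and ij: "i+j = b ! p+b ! Suc p"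
"a ! Suc p ~= 0 ==> j ~= 0"
 shows "fsl a(b[p := i,Suc p := j])"
proof -
let ?b = "b[p := i,Suc p := j]"
have l: "length b = length a" using b by (simp add: fsl_def)
have ps: "psum ?b k = psum b k" if "k <= length a" "k ~= Suc p" for k
by (rule psum_pair[of _ "length a" _ p]) (use l p ij that in \<open>auto\<close>)
show ?thesis unfolding fsl_def
using b p ij ps by (auto simp: fsl_def nth_list_update)
qed

lemma fixed_slides_fsl: "b : fixed_slides a ==> fsl a b"
proof (induction rule: fixed_slides.induct)
case refl show ?case by (rule fsl_refl)
next
case (step b p i j)
have l: "length b = length a" using step(6) by (simp add: fsl_def)
have "a ! p = 0" using step(2,3,6) l unfolding fsl_def by (metis Suc_lessD)
thus ?case using fsl_update[OF step(6),of p i j] step l by auto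
qed

text \<open>Run the moves backwards: push a part standing where a vanishes one place to the right,
  which lowers \<open>rk\<close>.\<close>

lemma fsl_fixed_slides: "fsl a b ==> b : fixed_slides a"
proof (induction "rk b" arbitrary: b rule: less_induct)
case less
have l: "length b = length a" using less(2) by (simp add: fsl_def)
show ?case
proof (cases "EX p<length a. b ! p ~= 0 & a ! p = 0")
 case False
 have "psum a k = psum b k" if "k <= length a" for k
 using that
 proof (induction k)
  case (Suc k)
  show ?case
  proof (cases "a ! k = 0")
   case True
   hence "b ! k = 0" using False Suc(2) by (meson Suc_le_lessD)
   thus ?thesis using Suc True by (simp add: psum_Suc)
  next
   case nz: False
   thus ?thesis using less(2) Suc(2) by (simp add: fsl_def)
  qed
 qed simp
 hence "a = b" using psum_inj[of a "length a" b] l by simp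
 thus ?thesis by (simp add: fixed_slides.refl)
next
 case True
 then obtain p where p: "p<length a" "b ! p ~= 0" "a ! p = 0" by blast
 \<comment> \<open>A positive part cannot stand at a final zero of a, because the totals agree and
   the earlier partial sums of b dominate those of a.\<close>
 have sp: "Suc p<length a"
 proof (rule ccontr)
  assume "~ Suc p<length a"
  hence n: "length a = Suc p" using p(1) by simp
  have "psum b p<psum b(Suc p)" using p(2) by (simp add: psum_Suc)
  also have "...=psum a(Suc p)" using less(2) n by (simp add: fsl_def)
  also have "...=psum a p" using p(3) by (simp add: psum_Suc)
  also have "...<=psum b p" by (rule fsl_dom[OF less(2)]) (use p in simp)
  finally show False by simp
 qed
 let ?c = "b[p := 0,Suc p := b ! p+b ! Suc p]"
 have f: "fsl a ?c" by (rule fsl_update[OF less(2) sp p(3)]) (use p in auto)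
 have ps: "psum ?c k = psum b k" if "k <= length a" "k ~= Suc p" for k
 by (rule psum_pair[of _ "length a" _ p]) (use l sp that in \<open>auto\<close>)
 have "psum ?c(Suc p) = psum b p" using ps[of p] sp l by (simp add: psum_Suc)
 hence lt: "psum ?c(Suc p)<psum b(Suc p)" using p(2) by (simp add: psum_Suc)
 have "(SUM k <= length a. psum ?c k)<(SUM k <= length a. psum b k)"
 proof (rule sum_strict_mono_ex1)
  show "ALL k:{..length a}. psum ?c k <= psum b k"
  proof
   fix k assume "k : {..length a}"
   thus "psum ?c k <= psum b k" using ps[of k] lt by (cases "k = Suc p") auto
  qed
  show "EX k:{..length a}. psum ?c k<psum b k" using lt sp by (intro bexI[of _ "Suc p"]) auto
 qed simp
 hence "rk ?c<rk b" using l by (simp add: rk_psum)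
 hence c: "?c : fixed_slides a" using less(1) f by blast
 have "?c[p := b ! p,Suc p := b ! Suc p] : fixed_slides a"
 by (rule fixed_slides.step[OF c]) (use sp l less(2) in \<open>auto simp: fsl_def\<close>)
 moreover have "?c[p := b ! p,Suc p := b ! Suc p] = b"
 using sp l by (intro nth_equalityI) (auto simp: nth_list_update)
 ultimately show ?thesis by simp
qed
qed

lemma fixed_slides_iff: "fixed_slides a = {b. fsl a b}"
using fixed_slides_fsl fsl_fixed_slides by blast

lemma fsl_sum: "fsl a b ==> length b = length a & sum_list b = sum_list a"
by (auto simp: fsl_def psum_take)

lemma finite_fsl: "finite {b. fsl a b}"
by (rule finite_subset[OF _ finite_lists_sum[of "length a" "sum_list a"]]) (auto dest: fsl_sum)

lemma particle_alt: "particle a = (SUM b:{b. fsl a b}. xmon b)"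
by (simp add: particle_def fixed_slides_iff)

lemma coef_particle: "length b = length a ==> coef(particle a) b = (if fsl a b then 1 else 0)"
using finite_fsl[of a] by (auto simp: particle_alt coef_sum coef_xmon fsl_def)

lemma particle_polys: "length a = n ==> particle a : polys n"
unfolding particle_alt by (intro polys_sum xmon_polys) (auto simp: fsl_def)

lemma triangular_particle: "triangular particle n"
using triangular_leads coef_particle fsl_dom by (auto simp: leads_def fsl_def particle_polys)

section \<open>Setting a variable to zero in a particle\<close>

definition del :: "nat => nat list => nat list" where
"del i b = take i b @ drop(Suc i) b"

lemma length_del: "i<length b ==> length(del i b) = length b-1"
by (simp add: del_def)

lemma nth_del: "length b = Suc N ==> i <= N ==> j<N ==> del i b ! j = b ! skip i j"
by (auto simp: del_def skip_def nth_append)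

lemma psum_del:
 assumes "length b = Suc N" "i <= N" "b ! i = 0"
 shows "k <= N ==> psum(del i b) k = psum b(if k <= i then k else Suc k)"
proof (induction k)
case (Suc k)
thus ?case using assms nth_del[OF assms(1,2),of k]
by (cases "k = i") (auto simp: psum_Suc skip_def)
qed simp

lemma fsl_del:
 assumes l: "length a = Suc N" "length b = Suc N" "i <= N" and z: "a ! i = 0" "b ! i = 0"
 shows "fsl(del i a)(del i b) \<longleftrightarrow> fsl a b"
proof -
have tot: "psum(del i x) N = psum x(Suc N)" if "length x = Suc N" "x ! i = 0" for x
using psum_del[OF that(1) l(3) that(2),of N] that l(3) by (cases "N = i") (auto simp: psum_Suc)
have ps: "psum(del i x)(Suc j) = psum x(Suc(skip i j))" if "length x = Suc N" "x ! i = 0" "j<N" for x j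
using psum_del[OF that(1) l(3) that(2),of "Suc j"] that by (auto simp: skip_def)
have dl: "length(del i a) = N" "length(del i b) = N" using l by (auto simp: length_del)
have "(ALL k<Suc N. a ! k ~= 0 --> b ! k ~= 0 & psum b(Suc k) = psum a(Suc k)) \<longleftrightarrow>
(ALL j<N. a ! skip i j ~= 0 --> b ! skip i j ~= 0 & psum b(Suc(skip i j)) = psum a(Suc(skip i j)))" (is "?L \<longleftrightarrow> ?R")
proof
 assume ?L thus ?R by (auto simp: skip_def)
next
 assume R: ?R
 show ?L
 proof (intro allI impI)
  fix k assume k: "k<Suc N" "a ! k ~= 0"
  define j where "j = (if k<i then k else k-1)"
  have "k ~= i" using k z by auto
  hence "skip i j = k" "j<N" using k(1) l(3) by (auto simp: j_def skip_def)
  thus "b ! k ~= 0 & psum b(Suc k) = psum a(Suc k)" using R k by metis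
 qed
qed
thus ?thesis unfolding fsl_def using l z dl tot ps nth_del by simp
qed

lemma res_particle:
 assumes a: "length a = Suc N" "i <= N"
 shows "res i(particle a) = (if a ! i = 0 then particle(del i a) else 0)"
proof -
have "res i(particle a) = (SUM b:{b. fsl a b}. if b ! i = 0 then xmon(del i b) else 0)"
unfolding particle_alt res_sum by (rule sum.cong) (use a in \<open>auto simp: res_xmon fsl_def del_def\<close>)
also have "...=(SUM b:{b : {b. fsl a b}. b ! i = 0}. xmon(del i b))"
by (rule sum.inter_filter[symmetric]) (rule finite_fsl)
also have "...=(if a ! i = 0 then particle(del i a) else 0)"
proof (cases "a ! i = 0")
 case True
 define ins where "ins d = take i d @ 0 # drop i d" for d :: "nat list"
 have "(SUM b:{b : {b. fsl a b}. b ! i = 0}. xmon(del i b)) = (SUM d:{d. fsl(del i a) d}. xmon d)"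
 proof (rule sum.reindex_bij_witness[of _ ins "del i"])
  fix b assume "b : {b : {b. fsl a b}. b ! i = 0}"
  hence b: "fsl a b" "b ! i = 0" "length b = Suc N" using a by (auto simp: fsl_def)
  show "del i b : {d. fsl(del i a) d}" using fsl_del[of a N b i] a b True by simp
  show "ins(del i b) = b" using b a by (intro nth_equalityI) (auto simp: ins_def del_def nth_append nth_Cons')
 next
  fix d assume "d : {d. fsl(del i a) d}"
  hence d: "fsl(del i a) d" "length d = N" using a by (auto simp: fsl_def length_del)
  have di: "del i(ins d) = d" using d a by (simp add: ins_def del_def)
  have "length(ins d) = Suc N" "ins d ! i = 0" using d a by (auto simp: ins_def nth_append)
  hence "fsl a(ins d)" using fsl_del[of a N "ins d" i] a d True di by simp
  thus "ins d : {b : {b. fsl a b}. b ! i = 0}" "del i(ins d) = d" using di \<open>ins d ! i=0\<close> by auto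
 qed simp
 thus ?thesis using True by (simp add: particle_alt)
next
 case False
 hence "b ! i ~= 0" if "fsl a b" for b using that a by (simp add: fsl_def)
 hence e: "{b : {b. fsl a b}. b ! i = 0} = {}" by blast
 show ?thesis unfolding e using False by simp
qed
finally show ?thesis .
qed

section \<open>Sets of partial sums: refinement and merging\<close>

definition PS :: "nat list => nat set" where
"PS x = psum x ` {..length x}"

lemma fsl_PS: "fsl c x ==> PS c <= PS x"
proof -
assume f: "fsl c x"
have "psum c k : PS x" if "k <= length c" for k
using that
proof (induction k)
 case 0 thus ?case by (auto simp: PS_def intro!: image_eqI[of _ _ 0])
next
 case (Suc k)
 show ?case
 proof (cases "c ! k = 0")
  case True thus ?thesis using Suc by (simp add: psum_Suc)
 next
  case False
  hence "psum c(Suc k) = psum x(Suc k)" "length x = length c" using f Suc by (auto simp: fsl_def)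
  thus ?thesis using Suc by (auto simp: PS_def)
 qed
qed
thus ?thesis by (auto simp: PS_def)
qed

lemma PS_positive: "s : PS c ==> s ~= 0 ==> EX v<length c. c ! v ~= 0 & psum c(Suc v) = s"
proof -
assume s: "s : PS c" "s ~= 0"
then obtain k where "k <= length c" "psum c k = s" by (auto simp: PS_def)
thus ?thesis using s(2)
proof (induction k)
 case (Suc k)
 thus ?case by (cases "c ! k = 0") (auto simp: psum_Suc intro!: exI[of _ k])
qed simp
qed

text \<open>Together with \<open>fsl_dom\<close> this identifies \<open>psum c i\<close> as the
  largest element of \<open>PS c\<close> not above \<open>psum x i\<close>, so that c can be
  recovered from x and \<open>PS c\<close>.\<close>

lemma fsl_psum_max:
 assumes f: "fsl c x" and i: "i <= length c" and s: "s : PS c" "s <= psum x i"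
 shows "s <= psum c i"
proof (rule ccontr)
assume n: "~ s <= psum c i"
obtain j where j: "j <= length c" "s = psum c j" using s(1) by (auto simp: PS_def)
have ij: "i<j" using n j(2) psum_mono[of j i c] by (metis not_le)
have "EX q. i <= q & q<j & c ! q ~= 0"
proof (rule ccontr)
 assume h: "~ (EX q. i <= q & q<j & c ! q ~= 0)"
 have "psum c j = psum c i+(SUM p:{i..<j}. c ! p)" unfolding psum_def
 using sum.atLeastLessThan_concat[of 0 i j "(!) c"] ij by (simp add: lessThan_atLeast0)
 moreover have "(SUM p:{i..<j}. c ! p) = 0" using h by auto
 ultimately show False using n j(2) by simp
qed
then obtain q where q: "i <= q" "q<j" "c ! q ~= 0" by blast
hence "x ! q ~= 0" "psum x(Suc q) = psum c(Suc q)" using f j(1) by (auto simp: fsl_def)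
hence "psum x q<psum c(Suc q)" by (simp add: psum_Suc)
hence "psum x i<psum c(Suc q)" using psum_mono[OF q(1),of x] by simp
also have "...<=s" unfolding j(2) by (rule psum_mono) (use q in simp)
finally show False using s(2) by simp
qed

lemma fsl_unique:
 assumes "fsl c x" "fsl c' x" "PS c = PS c'"
 shows "c = c'"
proof -
have l: "length c = length x" "length c' = length x" using assms by (auto simp: fsl_def)
have le: "psum c k <= psum c' k" if "fsl c x" "fsl c' x" "PS c = PS c'" "k <= length x" for c c' k
proof -
 have l: "length c = length x" "length c' = length x" using that by (auto simp: fsl_def)
 have "psum c k : PS c'" using that l by (auto simp: PS_def)
 moreover have "psum c k <= psum x k" using fsl_dom[OF that(1)] that(4) l by simp
 ultimately show ?thesis using fsl_psum_max[OF that(2),of k] that(4) l by simp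
qed
show ?thesis by (rule psum_inj[OF l]) (use le[of c c'] le[of c' c] assms in \<open>auto intro: antisym\<close>)
qed

text \<open>Merge the parts of x between consecutive elements of Q, placing each merged part at the
  last nonzero position it absorbs.\<close>

lemma fsl_merge:
 assumes x: "length x = n" and Q: "Q <= PS x" "0 : Q" "psum x n : Q"
 shows "EX c. PS c = Q & fsl c x"
proof -
have fQ: "finite Q" using Q(1) finite_subset by (auto simp: PS_def)
\<comment> \<open>\<open>B\<close> becomes the partial sum function of the merged
  composition.\<close>
define B where "B i = Max {s:Q. s <= psum x i}" for i
have "B i : {s:Q. s <= psum x i}" for i
proof -
 have "0 : {s:Q. s <= psum x i}" using Q(2) by simp
 thus ?thesis unfolding B_def by (intro Max_in) (use fQ in auto)
qed
hence B: "B i : Q" "B i <= psum x i" for i by auto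
have Bm: "s <= B i" if "s : Q" "s <= psum x i" for s i
unfolding B_def by (rule Max_ge) (use fQ that in auto)
have mono: "B i <= B(Suc i)" for i
by (rule Bm[OF B(1)]) (use B(2)[of i] psum_mono[of i "Suc i" x] in simp)
define c where "c = map(%i. B(Suc i)-B i) [0..<n]"
have lc: "length c = n" by (simp add: c_def)
have pc: "psum c k = B k" if "k <= n" for k
using that
proof (induction k)
 case 0 thus ?case using B(2)[of 0] by simp
next
 case (Suc k) thus ?case using mono[of k] by (simp add: psum_Suc c_def)
qed
have PSc: "PS c = Q"
proof
 show "PS c <= Q" using pc B(1) lc by (auto simp: PS_def)
 show "Q <= PS c"
 proof
  fix s assume s: "s : Q"
  then obtain j where j: "j <= n" "s = psum x j" using Q(1) x by (auto simp: PS_def)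
  hence "B j = s" using Bm[OF s,of j] B(2)[of j] by simp
  thus "s : PS c" using pc[OF j(1)] j(1) lc by (auto simp: PS_def intro!: image_eqI[of _ _ j])
 qed
qed
have "fsl c x" unfolding fsl_def lc
proof (intro conjI allI impI)
 show "psum x n = psum c n" using pc[of n] Bm[OF Q(3),of n] B(2)[of n] by simp
 fix i assume i: "i<n" "c ! i ~= 0"
 hence lt: "B i<B(Suc i)" by (simp add: c_def)
 have gt: "psum x i<B(Suc i)" using Bm[OF B(1)[of "Suc i"],of i] lt by linarith
 obtain j where j: "j <= n" "B(Suc i) = psum x j" using B(1)[of "Suc i"] Q(1) x by (auto simp: PS_def)
 have "Suc i <= j" using gt j(2) psum_mono[of j i x] by linarith
 hence "psum x(Suc i) <= B(Suc i)" unfolding j(2) by (rule psum_mono)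
 hence e: "psum x(Suc i) = B(Suc i)" using B(2)[of "Suc i"] by simp
 thus "psum x(Suc i) = psum c(Suc i)" using pc[of "Suc i"] i by simp
 show "x ! i ~= 0" using e gt by (simp add: psum_Suc)
qed (simp add: x)
thus ?thesis using PSc by blast
qed

text \<open>The set \<open>PS\<close> in recursive form (\<open>ps_PS\<close>), which ignores zeros
  and suits the recursion over the blocks of a refinement.\<close>

fun ps :: "nat list => nat set" where
"ps [] = {0}"
| "ps(v # l) = insert 0((+) v ` ps l)"

lemma zero_ps [simp]: "0 : ps l" by (cases l) auto

lemma ps_le: "s : ps l ==> s <= sum_list l"
by (induction l arbitrary: s) auto

lemma ps_PS: "ps x = PS x"
proof (induction x)
case Nil show ?case by (simp add: PS_def)
next
case (Cons v x)
have e: "psum(v # x)(Suc k) = v+psum x k" for k unfolding psum_def sum.lessThan_Suc_shift by simp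
have "{..length(v # x)} = insert 0(Suc ` {..length x})" by (simp add: atMost_Suc_eq_insert_0)
thus ?case using Cons e by (simp add: PS_def image_image)
qed

lemma ps_flat: "ps(flat x) = ps x"
by (induction x) (auto simp: flat_def insert_absorb)

lemma ps_append: "ps(l @ m) = ps l Un(+)(sum_list l) ` ps m"
by (induction l) (auto)

lemma ps_inj: "0 ~: set l ==> 0 ~: set m ==> ps l = ps m ==> l = m"
proof (induction l arbitrary: m)
case Nil
show ?case
proof (cases m)
 case (Cons w m')
 hence "w : ps m" by (auto)
 hence "w : ps []" unfolding Nil.prems(3) .
 thus ?thesis using Nil Cons by simp
qed simp
next
case (Cons v l)
obtain w m' where m: "m = w # m'"
proof (cases m)
 case Nil
 have "v : ps(v # l)" by (auto)
 hence "v : ps []" unfolding Cons.prems(3) Nil .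
 thus ?thesis using Cons.prems Nil by simp
qed (use that in blast)
have "v : ps m" "w : ps(v # l)" using Cons.prems(3)
by (metis add_0_right image_eqI insertCI ps.simps(2) zero_ps,metis m add_0_right image_eqI insertCI ps.simps(2) zero_ps)
hence vw: "v = w" using Cons.prems m by auto
have "ps l = {s. v+s : ps(v # l)-{0}}" if "v ~= 0" for v l using that by auto
hence "ps l = ps m'" using Cons.prems m vw by (metis list.set_intros(1))
thus ?case using Cons m vw by auto
qed

lemma refines_ps:
 assumes "0 ~: set be" "0 ~: set al"
 shows "refines be al \<longleftrightarrow> ps al <= ps be & sum_list al = sum_list be"
proof
assume "refines be al"
then obtain bs where "concat bs = be" "map sum_list bs = al" by (auto simp: refines_def)
moreover have "ps(map sum_list bs) <= ps(concat bs) & sum_list(map sum_list bs) = sum_list(concat bs)"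
by (induction bs) (auto simp: ps_append)
ultimately show "ps al <= ps be & sum_list al = sum_list be" by simp
next
assume "ps al <= ps be & sum_list al = sum_list be"
thus "refines be al" using assms
proof (induction al arbitrary: be)
 case Nil
 hence "be = []" by (cases be) auto
 thus ?case by (simp add: refines_def)
next
 case (Cons v al)
 have "v : ps(v # al)" by (auto)
 hence "v : ps be" using Cons.prems by blast
 hence "v : PS be" by (simp add: ps_PS)
 then obtain k where k: "k <= length be" "v = sum_list(take k be)" by (auto simp: PS_def psum_take)
 let ?l = "take k be" and ?r = "drop k be"
 have pb: "ps be = ps ?l Un(+) v ` ps ?r" using ps_append[of ?l ?r] k by simp
 have sb: "sum_list be = v+sum_list ?r" using k(2) by (metis append_take_drop_id sum_list_append)
 have "ps al <= ps ?r"
 proof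
  fix s assume "s : ps al"
  hence "v+s : ps be" using Cons.prems by auto
  hence "v+s : ps ?l | s : ps ?r" unfolding pb by auto
  thus "s : ps ?r" using ps_le[of "v+s" ?l] k(2) by auto
 qed
 moreover have "0 ~: set ?r" using Cons.prems(2) by (meson in_set_dropD)
 ultimately have "refines ?r al" using Cons.IH[of ?r] Cons.prems sb by auto
 then obtain bs where bs: "concat bs = ?r" "map sum_list bs = al" "ALL x:set bs. x ~= []" by (auto simp: refines_def)
 have "v ~= 0" using Cons.prems by auto
 hence "?l ~= []" using k(2) by (metis sum_list.Nil)
 thus ?case unfolding refines_def using bs k(2) by (intro exI[of _ "?l # bs"]) auto
qed
qed

lemma refines_flat: "refines(flat x)(flat a) \<longleftrightarrow> PS a <= PS x & sum_list a = sum_list x"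
using refines_ps[OF flat_nonzero flat_nonzero,of x a] unfolding ps_PS[symmetric] ps_flat sum_list_flat .

lemma flat_PS: "flat b = flat a \<longleftrightarrow> PS b = PS a"
using ps_inj[OF flat_nonzero flat_nonzero,of b a] by (metis ps_flat ps_PS)

text \<open>Each exponent of the fundamental slide polynomial merges to exactly one composition with
  the nonzero parts of a, by \<open>fsl_merge\<close> and \<open>fsl_unique\<close>, so the
  particles of these compositions partition its monomials.\<close>

lemma fundslide_slidesum: "fundslide a = slidesum particle a"
proof -
let ?U = "{b. dom_ge b a & flat b = flat a}"
have set: "{x. dom_ge x a & refines(flat x)(flat a)} = (UN b:?U. {x. fsl b x})"
proof (rule set_eqI,rule iffI)
 fix x assume "x : {x. dom_ge x a & refines(flat x)(flat a)}"
 hence x: "length x = length a" "!!k. k <= length a ==> psum a k <= psum x k" "PS a <= PS x" "sum_list a = sum_list x"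
 by (auto simp: dom_ge_psum refines_flat)
 have t: "psum x(length x) = psum a(length a)" using x by (simp add: psum_take)
 obtain b where b: "PS b = PS a" "fsl b x"
 using zero_ps[of a] fsl_merge[of x "length x" "PS a"] x(3) by (auto simp: t ps_PS PS_def)
 have lb: "length b = length a" using b(2) x(1) by (simp add: fsl_def)
 have "psum a k <= psum b k" if "k <= length a" for k
 by (rule fsl_psum_max[OF b(2)]) (use that lb b(1) x(2) in \<open>auto simp: PS_def\<close>)
 hence "b : ?U" using lb b(1) by (simp add: dom_ge_psum flat_PS)
 thus "x : (UN b:?U. {x. fsl b x})" using b(2) by blast
next
 fix x assume "x : (UN b:?U. {x. fsl b x})"
 then obtain b where b: "dom_ge b a" "flat b = flat a" "fsl b x" by blast
 have lb: "length b = length a" using b(1) by (simp add: dom_ge_def)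
 have "psum a k <= psum x k" if "k <= length a" for k
 using b(1) that fsl_dom[OF b(3),of k] by (fastforce simp: dom_ge_psum)
 moreover have "length x = length a" "sum_list x = sum_list b" using fsl_sum[OF b(3)] lb by auto
 moreover have "sum_list b = sum_list a" using b(2) by (metis sum_list_flat)
 moreover have "PS a <= PS x" using fsl_PS[OF b(3)] b(2) flat_PS by simp
 ultimately show "x : {x. dom_ge x a & refines(flat x)(flat a)}" by (simp add: dom_ge_psum refines_flat)
qed
have "fundslide a = (SUM b:?U. SUM x:{x. fsl b x}. xmon x)" unfolding fundslide_def set
proof (rule sum.UNION_disjoint)
 show "ALL b:?U. ALL b':?U. b ~= b' --> {x. fsl b x} Int {x. fsl b' x} = {}"
 using fsl_unique flat_PS by fastforce
qed (auto simp: finite_slides finite_fsl)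
thus ?thesis by (simp add: slidesum_def particle_alt)
qed

text \<open>The letter at place r of the weakly increasing word in which v occurs
  \<open>y ! v\<close> times.\<close>

definition wd :: "nat list => nat => nat" where
"wd y r = (LEAST v. r<psum y(Suc v))"

lemma wd_less_iff:
 assumes "r<psum y n"
 shows "wd y r<v \<longleftrightarrow> r<psum y v"
proof
obtain m where "n = Suc m" using assms by (cases n) auto
hence l: "r<psum y(Suc(wd y r))" unfolding wd_def using assms by (simp add: LeastI[where P= "%v. r<psum y(Suc v)" and k=m])
assume "wd y r<v"
hence "psum y(Suc(wd y r)) <= psum y v" by (intro psum_mono) simp
thus "r<psum y v" using l by simp
next
assume r: "r<psum y v"
then obtain u where v: "v = Suc u" by (cases v) auto
hence "wd y r <= u" unfolding wd_def using r Least_le[where P= "%v. r<psum y(Suc v)" and k=u] by simp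
thus "wd y r<v" using v by simp
qed

lemma nat_eq_by_less: "p<(n::nat) ==> q<n ==> (!!v. v <= n ==> p<v \<longleftrightarrow> q<v) ==> p = q"
proof (rule linorder_cases[of p q])
assume *: "p<n" "q<n" "!!v. v <= n ==> p<v \<longleftrightarrow> q<v"
show "p<q ==> p = q" using *(2) *(3)[of q] by simp
show "q<p ==> p = q" using *(1) *(3)[of p] by simp
qed

subsection \<open>P-partitions\<close>

locale labelled =
 fixes E :: "'e set" and lab :: "'e => nat" and n :: nat
 assumes fin: "finite E" and inj: "inj_on lab E"
begin

text \<open>Elements are ordered by value, ties by label; \<open>pos\<close> is then the
  standardization of the filling f.\<close>

definition bef :: "('e => nat) => 'e => 'e => bool" where
"bef f e e' \<longleftrightarrow> f e<f e' | (f e = f e' & lab e<lab e')"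

definition pos :: "('e => nat) => 'e => nat" where
"pos f e = card {e':E. bef f e' e}"

definition cont :: "('e => nat) => nat list" where
"cont f = map(%v. card {e:E. f e = v}) [0..<n]"

lemma length_cont [simp]: "length(cont f) = n" by (simp add: cont_def)

lemma psum_cont: "v <= n ==> psum(cont f) v = card {e:E. f e<v}"
proof (induction v)
case (Suc v)
have "{e:E. f e<Suc v} = {e:E. f e<v} Un {e:E. f e = v}" by auto
hence "card {e:E. f e<Suc v} = card {e:E. f e<v}+card {e:E. f e = v}"
using fin by (simp add: card_Un_disjoint disjoint_iff)
thus ?case using Suc by (simp add: psum_Suc cont_def)
qed simp

lemma psum_cont_total: "(!!e. e : E ==> f e<n) ==> psum(cont f) n = card E"
proof -
assume "!!e. e : E ==> f e<n"
hence "{e:E. f e<n} = E" by auto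
thus ?thesis by (simp add: psum_cont)
qed

lemma bef_total: "e : E ==> e' : E ==> e ~= e' ==> bef f e e' | bef f e' e"
using inj by (auto simp: bef_def inj_on_def) (metis linorder_neqE_nat)

lemma bef_asym: "bef f e e' ==> ~ bef f e' e" by (auto simp: bef_def)

lemma bef_pos: "e : E ==> bef f e e' ==> pos f e<pos f e'"
unfolding pos_def by (rule psubset_card_mono) (use fin in \<open>auto simp: bef_def\<close>)

lemma pos_bef: "e : E ==> e' : E ==> pos f e<pos f e' \<longleftrightarrow> bef f e e'"
by (metis bef_pos bef_total less_asym less_irrefl)

lemma pos_bij: "bij_betw(pos f) E {..<card E}"
proof -
have i: "inj_on(pos f) E" by (rule inj_onI) (metis bef_pos bef_total less_irrefl)
have "pos f e<card E" if "e : E" for e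
unfolding pos_def by (rule psubset_card_mono) (use fin that in \<open>auto simp: bef_def\<close>)
hence "pos f ` E <= {..<card E}" by auto
moreover have "card(pos f ` E) = card E" by (rule card_image[OF i])
ultimately have "pos f ` E = {..<card E}" by (intro card_subset_eq) auto
thus ?thesis using i by (simp add: bij_betw_def)
qed

lemma less_iff_pos:
 assumes "e : E" "v <= n"
 shows "f e<v \<longleftrightarrow> pos f e<psum(cont f) v"
proof -
have p: "psum(cont f) v = card {e:E. f e<v}" by (rule psum_cont[OF assms(2)])
show ?thesis
proof (cases "f e<v")
 case True
 have "pos f e<card {e:E. f e<v}" unfolding pos_def
 by (rule psubset_card_mono) (use fin assms True in \<open>auto simp: bef_def\<close>)
 thus ?thesis using True p by simp
next
 case False
 have "card {e:E. f e<v} <= pos f e" unfolding pos_def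
 by (rule card_mono) (use fin False in \<open>auto simp: bef_def\<close>)
 thus ?thesis using False p by simp
qed
qed

definition same :: "('e => nat) => ('e => nat) => bool" where
"same f h \<longleftrightarrow> (ALL e:E. ALL e':E. bef f e e' \<longleftrightarrow> bef h e e')"

lemma same_pos: "same f h ==> e : E ==> pos f e = pos h e"
unfolding pos_def same_def by (rule arg_cong[where f=card]) blast

text \<open>The partial sums that the content of f cannot avoid (\<open>cuts_PS\<close>): the two
  ends, the descents of the standardization, and the places just after the marked elements
  L.\<close>

definition cuts :: "'e set => ('e => nat) => nat set" where
"cuts L f = {0,card E} Un {s. EX e:E. EX e':E. s = pos f e' & pos f e' = Suc(pos f e) & lab e'<lab e}
Un {s. EX l:L. s = Suc(pos f l)}"

lemma same_cuts: "same f h ==> L <= E ==> cuts L f = cuts L h"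
proof -
assume s: "same f h" and L: "L <= E"
note p=same_pos[OF s]
have "{s. EX e:E. EX e':E. s = pos f e' & pos f e' = Suc(pos f e) & lab e'<lab e} =
{s. EX e:E. EX e':E. s = pos h e' & pos h e' = Suc(pos h e) & lab e'<lab e}" by (simp add: p cong: bex_cong)
moreover have "{s. EX l:L. s = Suc(pos f l)} = {s. EX l:L. s = Suc(pos h l)}"
using L p by (intro Collect_cong bex_cong) auto
ultimately show ?thesis by (simp only: cuts_def)
qed

definition last_of_value :: "'e set => ('e => nat) => bool" where
"last_of_value L f \<longleftrightarrow> (ALL l:L. ALL e:E. f e = f l --> lab e <= lab l)"

lemma cuts_PS:
 assumes f: "!!e. e : E ==> f e<n" and L: "L <= E" "last_of_value L f"
 shows "cuts L f <= PS(cont f)"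
proof
fix s assume "s : cuts L f"
then consider "s = 0" | "s = card E" | e e' where "e : E" "e' : E" "s = pos f e'" "pos f e' = Suc(pos f e)" "lab e'<lab e"
| l where "l : L" "s = Suc(pos f l)" by (auto simp: cuts_def)
then obtain k where "k <= n" "s = psum(cont f) k"
proof cases
 case 1 thus ?thesis using that[of 0] by simp
next
 case 2 thus ?thesis using that[of n] psum_cont_total[OF f] by simp
next
 case (3 e e')
 have "bef f e e'" using pos_bef[OF 3(1,2),of f] 3(4) by simp
 hence lt: "f e<f e'" using 3(5) by (auto simp: bef_def)
 have k: "f e' <= n" using f[OF 3(2)] by simp
 have "pos f e<psum(cont f)(f e')" using less_iff_pos[OF 3(1) k,of f] lt by simp
 moreover have "~ pos f e'<psum(cont f)(f e')" using less_iff_pos[OF 3(2) k,of f] by simp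
 ultimately show ?thesis using that[of "f e'"] k 3(3,4) by simp
next
 case (4 l)
 hence l: "l : E" using L by blast
 have "{e:E. f e<Suc(f l)} = insert l {e:E. bef f e l}"
 proof (rule set_eqI,rule iffI)
  fix e assume e: "e : {e:E. f e<Suc(f l)}"
  hence "f e<f l | f e = f l" by auto
  thus "e : insert l {e:E. bef f e l}"
  using L(2) 4(1) e l inj by (auto simp: last_of_value_def bef_def inj_on_def le_less)
 qed (use l in \<open>auto simp: bef_def\<close>)
 moreover have "l ~: {e:E. bef f e l}" by (auto simp: bef_def)
 ultimately have "card {e:E. f e<Suc(f l)} = Suc(pos f l)" using fin by (simp add: pos_def)
 hence "psum(cont f)(Suc(f l)) = Suc(pos f l)" using psum_cont[of "Suc(f l)" f] f[OF l] by simp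
 thus ?thesis using that[of "Suc(f l)"] 4(2) f[OF l] by simp
qed
thus "s : PS(cont f)" by (auto simp: PS_def)
qed

text \<open>The filling with the standardization of f and content y, provided that the cuts of f are
  among the partial sums of y (\<open>same_rfill\<close>).\<close>

definition rfill :: "('e => nat) => nat list => 'e => nat" where
"rfill f y e = (if e : E then wd y(pos f e) else 0)"

lemma rfill_less:
 assumes y: "psum y n = card E" and e: "e : E"
 shows "rfill f y e<v \<longleftrightarrow> pos f e<psum y v"
using pos_bij[of f] e y wd_less_iff[of "pos f e" y n v] by (auto simp: bij_betw_def rfill_def)

lemma cont_rfill:
 assumes y: "length y = n" "psum y n = card E"
 shows "cont(rfill f y) = y"
proof (rule psum_inj[of _ n])
fix k assume k: "k <= n"
have le: "psum y k <= card E" using psum_mono[OF k,of y] y by simp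
have "{e:E. rfill f y e<k} = {e:E. pos f e<psum y k}" using rfill_less[OF y(2)] by auto
moreover have "card {e:E. pos f e<psum y k} = card {..<psum y k}"
proof (rule bij_betw_same_card[of "pos f"])
 have "pos f ` {e:E. pos f e<psum y k} = {..<psum y k}"
 using set_eqI pos_bij[of f] le by (auto simp: bij_betw_def)
 thus "bij_betw(pos f) {e:E. pos f e<psum y k} {..<psum y k}"
 using pos_bij[of f] by (auto simp: bij_betw_def intro: inj_on_subset)
qed
ultimately show "psum(cont(rfill f y)) k = psum y k" using psum_cont[OF k,of "rfill f y"] by simp
qed (use y in auto)

lemma same_rfill:
 assumes y: "length y = n" "psum y n = card E" and c: "cuts L f <= PS y"
 shows "same f(rfill f y)"
proof -
let ?h = "rfill f y"
have main: "bef ?h e e'" if e: "e : E" "e' : E" "bef f e e'" for e e'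
proof -
 have lt: "pos f e<pos f e'" using pos_bef[OF e(1,2),of f] e(3) by simp
 have le: "?h e <= ?h e'"
 using rfill_less[OF y(2) e(2),of f "?h e"] y(2) e(2) rfill_less[OF y(2) e(1),of f "?h e"] lt e(1) by auto
 show ?thesis
 proof (cases "?h e<?h e'")
  case True thus ?thesis by (simp add: bef_def)
 next
  case False
  hence eq: "?h e = ?h e'" using le by simp
  define g where "g r = inv_into E(pos f) r" for r
  have g: "g r : E" "pos f(g r) = r" if "r<card E" for r
  proof -
   have "r : pos f ` E" using pos_bij[of f] that by (simp add: bij_betw_def)
   thus "g r : E" "pos f(g r) = r" unfolding g_def by (auto intro: inv_into_into f_inv_into_f)
  qed
  have gp: "g(pos f e) = e" if "e : E" for e unfolding g_def using pos_bij[of f] that by (auto simp: bij_betw_def)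
  have p': "pos f e'<card E" using pos_bij[of f] e(2) by (auto simp: bij_betw_def)
  \<comment> \<open>Between consecutive places with the same new value there is no cut, hence no
    descent: labels increase along the whole run.\<close>
  have up: "lab(g r)<lab(g(Suc r))" if r: "pos f e <= r" "r<pos f e'" for r
  proof (rule ccontr)
   assume n: "~ lab(g r)<lab(g(Suc r))"
   have gr: "g r : E" "pos f(g r) = r" "g(Suc r) : E" "pos f(g(Suc r)) = Suc r" using g[of r] g[of "Suc r"] r p' by auto
   hence "lab(g(Suc r)) ~= lab(g r)" using inj by (metis inj_on_def n_not_Suc_n)
   hence "lab(g(Suc r))<lab(g r)" using n by simp
   hence "EX e:E. EX e':E. Suc r = pos f e' & pos f e' = Suc(pos f e) & lab e'<lab e"
   using gr by (intro bexI[of _ "g r"] bexI[of _ "g(Suc r)"]) auto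
   hence "Suc r : cuts L f" unfolding cuts_def by blast
   then obtain k where k: "psum y k = Suc r" using c by (auto simp: PS_def)
   have "?h e<k" using rfill_less[OF y(2) e(1),of f k] k r by simp
   moreover have "~ ?h e'<k" using rfill_less[OF y(2) e(2),of f k] k r by simp
   ultimately show False using eq by simp
  qed
  have "pos f e+d <= pos f e' ==> d > 0 ==> lab(g(pos f e))<lab(g(pos f e+d))" for d
  proof (induction d)
   case (Suc d)
   thus ?case using up[of "pos f e+d"] by (cases "d = 0") auto
  qed simp
  from this[of "pos f e'-pos f e"] have "lab e<lab e'" using lt gp e by simp
  thus ?thesis using eq by (simp add: bef_def)
 qed
qed
show ?thesis unfolding same_def
using main bef_total bef_asym by (metis bef_def less_irrefl)
qed

text \<open>A marked element closes a merged part, and that part stands at the element's own value;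
  hence all fixed slides of c keep this value.\<close>

lemma fixed_value:
 assumes f: "!!e. e : E ==> f e<n" and c: "length c = n" "fsl c(cont f)" and l: "l : E" "Suc(pos f l) : PS c"
 shows "EX v<n. c ! v ~= 0 & psum c(Suc v) = Suc(pos f l) & f l = v"
proof -
obtain v where v: "v<n" "c ! v ~= 0" "psum c(Suc v) = Suc(pos f l)" using PS_positive[OF l(2)] c by auto
hence x: "cont f ! v ~= 0" "psum(cont f)(Suc v) = Suc(pos f l)" using c by (auto simp: fsl_def)
hence "psum(cont f) v <= pos f l" by (simp add: psum_Suc)
hence "~ f l<v" "f l<Suc v" using less_iff_pos[OF l(1),of v f] less_iff_pos[OF l(1),of "Suc v" f] v x by auto
hence "f l = v" by simp
thus ?thesis using v by blast
qed

text \<open>The P-partition argument: fillings with the same standardization whose contents are merged to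
the same composition \<open>c\<close> along the descents are enumerated by the fixed slides of \<open>c\<close>.\<close>

lemma particle_positive:
 assumes V: "finite V" "!!f e. f : V ==> e : E ==> f e<n" "!!f e. f : V ==> e ~: E ==> f e = 0"
 and L: "L <= E" "!!f. f : V ==> last_of_value L f"
 and closed: "!!f h. f : V ==> same f h ==> (!!e. e : E ==> h e<n) ==> (!!e. e ~: E ==> h e = 0) ==> 
(!!l. l : L ==> h l = f l) ==> last_of_value L h ==> h : V"
 shows "(SUM f:V. xmon(cont f)) : cone particle n"
proof -
define c where "c f = (SOME c. PS c = cuts L f & fsl c(cont f))" for f
have c: "PS(c f) = cuts L f & fsl(c f)(cont f)" if "f : V" for f
proof -
 have "psum(cont f) n = card E" by (rule psum_cont_total) (use V(2) that in auto)
 hence "EX c. PS c = cuts L f & fsl c(cont f)"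
 using cuts_PS[OF V(2)[OF that] L(1) L(2)[OF that]] by (intro fsl_merge[of _ n]) (auto simp: cuts_def)
 thus ?thesis unfolding c_def by (rule someI_ex)
qed
have lc: "length(c f) = n" if "f : V" for f using c[OF that] by (simp add: fsl_def)
\<comment> \<open>Fillings are grouped by standardization and merged content; each group turns out
  to be a single particle.\<close>
define K where "K f = ({(e,e'). e : E & e' : E & bef f e e'},c f)" for f
have Ksame: "K f = K h \<longleftrightarrow> same f h & c f = c h" for f h unfolding K_def same_def by auto
have cls: "(SUM h:{h:V. K h = K f}. xmon(cont h)) = particle(c f)" if f: "f : V" for f
proof -
 have "bij_betw cont {h:V. K h = K f} {b. fsl(c f) b}"
 proof (rule bij_betw_imageI)
  show "inj_on cont {h:V. K h = K f}"
  proof (rule inj_onI)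
   fix h h' assume "h : {h:V. K h = K f}" "h' : {h:V. K h = K f}" and eq: "cont h = cont h'"
   hence h: "h : V" "h' : V" "same h h'" using Ksame by (auto simp: same_def)
   show "h = h'"
   proof
    fix e show "h e = h' e"
    by (smt(verit) nat_eq_by_less[of _ n] V(2) h eq same_pos h(3) V(3)[OF h(1)] V(3)[OF h(2)] h(1) h(2) less_iff_pos)
   qed
  qed
  show "cont ` {h:V. K h = K f} = {b. fsl(c f) b}"
  proof (rule set_eqI,rule iffI)
   fix y assume "y : cont ` {h:V. K h = K f}"
   then obtain h where h: "h : V" "K h = K f" "y = cont h" by auto
   have "c h = c f" using h(2) Ksame by blast
   thus "y : {b. fsl(c f) b}" using c[OF h(1)] h(3) by simp
  next
   fix y assume "y : {b. fsl(c f) b}"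
   hence fy: "fsl(c f) y" by simp
   hence ly: "length y = n" using lc[OF f] by (simp add: fsl_def)
   have "psum y n = psum(cont f) n" using fy c[OF f] lc[OF f] by (simp add: fsl_def)
   also have "...=card E" by (rule psum_cont_total) (use V(2) f in auto)
   finally have py: "psum y n = card E" .
   let ?h = "rfill f y"
   have cont: "cont ?h = y" by (rule cont_rfill[OF ly py])
   have cy: "cuts L f <= PS y" using fsl_PS[OF fy] c[OF f] by simp
   have sm: "same f ?h" by (rule same_rfill[OF ly py cy])
   have hn: "?h e<n" if "e : E" for e
   using rfill_less[OF py that,of f n] pos_bij[of f] that py by (auto simp: bij_betw_def)
   have fixv: "?h l = f l & psum y(Suc(f l)) = Suc(pos f l)" if l: "l : L" for l
   proof -
    have lE: "l : E" using l L by blast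
    have in_c: "Suc(pos f l) : PS(c f)" using c[OF f] l by (auto simp: cuts_def)
    obtain v where v: "v<n" "c f ! v ~= 0" "psum(c f)(Suc v) = Suc(pos f l)" "f l = v"
    using fixed_value[of f "c f" l,OF V(2)[OF f] lc[OF f] _ lE in_c] c[OF f] by blast
    have y: "y ! v ~= 0" "psum y(Suc v) = Suc(pos f l)" using fy v lc[OF f] by (auto simp: fsl_def)
    hence "psum y v <= pos f l" by (simp add: psum_Suc)
    hence "~ ?h l<v" "?h l<Suc v" using rfill_less[OF py lE,of f] y(2) by auto
    thus ?thesis using v(4) y(2) by auto
   qed
   have lastv: "last_of_value L ?h" unfolding last_of_value_def
   proof (intro ballI impI)
    fix l e assume l: "l : L" and e: "e : E" "?h e = ?h l"
    have lE: "l : E" using l L by blast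
    have "?h e<Suc(f l)" using e(2) fixv[OF l] by simp
    hence "pos f e<Suc(pos f l)" using rfill_less[OF py e(1),of f "Suc(f l)"] fixv[OF l] by simp
    hence "~ bef f l e" using pos_bef[OF lE e(1),of f] by simp
    hence "~ bef ?h l e" using sm lE e(1) by (auto simp: same_def)
    thus "lab e <= lab l" using e(2) by (auto simp: bef_def)
   qed
   have hV: "?h : V" by (rule closed[OF f sm hn _ _ lastv]) (use fixv in \<open>auto simp: rfill_def\<close>)
   have "c ?h = c f"
   by (rule fsl_unique[of _ y]) (use c[OF hV] c[OF f] cont fy same_cuts[OF sm L(1)] in auto)
   hence "K ?h = K f" unfolding Ksame using sm by (auto simp: same_def)
   thus "y : cont ` {h:V. K h = K f}" using hV cont by (intro image_eqI[of _ _ ?h]) auto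
  qed
 qed
 thus ?thesis unfolding particle_alt by (rule sum.reindex_bij_betw)
qed
have "(SUM f:V. xmon(cont f)) = (SUM k:K ` V. SUM h:{h:V. K h = k}. xmon(cont h))"
by (rule sum.image_gen[OF V(1)])
also have "... : cone particle n"
by (rule cone_sum) (auto simp: cls cone_base lc)
finally show ?thesis .
qed

end

text \<open>The fixed slides of a as weakly increasing words: the last letter of the block belonging
  to the nonzero part at v is forced to be v, and no later letter has that value. These forced
  letters become the marked set L of the P-partition argument.\<close>

definition words :: "nat list => (nat => nat) set" where
"words a = {w. (ALL k. sum_list a <= k --> w k = 0) & (ALL k<sum_list a. w k<length a) &
(ALL j k. j <= k & k<sum_list a --> w j <= w k) &
(ALL v<length a. a ! v ~= 0 --> w(psum a(Suc v)-1) = v &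
(psum a(Suc v)<sum_list a --> v<w(psum a(Suc v))))}"

lemma psum_le_sum: "k <= length a ==> psum a k <= sum_list a"
using psum_mono[of k "length a" a] by (simp add: psum_take)

interpretation letters: labelled "{..<N}" "%k. k" n for N n
by unfold_locales auto

lemma words_pos:
 assumes w: "w : words a" and k: "k<sum_list a"
 shows "letters.pos(sum_list a) w k = k"
proof -
have "letters.bef w j k \<longleftrightarrow> j<k" if "j<sum_list a" for j
proof -
 have m: "w i <= w j" if "i <= j" "j<sum_list a" for i j using w that unfolding words_def by blast
 show ?thesis
 proof (cases "j<k")
  case True thus ?thesis using m[of j k] k by (auto simp: letters.bef_def)
 next
  case False thus ?thesis using m[of k j] that by (auto simp: letters.bef_def)
 qed
qed
hence "{e' : {..<sum_list a}. letters.bef w e' k} = {..<k}" using k by auto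
thus ?thesis by (simp add: letters.pos_def)
qed

lemma particle_words: "particle a = (SUM w:words a. xmon(letters.cont(sum_list a)(length a) w))"
proof -
let ?N = "sum_list a" and ?n = "length a"
let ?c = "letters.cont ?N ?n"
have pa: "psum a ?n = ?N" by (simp add: psum_take)
have less: "w k<v \<longleftrightarrow> k<psum(?c w) v" if "w : words a" "k<?N" "v <= ?n" for w k v
using letters.less_iff_pos[of k ?N v ?n w] words_pos[OF that(1,2)] that by simp
have wn: "w k<?n" if "w : words a" "k<?N" for w k using that unfolding words_def by blast
have wf: "w(psum a(Suc v)-1) = v" "psum a(Suc v)<?N ==> v<w(psum a(Suc v))"
if "w : words a" "v<?n" "a ! v ~= 0" for w v using that unfolding words_def by blast+
have "bij_betw ?c(words a) {b. fsl a b}"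
proof (rule bij_betw_imageI)
 show "inj_on ?c(words a)"
 proof (rule inj_onI,rule ext)
  fix w w' k assume w: "w : words a" "w' : words a" "?c w = ?c w'"
  show "w k = w' k"
  proof (cases "k<?N")
   case True
   show ?thesis
   using nat_eq_by_less[of _ ?n] less True wn w by auto
  next
   case False
   hence "?N <= k" by simp
   thus ?thesis using w(1,2) unfolding words_def by (metis(mono_tags,lifting) mem_Collect_eq)
  qed
 qed
 show "?c ` words a = {b. fsl a b}"
 proof (rule set_eqI,rule iffI)
  fix y assume "y : ?c ` words a"
  then obtain w where w: "w : words a" "y = ?c w" by blast
  have tot: "psum y ?n = ?N" unfolding w(2) using letters.psum_cont_total[of ?N w ?n] wn[OF w(1)] by simp
  have "fsl a y" unfolding fsl_def
  proof (intro conjI allI impI)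
   show "length y = ?n" using w(2) by simp
   show "psum y ?n = psum a ?n" using tot pa by simp
   fix v assume v: "v<?n" "a ! v ~= 0"
   let ?s = "psum a(Suc v)"
   have s: "0<?s" "?s <= ?N" using v psum_le_sum[of "Suc v" a] by (auto simp: psum_Suc)
   note ws=wf[OF w(1) v]
   have lt: "?s-1<?N" using s by simp
   have "?s-1<psum y(Suc v)" using less[OF w(1) lt,of "Suc v"] ws(1) v w(2) by simp
   moreover have "psum y(Suc v) <= ?s"
   proof (cases "?s<?N")
    case True thus ?thesis using less[OF w(1) True,of "Suc v"] ws(2) v w(2) by simp
   next
    case False
    thus ?thesis using psum_mono[of "Suc v" ?n y] v tot by simp
   qed
   ultimately show e: "psum y(Suc v) = ?s" by simp
   have "~ ?s-1<psum y v" using less[OF w(1) lt,of v] ws(1) v w(2) by simp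
   thus "y ! v ~= 0" using e s by (auto simp: psum_Suc)
  qed
  thus "y : {b. fsl a b}" by simp
 next
  fix y assume "y : {b. fsl a b}"
  hence y: "fsl a y" by simp
  have ly: "length y = ?n" and py: "psum y ?n = ?N" using y pa by (auto simp: fsl_def)
  define w where "w k = (if k<?N then wd y k else 0)" for k
  have wl: "w k<v \<longleftrightarrow> k<psum y v" if "k<?N" for k v
  using wd_less_iff[of k y ?n v] that py by (simp add: w_def)
  have W: "w : words a" unfolding words_def
  proof (intro CollectI conjI allI impI)
   fix k assume "k<?N" thus "w k<?n" using wl py by simp
  next
   fix j k assume jk: "j <= k & k<?N"
   show "w j <= w k"
   using wl[of k "w j"] jk wl[of j "w j"] by auto
  next
   fix v assume v: "v<?n" "a ! v ~= 0"
   let ?s = "psum a(Suc v)"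
   have s: "0<?s" "?s <= ?N" using v psum_le_sum[of "Suc v" a] by (auto simp: psum_Suc)
   have e: "psum y(Suc v) = ?s" "y ! v ~= 0" using y v by (auto simp: fsl_def)
   have "~ w(?s-1)<v" "w(?s-1)<Suc v" using wl[of "?s-1"] s e by (auto simp: psum_Suc[of y])
   thus "w(?s-1) = v" by simp
   assume "?s<?N"
   thus "v<w ?s" using wl[of ?s "Suc v"] e by simp
  qed (simp add: w_def)
  have "?c w = y"
  proof (rule psum_inj[of _ ?n])
   fix k assume k: "k <= ?n"
   have "psum y k <= ?N" using psum_mono[OF k,of y] py by simp
   hence "{e : {..<?N}. w e<k} = {..<psum y k}" using wl by auto
   thus "psum(?c w) k = psum y k" using letters.psum_cont[OF k,of ?N w] by simp
  qed (use ly in auto)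
  thus "y : ?c ` words a" using W by blast
 qed
qed
thus ?thesis unfolding particle_alt by (rule sum.reindex_bij_betw[symmetric])
qed

lemma finite_words: "finite(words a)"
proof (rule finite_subset)
show "words a <= {w. ALL k. (k : {..<sum_list a} --> w k : {..<length a}) & (k ~: {..<sum_list a} --> w k = 0)}"
by (auto simp: words_def)
qed (rule finite_set_of_finite_funs,auto)

text \<open>Labels decrease with the row index, so an equality down a column would reverse the
  standard order, which encodes strict columns; along a row they increase, which permits equalities.
  All letters come after all cells, so that a forced letter can be the last of its value.\<close>

definition pairlab :: "nat list => (nat \<times> nat)+nat => nat" where
"pairlab lam e = (case e of Inl(i,j) => (length lam-i) * Suc(sum_list lam)+j
| Inr k => Suc(length lam) * Suc(sum_list lam)+k)"

lemma young_col_less: "(i,j) : young lam ==> j<Suc(sum_list lam)"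
using member_le_sum_list[of "lam ! i" lam] by (force simp: young_def)

lemma pairlab_Inl_less: "(i,j) : young lam ==> pairlab lam(Inl(i,j))<pairlab lam(Inr k)"
proof -
assume "(i,j) : young lam"
hence "(length lam-i) * Suc(sum_list lam)+j<length lam * Suc(sum_list lam)+Suc(sum_list lam)"
using young_col_less by (intro add_le_less_mono mult_le_mono1) auto
thus ?thesis by (simp add: pairlab_def)
qed

lemma pairlab_row_less: "(i,j) : young lam ==> (i',j') : young lam ==> i'<i ==> 
pairlab lam(Inl(i,j))<pairlab lam(Inl(i',j'))"
proof -
assume y: "(i,j) : young lam" "(i',j') : young lam" and i: "i'<i"
have "i<length lam" using y by (simp add: young_def)
hence "Suc(length lam-i) <= length lam-i'" using i by simp
hence "Suc(length lam-i) * Suc(sum_list lam) <= (length lam-i') * Suc(sum_list lam)" by (rule mult_le_mono1)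
thus ?thesis using young_col_less[OF y(1)] by (simp add: pairlab_def)
qed

lemma inj_pairlab: "inj_on(pairlab lam)(Inl ` young lam Un Inr ` {..<N})"
proof (rule inj_onI)
fix e e' assume e: "e : Inl ` young lam Un Inr ` {..<N}" "e' : Inl ` young lam Un Inr ` {..<N}" "pairlab lam e = pairlab lam e'"
show "e = e'"
proof (cases e)
 case (Inl x)
 obtain i j where x: "x = (i,j)" by (cases x)
 have xy: "(i,j) : young lam" using e(1) Inl x by auto
 show ?thesis
 proof (cases e')
  case Inl': (Inl x')
  obtain i' j' where x': "x' = (i',j')" by (cases x')
  have xy': "(i',j') : young lam" using e(2) Inl' x' by auto
  have "i = i'" using pairlab_row_less[OF xy xy'] pairlab_row_less[OF xy' xy] e(3) Inl Inl' x x' by (metis less_irrefl linorder_neqE_nat)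
  thus ?thesis using e(3) Inl Inl' x x' by (simp add: pairlab_def)
 next
  case (Inr k) thus ?thesis using pairlab_Inl_less[OF xy,of k] e(3) Inl x by simp
 qed
next
 case (Inr k)
 show ?thesis
 proof (cases e')
  case (Inl x')
  obtain i' j' where x': "x' = (i',j')" by (cases x')
  have "(i',j') : young lam" using e(2) Inl x' by auto
  thus ?thesis using pairlab_Inl_less[of i' j' lam k] e(3) Inl Inr x' by simp
 next
  case Inr': (Inr k') thus ?thesis using e(3) Inr by (simp add: pairlab_def)
 qed
qed
qed

lemma labelled_pair: "labelled(Inl ` young lam Un Inr ` {..<N})(pairlab lam)"
by unfold_locales(auto intro: inj_pairlab)

text \<open>A pair of a tableau and a word is one filling of the disjoint union of cells and
  letters. Its conditions are conditions on the standardization, except that forced letters keep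
  their value and stay the last of it, which the set L records.\<close>

lemma particle_schur:
 assumes a: "length a = n" and lam: "partition lam"
 shows "particle a * schur n lam : cone particle n"
proof -
define N where "N = sum_list a"
let ?E = "Inl ` young lam Un Inr ` {..<N}"
interpret labelled ?E "pairlab lam" n by (rule labelled_pair)
\<comment> \<open>Tableau entries count from 1 and letters from 0; the shift turns both into
  variable indices.\<close>
define pr :: "((nat \<times> nat => nat) \<times> (nat => nat)) => (nat \<times> nat)+nat => nat" where
"pr = (%(T,w). case_sum(%x. T x-1) w)"
define V where "V = pr ` (ssyt n lam \<times> words a)"
define L :: "((nat \<times> nat)+nat) set" where "L = Inr ` {psum a(Suc v)-1 | v. v<n & a ! v ~= 0}"
have L_less: "psum a(Suc v)-1<N" "0<psum a(Suc v)" if "v<n" "a ! v ~= 0" for v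
using that psum_le_sum[of "Suc v" a] a by (auto simp: psum_Suc N_def)
have inj_pr: "inj_on pr(ssyt n lam \<times> words a)"
proof (rule inj_onI)
 fix p q assume p: "p : ssyt n lam \<times> words a" and q: "q : ssyt n lam \<times> words a" and e: "pr p = pr q"
 obtain T w T' w' where pq: "p = (T,w)" "q = (T',w')" by (cases p; cases q)
 have "w k = w' k" for k using fun_cong[OF e,of "Inr k"] pq by (simp add: pr_def)
 moreover have "T x = T' x" for x
 proof (cases "x : young lam")
  case True
  hence "T x >= 1" "T' x >= 1" using p q pq by (auto simp: ssyt_def)
  thus ?thesis using fun_cong[OF e,of "Inl x"] pq by (simp add: pr_def)
 next
  case False
  hence "T x = 0" "T' x = 0" using p q unfolding pq ssyt_def by blast+
  thus ?thesis by simp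
 qed
 ultimately show "p = q" using pq by auto
qed
have cont_pr: "xmon(cont(pr(T,w))) = xmon(tw n lam T) * xmon(letters.cont N n w)" if T: "T : ssyt n lam" for T w
proof -
 have "card {e : ?E. pr(T,w) e = v} = card {x : young lam. T x = Suc v}+card {k : {..<N}. w k = v}" for v
 proof -
  have "{e : ?E. pr(T,w) e = v} = Inl ` {x : young lam. T x = Suc v} Un Inr ` {k : {..<N}. w k = v}"
  using set_eqI T by (auto simp: ssyt_def pr_def)
  moreover have "card(Inl ` {x : young lam. T x = Suc v} Un Inr ` {k : {..<N}. w k = v} :: ((nat \<times> nat)+nat) set) =
  card(Inl ` {x : young lam. T x = Suc v} :: ((nat \<times> nat)+nat) set)+card(Inr ` {k : {..<N}. w k = v} :: ((nat \<times> nat)+nat) set)"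
  by (rule card_Un_disjoint) auto
  ultimately show ?thesis by (simp add: card_image)
 qed
 hence "cont(pr(T,w)) = map2(+)(tw n lam T)(letters.cont N n w)"
 by (intro nth_equalityI) (auto simp: cont_def tw_def letters.cont_def)
 thus ?thesis by (simp add: xmon_mult tw_def)
qed
have "particle a * schur n lam = (SUM T:ssyt n lam. SUM w:words a. xmon(tw n lam T) * xmon(letters.cont N n w))"
unfolding particle_words schur_alt a N_def by (subst mult.commute) (rule sum_product)
also have "...=(SUM T:ssyt n lam. SUM w:words a. xmon(cont(pr(T,w))))"
by (simp add: cont_pr)
also have "...=(SUM p:ssyt n lam \<times> words a. xmon(cont(pr p)))"
by (simp add: sum.cartesian_product)
also have "...=(SUM f:V. xmon(cont f))" unfolding V_def using inj_pr by (simp add: sum.reindex)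
also have "... : cone particle n"
proof (rule particle_positive[where L=L])
 show "finite V" unfolding V_def using finite_words by simp
 show "L <= ?E" using L_less by (auto simp: L_def)
next
 fix f e assume "f : V"
 then obtain T w where f: "T : ssyt n lam" "w : words a" "f = pr(T,w)" by (auto simp: V_def)
 show "f e<n" if "e : ?E"
 proof (cases e)
  case (Inl x)
  hence "T x : {1..n}" using f(1) that by (auto simp: ssyt_def)
  thus ?thesis using f(3) Inl by (auto simp: pr_def)
 next
  case (Inr k)
  hence "w k<length a" using f(2) that unfolding words_def N_def by blast
  thus ?thesis using f(3) Inr a by (simp add: pr_def)
 qed
 show "f e = 0" if "e ~: ?E"
 proof (cases e)
  case (Inl x)
  hence "x ~: young lam" using that by blast
  hence "T x = 0" using f(1) unfolding ssyt_def by blast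
  thus ?thesis using f(3) Inl by (simp add: pr_def)
 next
  case (Inr k)
  hence "N <= k" using that by (auto)
  hence "w k = 0" using f(2) unfolding words_def N_def by blast
  thus ?thesis using f(3) Inr by (simp add: pr_def)
 qed
next
 fix f assume "f : V"
 then obtain T w where f: "T : ssyt n lam" "w : words a" "f = pr(T,w)" by (auto simp: V_def)
 show "last_of_value L f" unfolding last_of_value_def
 proof (intro ballI impI)
  fix l e assume l: "l : L" and e: "e : ?E" "f e = f l"
  obtain v where v: "v<n" "a ! v ~= 0" "l = Inr(psum a(Suc v)-1)" using l by (auto simp: L_def)
  show "pairlab lam e <= pairlab lam l"
  proof (cases e)
   case (Inl x)
   thus ?thesis using e(1) pairlab_Inl_less[of "fst x" "snd x" lam] v(3) by (auto intro: less_imp_le)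
  next
   case (Inr k)
   have k: "k<N" using e(1) Inr by auto
   have wl: "w(psum a(Suc v)-1) = v" "psum a(Suc v)<N ==> v<w(psum a(Suc v))"
   using f(2) v unfolding words_def N_def a by blast+
   have "w k = v" using e(2) Inr v(3) f(3) wl(1) by (simp add: pr_def)
   have "k <= psum a(Suc v)-1"
   proof (rule ccontr)
    assume "~ k <= psum a(Suc v)-1"
    hence s: "psum a(Suc v) <= k" by simp
    hence "w(psum a(Suc v)) <= w k" using f(2) k unfolding words_def N_def by blast
    thus False using wl(2) s k \<open>w k=v\<close> by simp
   qed
   thus ?thesis using Inr v(3) by (simp add: pairlab_def)
  qed
 qed
next
 fix f h assume fV: "f : V" and sm: "same f h" and hn: "!!e. e : ?E ==> h e<n" and h0: "!!e. e ~: ?E ==> h e = 0"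
 and hl: "!!l. l : L ==> h l = f l" and lv: "last_of_value L h"
 obtain T w where f: "T : ssyt n lam" "w : words a" "f = pr(T,w)" using fV by (auto simp: V_def)
 have bb: "bef f e e' ==> bef h e e'" if "e : ?E" "e' : ?E" for e e' using sm that by (simp add: same_def)
 define T' where "T' x = (if x : young lam then Suc(h(Inl x)) else 0)" for x
 define w' where "w' k = h(Inr k)" for k
 have Tv: "f(Inl x) = T x-1" for x using f(3) by (simp add: pr_def)
 have Tpos: "T x >= 1" if "x : young lam" for x using f(1) that by (auto simp: ssyt_def)
 have T': "T' : ssyt n lam" unfolding ssyt_def
 proof (intro CollectI conjI ballI allI impI)
  fix x assume "x : young lam" thus "T' x : {1..n}" using hn[of "Inl x"] by (simp add: T'_def)
 next
  fix x assume "x ~: young lam" thus "T' x = 0" by (simp add: T'_def)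
 next
  fix i j assume y: "(i,Suc j) : young lam"
  hence y': "(i,j) : young lam" by (auto simp: young_def)
  have "T(i,j) <= T(i,Suc j)" using f(1) y by (auto simp: ssyt_def)
  hence "bef f(Inl(i,j))(Inl(i,Suc j))" by (auto simp: bef_def Tv pairlab_def)
  from bb[OF _ _ this] y y' show "T'(i,j) <= T'(i,Suc j)" by (auto simp: T'_def bef_def)
 next
  fix i j assume y: "(Suc i,j) : young lam"
  hence y': "(i,j) : young lam" using young_up[OF lam y,of i] by simp
  have "T(i,j)<T(Suc i,j)" using f(1) y by (auto simp: ssyt_def)
  hence "bef f(Inl(i,j))(Inl(Suc i,j))" using Tpos[OF y'] by (auto simp: bef_def Tv)
  from bb[OF _ _ this] y y' have "bef h(Inl(i,j))(Inl(Suc i,j))" by auto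
  thus "T'(i,j)<T'(Suc i,j)" using pairlab_row_less[OF y y'] y by (auto simp: T'_def bef_def)
 qed
 have wf: "f(Inr k) = w k" for k using f(3) by (simp add: pr_def)
 have mono: "w' j <= w' k" if "j <= k" "k<N" for j k
 proof (cases "j = k")
  case False
  hence jk: "j<k" using that by simp
  have "w j <= w k" using f(2) that unfolding words_def N_def by blast
  hence "bef f(Inr j)(Inr k)" using jk by (auto simp: bef_def wf pairlab_def)
  from bb[OF _ _ this] that show ?thesis by (auto simp: w'_def bef_def)
 qed simp
 have W': "w' : words a" unfolding words_def
 proof (intro CollectI conjI allI impI)
  fix k assume "sum_list a <= k"
  hence "Inr k ~: ?E" by (auto simp: N_def)
  thus "w' k = 0" using h0 by (simp add: w'_def)
 next
  fix k assume "k<sum_list a" thus "w' k<length a" using hn[of "Inr k"] a by (auto simp: w'_def N_def)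
 next
  fix j k assume "j <= k & k<sum_list a" thus "w' j <= w' k" using mono by (simp add: N_def)
 next
  fix v assume v: "v<length a" "a ! v ~= 0"
  let ?s = "psum a(Suc v)"
  have l: "Inr(?s-1) : L" using v a by (auto simp: L_def)
  have "w(?s-1) = v" using f(2) v unfolding words_def by blast
  thus wv: "w'(?s-1) = v" using hl[OF l] wf by (simp add: w'_def)
  assume s: "?s<sum_list a"
  have sp: "0<?s" using L_less(2) v a by simp
  have "v <= w' ?s" using mono[of "?s-1" ?s] s wv by (simp add: N_def)
  moreover have "w' ?s ~= v"
  proof
   assume "w' ?s = v"
   hence "pairlab lam(Inr ?s) <= pairlab lam(Inr(?s-1))"
   using lv l s wv unfolding last_of_value_def by (auto simp: w'_def N_def)
   thus False using sp by (simp add: pairlab_def)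
  qed
  ultimately show "v<w' ?s" by simp
 qed
 have "h = pr(T',w')"
 proof
  fix e show "h e = pr(T',w') e"
  using h0[of e] by (cases e) (auto simp: pr_def T'_def w'_def)
 qed
 thus "h : V" unfolding V_def using T' W' by blast
qed
finally show ?thesis .
qed

interpretation particles: slide_family particle
by unfold_locales(auto simp: triangular_particle res_particle del_def particle_schur)

theorem fundslide_schur:
 assumes "length a = n" "partition lam"
 shows "fundslide a * schur n lam : cone fundslide n"
by (metis particles.slidesum_schur[OF assms] assms fun_eq_iff fundslide_slidesum)

subsection \<open>Quasi-key polynomials\<close>

definition Lr :: "nat list => nat set" where "Lr b = {r. r<length b & 0<b ! r}"
definition Nr :: "nat list => nat set" where "Nr b = {r. r<length b & Suc 0<b ! r}"
definition pe :: "nat list => nat list" where "pe b = map(%x. x-1) b"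

text \<open>Row r of shape e is relocated to row \<open>s r - 1\<close>, and rows with
  \<open>s r = 0\<close> are dropped. In its uses s is injective on the nonzero rows, so no lengths
  are really added.\<close>

definition dd :: "nat list => (nat => nat) => nat list" where
"dd e s = map(%p. SUM r<length e. if s r = Suc p then e ! r else 0) [0..<length e]"

text \<open>The candidates for the second column beside a first column u. The ordering conditions
  depend on row lengths, as in quasi-key tableaux and unlike \<open>ok\<close>; the two descriptions
  of an atom meet in \<open>atom_recursion\<close> and \<open>FQ_recursion\<close>.\<close>

definition Sig :: "nat list => (nat => nat) => (nat => nat) set" where
"Sig b u = {s. (ALL r. r ~: Nr b --> s r = 0) & (ALL r:Nr b. 0<s r & s r <= u r) & inj_on s(Nr b) &
(ALL r r'. r<r' & r : Nr b & r' : Nr b & b ! r = b ! r' --> s r<s r') &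
(ALL r r'. r<r' & r : Lr b & r' : Nr b & b ! r<b ! r' --> u r<s r')}"

lemma SigI:
 assumes "!!r. r ~: Nr b ==> s r = 0" "!!r. r : Nr b ==> 0<s r" "!!r. r : Nr b ==> s r <= u r" "inj_on s(Nr b)"
"!!r r'. r<r' ==> r : Nr b ==> r' : Nr b ==> b ! r = b ! r' ==> s r<s r'"
"!!r r'. r<r' ==> r : Lr b ==> r' : Nr b ==> b ! r<b ! r' ==> u r<s r'"
 shows "s : Sig b u"
unfolding Sig_def using assms by blast

lemma SigD:
 assumes "s : Sig b u"
 shows "!!r. r ~: Nr b ==> s r = 0" "!!r. r : Nr b ==> 0<s r" "!!r. r : Nr b ==> s r <= u r" "inj_on s(Nr b)"
"!!r r'. r<r' ==> r : Nr b ==> r' : Nr b ==> b ! r = b ! r' ==> s r<s r'"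
"!!r r'. r<r' ==> r : Lr b ==> r' : Nr b ==> b ! r<b ! r' ==> u r<s r'"
using assms unfolding Sig_def by blast+

lemma Nr_Lr: "Nr b <= Lr b" by (auto simp: Nr_def Lr_def)
lemma finite_Lr [simp]: "finite(Lr b)" by (simp add: Lr_def)
lemma finite_Nr [simp]: "finite(Nr b)" by (simp add: Nr_def)
lemma length_pe [simp]: "length(pe b) = length b" by (simp add: pe_def)
lemma length_dd [simp]: "length(dd e s) = length e" by (simp add: dd_def)

lemma finite_Sig: "finite(Sig b u)"
proof (rule finite_subset)
let ?M = "Max(u ` Nr b)"
show "Sig b u <= {s. ALL r. (r : Nr b --> s r : {..?M}) & (r ~: Nr b --> s r = 0)}"
proof
 fix s assume s: "s : Sig b u"
 have "s r <= ?M" if "r : Nr b" for r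
 proof -
  have "u r <= ?M" by (rule Max_ge) (use that in auto)
  thus ?thesis using SigD(3)[OF s that] by simp
 qed
 thus "s : {s. ALL r. (r : Nr b --> s r : {..?M}) & (r ~: Nr b --> s r = 0)}" using SigD(1)[OF s] by simp
qed
qed (rule finite_set_of_finite_funs,auto)

text \<open>The remaining length of the row whose second entry is v, which is the part of
  \<open>dd (pe b) s\<close> belonging to v (\<open>nth_dd\<close>).\<close>

definition occ :: "nat list => (nat => nat) => nat => nat" where
"occ b s v = (SUM r<length b. if s r = v then b ! r-1 else 0)"

lemma nth_dd: "p<length b ==> dd(pe b) s ! p = occ b s(Suc p)"
proof -
assume "p<length b"
moreover have "(SUM r<length b. if s r = Suc p then pe b ! r else 0) = occ b s(Suc p)"
unfolding occ_def by (rule sum.cong) (auto simp: pe_def)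
ultimately show ?thesis by (simp add: dd_def)
qed

lemma occ_eq:
 assumes z: "!!r. r ~: Nr b ==> s r = 0" and i: "inj_on s(Nr b)" and r: "r : Nr b" "0<s r"
 shows "occ b s(s r) = b ! r-1"
proof -
have "occ b s(s r) = (SUM q<length b. if q = r then b ! r-1 else 0)" unfolding occ_def
proof (rule sum.cong)
 fix q assume "q : {..<length b}"
 have "s q = s r \<longleftrightarrow> q = r"
 proof
  assume e: "s q = s r"
  hence "q : Nr b" using z[of q] r(2) by (cases "q : Nr b") auto
  thus "q = r" using i e r(1) by (auto dest: inj_onD)
 qed simp
 thus "(if s q = s r then b ! q-1 else 0) = (if q = r then b ! r-1 else 0)" by auto
qed simp
also have "...=b ! r-1" using r(1) by (simp add: Nr_def)
finally show ?thesis .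
qed

lemma occ_pos:
 assumes z: "!!r. r ~: Nr b ==> s r = 0" and "0<occ b s v" "0<v"
 shows "EX r:Nr b. s r = v"
proof (rule ccontr)
assume "~ ?thesis"
hence "s r ~= v" for r using z[of r] assms(3) by (cases "r : Nr b") auto
hence "occ b s v = 0" by (simp add: occ_def)
thus False using assms(2) by simp
qed

lemma sv_less: "x<y ==> ~ (x = Suc i & y = Suc(Suc i)) ==> sv i x<sv i y"
by (rule rsw_less)

lemma dd_sv: "Suc i<length b ==> dd(pe b)(sv i o s) = swapl i(dd(pe b) s)"
proof (rule nth_equalityI)
assume i: "Suc i<length b"
fix p assume "p<length(dd(pe b)(sv i o s))"
hence p: "p<length b" by simp
have "sv i x = Suc p \<longleftrightarrow> x = Suc(swapidx i p)" for x by (auto simp: swapidx_def)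
hence "occ b(sv i o s)(Suc p) = occ b s(Suc(swapidx i p))" by (simp add: occ_def)
moreover have "swapidx i p<length b" using i p by (auto simp: swapidx_def)
ultimately show "dd(pe b)(sv i o s) ! p = swapl i(dd(pe b) s) ! p" using i p by (simp add: nth_dd nth_swapl)
qed simp

text \<open>One step of raising a first column: the entry \<open>Suc i\<close> of row j becomes
  \<open>Suc(Suc i)\<close>, which is free. The sum over \<open>Sig\<close> reacts to it by pi_i
  (\<open>pidiff_Sig\<close>), as the fillings do by \<open>Fk_sv\<close>.\<close>

locale push =
 fixes b :: "nat list" and u :: "nat => nat" and i j :: nat
 assumes mono: "strict_mono_on(Lr b) u" and j: "j : Lr b" "u j = Suc i"
 and free: "!!r. r : Lr b ==> u r ~= Suc(Suc i)"
begin

abbreviation "u' == sv i o u"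

lemma ui: "r : Lr b ==> u r = Suc i ==> r = j"
using mono j by (metis strict_mono_on_imp_inj_on inj_onD)

lemma u'_other: "r : Lr b ==> r ~= j ==> u' r = u r"
using ui free by (auto simp: swapidx_def)

lemma u'_j: "u' j = Suc(Suc i)" using j by (simp add: swapidx_def)

lemma u_le_u': "r : Lr b ==> u r <= u' r"
using u'_other u'_j j by (cases "r = j") auto

lemma above_j: "r : Lr b ==> Suc i <= u r ==> r ~= j ==> j<r & Suc(Suc i)<u r"
proof -
assume r: "r : Lr b" "Suc i <= u r" "r ~= j"
have "u r ~= Suc i" "u r ~= Suc(Suc i)" using ui free r by auto
hence lt: "Suc(Suc i)<u r" using r(2) by simp
have "~ r<j" using strict_mono_onD[OF mono r(1) j(1)] j(2) lt by fastforce
thus ?thesis using lt r(3) by simp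
qed

text \<open>Only comparisons of row j with the value \<open>Suc(Suc i)\<close> can change. By the
  hypothesis on lengths, a violation would give some row above j, at least as long, the second entry
  \<open>Suc i\<close>, which the ordering conditions exclude.\<close>

lemma Sig_stay:
 assumes le: "occ b s(Suc(Suc i)) <= occ b s(Suc i)"
 shows "s : Sig b u \<longleftrightarrow> s : Sig b u'"
proof
assume s: "s : Sig b u"
note S=SigD[OF s]
show "s : Sig b u'"
proof (rule SigI)
 fix r assume "r : Nr b" thus "s r <= u' r" using S(3)[of r] u_le_u'[of r] Nr_Lr by force
next
 fix r q assume rq: "r<q" "r : Lr b" "q : Nr b" "b ! r<b ! q"
 hence lt: "u r<s q" by (rule S(6))
 show "u' r<s q"
 proof (cases "r = j")
  case True
  have "s q ~= Suc(Suc i)"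
  proof
   assume q: "s q = Suc(Suc i)"
   hence "occ b s(Suc(Suc i)) = b ! q-1" using occ_eq[of b s,OF S(1) S(4) rq(3)] by simp
   hence o: "b ! q-1 <= occ b s(Suc i)" "0<b ! q-1" using le rq(3) by (auto simp: Nr_def)
   hence "0<occ b s(Suc i)" by simp
   then obtain p where p: "p : Nr b" "s p = Suc i" using occ_pos[of b s,OF S(1)] by blast
   hence "occ b s(Suc i) = b ! p-1" using occ_eq[of b s,OF S(1) S(4) p(1)] by simp
   hence bp: "b ! j<b ! p" using o rq(4) True by simp
   have "Suc i <= u p" using S(3)[OF p(1)] p(2) by simp
   hence "j<p" using above_j[of p] bp p(1) Nr_Lr by blast
   hence "Suc i<s p" using S(6)[of j p] j p bp by simp
   thus False using p(2) by simp
  qed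
  thus ?thesis using True lt j u'_j by simp
 qed (use lt u'_other rq in auto)
qed (use S in auto)
next
assume s: "s : Sig b u'"
note S=SigD[OF s]
show "s : Sig b u"
proof (rule SigI)
 fix r assume r: "r : Nr b"
 show "s r <= u r"
 proof (cases "r = j")
  case True
  have "s j ~= Suc(Suc i)"
  proof
   assume q: "s j = Suc(Suc i)"
   hence "occ b s(Suc(Suc i)) = b ! j-1" using occ_eq[of b s,OF S(1) S(4) r] True by simp
   hence o: "b ! j-1 <= occ b s(Suc i)" "0<b ! j-1" using le r True by (auto simp: Nr_def)
   hence "0<occ b s(Suc i)" by simp
   then obtain p where p: "p : Nr b" "s p = Suc i" using occ_pos[of b s,OF S(1)] by blast
   hence "occ b s(Suc i) = b ! p-1" using occ_eq[of b s,OF S(1) S(4) p(1)] by simp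
   hence bp: "b ! j <= b ! p" using o by simp
   have pj: "p ~= j" using p q by auto
   have pL: "p : Lr b" using p(1) Nr_Lr by blast
   have "Suc i <= u p" using S(3)[OF p(1)] p(2) u'_other[OF pL pj] by simp
   hence jp: "j<p" using above_j[OF pL _ pj] by blast
   show False
   using S(5)[OF jp] r \<open>r=j\<close> q S(6)[OF jp j(1) p(1)] bp u'_j p(2) p(1) by force
  qed
  thus ?thesis using S(3)[OF r] True u'_j j(2) by simp
 next
  case False
  have "r : Lr b" using r Nr_Lr by blast
  thus ?thesis using S(3)[OF r] u'_other False by simp
 qed
next
 fix r q assume rq: "r<q" "r : Lr b" "q : Nr b" "b ! r<b ! q"
 thus "u r<s q" using S(6)[OF rq] u_le_u'[OF rq(2)] by simp
qed (use S in auto)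
qed

lemma Sig_swap:
 assumes lt: "occ b s(Suc(Suc i))<occ b s(Suc i)"
 shows "s : Sig b u \<longleftrightarrow> sv i o s : Sig b u'"
proof
assume s: "s : Sig b u"
note S=SigD[OF s]
obtain p where p: "p : Nr b" "s p = Suc i" using occ_pos[of b s "Suc i",OF S(1)] lt by auto
have op: "occ b s(Suc i) = b ! p-1" using occ_eq[of b s,OF S(1) S(4) p(1)] p by simp
have bq: "b ! q<b ! p" if "q : Nr b" "s q = Suc(Suc i)" for q
using occ_eq[of b s,OF S(1) S(4) that(1)] that(2) lt op by simp
have pL: "p : Lr b" using p Nr_Lr by blast
have up: "Suc i <= u p" using S(3)[OF p(1)] p(2) by simp
have bpj: "b ! p <= b ! j"
using above_j[OF pL up] up S(6)[of j p] j p by force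
show "sv i o s : Sig b u'"
proof (rule SigI)
 fix r assume "r ~: Nr b" thus "(sv i o s) r = 0" using S(1)[of r] by (simp add: swapidx_def)
next
 fix r assume "r : Nr b" thus "0<(sv i o s) r" using S(2)[of r] by (auto simp: swapidx_def)
next
 fix r assume r: "r : Nr b"
 have rL: "r : Lr b" using r Nr_Lr by blast
 show "(sv i o s) r <= u' r"
 using r S(3)[OF r] u_le_u'[OF rL] by (force simp: swapidx_def)
next
 show "inj_on(sv i o s)(Nr b)" by (rule inj_on_sv[OF S(4)])
next
 fix r q assume rq: "r<q" "r : Nr b" "q : Nr b" "b ! r = b ! q"
 have "s r<s q" by (rule S(5)[OF rq])
 moreover have "~ (s r = Suc i & s q = Suc(Suc i))"
 proof
  assume h: "s r = Suc i & s q = Suc(Suc i)"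
  hence "r = p" using p rq(2) S(4) by (metis inj_onD)
  thus False using bq[OF rq(3)] h rq(4) by simp
 qed
 ultimately show "(sv i o s) r<(sv i o s) q" using sv_less by simp
next
 fix r q assume rq: "r<q" "r : Lr b" "q : Nr b" "b ! r<b ! q"
 have l: "u r<s q" by (rule S(6)[OF rq])
 show "u' r<(sv i o s) q"
 using bq[OF rq(3)] bpj rq(4) rq(3) l ui rq(2) by (auto simp: swapidx_def)
qed
next
assume t: "sv i o s : Sig b u'"
note S=SigD[OF t]
have z: "s r = 0" if "r ~: Nr b" for r using S(1)[OF that] by (auto simp: swapidx_def split: if_splits)
have inj: "inj_on s(Nr b)" using inj_on_sv[OF S(4),of i] by simp
have nz: "0<s r" if "r : Nr b" for r using S(2)[OF that] by (auto simp: swapidx_def split: if_splits)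
obtain p where p: "p : Nr b" "s p = Suc i" using occ_pos[of b s "Suc i",OF z] lt by auto
have op: "occ b s(Suc i) = b ! p-1" using occ_eq[of b s,OF z inj p(1)] p by simp
have bq: "b ! q<b ! p" if "q : Nr b" "s q = Suc(Suc i)" for q
using occ_eq[of b s,OF z inj that(1)] that(2) lt op by simp
have pL: "p : Lr b" using p Nr_Lr by blast
have up: "Suc(Suc i) <= u' p" using S(3)[OF p(1)] p(2) by (simp add: swapidx_def)
have upp: "Suc i <= u p" using up u'_other[OF pL] j by (cases "p = j") auto
have bpj: "b ! p <= b ! j"
using above_j[OF pL upp] pL S(6)[of j p] j p by (force)
show "s : Sig b u"
proof (rule SigI)
 fix r assume r: "r : Nr b"
 have rL: "r : Lr b" using r Nr_Lr by blast
 have tr: "sv i(s r) <= u' r" using S(3)[OF r] by simp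
 show "s r <= u r"
 using bq[OF r] bpj tr u'_other rL above_j by (force simp: swapidx_def split: if_splits)
next
 fix r q assume rq: "r<q" "r : Nr b" "q : Nr b" "b ! r = b ! q"
 have l: "sv i(s r)<sv i(s q)" using S(5)[OF rq] by simp
 moreover have "~ (sv i(s r) = Suc i & sv i(s q) = Suc(Suc i))"
 proof
  assume "sv i(s r) = Suc i & sv i(s q) = Suc(Suc i)"
  hence h: "s r = Suc(Suc i)" "s q = Suc i" by (auto simp: swapidx_def split: if_splits)
  hence "q = p" using p rq(3) inj by (metis inj_onD)
  thus False using bq[OF rq(2)] h rq(4) by simp
 qed
 ultimately show "s r<s q" using sv_less[of "sv i(s r)" "sv i(s q)" i] by simp
next
 fix r q assume rq: "r<q" "r : Lr b" "q : Nr b" "b ! r<b ! q"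
 have l: "u' r<sv i(s q)" using S(6)[OF rq] by simp
 show "u r<s q"
 proof (cases "r = j")
  case True
  thus ?thesis using l u'_j by (auto simp: swapidx_def split: if_splits)
 next
  case False
  hence "u r ~= Suc i" "u r<sv i(s q)" using ui rq(2) l u'_other[OF rq(2) False] by auto
  thus ?thesis by (auto simp: swapidx_def split: if_splits)
 qed
qed (use z nz inj in auto)
qed

text \<open>\<open>pidiff_atom\<close> keeps the terms with weakly decreasing parts at i and adds
  the swapped index for strictly decreasing ones; \<open>Sig_stay\<close> and
  \<open>Sig_swap\<close> match the result with the terms over the raised column.\<close>

lemma pidiff_Sig:
 assumes i: "Suc i<length b"
 shows "pidiff i(SUM s:Sig b u. atom(dd(pe b) s)) = (SUM s:Sig b u'. atom(dd(pe b) s))"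
proof -
let ?A = "%s. atom(dd(pe b) s)"
let ?x = "%s. occ b s(Suc i)" and ?y = "%s. occ b s(Suc(Suc i))"
have pd: "pidiff i(?A s) = (if ?y s <= ?x s then ?A s else 0)+(if ?y s<?x s then ?A(sv i o s) else 0)" for s
using pidiff_atom[of i "dd(pe b) s"] i by (auto simp: nth_dd dd_sv)
have "pidiff i(SUM s:Sig b u. ?A s) = (SUM s:{s:Sig b u. ?y s <= ?x s}. ?A s)+(SUM s:{s:Sig b u. ?y s<?x s}. ?A(sv i o s))"
unfolding pidiff_sum pd sum.distrib using finite_Sig by (simp add: sum.inter_filter)
also have "{s:Sig b u. ?y s <= ?x s} = {s:Sig b u'. ?y s <= ?x s}" using Sig_stay by blast
also have "(SUM s:{s:Sig b u. ?y s<?x s}. ?A(sv i o s)) = (SUM s:{s:Sig b u'. ~ ?y s <= ?x s}. ?A s)"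
proof (rule sum.reindex_bij_witness[of _ "%s. sv i o s" "%s. sv i o s"])
 have o: "?x(sv i o s) = ?y s" "?y(sv i o s) = ?x s" for s
 unfolding occ_def by (rule sum.cong; auto simp: swapidx_def)+
 fix s
 show "sv i o s : {s:Sig b u'. ~ ?y s <= ?x s}" if "s : {s:Sig b u. ?y s<?x s}"
 using that Sig_swap[of s] o by auto
 show "sv i o s : {s:Sig b u. ?y s<?x s}" if "s : {s:Sig b u'. ~ ?y s <= ?x s}"
 using that Sig_swap[of "sv i o s"] o by auto
qed auto
also have "(SUM s:{s:Sig b u'. ?y s <= ?x s}. ?A s)+(SUM s:{s:Sig b u'. ~ ?y s <= ?x s}. ?A s) = (SUM s:Sig b u'. ?A s)"
proof -
 have "Sig b u' = {s:Sig b u'. ?y s <= ?x s} Un {s:Sig b u'. ~ ?y s <= ?x s}" by blast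
 thus ?thesis using sum.union_disjoint[of "{s:Sig b u'. ?y s <= ?x s}" "{s:Sig b u'. ~ ?y s <= ?x s}" ?A] finite_Sig[of b u']
 by (metis(no_types,lifting) disjoint_iff finite_Un mem_Collect_eq)
qed
finally show ?thesis .
qed

end

lemma rows_Lr: "rows(length b)(ln b)(Suc 0) = Lr b"
by (auto simp: rows_def Lr_def ln_def)

lemma rows_Nr: "rows(length b)(ln b)(Suc(Suc 0)) = Nr b"
by (auto simp: rows_def Nr_def ln_def)

section \<open>Recursion for atoms along the first column\<close>

definition rankL :: "nat list => nat => nat" where
"rankL b r = card {q:Lr b. q<r}"

lemma rankL_mono: "r : Lr b ==> r<q ==> rankL b r<rankL b q"
unfolding rankL_def by (rule psubset_card_mono) auto

lemma rankL_bij: "bij_betw(rankL b)(Lr b) {..<card(Lr b)}"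
proof -
have i: "inj_on(rankL b)(Lr b)" by (rule inj_onI) (metis rankL_mono less_irrefl linorder_neqE_nat)
have "rankL b r<card(Lr b)" if "r : Lr b" for r
unfolding rankL_def by (rule psubset_card_mono) (use that in auto)
hence "rankL b ` Lr b <= {..<card(Lr b)}" by auto
hence "rankL b ` Lr b = {..<card(Lr b)}" using card_image[OF i] by (intro card_subset_eq) auto
thus ?thesis using i by (simp add: bij_betw_def)
qed

lemma rankL_less: "r : Lr b ==> rankL b r<card(Lr b)"
unfolding rankL_def by (rule psubset_card_mono) auto

lemma card_Lr: "card(Lr b) <= length b"
proof -
have "card(Lr b) <= card {..<length b}" by (rule card_mono) (auto simp: Lr_def)
thus ?thesis by simp
qed

lemma rankL_le:
 assumes u: "strict_mono_on(Lr b) u" "!!r. r : Lr b ==> 0<u r" and r: "r : Lr b"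
 shows "rankL b r<u r"
proof -
have "card(u ` {q:Lr b. q<r}) = rankL b r" unfolding rankL_def
by (rule card_image) (rule inj_on_subset[OF strict_mono_on_imp_inj_on[OF u(1)]],auto)
moreover have "u ` {q:Lr b. q<r} <= {1..<u r}" using u r by (auto simp: Suc_le_eq strict_mono_on_def)
hence "card(u ` {q:Lr b. q<r}) <= card {1..<u r}" by (intro card_mono) auto
ultimately show ?thesis using u(2)[OF r] by simp
qed

text \<open>If the first column is 1, 2, ..., the nonzero rows can be compressed to the bottom over
  the basement \<open>Suc\<close>, so the continuations form a single atom; correspondingly the
  second column is forced to copy the first.\<close>

lemma Fk_rank:
 assumes u: "!!r. r : Lr b ==> u r = Suc(rankL b r)" and k: "!!r. ln b r <= Suc k"
 shows "Fk(length b)(ln b) k(Suc 0) u = (SUM s:Sig b u. atom(dd(pe b) s))"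
proof -
let ?n = "length b"
define s0 where "s0 r = (if r : Nr b then u r else 0)" for r
let ?d = "dd(pe b) s0"
have inju: "inj_on u(Lr b)" using u rankL_bij[of b] by (auto simp: bij_betw_def inj_on_def)
have z: "!!r. r ~: Nr b ==> s0 r = 0" by (simp add: s0_def)
have inj0: "inj_on s0(Nr b)"
proof (rule inj_onI)
 fix x y assume xy: "x : Nr b" "y : Nr b" "s0 x = s0 y"
 hence "u x = u y" "x : Lr b" "y : Lr b" using Nr_Lr by (auto simp: s0_def)
 thus "x = y" using inju by (auto dest: inj_onD)
qed
\<comment> \<open>A smaller second entry would equal the first-column entry of a lower row; that row
  either copies it already or ends, and the latter is forbidden by the last condition of
  \<open>Sig\<close>.\<close>
have uq: "s = s0" if s: "s : Sig b u" for s
proof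
 note S=SigD[OF s]
 fix r show "s r = s0 r"
 proof (induction r rule: less_induct)
  case (less r)
  show ?case
  proof (cases "r : Nr b")
   case True
   have rL: "r : Lr b" using True Nr_Lr by blast
   have "~ s r<u r"
   proof
    assume lt: "s r<u r"
    have "rankL b r<card(Lr b)" by (rule rankL_less[OF rL])
    hence "s r-1<card(Lr b)" using lt u[OF rL] by simp
    hence "s r-1 : rankL b ` Lr b" using rankL_bij[of b] by (simp add: bij_betw_def)
    then obtain q where q: "q : Lr b" "rankL b q = s r-1" by auto
    have sq: "u q = s r" using u[OF q(1)] q(2) S(2)[OF True] by simp
    have qr: "q<r"
    proof (rule ccontr)
     assume "~ q<r"
     hence "r = q | r<q" by auto
     thus False using rankL_mono[OF rL,of q] lt sq u[OF rL] u[OF q(1)] by auto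
    qed
    show False
    proof (cases "q : Nr b")
     case qN: True
     hence "s q = s r" using less[OF qr] sq by (simp add: s0_def)
     thus False using S(4) qN True qr by (auto dest: inj_onD)
    next
     case False
     hence "b ! q<b ! r" using q(1) True by (auto simp: Lr_def Nr_def)
     thus False using S(6)[OF qr q(1) True] sq by simp
    qed
   qed
   thus ?thesis using S(3)[OF True] True by (simp add: s0_def)
  qed (use S(1) z in simp)
 qed
qed
have um: "u r<u q" if "r : Lr b" "q : Lr b" "r<q" for r q using u that rankL_mono by simp
have NL: "r : Lr b" if "r : Nr b" for r using that Nr_Lr by blast
have sN: "s0 r = u r" if "r : Nr b" for r using that by (simp add: s0_def)
have in0: "s0 : Sig b u"
using SigI sN u NL um[OF NL NL] um by (auto simp: z sN inj0)
have Sig0: "Sig b u = {s0}"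
using uq in0 by blast
have val: "ln ?d(rankL b r) = b ! r-1" if r: "r : Lr b" for r
proof -
 have lt: "rankL b r<?n" using rankL_less[OF r] card_Lr[of b] by simp
 have "occ b s0(Suc(rankL b r)) = b ! r-1"
 proof (cases "r : Nr b")
  case True
  thus ?thesis using occ_eq[of b s0,OF z inj0 True] u[OF r] by (simp add: s0_def)
 next
  case False
  have "occ b s0(Suc(rankL b r)) = 0"
  proof (rule ccontr)
   assume "occ b s0(Suc(rankL b r)) ~= 0"
   then obtain q where q: "q : Nr b" "s0 q = Suc(rankL b r)" using occ_pos[of b s0,OF z] by blast
   hence "u q = u r" "q : Lr b" using u[OF r] Nr_Lr by (auto simp: s0_def)
   hence "q = r" using inju r by (auto dest: inj_onD)
   thus False using False q by simp
  qed
  thus ?thesis using False r by (auto simp: Lr_def Nr_def)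
 qed
 thus ?thesis using lt by (simp add: ln_def nth_dd)
qed
have out: "ln ?d q = 0" if q: "q ~: rankL b ` Lr b" for q
using occ_pos[of b s0,OF z] z Nr_Lr u q by (force simp: ln_def nth_dd s0_def split: if_splits)
have bound: "ln ?d p <= k" for p
proof (cases "p : rankL b ` Lr b")
 case True
 then obtain r where r: "r : Lr b" "p = rankL b r" by auto
 have "b ! r <= Suc k" using k[of r] r(1) by (simp add: ln_def Lr_def)
 thus ?thesis using val[OF r(1)] r(2) by simp
qed (use out in simp)
have "Fk ?n(ln b) k(Suc 0) u = Fk ?n(ln ?d) k 0 Suc"
proof (rule Fk_reindex[where h= "rankL b"])
 show "strict_mono_on(rows ?n(ln b)(Suc 0))(rankL b)" unfolding rows_Lr by (rule strict_mono_onI) (rule rankL_mono)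
 show "rankL b ` rows ?n(ln b)(Suc 0) <= rows ?n(ln ?d) 0" unfolding rows_Lr
 using rankL_less card_Lr[of b] by (force simp: rows_def)
next
 fix r assume "r : rows ?n(ln b)(Suc 0)"
 hence r: "r : Lr b" unfolding rows_Lr .
 show "ln ?d(rankL b r)+Suc 0 = ln b r+0" using val[OF r] r by (auto simp: ln_def Lr_def)
 show "Suc(rankL b r) = u r" using u[OF r] by simp
next
 fix q assume q: "q : rows ?n(ln ?d) 0-rankL b ` rows ?n(ln b)(Suc 0)"
 hence qn: "q ~: rankL b ` Lr b" unfolding rows_Lr by blast
 thus "ln ?d q = 0" by (rule out)
 fix r assume "r : rows ?n(ln b)(Suc(Suc 0))"
 hence "r : Lr b" unfolding rows_Nr using Nr_Lr by blast
 hence "rankL b r<card(Lr b)" by (rule rankL_less)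
 moreover have "card(Lr b) <= q"
 using rankL_bij[of b] qn by (auto simp: bij_betw_def)
 ultimately show "rankL b r<q" by simp
qed
also have "...=atom ?d" using atom_Fk[of ?d ?n k] bound by simp
finally show ?thesis by (simp add: Sig0)
qed

text \<open>Any increasing first column is reached from 1, 2, ... by raising one entry at a time
  through free values; both sides change by pi_i at each step.\<close>

lemma Fk_increasing:
 assumes k: "!!r. ln b r <= Suc k"
 shows "strict_mono_on(Lr b) u ==> (!!r. r : Lr b ==> 0<u r & u r <= length b) ==> 
Fk(length b)(ln b) k(Suc 0) u = (SUM s:Sig b u. atom(dd(pe b) s))"
proof (induction "SUM r:Lr b. u r" arbitrary: u rule: less_induct)
case less
show ?case
proof (cases "ALL r:Lr b. u r = Suc(rankL b r)")
 case True thus ?thesis using Fk_rank[OF _ k] by blast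
next
 case False
 \<comment> \<open>In the lowest row not at its rank, the value just below the entry is free, so the
   entry can be lowered.\<close>
 define j where "j = (LEAST r. r : Lr b & u r ~= Suc(rankL b r))"
 have j: "j : Lr b" "u j ~= Suc(rankL b j)" unfolding j_def using False LeastI_ex[of "%r. r : Lr b & u r ~= Suc(rankL b r)"] by blast+
 have jm: "u r = Suc(rankL b r)" if "r : Lr b" "r<j" for r using not_less_Least that unfolding j_def by blast
 have "Suc(rankL b j)<u j" using rankL_le[OF less(2) _ j(1)] less(3) j by fastforce
 then obtain i where i: "u j = Suc(Suc i)" by (cases "u j"; cases "u j-1") auto
 have ri: "rankL b j <= i" using \<open>Suc(rankL b j)<u j\<close> i by simp
 have fre: "u r ~= Suc i" if r: "r : Lr b" for r
 using i n_not_Suc_n strict_mono_onD[OF less(2) j(1) r] jm[OF r] rankL_mono[OF r,of j] ri by force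
 define v where "v = sv i o u"
 have vu: "sv i o v = u" by (simp add: v_def)
 have injL: "inj_on u(Lr b)" by (rule strict_mono_on_imp_inj_on[OF less(2)])
 have vj: "v j = Suc i" using i by (simp add: v_def swapidx_def)
 have vo: "v r = u r" if "r : Lr b" "r ~= j" for r
 proof -
  have "u r ~= u j" using injL that j(1) by (auto dest: inj_onD)
  thus ?thesis using fre[OF that(1)] i by (simp add: v_def swapidx_def)
 qed
 have vm: "strict_mono_on(Lr b) v"
 proof (rule strict_mono_onI)
  fix r q assume rq: "r : Lr b" "q : Lr b" "r<q"
  have lt: "u r<u q" by (rule strict_mono_onD[OF less(2) rq])
  thus "v r<v q" using vo[OF rq(1)] vo[OF rq(2)] vj fre[OF rq(1)] i by (cases "r = j"; cases "q = j") auto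
 qed
 interpret push b v i j
 proof
  fix r assume r: "r : Lr b"
  have "u r ~= u j" if "r ~= j" using injL that j(1) r by (auto dest: inj_onD)
  thus "v r ~= Suc(Suc i)" using vo[OF r] vj i by (cases "r = j") auto
 qed (use vm j(1) vj in auto)
 have vb: "0<v r & v r <= length b" if "r : Lr b" for r using less(3)[OF that] vo[OF that] vj i by (cases "r = j") auto
 have "(SUM r:Lr b. v r)<(SUM r:Lr b. u r)"
 proof (rule sum_strict_mono_ex1)
  show "ALL r:Lr b. v r <= u r"
  proof
   fix r assume "r : Lr b"
   thus "v r <= u r" using vo[of r] vj i by (cases "r = j") auto
  qed
  show "EX r:Lr b. v r<u r" using j(1) vj i by (intro bexI[of _ j]) auto
 qed simp
 hence IH: "Fk(length b)(ln b) k(Suc 0) v = (SUM s:Sig b v. atom(dd(pe b) s))"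
 by (rule less(1)[OF _ vm vb])
 have il: "Suc i<length b" using less(3)[OF j(1)] i by simp
 have "Fk(length b)(ln b) k(Suc 0) u = pidiff i(Fk(length b)(ln b) k(Suc 0) v)"
 by (metis Fk_sv vm vu rows_Lr good_def Fk_sv free strict_mono_on_imp_inj_on[OF vm] vm)
 also have "...=(SUM s:Sig b u. atom(dd(pe b) s))" unfolding IH pidiff_Sig[OF il] vu ..
 finally show ?thesis .
qed
qed

text \<open>\<open>Fk_increasing\<close> for the first column forced by the basement; atoms are now
  described by rules of quasi-key type in place of triples.\<close>

theorem atom_recursion: "atom b = xset(Lr b) * (SUM s:Sig b Suc. atom(dd(pe b) s))"
proof -
let ?n = "length b"
define k where "k = sum_list b"
have kb: "ln b r <= Suc k" for r using ln_le_sum[of b r] by (simp add: k_def)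
define t0 where "t0 r = (if r : Lr b then Suc r else 0)" for r
have r0: "rows ?n(ln b) 0 = {..<?n}" by (auto simp: rows_def)
have ok0: "ok(Lr b) {..<?n} Suc t0" by (rule okI) (auto simp: t0_def inj_on_def)
have "Th ?n(ln b) 0 Suc = {t0}"
proof (rule set_eqI,rule iffI)
 fix t assume "t : Th ?n(ln b) 0 Suc"
 hence t: "ok(Lr b) {..<?n} Suc t" "!!r. r ~: Lr b ==> t r = 0" by (auto simp: Th_def rows_Lr r0)
 have "t r = t0 r" for r
 using first_col_id[OF t(1),of r] t(2)[of r] by (auto simp: t0_def Lr_def)
 thus "t : {t0}" by auto
next
 fix t assume "t : {t0}"
 thus "t : Th ?n(ln b) 0 Suc" using ok0 by (simp add: Th_def rows_Lr r0 t0_def)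
qed
hence "atom b = xt(Lr b) t0 * Fk ?n(ln b) k(Suc 0) t0"
using atom_Fk[of b ?n "Suc k"] kb by (simp add: rows_Lr)
also have "Fk ?n(ln b) k(Suc 0) t0 = (SUM s:Sig b t0. atom(dd(pe b) s))"
by (rule Fk_increasing[OF kb]) (auto simp: t0_def Lr_def strict_mono_on_def)
also have "Sig b t0 = Sig b Suc"
proof -
 have "t0 r = Suc r" if "r : Lr b" for r using that by (simp add: t0_def)
 moreover have "t0 r = Suc r" if "r : Nr b" for r using that Nr_Lr by (auto simp: t0_def)
 ultimately show ?thesis unfolding Sig_def by (intro Collect_cong conj_cong ball_cong all_cong1 imp_cong) auto
qed
also have "xt(Lr b) t0 = xset(Lr b)" unfolding xt_def xset_def by (rule prod.cong) (auto simp: t0_def)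
finally show ?thesis .
qed

lemma res_atom_zero:
 assumes a: "length a = Suc N" "i <= N" "a ! i ~= 0"
 shows "res i(atom a) = 0"
unfolding atom_alt res_sum
proof (rule sum.neutral,rule ballI)
fix S assume S: "S : atom_fill a"
have "S(i,0) = Suc i" "(i,0) : skyline a" using S a by (auto simp: atom_fill_def skyline_def)
hence "(i,0) : {x : skyline a. S x = Suc i}" by simp
hence ne: "{x : skyline a. S x = Suc i} ~= {}" by blast
have "finite {x : skyline a. S x = Suc i}" by simp
hence c: "0<card {x : skyline a. S x = Suc i}" unfolding card_gt_0_iff using ne by blast
have e: "fwt a S ! i = card {x : skyline a. S x = Suc i}" using a unfolding fwt_def by (subst nth_map) (auto simp del: upt_Suc)
have "fwt a S ! i ~= 0" unfolding e using c by (rule gr_implies_not0)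
thus "res i(xmon(fwt a S)) = 0" using res_xmon[of "fwt a S" N i] a by simp
qed

text \<open>Downward induction on i. If a nonzero part follows the zero at i, the atom is
  \<open>xvar (Suc i)\<close> times \<open>ddiff i\<close> of the swapped atom f; restricting the
  defining equation of \<open>ddiff i f\<close> leaves only \<open>res (Suc i) f\<close>, because
  \<open>res i f\<close> vanishes.\<close>

lemma res_atom:
 assumes N: "i <= N"
 shows "!!a. length a = Suc N ==> res i(atom a) = (if a ! i = 0 then atom(take i a @ drop(Suc i) a) else 0)"
using N
proof (induction rule: inc_induct)
case base
show ?case
proof (cases "a ! N = 0")
 case True
 define d where "d = take N a"
 have a: "a = d @ [0]" using base True unfolding d_def by (metis lessI take_Suc_conv_app_nth take_all_iff order_refl)
 have "length d = N" using base by (simp add: d_def)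
 hence d: "atom d : polys N" by (rule atom_polys)
 have "res N f = f" if "f : polys N" for f
 proof -
  have x: "res N(xmon c) = xmon c" if "length c = N" for c
  using res_xmon[of "c @ [0]" N N] that by (simp add: xmon_snoc0 nth_append)
  have "f : zspan xmon N" using that polys_zspan_xmon by blast
  thus ?thesis by (induction rule: zspan.induct) (simp_all add: x)
 qed
 thus ?thesis using d a True \<open>length d=N\<close> by (simp add: atom_snoc0)
next
 case False thus ?thesis using res_atom_zero[of a N N] base by simp
qed
next
case (step i)
have i: "Suc i<length a" using step(1,2,4) by simp
show ?case
proof (cases "a ! i = 0")
 case z: True
 have del: "take(Suc i)(swapl i a) @ drop(Suc(Suc i))(swapl i a) = take i a @ drop(Suc i) a"
 using i by (intro nth_equalityI) (auto simp: nth_append nth_swapl swapidx_def less_Suc_eq)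
 show ?thesis
 proof (cases "a ! Suc i = 0")
  case True
  have sw: "swapl i a = a" using i z True by (intro swapl_eq) simp_all
  have "pidiff i(atom a) = atom a" using pidiff_atom[OF i] z True by simp
  hence "swap_poly i(atom a) = atom a" using pidiff_sym by blast
  hence "res i(atom a) = res(Suc i)(atom a)" using res_swap[of i "atom a"] by simp
  also have "...=atom(take(Suc i) a @ drop(Suc(Suc i)) a)" using step(3)[OF step(4)] True by simp
  finally show ?thesis using z del sw by simp
 next
  case False
  let ?f = "atom(swapl i a)"
  have at: "atom a = xvar(Suc i) * ddiff i ?f" using atom_unswap[OF i] z False by (simp add: hdiff_def)
  have "res i((xvar i-xvar(Suc i)) * ddiff i ?f) = res i(?f-swap_poly i ?f)" by (simp only: ddiff_eq)
  hence "- (xvar i * res i(ddiff i ?f)) = res i ?f-res(Suc i) ?f" by (simp add: res_mult res_xvar res_swap)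
  moreover have "res i(atom a) = xvar i * res i(ddiff i ?f)" unfolding at by (simp add: res_mult res_xvar)
  moreover have "res i ?f = 0" by (rule res_atom_zero[of _ N]) (use step i False in auto)
  moreover have "res(Suc i) ?f = atom(take i a @ drop(Suc i) a)"
  using step(3)[of "swapl i a"] step(4) i z del by simp
  ultimately show ?thesis using z by (simp)
 qed
next
 case False thus ?thesis using res_atom_zero[of a N i] step by simp
qed
qed

interpretation atoms: slide_family atom
by unfold_locales(auto simp: triangular_atom res_atom atom_schur)

section \<open>Quasi-key conditions as a relation between two rows\<close>

definition wdec :: "nat => (nat => nat) => bool" where
"wdec k f \<longleftrightarrow> (ALL c. Suc c<k --> f(Suc c) <= f c)"

definition pc :: "nat => (nat => nat) => nat => (nat => nat) => bool" where
"pc k f m g \<longleftrightarrow> (ALL c. c<k & c<m --> f c ~= g c) &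
(ALL c. c<k & c<m & g c<f c --> Suc c<k & g c<f(Suc c)) &
(ALL c. k<m & c<k & Suc c<m --> f c<g(Suc c))"

lemma pcI:
 assumes "!!c. c<k ==> c<m ==> f c ~= g c" "!!c. c<k ==> c<m ==> g c<f c ==> Suc c<k & g c<f(Suc c)"
"!!c. k<m ==> c<k ==> Suc c<m ==> f c<g(Suc c)"
 shows "pc k f m g"
unfolding pc_def using assms by blast

lemma pcD:
 assumes "pc k f m g"
 shows "!!c. c<k ==> c<m ==> f c ~= g c" "!!c. c<k ==> c<m ==> g c<f c ==> Suc c<k & g c<f(Suc c)"
"!!c. k<m ==> c<k ==> Suc c<m ==> f c<g(Suc c)"
using assms unfolding pc_def by blast+

lemma pc_0: "k = 0 | m = 0 ==> pc k f m g" by (rule pcI) auto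

lemma wdec_le: "wdec k f ==> c<k ==> f c <= f 0"
by (induction c) (auto simp: wdec_def)

lemma pc_inverted:
 assumes g: "wdec m g" and p: "pc k f m g" and k: "0<k" "0<m" and lt: "g 0<f 0"
 shows "m<k & (ALL c<m. g c<f(Suc c))"
proof -
note P=pcD[OF p]
have A: "c<m ==> c<k & g c<f c" for c
proof (induction c)
 case (Suc c)
 hence c: "c<m" "c<k" "g c<f c" by auto
 have "g(Suc c) <= g c" using g Suc(2) by (simp add: wdec_def)
 thus ?case using P(2)[OF c(2,1,3)] by simp
qed (use k lt in simp)
have B: "Suc c<k & g c<f(Suc c)" if "c<m" for c using A[OF that] P(2)[of c] that by blast
show ?thesis using B[of "m-1"] B k by auto
qed

text \<open>If the higher row starts with the smaller entry, it is strictly shorter and stays below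
  the next entry of the other row, which is precisely what the exchanged pair has to satisfy. So
  rows may be reordered by their first entries.\<close>

lemma pc_swap:
 assumes f: "wdec k f" and g: "wdec m g" and k: "0<k" "0<m" and lt: "g 0<f 0"
 shows "pc k f m g \<longleftrightarrow> m<k & pc m g k f"
proof
assume p: "pc k f m g"
have i: "m<k" "!!c. c<m ==> g c<f(Suc c)" using pc_inverted[OF g p k lt] by auto
have "pc m g k f"
proof (rule pcI)
 fix c assume c: "c<m" "c<k"
 show "g c ~= f c" using pcD(1)[OF p c(2,1)] by simp
 assume h: "f c<g c"
 have "f(Suc c) <= f c" using f c i(1) by (simp add: wdec_def)
 thus "Suc c<m & f c<g(Suc c)" using i(2)[OF c(1)] h by simp
qed (use i in auto)
thus "m<k & pc m g k f" using i by simp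
next
assume h: "m<k & pc m g k f"
hence P: "!!c. c<m ==> g c<f(Suc c)" using pcD(3)[of m g k f] by auto
show "pc k f m g"
proof (rule pcI)
 fix c assume c: "c<k" "c<m"
 show "f c ~= g c" using pcD(1)[of m g k f c] h c by auto
 show "Suc c<k & g c<f(Suc c)" using P[OF c(2)] h c by auto
qed (use h in auto)
qed

text \<open>Stripping the first column leaves a single condition that looks back at it; it becomes
  the last clause of \<open>Sig\<close>.\<close>

lemma pc_Suc:
 assumes lt: "f 0<g 0"
 shows "pc k f m g \<longleftrightarrow> pc(k-1)(%c. f(Suc c))(m-1)(%c. g(Suc c)) & (0<k & k<m --> f 0<g(Suc 0))"
proof
assume p: "pc k f m g"
note P=pcD[OF p]
have "pc(k-1)(%c. f(Suc c))(m-1)(%c. g(Suc c))"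
proof (rule pcI)
 fix c assume c: "c<k-1" "c<m-1"
 show "f(Suc c) ~= g(Suc c)" using P(1)[of "Suc c"] c by simp
 assume h: "g(Suc c)<f(Suc c)"
 have "Suc c<k" "Suc c<m" using c by simp_all
 from P(2)[OF this h] show "Suc c<k-1 & g(Suc c)<f(Suc(Suc c))" by linarith
next
 fix c assume "k-1<m-1" "c<k-1" "Suc c<m-1"
 thus "f(Suc c)<g(Suc(Suc c))" using P(3)[of "Suc c"] by simp
qed
moreover have "f 0<g(Suc 0)" if "0<k & k<m" using P(3)[of 0] that by simp
ultimately show "pc(k-1)(%c. f(Suc c))(m-1)(%c. g(Suc c)) & (0<k & k<m --> f 0<g(Suc 0))" by blast
next
assume h: "pc(k-1)(%c. f(Suc c))(m-1)(%c. g(Suc c)) & (0<k & k<m --> f 0<g(Suc 0))"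
hence p: "pc(k-1)(%c. f(Suc c))(m-1)(%c. g(Suc c))" by blast
note P=pcD[OF p]
show "pc k f m g"
proof (rule pcI)
 fix c assume c: "c<k" "c<m"
 show "f c ~= g c" using P(1)[of "c-1"] c lt by (cases c) auto
 assume gf: "g c<f c"
 then obtain e where e: "c = Suc e" using lt by (cases c) auto
 have "e<k-1" "e<m-1" "g(Suc e)<f(Suc e)" using c gf e by simp_all
 from P(2)[OF this] show "Suc c<k & g c<f(Suc c)" unfolding e by linarith
next
 fix c assume c: "k<m" "c<k" "Suc c<m"
 show "f c<g(Suc c)"
 proof (cases c)
  case 0 thus ?thesis using h c by simp
 next
  case (Suc e) thus ?thesis using P(3)[of e] c by simp
 qed
qed
qed

lemma pc_cong:
 assumes "!!c. c<k ==> f c = f' c" "!!c. c<m ==> g c = g' c" "pc k f m g"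
 shows "pc k f' m g'"
by (smt(verit) pcI assms(3) assms(1,2) assms assms(2) pcD)

definition QR :: "nat list => (nat \<times> nat => nat) => bool" where
"QR e T \<longleftrightarrow> (ALL r<length e. wdec(e ! r)(%c. T(r,c))) &
(ALL r s. r<s & s<length e --> pc(e ! r)(%c. T(r,c))(e ! s)(%c. T(s,c)))"

lemma QRD:
 assumes "QR e T"
 shows "!!r. r<length e ==> wdec(e ! r)(%c. T(r,c))"
"!!r s. r<s ==> s<length e ==> pc(e ! r)(%c. T(r,c))(e ! s)(%c. T(s,c))"
using assms unfolding QR_def by blast+

lemma QRI:
 assumes "!!r. r<length e ==> 0<e ! r ==> wdec(e ! r)(%c. T(r,c))"
"!!r s. r<s ==> r : Lr e ==> s : Lr e ==> pc(e ! r)(%c. T(r,c))(e ! s)(%c. T(s,c))"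
 shows "QR e T"
unfolding QR_def
proof (intro conjI allI impI)
fix r assume "r<length e"
thus "wdec(e ! r)(%c. T(r,c))" using assms(1)[of r] by (cases "e ! r = 0") (auto simp: wdec_def)
next
fix r s assume rs: "r<s & s<length e"
show "pc(e ! r)(%c. T(r,c))(e ! s)(%c. T(s,c))"
using pc_0 assms rs by (cases "e ! r = 0 | e ! s = 0") (auto simp: Lr_def)
qed

lemma qkt_QR: "quasi_key_tableau a T \<longleftrightarrow> QR a T & (ALL r c. (r,c) : skyline a --> T(r,c) <= Suc r) &
(ALL r s. r<s & (r,0) : skyline a & (s,0) : skyline a --> T(r,0)<T(s,0))"
(is "?Q \<longleftrightarrow> ?R")
proof
have sk: "(r,c) : skyline a \<longleftrightarrow> r<length a & c<a ! r" for r c by (simp add: skyline_def)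
assume q: ?Q
have c1: "ALL r c. (r,Suc c) : skyline a --> T(r,Suc c) <= T(r,c)"
using q unfolding quasi_key_tableau_def by (elim conjE)
have c2: "ALL r s c. (r,c) : skyline a & (s,c) : skyline a & r ~= s --> T(r,c) ~= T(s,c)"
using q unfolding quasi_key_tableau_def by (elim conjE)
have c3: "ALL r s c. r<s & (r,c) : skyline a & (s,c) : skyline a & T(s,c)<T(r,c) -->
(r,Suc c) : skyline a & T(r,Suc c) > T(s,c)"
using q unfolding quasi_key_tableau_def by (elim conjE)
have c4: "ALL r s c. r<s & a ! s > a ! r & (r,c) : skyline a & (s,Suc c) : skyline a -->
T(r,c)<T(s,Suc c)"
using q unfolding quasi_key_tableau_def by (elim conjE)
have c5: "ALL r c. (r,c) : skyline a --> T(r,c) <= Suc r"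
using q unfolding quasi_key_tableau_def by (elim conjE)
have c6: "ALL r s. r<s & (r,0) : skyline a & (s,0) : skyline a --> T(r,0)<T(s,0)"
using q unfolding quasi_key_tableau_def by (elim conjE)
note q1=c1[rule_format]
have "QR a T"
proof (rule QRI)
 fix r assume "r<length a" thus "wdec(a ! r)(%c. T(r,c))" unfolding wdec_def using q1 sk by simp
next
 fix r s assume rs: "r<s" "r : Lr a" "s : Lr a"
 hence l: "r<length a" "s<length a" by (auto simp: Lr_def)
 show "pc(a ! r)(%c. T(r,c))(a ! s)(%c. T(s,c))"
 using pcI c2 sk l rs(1) c3 c4 by auto
qed
thus ?R using c5 c6 by (intro conjI)
next
have sk: "(r,c) : skyline a \<longleftrightarrow> r<length a & c<a ! r" for r c by (simp add: skyline_def)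
assume R: ?R
note QR=R[THEN conjunct1] and R1=R[THEN conjunct2,THEN conjunct1] and R2=R[THEN conjunct2,THEN conjunct2]
have d: "T(r,c) ~= T(s,c)" if "r<s" "(r,c) : skyline a" "(s,c) : skyline a" for r s c
using pcD(1)[OF QRD(2)[OF QR that(1)],of c] that sk by simp
show ?Q unfolding quasi_key_tableau_def
proof (intro conjI allI impI)
 fix r c assume "(r,Suc c) : skyline a"
 thus "T(r,Suc c) <= T(r,c)" using QRD(1)[OF QR,of r] sk by (simp add: wdec_def)
next
 fix r c assume "(r,c) : skyline a" thus "T(r,c) <= Suc r" by (rule R1[rule_format])
next
 fix r s c assume h: "(r,c) : skyline a & (s,c) : skyline a & r ~= s"
 then consider "r<s" | "s<r" by linarith
 thus "T(r,c) ~= T(s,c)" using d[of r s c] d[of s r c] h by cases auto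
next
 fix r s assume "r<s & (r,0) : skyline a & (s,0) : skyline a" thus "T(r,0)<T(s,0)" by (rule R2[rule_format])
next
 fix r s c assume h: "r<s & (r,c) : skyline a & (s,c) : skyline a & T(s,c)<T(r,c)"
 hence rs: "r<s" "s<length a" using sk by auto
 have x: "Suc c<a ! r & T(s,c)<T(r,Suc c)" using pcD(2)[OF QRD(2)[OF QR rs],of c] h sk by simp
 thus "(r,Suc c) : skyline a" "T(r,Suc c) > T(s,c)" using h sk by auto
next
 fix r s c assume h: "r<s & a ! s > a ! r & (r,c) : skyline a & (s,Suc c) : skyline a"
 hence rs: "r<s" "s<length a" using sk by auto
 show "T(r,c)<T(s,Suc c)" using pcD(3)[OF QRD(2)[OF QR rs],of c] h sk by simp
qed
qed

lemma QR_order: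
 assumes QR: "QR e T" and rs: "r<s" "r : Lr e" "s : Lr e" "e ! r <= e ! s"
 shows "T(r,0)<T(s,0)"
proof (rule ccontr)
have l: "s<length e" "0<e ! r" "0<e ! s" using rs by (auto simp: Lr_def)
note p=QRD(2)[OF QR rs(1) l(1)]
assume "~ T(r,0)<T(s,0)"
hence "T(s,0)<T(r,0)" using pcD(1)[OF p l(2,3)] by simp
hence "e ! s<e ! r" using pc_inverted[OF QRD(1)[OF QR l(1)] p l(2,3)] by blast
thus False using rs(4) by simp
qed

definition X :: "nat list => (nat => nat) => (nat \<times> nat => nat) set" where
"X e s = {T : fillings e. QR e T & (ALL r:Lr e. T(r,0) = s r)}"

definition wt :: "nat list => (nat \<times> nat => nat) => mpoly" where
"wt e T = (PROD x:skyline e. xvar(T x-1))"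

lemma finite_fillings: "finite(fillings a)"
proof (rule finite_subset)
show "fillings a <= {S. ALL x. (x : skyline a --> S x : {1..length a}) & (x ~: skyline a --> S x = 0)}"
unfolding fillings_def by blast
qed (rule finite_set_of_finite_funs,auto)

lemma finite_X: "finite(X e s)"
by (rule finite_subset[OF _ finite_fillings[of e]]) (auto simp: X_def)

lemma skyline_iff: "(r,c) : skyline e \<longleftrightarrow> r<length e & c<e ! r" by (simp add: skyline_def)

text \<open>Rows are moved to the places named by their first entries, so that the first column
  becomes \<open>Suc\<close>. The hypothesis on lengths allows an order reversal only where the
  higher row is strictly shorter, and there \<open>pc_swap\<close> keeps the conditions.\<close>

lemma X_reindex:
 assumes sp: "!!r. r : Lr e ==> 0<s r & s r <= length e" and sz: "!!r. r ~: Lr e ==> s r = 0" and inj: "inj_on s(Lr e)"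
 and ord: "!!r q. r<q ==> r : Lr e ==> q : Lr e ==> e ! r <= e ! q ==> s r<s q"
 shows "(SUM T:X e s. wt e T) = (SUM T:X(dd e s) Suc. wt(dd e s) T)"
proof -
let ?d = "dd e s" and ?n = "length e"
define t where "t p = inv_into(Lr e) s(Suc p)" for p
define u where "u r = s r-1" for r
have u: "u r<?n" "Suc(u r) = s r" if "r : Lr e" for r using sp[OF that] by (auto simp: u_def)
have tu: "t(u r) = r" if "r : Lr e" for r unfolding t_def u(2)[OF that] using inj that by simp
have du: "?d ! u r = e ! r" if r: "r : Lr e" for r
proof -
 have "s q = s r \<longleftrightarrow> q = r" for q
 proof
  assume h: "s q = s r"
  hence "q : Lr e" using sz[of q] sp[OF r] by (cases "q : Lr e") auto
  thus "q = r" using inj h r by (metis inj_onD)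
 qed simp
 hence "(SUM q<?n. if s q = Suc(u r) then e ! q else 0) = (SUM q<?n. if q = r then e ! q else 0)"
 using u(2)[OF r] by simp
 also have "...=e ! r" using r by (simp add: Lr_def)
 finally show ?thesis using u(1)[OF r] by (simp add: dd_def)
qed
have t: "t p : Lr e" "u(t p) = p" if p: "p : Lr ?d" for p
proof -
 have pn: "p<?n" "0<?d ! p" using p by (auto simp: Lr_def)
 have "EX r:Lr e. s r = Suc p"
 proof (rule ccontr)
  assume h: "~ ?thesis"
  have "s r ~= Suc p" for r using h sz[of r] by (cases "r : Lr e") auto
  hence "?d ! p = 0" using pn(1) by (simp add: dd_def)
  thus False using pn(2) by simp
 qed
 hence im: "Suc p : s ` Lr e" by force
 show "t p : Lr e" unfolding t_def by (rule inv_into_into[OF im])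
 have "s(t p) = Suc p" unfolding t_def by (rule f_inv_into_f[OF im])
 thus "u(t p) = p" by (simp add: u_def)
qed
have dt: "?d ! p = e ! t p" if "p : Lr ?d" for p using du[OF t(1)[OF that]] t(2)[OF that] by simp
have uL: "u r : Lr ?d" if "r : Lr e" for r using du[OF that] u(1)[OF that] that by (simp add: Lr_def)
have skL: "r : Lr e'" if "(r,c) : skyline e'" for r c e' using that by (auto simp: skyline_def Lr_def)
have skt: "(t p,c) : skyline e" if "(p,c) : skyline ?d" for p c
using that dt[OF skL[OF that]] t(1)[OF skL[OF that]] by (simp add: skyline_iff Lr_def)
have sku: "(u r,c) : skyline ?d" if "(r,c) : skyline e" for r c
using that du[OF skL[OF that]] u(1)[OF skL[OF that]] by (simp add: skyline_iff)
define F where "F T x = (if x : skyline ?d then T(t(fst x),snd x) else 0)" for T :: "nat \<times> nat => nat" and x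
define G where "G T x = (if x : skyline e then T(u(fst x),snd x) else 0)" for T :: "nat \<times> nat => nat" and x
have Fv: "F T(p,c) = T(t p,c)" if "p : Lr ?d" "c<?d ! p" for T p c using that by (simp add: F_def skyline_iff Lr_def)
have Gv: "G T(r,c) = T(u r,c)" if "r : Lr e" "c<e ! r" for T r c using that by (simp add: G_def skyline_iff Lr_def)
have Lpos: "0<e' ! r" "r<length e'" if "r : Lr e'" for r e' using that by (auto simp: Lr_def)
have FX: "F T : X ?d Suc" if T: "T : X e s" for T
proof -
 have T1: "T : fillings e" and QT: "QR e T" and T0: "!!r. r : Lr e ==> T(r,0) = s r" using T by (auto simp: X_def)
 have "F T : fillings ?d" unfolding fillings_def
 using skt T1 by (auto simp: fillings_def F_def)
 moreover have "QR ?d(F T)"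
 proof (rule QRI)
  fix p assume "p<length ?d" "0<?d ! p"
  hence p: "p : Lr ?d" by (simp add: Lr_def)
  have "wdec(e ! t p)(%c. T(t p,c))" by (rule QRD(1)[OF QT Lpos(2)[OF t(1)[OF p]]])
  thus "wdec(?d ! p)(%c. F T(p,c))" using Fv[OF p] dt[OF p] by (simp add: wdec_def)
 next
  fix p q assume pq: "p<q" "p : Lr ?d" "q : Lr ?d"
  let ?r = "t p" and ?q = "t q"
  have r: "?r : Lr e" "?q : Lr e" using t(1) pq by auto
  have ne: "?r ~= ?q" using t(2)[OF pq(2)] t(2)[OF pq(3)] pq(1) by auto
  have lt: "T(?r,0)<T(?q,0)" using T0[OF r(1)] T0[OF r(2)] u(2)[OF r(1)] u(2)[OF r(2)] t(2)[OF pq(2)] t(2)[OF pq(3)] pq(1) by simp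
  have "pc(e ! ?r)(%c. T(?r,c))(e ! ?q)(%c. T(?q,c))"
  using r(2) QT ne QRD(2)[OF QT] pc_swap[OF QRD(1)[OF QT Lpos(2)[OF r(2)]] QRD(1)[OF QT Lpos(2)[OF r(1)]] Lpos(1)[OF r(2)] Lpos(1)[OF r(1)]] lt QRD(1)[OF QT Lpos(2)[OF r(1)]] Lpos(1)[OF r(2)] Lpos(1)[OF r(1)] Lpos(2)[OF r(2)] Lpos(2)[OF r(1)] by (cases "?r<?q") (auto)
  thus "pc(?d ! p)(%c. F T(p,c))(?d ! q)(%c. F T(q,c))"
  unfolding dt[OF pq(2)] dt[OF pq(3)]
  by (rule pc_cong[rotated 2]) (use Fv pq dt in auto)
 qed
 moreover have "F T(p,0) = Suc p" if p: "p : Lr ?d" for p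
 using Fv[OF p Lpos(1)[OF p]] T0[OF t(1)[OF p]] u(2)[OF t(1)[OF p]] t(2)[OF p] by simp
 ultimately show ?thesis by (simp add: X_def)
qed
have GX: "G T : X e s" if T: "T : X ?d Suc" for T
proof -
 have T1: "T : fillings ?d" and QT: "QR ?d T" and T0: "!!p. p : Lr ?d ==> T(p,0) = Suc p" using T by (auto simp: X_def)
 have "G T : fillings e" unfolding fillings_def
 using sku T1 by (auto simp: fillings_def G_def)
 moreover have "QR e(G T)"
 proof (rule QRI)
  fix r assume "r<?n" "0<e ! r"
  hence r: "r : Lr e" by (simp add: Lr_def)
  have "wdec(?d ! u r)(%c. T(u r,c))" by (rule QRD(1)[OF QT Lpos(2)[OF uL[OF r]]])
  thus "wdec(e ! r)(%c. G T(r,c))" using Gv[OF r] du[OF r] by (simp add: wdec_def)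
 next
  fix r q assume rq: "r<q" "r : Lr e" "q : Lr e"
  let ?p = "u r" and ?q = "u q"
  have L: "?p : Lr ?d" "?q : Lr ?d" using uL rq by auto
  have ne: "?p ~= ?q" using tu[OF rq(2)] tu[OF rq(3)] rq(1) by auto
  have "pc(?d ! ?p)(%c. T(?p,c))(?d ! ?q)(%c. T(?q,c))"
  proof (cases "?p<?q")
   case True thus ?thesis using QRD(2)[OF QT True Lpos(2)[OF L(2)]] by simp
  next
   case False
   hence qp: "?q<?p" using ne by simp
   hence "~ s r<s q" using u(2)[OF rq(2)] u(2)[OF rq(3)] by simp
   hence "~ e ! r <= e ! q" using ord[OF rq] by blast
   hence lt: "?d ! ?q<?d ! ?p" using du[OF rq(2)] du[OF rq(3)] by simp
   have "pc(?d ! ?q)(%c. T(?q,c))(?d ! ?p)(%c. T(?p,c))" by (rule QRD(2)[OF QT qp Lpos(2)[OF L(1)]])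
   moreover have "T(?q,0)<T(?p,0)" using T0[OF L(1)] T0[OF L(2)] qp by simp
   ultimately show ?thesis
   using pc_swap[OF QRD(1)[OF QT Lpos(2)[OF L(1)]] QRD(1)[OF QT Lpos(2)[OF L(2)]] Lpos(1)[OF L(1)] Lpos(1)[OF L(2)]] lt by blast
  qed
  thus "pc(e ! r)(%c. G T(r,c))(e ! q)(%c. G T(q,c))"
  unfolding du[OF rq(2)] du[OF rq(3)]
  by (rule pc_cong[rotated 2]) (use Gv rq in auto)
 qed
 moreover have "G T(r,0) = s r" if r: "r : Lr e" for r
 using Gv[OF r Lpos(1)[OF r]] T0[OF uL[OF r]] u(2)[OF r] by simp
 ultimately show ?thesis by (simp add: X_def)
qed
have zero: "T x = 0" if "T : X e' s'" "x ~: skyline e'" for T x e' s' using that unfolding X_def fillings_def by blast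
show ?thesis
proof (rule sum.reindex_bij_witness[of _ G F])
 fix T assume T: "T : X e s"
 show "F T : X ?d Suc" by (rule FX[OF T])
 show "G(F T) = T"
 proof
  fix x show "G(F T) x = T x"
  using sku[of "fst x" "snd x"] tu[OF skL[of "fst x" "snd x" e]] zero[OF T] by (auto simp: G_def F_def)
 qed
 show "wt ?d(F T) = wt e T" unfolding wt_def
 by (rule prod.reindex_bij_witness[of _ "%x. (u(fst x),snd x)" "%x. (t(fst x),snd x)"]) (auto simp: F_def t skL skt tu sku)
next
 fix T assume T: "T : X ?d Suc"
 show "G T : X e s" by (rule GX[OF T])
 show "F(G T) = T"
 proof
  fix x show "F(G T) x = T x"
  using skt[of "fst x" "snd x"] t(2)[OF skL[of "fst x" "snd x" ?d]] zero[OF T] by (auto simp: G_def F_def)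
 qed
qed
qed

text \<open>Generating function of the quasi-key row conditions with the first column prescribed as
  for an atom; it turns out to be the atom (\<open>FQ_atom\<close>).\<close>

definition FQ :: "nat list => mpoly" where
"FQ b = (SUM T:X b Suc. wt b T)"

lemma Lr_pe: "Lr(pe b) = Nr b" by (auto simp: Lr_def Nr_def pe_def)

lemma nth_pe: "r<length b ==> pe b ! r = b ! r-1" by (simp add: pe_def)

definition strip :: "(nat \<times> nat => nat) => nat \<times> nat => nat" where
"strip T x = T(fst x,Suc(snd x))"

definition unstrip :: "nat list => (nat \<times> nat => nat) => nat \<times> nat => nat" where
"unstrip b T x = (case snd x of 0 => if fst x : Lr b then Suc(fst x) else 0 | Suc c => T(fst x,c))"

lemma skyline_pe: "(r,c) : skyline(pe b) \<longleftrightarrow> (r,Suc c) : skyline b"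
by (auto simp: skyline_def pe_def)

lemma skyline_split: "skyline b = (%r. (r,0)) ` Lr b Un(%x. (fst x,Suc(snd x))) ` skyline(pe b)"
proof (rule set_eqI)
fix x show "x : skyline b \<longleftrightarrow> x : (%r. (r,0)) ` Lr b Un(%x. (fst x,Suc(snd x))) ` skyline(pe b)"
proof (cases x)
 case (Pair r c)
 show ?thesis
 proof (cases c)
  case 0 thus ?thesis using Pair by (auto simp: skyline_def Lr_def)
 next
  case (Suc d)
  have "(r,Suc d) : (%x. (fst x,Suc(snd x))) ` skyline(pe b) \<longleftrightarrow> (r,d) : skyline(pe b)" by force
  thus ?thesis using Pair Suc by (auto simp: skyline_pe)
 qed
qed
qed

lemma strip_X:
 assumes T: "T : X b Suc"
 shows "EX s:Sig b Suc. strip T : X(pe b) s" "unstrip b(strip T) = T"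
proof -
let ?e = "pe b" and ?S = "strip T"
have T1: "T : fillings b" and QT: "QR b T" and T0: "!!r. r : Lr b ==> T(r,0) = Suc r" using T by (auto simp: X_def)
have pos: "0<T x & T x <= length b" if "x : skyline b" for x using T1 that unfolding fillings_def by force
have zer: "T x = 0" if "x ~: skyline b" for x using T1 that unfolding fillings_def by blast
have rowS: "?S(r,c) = T(r,Suc c)" for r c by (simp add: strip_def)
have fS: "?S : fillings ?e" unfolding fillings_def
proof (intro CollectI conjI ballI allI impI)
 fix x assume "x : skyline ?e"
 hence "(fst x,Suc(snd x)) : skyline b" using skyline_pe[of "fst x" "snd x" b] by simp
 from pos[OF this] show "?S x : {1..length ?e}" by (simp add: strip_def)
next
 fix x assume "x ~: skyline ?e"
 hence "(fst x,Suc(snd x)) ~: skyline b" using skyline_pe[of "fst x" "snd x" b] by simp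
 from zer[OF this] show "?S x = 0" by (simp add: strip_def)
qed
have QS: "QR ?e ?S"
proof (rule QRI)
 fix r assume r: "r<length ?e" "0<?e ! r"
 hence "wdec(b ! r)(%c. T(r,c))" using QRD(1)[OF QT] by simp
 thus "wdec(?e ! r)(%c. ?S(r,c))" using r by (simp add: wdec_def rowS nth_pe)
next
 fix r q assume rq: "r<q" "r : Lr ?e" "q : Lr ?e"
 hence L: "r : Lr b" "q : Lr b" using Nr_Lr unfolding Lr_pe by auto
 hence l: "r<length b" "q<length b" by (auto simp: Lr_def)
 have lt: "T(r,0)<T(q,0)" using T0[OF L(1)] T0[OF L(2)] rq(1) by simp
 have "pc(b ! r)(%c. T(r,c))(b ! q)(%c. T(q,c))" by (rule QRD(2)[OF QT rq(1) l(2)])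
 thus "pc(?e ! r)(%c. ?S(r,c))(?e ! q)(%c. ?S(q,c))"
 using pc_Suc[of "%c. T(r,c)" "%c. T(q,c)" "b ! r" "b ! q"] lt l by (simp add: rowS nth_pe)
qed
define s where "s r = (if r : Nr b then T(r,Suc 0) else 0)" for r
have NL: "r : Lr b" "r<length b" "Suc 0<b ! r" if "r : Nr b" for r using that by (auto simp: Nr_def Lr_def)
have sN: "s r = T(r,Suc 0)" if "r : Nr b" for r using that by (simp add: s_def)
have "s : Sig b Suc"
proof (rule SigI)
 fix r assume r: "r : Nr b"
 have "(r,Suc 0) : skyline b" using NL[OF r] by (simp add: skyline_iff)
 thus "0<s r" using pos sN[OF r] by simp
 have "T(r,Suc 0) <= T(r,0)" using QRD(1)[OF QT NL(2)[OF r]] NL(3)[OF r] by (simp add: wdec_def)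
 thus "s r <= Suc r" using sN[OF r] T0[OF NL(1)[OF r]] by simp
next
 show "inj_on s(Nr b)"
 proof (rule inj_onI)
  fix r q assume rq: "r : Nr b" "q : Nr b" "s r = s q"
  have "T(r,Suc 0) ~= T(q,Suc 0)" if "r<q" "r : Nr b" "q : Nr b" for r q
  using pcD(1)[OF QRD(2)[OF QT that(1) NL(2)[OF that(3)]]] NL(3)[OF that(2)] NL(3)[OF that(3)] by simp
  thus "r = q" using rq sN by (metis linorder_neqE_nat)
 qed
next
 fix r q assume rq: "r<q" "r : Nr b" "q : Nr b" "b ! r = b ! q"
 have "?S(r,0)<?S(q,0)" by (rule QR_order[OF QS rq(1)]) (use rq NL in \<open>auto simp: Lr_pe nth_pe\<close>)
 thus "s r<s q" using sN rq by (simp add: rowS)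
next
 fix r q assume rq: "r<q" "r : Lr b" "q : Nr b" "b ! r<b ! q"
 have "T(r,0)<T(q,Suc 0)"
 using pcD(3)[OF QRD(2)[OF QT rq(1) NL(2)[OF rq(3)]] rq(4),of 0] rq(2) NL(3)[OF rq(3)] by (simp add: Lr_def)
 thus "Suc r<s q" using sN[OF rq(3)] T0[OF rq(2)] by simp
qed (simp add: s_def)
moreover have "?S : X ?e s" using fS QS sN by (simp add: X_def Lr_pe rowS)
ultimately show "EX s:Sig b Suc. strip T : X(pe b) s" by blast
show "unstrip b(strip T) = T"
proof
 fix x :: "nat \<times> nat"
 obtain r c where x: "x = (r,c)" by (cases x)
 show "unstrip b(strip T) x = T x"
 using zer x T0 by (cases c) (auto simp: skyline_def Lr_def unstrip_def strip_def)
qed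
qed

lemma unstrip_X:
 assumes s: "s : Sig b Suc" and T: "T : X(pe b) s"
 shows "unstrip b T : X b Suc" "strip(unstrip b T) = T" "wt b(unstrip b T) = xset(Lr b) * wt(pe b) T"
proof -
let ?e = "pe b" and ?U = "unstrip b T"
note S=SigD[OF s]
have T1: "T : fillings ?e" and QT: "QR ?e T" and T0: "!!r. r : Nr b ==> T(r,0) = s r" using T by (auto simp: X_def Lr_pe)
have U0: "?U(r,0) = (if r : Lr b then Suc r else 0)" and US: "?U(r,Suc c) = T(r,c)" for r c by (auto simp: unstrip_def)
show st: "strip(unstrip b T) = T" by (rule ext) (simp add: strip_def US)
have "?U : fillings b" unfolding fillings_def
proof (intro CollectI conjI ballI allI impI)
 fix x assume "x : skyline b"
 thus "?U x : {1..length b}"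
 proof (cases x)
  case (Pair r c)
  show ?thesis
  proof (cases c)
   case 0 thus ?thesis using \<open>x : skyline b\<close> Pair U0 by (simp add: skyline_def Lr_def)
  next
   case (Suc d)
   hence "(r,d) : skyline ?e" using \<open>x : skyline b\<close> Pair by (simp add: skyline_pe)
   hence "T(r,d) : {1..length ?e}" using T1 unfolding fillings_def by blast
   thus ?thesis using Pair Suc US by simp
  qed
 qed
next
 fix x assume "x ~: skyline b"
 thus "?U x = 0"
 proof (cases x)
  case (Pair r c)
  show ?thesis
  proof (cases c)
   case 0 thus ?thesis using \<open>x ~: skyline b\<close> Pair U0 by (simp add: skyline_def Lr_def)
  next
   case (Suc d)
   hence "(r,d) ~: skyline ?e" using \<open>x ~: skyline b\<close> Pair by (simp add: skyline_pe)
   hence "T(r,d) = 0" using T1 unfolding fillings_def by blast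
   thus ?thesis using Pair Suc US by simp
  qed
 qed
qed
moreover have "QR b ?U"
proof (rule QRI)
 fix r assume r: "r<length b" "0<b ! r"
 show "wdec(b ! r)(%c. ?U(r,c))" unfolding wdec_def
 proof (intro allI impI)
  fix c assume c: "Suc c<b ! r"
  show "?U(r,Suc c) <= ?U(r,c)"
  using r c Nr_Lr U0[of r] US T0 S QRD(1)[OF QT] by (cases c) (auto simp: Nr_def wdec_def nth_pe)
 qed
next
 fix r q assume rq: "r<q" "r : Lr b" "q : Lr b"
 hence l: "r<length b" "q<length b" "0<b ! r" by (auto simp: Lr_def)
 have p: "pc(?e ! r)(%c. T(r,c))(?e ! q)(%c. T(q,c))" using QRD(2)[OF QT rq(1)] l by simp
 have "Suc r<T(q,0)" if "b ! r<b ! q"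
 proof -
  have qN: "q : Nr b" using that l by (simp add: Nr_def)
  show ?thesis using S(6)[OF rq(1,2) qN that] T0[OF qN] by simp
 qed
 thus "pc(b ! r)(%c. ?U(r,c))(b ! q)(%c. ?U(q,c))"
 using pc_Suc[of "%c. ?U(r,c)" "%c. ?U(q,c)" "b ! r" "b ! q"] p l rq U0 US by (simp add: nth_pe)
qed
ultimately show "?U : X b Suc" by (simp add: X_def U0)
have "wt b ?U = (PROD x:(%r. (r,0)) ` Lr b. xvar(?U x-1)) * (PROD x:(%x. (fst x,Suc(snd x))) ` skyline ?e. xvar(?U x-1))"
unfolding wt_def skyline_split[of b] by (rule prod.union_disjoint) auto
moreover have "(PROD x:(%r. (r,0)) ` Lr b. xvar(?U x-1)) = xset(Lr b)"
by (subst prod.reindex) (auto simp: inj_on_def U0 xset_def)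
moreover have "(PROD x:(%x. (fst x,Suc(snd x))) ` skyline ?e. xvar(?U x-1)) = wt ?e T"
by (subst prod.reindex) (auto simp: inj_on_def US wt_def)
ultimately show "wt b ?U = xset(Lr b) * wt ?e T" by simp
qed

text \<open>Stripping the first column gives a filling of \<open>pe b\<close> whose first column s
  lies in \<open>Sig\<close>; moving its rows to the places named by s restores the standard first
  column. This is the recursion that \<open>atom_recursion\<close> gives for atoms.\<close>

lemma FQ_recursion: "FQ b = xset(Lr b) * (SUM s:Sig b Suc. FQ(dd(pe b) s))"
proof -
let ?e = "pe b" and ?Y = "UN s:Sig b Suc. X(pe b) s"
have "FQ b = (SUM T:?Y. xset(Lr b) * wt ?e T)" unfolding FQ_def
proof (rule sum.reindex_bij_witness[of _ "unstrip b" strip])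
 fix T assume T: "T : X b Suc"
 show "unstrip b(strip T) = T" by (rule strip_X(2)[OF T])
 obtain s where s: "s : Sig b Suc" "strip T : X ?e s" using strip_X(1)[OF T] by blast
 thus "strip T : ?Y" by blast
 show "xset(Lr b) * wt ?e(strip T) = wt b T" using unstrip_X(3)[OF s] strip_X(2)[OF T] by simp
next
 fix T assume "T : ?Y"
 then obtain s where s: "s : Sig b Suc" "T : X ?e s" by blast
 show "strip(unstrip b T) = T" by (rule unstrip_X(2)[OF s])
 show "unstrip b T : X b Suc" by (rule unstrip_X(1)[OF s])
qed
also have "...=xset(Lr b) * (SUM T:?Y. wt ?e T)" by (simp add: sum_distrib_left)
also have "(SUM T:?Y. wt ?e T) = (SUM s:Sig b Suc. SUM T:X ?e s. wt ?e T)"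
proof (rule sum.UNION_disjoint)
 show "ALL s:Sig b Suc. ALL s':Sig b Suc. s ~= s' --> X ?e s Int X ?e s' = {}"
 proof (intro ballI impI)
  fix s s' assume s: "s : Sig b Suc" "s' : Sig b Suc" "s ~= s'"
  show "X ?e s Int X ?e s' = {}"
  proof (rule ccontr)
   assume "X ?e s Int X ?e s' ~= {}"
   then obtain T where T: "T : X ?e s" "T : X ?e s'" by blast
   have "s r = s' r" for r
   proof (cases "r : Nr b")
    case True thus ?thesis using T by (auto simp: X_def Lr_pe)
   next
    case False thus ?thesis using SigD(1)[OF s(1)] SigD(1)[OF s(2)] by simp
   qed
   thus False using s(3) by auto
  qed
 qed
qed (auto simp: finite_Sig finite_X)
also have "...=(SUM s:Sig b Suc. FQ(dd ?e s))"
proof (rule sum.cong)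
 fix s assume s: "s : Sig b Suc"
 note S=SigD[OF s]
 show "(SUM T:X ?e s. wt ?e T) = FQ(dd ?e s)" unfolding FQ_def
 proof (rule X_reindex)
  fix r assume "r : Lr ?e"
  hence r: "r : Nr b" by (simp add: Lr_pe)
  thus "0<s r & s r <= length ?e" using S(2)[OF r] S(3)[OF r] by (auto simp: Nr_def)
 next
  fix r q assume rq: "r<q" "r : Lr ?e" "q : Lr ?e" "?e ! r <= ?e ! q"
  hence N: "r : Nr b" "q : Nr b" by (auto simp: Lr_pe)
  hence le: "b ! r <= b ! q" using rq(4) by (auto simp: Nr_def nth_pe)
  show "s r<s q"
  using S(5)[OF rq(1) N] Nr_Lr S(6)[OF rq(1) _ N(2)] le S(3)[OF N(1)] N(1) by force
 qed (use S in \<open>auto simp: Lr_pe\<close>)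
qed simp
finally show ?thesis .
qed

lemma sum_dd_le: "sum_list(dd e s) <= sum_list e"
proof -
have "sum_list(dd e s) = (SUM p<length e. SUM r<length e. if s r = Suc p then e ! r else 0)"
unfolding sum_list_lessThan by (simp add: dd_def)
also have "...=(SUM r<length e. SUM p<length e. if s r = Suc p then e ! r else 0)" by (rule sum.swap)
also have "...<=(SUM r<length e. e ! r)"
proof (rule sum_mono)
 fix r
 have "(SUM p<length e. if s r = Suc p then e ! r else 0) <= (SUM p<length e. if p = s r-1 then e ! r else 0)"
 by (rule sum_mono) auto
 also have "...<=e ! r" by simp
 finally show "(SUM p<length e. if s r = Suc p then e ! r else 0) <= e ! r" .
qed
finally show ?thesis by (simp add: sum_list_lessThan)
qed

lemma FQ_atom: "FQ b = atom b"
proof (induction "sum_list b" arbitrary: b rule: less_induct)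
case less
show ?case
proof (cases "Lr b = {}")
 case True
 hence z: "b ! r = 0" if "r<length b" for r using that by (auto simp: Lr_def)
 have sk: "skyline b = {}" using z by (auto simp: skyline_def)
 have "fillings b = {%_. 0}" unfolding fillings_def sk by auto
 moreover have "QR b(%_. 0)" by (rule QRI) (use True z in auto)
 ultimately have "X b Suc = {%_. 0}" using True by (auto simp: X_def)
 hence "FQ b = 1" by (simp add: FQ_def wt_def sk)
 moreover have "partition b" using z by (simp add: partition_def)
 hence "atom b = xmon b" by (rule atom_partition)
 moreover have "xmon b = 1" unfolding xmon_prod using z by simp
 ultimately show ?thesis by simp
next
 case False
 then obtain q where q: "q<length b" "0<b ! q" by (auto simp: Lr_def)
 have lt: "sum_list(pe b)<sum_list b"
 by (auto simp: nth_pe sum_strict_mono_ex1 q bexI[of _ q] sum_list_lessThan)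
 have "FQ(dd(pe b) s) = atom(dd(pe b) s)" for s
 by (rule less) (use sum_dd_le[of "pe b" s] lt in simp)
 thus ?thesis unfolding FQ_recursion[of b] atom_recursion[of b] by simp
qed
qed

section \<open>Quasi-key polynomials as slide sums of atoms\<close>

definition Inc :: "nat list => (nat => nat) set" where
"Inc a = {s. (ALL r. r ~: Lr a --> s r = 0) & (ALL r:Lr a. 0<s r & s r <= Suc r) &
(ALL r q. r<q & r : Lr a & q : Lr a --> s r<s q)}"

lemma IncD:
 assumes "s : Inc a"
 shows "!!r. r ~: Lr a ==> s r = 0" "!!r. r : Lr a ==> 0<s r" "!!r. r : Lr a ==> s r <= Suc r"
"!!r q. r<q ==> r : Lr a ==> q : Lr a ==> s r<s q"
using assms unfolding Inc_def by blast+

lemma Inc_len: "s : Inc a ==> r : Lr a ==> s r <= length a"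
using IncD(3)[of s a r] by (auto simp: Lr_def)

lemma Inc_mono: "s : Inc a ==> r <= q ==> r : Lr a ==> q : Lr a ==> s r <= s q"
using IncD(4)[of s a r q] by (cases "r = q") auto

lemma finite_Inc: "finite(Inc a)"
proof (rule finite_subset)
show "Inc a <= {s. ALL r. (r : Lr a --> s r : {..length a}) & (r ~: Lr a --> s r = 0)}"
using Inc_len IncD(1) by blast
qed (rule finite_set_of_finite_funs,auto)

text \<open>Group the tableaux by first column. Entries of a row never exceed its first one, so the
  bound by the row number becomes a condition on the first column.\<close>

lemma quasikey_FQ: "quasikey a = (SUM s:Inc a. FQ(dd a s))"
proof -
have "{T:fillings a. quasi_key_tableau a T} = (UN s:Inc a. X a s)"
proof (rule set_eqI,rule iffI)
 fix T assume T: "T : {T:fillings a. quasi_key_tableau a T}"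
 hence f: "T : fillings a" and QT: "QR a T" and le: "!!r c. (r,c) : skyline a ==> T(r,c) <= Suc r"
 and inc: "!!r q. r<q ==> (r,0) : skyline a ==> (q,0) : skyline a ==> T(r,0)<T(q,0)"
 unfolding qkt_QR by blast+
 have sk: "(r,0) : skyline a" if "r : Lr a" for r using that by (simp add: skyline_def Lr_def)
 have pos: "0<T x" if "x : skyline a" for x using f that unfolding fillings_def by force
 define s where "s r = (if r : Lr a then T(r,0) else 0)" for r
 have "s : Inc a" unfolding Inc_def using pos le inc sk by (auto simp: s_def)
 moreover have "T : X a s" using f QT by (simp add: X_def s_def)
 ultimately show "T : (UN s:Inc a. X a s)" by blast
next
 fix T assume "T : (UN s:Inc a. X a s)"
 then obtain s where s: "s : Inc a" and T: "T : X a s" by blast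
 have f: "T : fillings a" and QT: "QR a T" and T0: "!!r. r : Lr a ==> T(r,0) = s r" using T by (auto simp: X_def)
 have "T(r,c) <= Suc r" if "(r,c) : skyline a" for r c
 proof -
  have r: "r : Lr a" "r<length a" "c<a ! r" using that by (auto simp: skyline_def Lr_def)
  have "T(r,c) <= T(r,0)" using wdec_le[OF QRD(1)[OF QT r(2)] r(3)] .
  thus ?thesis using T0[OF r(1)] IncD(3)[OF s r(1)] by simp
 qed
 moreover have "T(r,0)<T(q,0)" if "r<q & (r,0) : skyline a & (q,0) : skyline a" for r q
 proof -
  have "r : Lr a" "q : Lr a" using that by (auto simp: skyline_def Lr_def)
  thus ?thesis using T0 IncD(4)[OF s] that by simp
 qed
 ultimately have "quasi_key_tableau a T" unfolding qkt_QR using QT by blast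
 thus "T : {T:fillings a. quasi_key_tableau a T}" using f by simp
qed
hence "quasikey a = (SUM T:(UN s:Inc a. X a s). xmon(fwt a T))" by (simp only: quasikey_def)
also have "...=(SUM T:(UN s:Inc a. X a s). wt a T)"
by (rule sum.cong) (auto simp: X_def wt_def xmon_fwt)
also have "...=(SUM s:Inc a. SUM T:X a s. wt a T)"
proof (rule sum.UNION_disjoint)
 show "ALL s:Inc a. ALL s':Inc a. s ~= s' --> X a s Int X a s' = {}"
 proof (intro ballI impI)
  fix s s' assume s: "s : Inc a" "s' : Inc a" "s ~= s'"
  show "X a s Int X a s' = {}"
  proof (rule ccontr)
   assume "X a s Int X a s' ~= {}"
   then obtain T where T: "T : X a s" "T : X a s'" by blast
   have "s r = s' r" for r
   proof (cases "r : Lr a")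
    case True thus ?thesis using T by (auto simp: X_def)
   next
    case False thus ?thesis using IncD(1)[OF s(1)] IncD(1)[OF s(2)] by simp
   qed
   thus False using s(3) by auto
  qed
 qed
qed (auto simp: finite_Inc finite_X)
also have "...=(SUM s:Inc a. FQ(dd a s))"
proof (rule sum.cong)
 fix s assume s: "s : Inc a"
 show "(SUM T:X a s. wt a T) = FQ(dd a s)" unfolding FQ_def
 by (metis X_reindex inj_onI IncD(4)[OF s] less_irrefl linorder_neqE_nat s IncD[OF s] Inc_len[OF s])
qed simp
finally show ?thesis .
qed

lemma psum_dd: "p <= length a ==> psum(dd a s) p = (SUM r<length a. if 0<s r & s r <= p then a ! r else 0)"
proof -
assume p: "p <= length a"
have "psum(dd a s) p = (SUM q<p. SUM r<length a. if s r = Suc q then a ! r else 0)"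
unfolding psum_def by (rule sum.cong) (use p in \<open>auto simp: dd_def\<close>)
also have "...=(SUM r<length a. SUM q<p. if s r = Suc q then a ! r else 0)" by (rule sum.swap)
also have "...=(SUM r<length a. if 0<s r & s r <= p then a ! r else 0)"
proof (rule sum.cong)
 fix r
 show "(SUM q<p. if s r = Suc q then a ! r else 0) = (if 0<s r & s r <= p then a ! r else 0)"
 by (cases "s r") (auto)
qed simp
finally show ?thesis .
qed

lemma psum_dd_ge:
 assumes s: "s : Inc a" and p: "p <= length a" "k <= length a" and h: "!!r. r : Lr a ==> r<k ==> s r <= p"
 shows "psum a k <= psum(dd a s) p"
proof -
let ?f = "%r. if 0<s r & s r <= p then a ! r else 0"
have "psum a k = (SUM r<k. ?f r)" unfolding psum_def
proof (rule sum.cong)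
 fix r assume "r : {..<k}"
 hence r: "r<k" by simp
 show "a ! r = ?f r"
 proof (cases "r : Lr a")
  case True thus ?thesis using h[OF True r] IncD(2)[OF s True] by simp
 next
  case False thus ?thesis using r p(2) by (simp add: Lr_def)
 qed
qed simp
also have "...<=(SUM r<length a. ?f r)" by (rule sum_mono2) (use p(2) in auto)
finally show ?thesis using psum_dd[OF p(1),of s] by simp
qed

lemma psum_dd_le:
 assumes s: "s : Inc a" and p: "p <= length a" "k <= length a" and h: "!!r. r : Lr a ==> s r <= p ==> r<k"
 shows "psum(dd a s) p <= psum a k"
proof -
let ?f = "%r. if 0<s r & s r <= p then a ! r else 0"
have "(SUM r<length a. ?f r) <= (SUM r<length a. if r<k then a ! r else 0)"
proof (rule sum_mono)
 fix r assume "r : {..<length a}"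
 show "?f r <= (if r<k then a ! r else 0)"
 proof (cases "r : Lr a")
  case True thus ?thesis using h[OF True] by auto
 next
  case False thus ?thesis using IncD(1)[OF s False] by simp
 qed
qed
also have "...=(SUM r:{r:{..<length a}. r<k}. a ! r)" by (rule sum.inter_filter[symmetric]) simp
also have "{r:{..<length a}. r<k} = {..<k}" using p(2) by auto
finally show ?thesis using psum_dd[OF p(1),of s] by (simp add: psum_def)
qed

lemma dd_slide:
 assumes s: "s : Inc a" shows "dom_ge(dd a s) a & flat(dd a s) = flat a"
proof
let ?d = "dd a s" and ?n = "length a"
show "dom_ge ?d a" unfolding dom_ge_psum
proof (intro conjI allI impI)
 fix k assume k: "k <= ?n"
 show "psum a k <= psum ?d k"
 proof (rule psum_dd_ge[OF s k k])
  fix r assume "r : Lr a" "r<k" thus "s r <= k" using IncD(3)[OF s,of r] by simp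
 qed
qed simp
\<comment> \<open>Relocation preserves the order of the rows, so the parts standing before p are
  exactly those of the rows up to the last one moved there.\<close>
have eq: "psum ?d p = psum a(Suc v)" if v: "v : Lr a" "p <= ?n" "s v <= p" and h: "!!r. r : Lr a ==> s r <= p ==> r <= v" for v p
proof (rule antisym)
 have vn: "Suc v <= ?n" using v(1) by (simp add: Lr_def)
 show "psum ?d p <= psum a(Suc v)" by (rule psum_dd_le[OF s v(2) vn]) (use h in \<open>auto simp: less_Suc_eq_le\<close>)
 show "psum a(Suc v) <= psum ?d p"
 proof (rule psum_dd_ge[OF s v(2) vn])
  fix r assume "r : Lr a" "r<Suc v"
  hence "s r <= s v" using Inc_mono[OF s,of r v] v(1) by simp
  thus "s r <= p" using v(3) by simp
 qed
qed
have "PS ?d = PS a"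
proof
 show "PS ?d <= PS a"
 proof
  fix x assume "x : PS ?d"
  then obtain p where p: "p <= ?n" "x = psum ?d p" by (auto simp: PS_def)
  let ?A = "{r:Lr a. s r <= p}"
  show "x : PS a"
  proof (cases "?A = {}")
   case True
   have "psum ?d p <= psum a 0" by (rule psum_dd_le[OF s p(1)]) (use True in auto)
   hence "x = psum a 0" using p(2) by simp
   thus ?thesis unfolding PS_def by blast
  next
   case False
   have fA: "finite ?A" by simp
   have M: "Max ?A : ?A" by (rule Max_in[OF fA False])
   have "psum ?d p = psum a(Suc(Max ?A))"
   using eq M p by auto
   moreover have "Suc(Max ?A) <= ?n" using M by (simp add: Lr_def)
   ultimately show ?thesis using p(2) unfolding PS_def by blast
  qed
 qed
 show "PS a <= PS ?d"
 proof
  fix x assume x: "x : PS a"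
  show "x : PS ?d"
  proof (cases "x = 0")
   case True thus ?thesis using zero_ps[of ?d] by (simp add: ps_PS)
  next
   case False
   then obtain v where v: "v<?n" "a ! v ~= 0" "psum a(Suc v) = x" using PS_positive[OF x] by blast
   have vL: "v : Lr a" using v by (simp add: Lr_def)
   have "psum ?d(s v) = psum a(Suc v)"
   proof (rule eq[OF vL Inc_len[OF s vL]])
    fix r assume r: "r : Lr a" "s r <= s v"
    show "r <= v" using IncD(4)[OF s _ vL r(1)] r(2) by (meson linorder_not_less)
   qed simp
   thus ?thesis using v(3) Inc_len[OF s vL] unfolding PS_def by auto
  qed
 qed
qed
thus "flat ?d = flat a" by (simp add: flat_PS)
qed

lemma dd_less_iff:
 assumes s: "s : Inc a" and r: "r : Lr a" and p: "p <= length a"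
 shows "s r <= p \<longleftrightarrow> psum a(Suc r) <= psum(dd a s) p"
proof
have rn: "Suc r <= length a" "r <= length a" using r by (auto simp: Lr_def)
show "psum a(Suc r) <= psum(dd a s) p" if "s r <= p"
proof (rule psum_dd_ge[OF s p rn(1)])
 fix q assume "q : Lr a" "q<Suc r"
 hence "s q <= s r" using Inc_mono[OF s,of q r] r by simp
 thus "s q <= p" using that by simp
qed
assume le: "psum a(Suc r) <= psum(dd a s) p"
show "s r <= p"
proof (rule ccontr)
 assume n: "~ s r <= p"
 have "psum(dd a s) p <= psum a r"
 proof (rule psum_dd_le[OF s p rn(2)])
  fix q assume q: "q : Lr a" "s q <= p"
  show "q<r"
  using Inc_mono[OF s,of r q] r q n by force
 qed
 moreover have "psum a r<psum a(Suc r)" using r by (simp add: psum_Suc Lr_def)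
 ultimately show False using le by simp
qed
qed

lemma slide_dd:
 assumes b: "dom_ge b a" "flat b = flat a"
 shows "EX s:Inc a. dd a s = b"
proof -
let ?n = "length a"
have lb: "length b = ?n" and dom: "!!k. k <= ?n ==> psum a k <= psum b k" using b(1) by (auto simp: dom_ge_psum)
have PSe: "PS b = PS a" using b(2) flat_PS by blast
\<comment> \<open>The part of row r stands in b where the partial sums of b first reach that of a
  through row r; counted from 1, this position is the entry \<open>s r\<close>.\<close>
define s where "s r = (if r : Lr a then(LEAST p. psum a(Suc r) <= psum b p) else 0)" for r
have ra: "r<?n" "Suc r <= ?n" "psum a r<psum a(Suc r)" if "r : Lr a" for r using that by (auto simp: Lr_def psum_Suc)
have sle: "s r <= p \<longleftrightarrow> psum a(Suc r) <= psum b p" if r: "r : Lr a" for r p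
proof
 have ex: "psum a(Suc r) <= psum b(Suc r)" by (rule dom[OF ra(2)[OF r]])
 have sr: "s r = (LEAST p. psum a(Suc r) <= psum b p)" using r by (simp add: s_def)
 have "psum a(Suc r) <= psum b(s r)" unfolding sr using LeastI[where P= "%p. psum a(Suc r) <= psum b p" and k= "Suc r"] ex by blast
 thus "psum a(Suc r) <= psum b p" if "s r <= p" using psum_mono[OF that,of b] by simp
 show "s r <= p" if "psum a(Suc r) <= psum b p" unfolding sr using Least_le[where P= "%p. psum a(Suc r) <= psum b p" and k=p] that by blast
qed
have sI: "s : Inc a" unfolding Inc_def
proof (intro CollectI conjI ballI allI impI)
 fix r assume "r ~: Lr a" thus "s r = 0" by (simp add: s_def)
next
 fix r assume r: "r : Lr a"
 have "~ s r <= 0" using sle[OF r,of 0] ra(3)[OF r] by simp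
 thus "0<s r" by simp
 show "s r <= Suc r" using sle[OF r,of "Suc r"] dom[OF ra(2)[OF r]] by simp
next
 fix r q assume h: "r<q & r : Lr a & q : Lr a"
 hence r: "r : Lr a" and q: "q : Lr a" and rq: "r<q" by auto
 show "s r<s q"
 proof (rule ccontr)
  assume "~ s r<s q"
  hence le: "psum a(Suc q) <= psum b(s r)" using sle[OF q,of "s r"] by simp
  have "psum a(Suc r) : PS a" unfolding PS_def using ra(2)[OF r] by (intro imageI) simp
  hence "psum a(Suc r) : PS b" using PSe by simp
  then obtain k where k: "psum b k = psum a(Suc r)" by (auto simp: PS_def)
  hence "s r <= k" using sle[OF r,of k] by simp
  hence "psum b(s r) <= psum a(Suc r)" using psum_mono[of "s r" k b] k by simp
  also have "...<=psum a q" using rq by (intro psum_mono) simp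
  also have "...<psum a(Suc q)" by (rule ra(3)[OF q])
  finally show False using le by simp
 qed
qed
have "dd a s = b"
proof (rule psum_inj[of _ ?n])
 fix p assume p: "p <= ?n"
 have "psum b p : PS b" unfolding PS_def using p lb by (intro imageI) simp
 hence "psum b p : PS a" using PSe by simp
 then obtain k where k: "k <= ?n" "psum b p = psum a k" by (auto simp: PS_def)
 have iff: "s r <= p \<longleftrightarrow> r<k" if r: "r : Lr a" for r
 proof
  show "r<k" if "s r <= p"
  proof (rule ccontr)
   assume "~ r<k"
   hence "psum a k <= psum a r" by (intro psum_mono) simp
   thus False using sle[OF r,of p] that k(2) ra(3)[OF r] by simp
  qed
  show "s r <= p" if "r<k"
  using sle[OF r,of p] psum_mono[of "Suc r" k a] that k(2) by simp
 qed
 have "psum(dd a s) p = psum a k"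
 by (rule antisym) (rule psum_dd_le[OF sI p k(1)],use iff in blast,rule psum_dd_ge[OF sI p k(1)],use iff in blast)
 thus "psum(dd a s) p = psum b p" using k(2) by simp
qed (use lb in auto)
thus ?thesis using sI by blast
qed

lemma quasikey_slidesum: "quasikey a = slidesum atom a"
proof -
have "bij_betw(dd a)(Inc a) {b. dom_ge b a & flat b = flat a}"
proof (rule bij_betw_imageI)
 show "inj_on(dd a)(Inc a)"
 proof (rule inj_onI,rule ext)
  fix s s' r assume s: "s : Inc a" "s' : Inc a" "dd a s = dd a s'"
  show "s r = s' r"
  proof (cases "r : Lr a")
   case True
   have "s r <= p \<longleftrightarrow> s' r <= p" if "p <= length a" for p
   using dd_less_iff[OF s(1) True that] dd_less_iff[OF s(2) True that] s(3) by simp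
   from this[of "s r"] this[of "s' r"] show ?thesis using Inc_len[OF s(2) True] by simp
  next
   case False thus ?thesis using IncD(1)[OF s(1) False] IncD(1)[OF s(2) False] by simp
  qed
 qed
 show "dd a ` Inc a = {b. dom_ge b a & flat b = flat a}"
 proof (rule set_eqI,rule iffI)
  fix b assume "b : dd a ` Inc a"
  then obtain s where "s : Inc a" "b = dd a s" by blast
  thus "b : {b. dom_ge b a & flat b = flat a}" using dd_slide by blast
 next
  fix b assume "b : {b. dom_ge b a & flat b = flat a}"
  then obtain s where "s : Inc a" "dd a s = b" using slide_dd by blast
  thus "b : dd a ` Inc a" by blast
 qed
qed
thus ?thesis unfolding quasikey_FQ slidesum_def FQ_atom by (rule sum.reindex_bij_betw)
qed

theorem quasikey_schur:
 assumes "length a = n" "partition lam"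
 shows "quasikey a * schur n lam : cone quasikey n"
proof -
have "quasikey = slidesum atom" by (rule ext) (rule quasikey_slidesum)
thus ?thesis using atoms.slidesum_schur[OF assms] by simp
qed

theorem theoremB:
  fixes B :: family and a lam :: "nat list" and n :: nat
  assumes "length a = n" and "partition lam"
  shows "\<exists>c :: nat list \<Rightarrow> nat.
           finite {b. c b \<noteq> 0} \<and> (\<forall>b. c b \<noteq> 0 \<longrightarrow> length b = n) \<and>
           basis B a * schur n lam = (\<Sum>b\<in>{b. c b \<noteq> 0}. of_nat (c b) * basis B b)"
proof -
have "basis B a * schur n lam : cone(basis B) n"
proof (cases B)
 case Schubert
 have "basis B = schubert" by (rule ext) (simp add: Schubert)
 thus ?thesis using schubert_schur[OF assms] by simp
next
 case Demazure
 have "basis B = demazure" by (rule ext) (simp add: Demazure)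
 thus ?thesis using demazure_schur[OF assms] by simp
next
 case QuasiKey
 have "basis B = quasikey" by (rule ext) (simp add: QuasiKey)
 thus ?thesis using quasikey_schur[OF assms] by simp
next
 case FundSlide
 have "basis B = fundslide" by (rule ext) (simp add: FundSlide)
 thus ?thesis using fundslide_schur[OF assms] by simp
next
 case MonSlide
 have "basis B = monslide" by (rule ext) (simp add: MonSlide)
 thus ?thesis using monslide_schur[OF assms] by simp
next
 case Atom
 have "basis B = atom" by (rule ext) (simp add: Atom)
 thus ?thesis using atom_schur[OF assms] by simp
next
 case Particle
 have "basis B = particle" by (rule ext) (simp add: Particle)
 thus ?thesis using particle_schur[OF assms] by simp
next
 case Monomial
 have "basis B = xmon" by (rule ext) (simp add: Monomial)
 thus ?thesis using xmon_schur[OF assms(1)] by simp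
qed
thus ?thesis by (rule cone_coeffs)
qed

end
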